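(* Let $\mathfrak g$ be a dg Lie algebra. For each weak Loday-Pirashvili module $f\colon M\rightsquigarrow\mathfrak g$ there exists a Leibniz$_\infty[1]$ $C(\mathfrak g)$-algebra structure $\{\lambda_k\}_{k\ge1}$ on the $C(\mathfrak g)$-module $C(\mathfrak g,M[1])$, namely the one given by the explicit construction recalled in the context, whose unary bracket $\lambda_1$ is the Chevalley-Eilenberg differential $d_{\mathrm{tot}}^{M[1]}$. This correspondence yields a functor $$\mathcal G_{\mathfrak g}^\infty\colon \mathbf{wLP}_{\mathfrak g}\to\mathbf{Leib}^{\infty[1]}_{C(\mathfrak g)}$$ from the category of weak Loday-Pirashvili modules over $\mathfrak g$ to the category of Leibniz$_\infty[1]$ $C(\mathfrak g)$-algebras. Furthermore, this functor is homotopy invariant: if $f'\colon M\rightsquigarrow\mathfrak g$ is another weak Loday-Pirashvili module that is homotopic to $f$, then the two Leibniz$_\infty[1]$ $C(\mathfrak g)$-algebra structures on $C(\mathfrak g,M[1])$ are isomorphic to each other.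
   Context: Conventions: $\mathbb K$ is $\mathbb R$ or $\mathbb C$; graded means $\mathbb Z$-graded; dg Lie algebras and (underlying spaces of) modules are finite dimensional; differentials have degree $+1$; $V[p]^i=V^{i+p}$. For a dg Lie algebra $\mathfrak g=(\mathfrak g,d,[-,-])$, $C(\mathfrak g)=\bigoplus_{p\ge0}C^p(\mathfrak g)$, $C^p(\mathfrak g)=S^p(\mathfrak g^\vee[-1])$, with differential $d_{\mathrm{CE}}=d_0+d_1$, $d_0$ induced by the dual of $d$ and $d_1$ the derivation with $d_1(\xi[-1])(x[1],y[1])=(-1)^{|\xi|+1+|x|}\xi([x,y])$. Put $C^k(\mathfrak g,M)=C^k(\mathfrak g)\otimes M$, $C(\mathfrak g,M)=C(\mathfrak g)\otimes M$. A locally finite $\infty$-$\mathfrak g$-module is a cochain complex $(M,d^M)$ with degree $+1$ maps $d_k^M\colon M\to C^k(\mathfrak g,M)$, $k\ge 0$, $d_0^M=d^M$, such that for each $m$, $d_k^M(m)=0$ for large $k$, and $d_{\mathrm{tot}}^M=d_{\mathrm{CE}}\otimes\mathrm{id}_M+\sum_k\mathrm{id}_{C(\mathfrak g)}\otimes d_k^M$ squares to zero on $C(\mathfrak g,M)$. An $\infty$-morphism $f\colon M\rightsquigarrow N$ is a family of degree $0$ maps $f_k\colon M\to C^k(\mathfrak g,N)$, with $f_k(m)=0$ for large $k$ (depending on $m$), whose $C(\mathfrak g)$-linear extension $F=\mathrm{id}\otimes\sum_kf_k$ commutes with total differentials; composition is that of the extensions. We write $f(m)=\sum_k f_k(m)$.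 The adjoint module is $\mathfrak g$ with $d_0^{\mathfrak g}=d$, $\iota_{x[1]}d_1^{\mathfrak g}(y)=[x,y]$, $d_k^{\mathfrak g}=0$ for $k\ge2$. A weak Loday-Pirashvili module over $\mathfrak g$ is an $\infty$-morphism $f\colon M\rightsquigarrow\mathfrak g$ from a locally finite $\infty$-$\mathfrak g$-module to the adjoint module. A morphism from $f\colon M\rightsquigarrow\mathfrak g$ to $g\colon N\rightsquigarrow\mathfrak g$ is an $\infty$-morphism $\phi\colon M\rightsquigarrow N$ with $g\circ\phi=f$. These form the category $\mathbf{wLP}_{\mathfrak g}$. Homotopy: let $J=\mathbb K\oplus\mathbb Kt\oplus\mathbb K\,dt$ be the complex with $|t|=0$, $|dt|=1$, differential $t\mapsto dt$. For a locally finite $\infty$-$\mathfrak g$-module $N$, $J(N)=J\otimes N$ is the locally finite $\infty$-$\mathfrak g$-module whose total differential is the tensor product differential on $J\otimes C(\mathfrak g,N)\cong C(\mathfrak g,J(N))$; the strict morphisms $\epsilon_0,\epsilon_1\colon J(N)\to N$ are $\epsilon_0(n_0+tn_1+(dt)u)=n_0$, $\epsilon_1(n_0+tn_1+(dt)u)=n_0+n_1$. Two weak Loday-Pirashvili modules $f,f'\colon M\rightsquigarrow\mathfrak g$ are homotopic if there is an $\infty$-morphism $H\colon M\rightsquigarrow J(\mathfrak g)$ with $\epsilon_0H=f$, $\epsilon_1H=f'$. A Leibniz$_\infty[1]$ algebra is a graded vector space $U$ with degree $+1$ multilinear maps $\lambda_k\colon U^{\otimes k}\to U$, $k\ge1$,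 such that for all $n\ge1$ and homogeneous $x_i$, $$\sum_{i+j=n+1}\sum_{k=j}^n\sum_{\sigma\in \mathrm{sh}(k-j,j-1)}\epsilon(\sigma)(-1)^{|x_{\sigma(1)}|+\cdots+|x_{\sigma(k-j)}|}\lambda_i(x_{\sigma(1)},\dots,x_{\sigma(k-j)},\lambda_j(x_{\sigma(k-j+1)},\dots,x_{\sigma(k-1)},x_k),x_{k+1},\dots,x_n)=0,$$ with $\mathrm{sh}(p,q)$ the $(p,q)$-shuffles and $\epsilon(\sigma)$ the Koszul sign. A morphism $(U,\lambda)\to(K,\tau)$ is a family of degree $0$ maps $\phi_n\colon U^{\otimes n}\to K$, $n\ge 1$, such that for all $n$ the sum obtained from the left side above by replacing the outer $\lambda_i$ by $\phi_i$ equals $\sum_{q\ge1}\sum_{i_1+\cdots+i_q=n}\sum_{\sigma}\epsilon(\sigma)\tau_q(\phi_{i_1}(x_{\sigma(1)},\dots,x_{\sigma(i_1)}),\dots,\phi_{i_q}(x_{\sigma(n-i_q+1)},\dots,x_{\sigma(n)}))$, where all $i_r\ge1$ and $\sigma$ runs over $(i_1,\dots,i_q)$-shuffles with $\sigma(i_1)<\sigma(i_1+i_2)<\cdots<\sigma(n)$; composition is given by the same kind of sum with $\tau_q$ replaced by the components of the second morphism. For a commutative dg algebra $\mathcal A$, a Leibniz$_\infty[1]$ $\mathcal A$-algebra is one for which $(U,\lambda_1)$ is a dg $\mathcal A$-module and all $\lambda_k$, $k\ge2$, are $\mathcal A$-multilinear (with Koszul signs); morphisms have $\mathcal A$-multilinear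 components. They form the category $\mathbf{Leib}^{\infty[1]}_{\mathcal A}$ (equivalent by degree shift to the category of Leibniz$_\infty$ $\mathcal A$-algebras). Construction of $\lambda_k$: for $b=\sum_i\omega_i\otimes x_i\in C(\mathfrak g)\otimes\mathfrak g$ set $\iota_{b[1]}(\alpha\otimes m[1])=\sum_i\omega_i\odot(\iota_{x_i[1]}\alpha)\otimes m[1]$, where $\iota_{x[1]}\colon C^\bullet(\mathfrak g)\to C^{\bullet-1}(\mathfrak g)$ is contraction, of degree $|x|-1$. Given $f\colon M\rightsquigarrow\mathfrak g$, $\lambda_1=d_{\mathrm{tot}}^{M[1]}$, and for $n\ge2$ the map $\lambda_n$ is the $C(\mathfrak g)$-multilinear extension of $$\lambda_n(m_1[1],\dots,m_n[1])=(-1)^{|m_1|+\cdots+|m_{n-1}|-n+1}\,\iota_{f(m_1)[1]}\cdots\iota_{f(m_{n-1})[1]}\Big(\sum_{k\ge1}d_k^Mm_n\Big)[1].$$ *)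

theory Defs
  imports
    Complex_Main
    "HOL-Library.Poly_Mapping"
    "HOL-Library.Product_Plus"
    "HOL-Combinatorics.Permutations"
begin

section \<open>Graded vector spaces\<close>

text \<open>
  The ground field is a type of class \<^class>\<open>real_normed_field\<close>: \<real> and \<complex> are
  instances and, by Gelfand--Mazur, the only ones up to isomorphism.

  A graded vector space consists of a scalar multiplication on an ambient type and a family
  of subspaces \<open>gr V i\<close> whose sum in the ambient type is direct; the space itself is that
  sum, \<open>car V\<close>. The ambient type may be larger, so that the objects of a category may have
  different underlying spaces. Linear maps are total functions whose values matter on \<open>car V\<close>
  only; arrows of categories are made unique by requiring the value 0 elsewhere.
\<close>

definition ksign :: "int \<Rightarrow> 'k::real_normed_field" where
  "ksign n = (if even n then 1 else - 1)"

record ('k, 'v) gspace =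
  scl :: "'k \<Rightarrow> 'v \<Rightarrow> 'v"
  gr :: "int \<Rightarrow> 'v set"

definition is_decomp :: "('k, 'v::ab_group_add, 'z) gspace_scheme \<Rightarrow> 'v \<Rightarrow> (int \<Rightarrow> 'v) \<Rightarrow> bool" where
  "is_decomp V v c \<longleftrightarrow>
     (\<forall>i. c i \<in> gr V i) \<and> finite {i. c i \<noteq> 0} \<and> v = (\<Sum>i | c i \<noteq> 0. c i)"

definition car :: "('k, 'v::ab_group_add, 'z) gspace_scheme \<Rightarrow> 'v set" where
  "car V = {v. \<exists>c. is_decomp V v c}"

definition graded_space ::
    "('k::real_normed_field, 'v::ab_group_add, 'z) gspace_scheme \<Rightarrow> bool" where
  "graded_space V \<longleftrightarrow>
     vector_space (scl V) \<and>
     (\<forall>i. module.subspace (scl V) (gr V i)) \<and>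
     (\<forall>v c c'. is_decomp V v c \<longrightarrow> is_decomp V v c' \<longrightarrow> c = c')"

definition fin_dim :: "('k::real_normed_field, 'v::ab_group_add, 'z) gspace_scheme \<Rightarrow> bool" where
  "fin_dim V \<longleftrightarrow> (\<exists>B. finite B \<and> module.span (scl V) B = car V)"

definition hcomp :: "('k, 'v::ab_group_add, 'z) gspace_scheme \<Rightarrow> 'v \<Rightarrow> int \<Rightarrow> 'v" where
  "hcomp V v = (if v \<in> car V then (THE c. is_decomp V v c) else (\<lambda>_. 0))"

definition hsupp :: "('k, 'v::ab_group_add, 'z) gspace_scheme \<Rightarrow> 'v \<Rightarrow> int set" where
  "hsupp V v = {i. hcomp V v i \<noteq> 0}"

text \<open>
  \<open>shift p V\<close> is \<open>V[p]\<close>, with \<open>v[p]\<close> represented by \<open>v\<close> itself. It also applies to the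
  modules below: the structure maps of \<open>M[p]\<close> are those of \<open>M\<close>, without an additional sign.
\<close>

definition shift ::
    "int \<Rightarrow> ('k, 'v, 'z) gspace_scheme \<Rightarrow> ('k, 'v, 'z) gspace_scheme" where
  "shift p V = V\<lparr>gr := (\<lambda>i. gr V (i + p))\<rparr>"

definition linear_deg ::
    "('k, 'v::ab_group_add, 'y) gspace_scheme \<Rightarrow> ('k, 'w::ab_group_add, 'z) gspace_scheme \<Rightarrow>
     int \<Rightarrow> ('v \<Rightarrow> 'w) \<Rightarrow> bool" where
  "linear_deg V W p f \<longleftrightarrow>
     (\<forall>x \<in> car V. \<forall>y \<in> car V. f (x + y) = f x + f y) \<and>
     (\<forall>c. \<forall>x \<in> car V. f (scl V c x) = scl W c (f x)) \<and>
     (\<forall>i. \<forall>x \<in> gr V i. f x \<in> gr W (i + p))"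


section \<open>dg Lie algebras and their Chevalley--Eilenberg algebras\<close>

text \<open>
  A finite-dimensional dg Lie algebra comes with an arbitrary ordered homogeneous basis
  \<open>e\<^sub>0, \<dots>, e\<^sub>n\<^sub>-\<^sub>1\<close>. The basis only serves to write down \<open>S(\<gg>\<^sup>\<or>[-1])\<close> as the free graded
  commutative algebra on the shifted dual basis.
\<close>

record ('k, 'g) dgla = "('k, 'g) gspace" +
  ldiff :: "'g \<Rightarrow> 'g"
  lbr :: "'g \<Rightarrow> 'g \<Rightarrow> 'g"
  bas :: "'g list"

definition dg_lie_algebra :: "('k::real_normed_field, 'g::ab_group_add) dgla \<Rightarrow> bool" where
  "dg_lie_algebra L \<longleftrightarrow>
     graded_space L \<and>
     distinct (bas L) \<and> \<not> module.dependent (scl L) (set (bas L)) \<and>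
     module.span (scl L) (set (bas L)) = car L \<and> (\<forall>b \<in> set (bas L). \<exists>i. b \<in> gr L i) \<and>
     linear_deg L L 1 (ldiff L) \<and> (\<forall>x \<in> car L. ldiff L (ldiff L x) = 0) \<and>
     (\<forall>i. \<forall>x \<in> gr L i. linear_deg L L i (lbr L x)) \<and>
     (\<forall>x \<in> car L. \<forall>y \<in> car L. \<forall>z \<in> car L. lbr L (x + y) z = lbr L x z + lbr L y z) \<and>
     (\<forall>c. \<forall>x \<in> car L. \<forall>z \<in> car L. lbr L (scl L c x) z = scl L c (lbr L x z)) \<and>
     (\<forall>i j. \<forall>x \<in> gr L i. \<forall>y \<in> gr L j.
        lbr L x y = scl L (- ksign (i * j)) (lbr L y x) \<and>
        ldiff L (lbr L x y) = lbr L (ldiff L x) y + scl L (ksign i) (lbr L x (ldiff L y))) \<and>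
     (\<forall>i j. \<forall>x \<in> gr L i. \<forall>y \<in> gr L j. \<forall>z \<in> car L.
        lbr L x (lbr L y z) = lbr L (lbr L x y) z + scl L (ksign (i * j)) (lbr L y (lbr L x z)))"

abbreviation ldim :: "('k, 'g) dgla \<Rightarrow> nat" where
  "ldim L \<equiv> length (bas L)"

definition coord :: "('k::real_normed_field, 'g::ab_group_add) dgla \<Rightarrow> nat \<Rightarrow> 'g \<Rightarrow> 'k" where
  "coord L i x = module.representation (scl L) (set (bas L)) x (bas L ! i)"

definition edeg :: "('k, 'g) dgla \<Rightarrow> nat \<Rightarrow> int" where
  "edeg L i = (THE j. bas L ! i \<in> gr L j)"

text \<open>
  Let \<open>\<xi>\<^sup>i\<close> be the dual basis. The generator \<open>x\<^sub>i = \<xi>\<^sup>i[-1]\<close> of \<open>C(\<gg>)\<close> has degree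
  \<open>wt L i = 1 - |e\<^sub>i|\<close>. An exponent function \<open>a\<close> stands for the ordered monomial
  \<open>x\<^sup>a = x\<^sub>0\<^bsup>a 0\<^esup> \<odot> x\<^sub>1\<^bsup>a 1\<^esup> \<odot> \<dots>\<close>; those in \<open>mons L\<close> form a basis of \<open>C(\<gg>)\<close>.
\<close>

type_synonym mono = "nat \<Rightarrow>\<^sub>0 nat"

definition wt :: "('k, 'g) dgla \<Rightarrow> nat \<Rightarrow> int" where
  "wt L i = 1 - edeg L i"

definition mons :: "('k, 'g) dgla \<Rightarrow> mono set" where
  "mons L = {a. Poly_Mapping.keys a \<subseteq> {..<ldim L} \<and> (\<forall>i. odd (wt L i) \<longrightarrow> Poly_Mapping.lookup a i \<le> 1)}"

definition arity :: "mono \<Rightarrow> nat" where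
  "arity a = (\<Sum>i \<in> Poly_Mapping.keys a. Poly_Mapping.lookup a i)"

definition mdeg :: "('k, 'g) dgla \<Rightarrow> mono \<Rightarrow> int" where
  "mdeg L a = (\<Sum>i \<in> Poly_Mapping.keys a. int (Poly_Mapping.lookup a i) * wt L i)"

text \<open>\<open>x\<^sup>a \<odot> x\<^sup>b\<close> is \<open>msign L a b\<close> times the ordered monomial of exponent \<open>a + b\<close>.\<close>

definition msign :: "('k::real_normed_field, 'g) dgla \<Rightarrow> mono \<Rightarrow> mono \<Rightarrow> 'k" where
  "msign L a b = ksign (\<Sum>i<ldim L. \<Sum>j<i.
     int (Poly_Mapping.lookup a i) * int (Poly_Mapping.lookup b j) * wt L i * wt L j)"

text \<open>
  An element of \<open>C(\<gg>, V) = C(\<gg>) \<otimes> V\<close> is the family of its coefficients: \<open>\<Omega>\<close> represents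
  \<open>\<Sum>\<^sub>a x\<^sup>a \<otimes> \<Omega> a\<close>, and \<open>C(\<gg>)\<close> itself is the case of the ground field.
\<close>

definition coch ::
    "('k, 'g) dgla \<Rightarrow> ('k, 'v::ab_group_add, 'z) gspace_scheme \<Rightarrow> ('k, mono \<Rightarrow>\<^sub>0 'v) gspace" where
  "coch L V =
     \<lparr>scl = (\<lambda>c. Poly_Mapping.map (scl V c)),
      gr = (\<lambda>n. {\<Omega>. Poly_Mapping.keys \<Omega> \<subseteq> mons L \<and>
                     (\<forall>a. Poly_Mapping.lookup \<Omega> a \<in> gr V (n - mdeg L a))})\<rparr>"

definition has_arity :: "nat \<Rightarrow> (mono \<Rightarrow>\<^sub>0 'v::zero) \<Rightarrow> bool" where
  "has_arity k \<Omega> \<longleftrightarrow> (\<forall>a \<in> Poly_Mapping.keys \<Omega>. arity a = k)"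

definition arity_part :: "nat \<Rightarrow> (mono \<Rightarrow>\<^sub>0 'v::ab_group_add) \<Rightarrow> (mono \<Rightarrow>\<^sub>0 'v)" where
  "arity_part k \<Omega> =
     (\<Sum>a | a \<in> Poly_Mapping.keys \<Omega> \<and> arity a = k. Poly_Mapping.single a (Poly_Mapping.lookup \<Omega> a))"

definition ground :: "('k::real_normed_field, 'k) gspace" where
  "ground = \<lparr>scl = (*), gr = (\<lambda>i. if i = 0 then UNIV else {0})\<rparr>"

definition cmul ::
    "('k::real_normed_field, 'g) dgla \<Rightarrow> ('k, 'v::ab_group_add, 'z) gspace_scheme \<Rightarrow>
     (mono \<Rightarrow>\<^sub>0 'k) \<Rightarrow> (mono \<Rightarrow>\<^sub>0 'v) \<Rightarrow> (mono \<Rightarrow>\<^sub>0 'v)" where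
  "cmul L V \<alpha> \<Omega> =
     (\<Sum>a \<in> Poly_Mapping.keys \<alpha>. \<Sum>b \<in> Poly_Mapping.keys \<Omega>.
        if a + b \<in> mons L
        then Poly_Mapping.single (a + b)
               (scl V (msign L a b * Poly_Mapping.lookup \<alpha> a) (Poly_Mapping.lookup \<Omega> b))
        else 0)"

text \<open>
  Contraction with \<open>e\<^sub>i[1]\<close>: the derivation of degree \<open>|e\<^sub>i| - 1\<close> with
  \<open>\<iota>\<^bsub>x[1]\<^esub> (\<xi>[-1]) = \<xi> x\<close>, acting on \<open>C(\<gg>) \<otimes> V\<close> through the first factor.
\<close>

definition contr_bas ::
    "('k::real_normed_field, 'g) dgla \<Rightarrow> ('k, 'v::ab_group_add, 'z) gspace_scheme \<Rightarrow> nat \<Rightarrow>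
     (mono \<Rightarrow>\<^sub>0 'v) \<Rightarrow> (mono \<Rightarrow>\<^sub>0 'v)" where
  "contr_bas L V i \<Omega> =
     (\<Sum>a \<in> Poly_Mapping.keys \<Omega>.
        Poly_Mapping.single (a - Poly_Mapping.single i 1)
          (scl V (of_nat (Poly_Mapping.lookup a i) *
                  ksign (wt L i * (\<Sum>j<i. int (Poly_Mapping.lookup a j) * wt L j)))
             (Poly_Mapping.lookup \<Omega> a)))"

definition contr ::
    "('k::real_normed_field, 'g::ab_group_add) dgla \<Rightarrow> ('k, 'v::ab_group_add, 'z) gspace_scheme \<Rightarrow>
     'g \<Rightarrow> (mono \<Rightarrow>\<^sub>0 'v) \<Rightarrow> (mono \<Rightarrow>\<^sub>0 'v)" where
  "contr L V x \<Omega> = (\<Sum>i<ldim L. scl (coch L V) (coord L i x) (contr_bas L V i \<Omega>))"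

text \<open>\<open>contr_coch L V b\<close> is \<open>\<iota>\<^bsub>b[1]\<^esub>\<close> for \<open>b \<in> C(\<gg>, \<gg>)\<close>.\<close>

definition contr_coch ::
    "('k::real_normed_field, 'g::ab_group_add) dgla \<Rightarrow> ('k, 'v::ab_group_add, 'z) gspace_scheme \<Rightarrow>
     (mono \<Rightarrow>\<^sub>0 'g) \<Rightarrow> (mono \<Rightarrow>\<^sub>0 'v) \<Rightarrow> (mono \<Rightarrow>\<^sub>0 'v)" where
  "contr_coch L V b \<Omega> =
     (\<Sum>c \<in> Poly_Mapping.keys b.
        cmul L V (Poly_Mapping.single c 1) (contr L V (Poly_Mapping.lookup b c) \<Omega>))"

text \<open>
  The differential on generators. \<open>d\<^sub>0\<close> is the dual differential
  \<open>\<xi> \<mapsto> (x \<mapsto> (-1)\<^bsup>|\<xi>| + 1\<^esup> \<xi> (d x))\<close> under \<open>[-1]\<close>. For \<open>d\<^sub>1\<close>, every \<open>\<alpha> \<in> C\<^sup>2(\<gg>)\<close> equals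
  \<open>1/2 \<Sum>\<^sub>i\<^sub>j (\<iota>\<^sub>i \<iota>\<^sub>j \<alpha>) x\<^sub>j \<odot> x\<^sub>i\<close>, and evaluation of two-cochains is
  \<open>\<alpha>(x[1], y[1]) = - \<iota>\<^bsub>x[1]\<^esub> \<iota>\<^bsub>y[1]\<^esub> \<alpha>\<close> (so \<open>\<alpha>(x[1], y[1]) = \<iota>\<^bsub>y[1]\<^esub> \<iota>\<^bsub>x[1]\<^esub> \<alpha>\<close> for an ordinary Lie
  algebra); then \<open>d\<^sub>1\<close> satisfies
  \<open>d\<^sub>1(\<xi>[-1])(x[1], y[1]) = (-1)\<^bsup>|\<xi>| + 1 + |x|\<^esup> \<xi> [x, y]\<close>. This is the choice of signs for
  which the total differential of the adjoint module below squares to zero.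
\<close>

definition d0_gen ::
    "('k::real_normed_field, 'g::ab_group_add) dgla \<Rightarrow> nat \<Rightarrow> (mono \<Rightarrow>\<^sub>0 'k)" where
  "d0_gen L k =
     (\<Sum>j<ldim L. Poly_Mapping.single (Poly_Mapping.single j 1)
        (ksign (- edeg L k + 1) * coord L k (ldiff L (bas L ! j))))"

definition d1_gen ::
    "('k::real_normed_field, 'g::ab_group_add) dgla \<Rightarrow> nat \<Rightarrow> (mono \<Rightarrow>\<^sub>0 'k)" where
  "d1_gen L k =
     (\<Sum>i<ldim L. \<Sum>j<ldim L.
        cmul L ground
          (Poly_Mapping.single (Poly_Mapping.single j 1)
             (- (1 / 2) * ksign (- edeg L k + 1 + edeg L i) * coord L k (lbr L (bas L ! i) (bas L ! j))))
          (Poly_Mapping.single (Poly_Mapping.single i 1) 1))"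

text \<open>The derivation \<open>d\<^sub>C\<^sub>E\<close> with these values on generators, \<open>\<Sum>\<^sub>k d(x\<^sub>k) \<odot> \<partial>/\<partial>x\<^sub>k\<close>.\<close>

definition d_CE ::
    "('k::real_normed_field, 'g::ab_group_add) dgla \<Rightarrow> (mono \<Rightarrow>\<^sub>0 'k) \<Rightarrow> (mono \<Rightarrow>\<^sub>0 'k)" where
  "d_CE L \<alpha> = (\<Sum>k<ldim L. cmul L ground (d0_gen L k + d1_gen L k) (contr_bas L ground k \<alpha>))"

record ('k, 'a) dga = "('k, 'a) gspace" +
  amult :: "'a \<Rightarrow> 'a \<Rightarrow> 'a"
  aone :: 'a
  adiff :: "'a \<Rightarrow> 'a"

definition CE ::
    "('k::real_normed_field, 'g::ab_group_add) dgla \<Rightarrow> ('k, mono \<Rightarrow>\<^sub>0 'k) dga" where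
  "CE L = \<lparr>scl = scl (coch L ground), gr = gr (coch L ground),
           amult = cmul L ground, aone = Poly_Mapping.single 0 1, adiff = d_CE L\<rparr>"


section \<open>Locally finite infinity-modules and infinity-morphisms\<close>

record (overloaded) ('k, 'm) infmod = "('k, 'm) gspace" +
  act :: "nat \<Rightarrow> 'm \<Rightarrow> (mono \<Rightarrow>\<^sub>0 'm)"

text \<open>\<open>tot F m\<close> is \<open>\<Sum>\<^sub>k F k m\<close>, for families with \<open>F k m = 0\<close> for large \<open>k\<close>.\<close>

definition tot :: "(nat \<Rightarrow> 'm \<Rightarrow> (mono \<Rightarrow>\<^sub>0 'n::ab_group_add)) \<Rightarrow> 'm \<Rightarrow> (mono \<Rightarrow>\<^sub>0 'n)" where
  "tot F m = (\<Sum>k | F k m \<noteq> 0. F k m)"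

definition cochain_family ::
    "('k::real_normed_field, 'g) dgla \<Rightarrow> ('k, 'm::ab_group_add, 'y) gspace_scheme \<Rightarrow>
     ('k, 'n::ab_group_add, 'z) gspace_scheme \<Rightarrow> int \<Rightarrow> (nat \<Rightarrow> 'm \<Rightarrow> (mono \<Rightarrow>\<^sub>0 'n)) \<Rightarrow> bool" where
  "cochain_family L M N p F \<longleftrightarrow>
     (\<forall>k. linear_deg M (coch L N) p (F k)) \<and>
     (\<forall>k. \<forall>m \<in> car M. has_arity k (F k m)) \<and>
     (\<forall>m \<in> car M. \<exists>K. \<forall>k\<ge>K. F k m = 0)"

definition d_tot ::
    "('k::real_normed_field, 'g::ab_group_add) dgla \<Rightarrow> ('k, 'm::ab_group_add) infmod \<Rightarrow>
     (mono \<Rightarrow>\<^sub>0 'm) \<Rightarrow> (mono \<Rightarrow>\<^sub>0 'm)" where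
  "d_tot L M \<Omega> =
     (\<Sum>a \<in> Poly_Mapping.keys \<Omega>.
        cmul L M (d_CE L (Poly_Mapping.single a 1)) (Poly_Mapping.single 0 (Poly_Mapping.lookup \<Omega> a)) +
        cmul L M (Poly_Mapping.single a (ksign (mdeg L a))) (tot (act M) (Poly_Mapping.lookup \<Omega> a)))"

text \<open>\<open>C\<^sup>0(\<gg>, M) = M\<close>, so the differential of the complex underlying \<open>M\<close> is \<open>act M 0\<close>.\<close>

definition inf_module ::
    "('k::real_normed_field, 'g::ab_group_add) dgla \<Rightarrow> ('k, 'm::ab_group_add) infmod \<Rightarrow> bool" where
  "inf_module L M \<longleftrightarrow>
     graded_space M \<and> fin_dim M \<and> cochain_family L M M 1 (act M) \<and>
     (\<forall>\<Omega> \<in> car (coch L M). d_tot L M (d_tot L M \<Omega>) = 0)"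

definition lin_ext ::
    "('k::real_normed_field, 'g) dgla \<Rightarrow> ('k, 'n::ab_group_add) infmod \<Rightarrow>
     (nat \<Rightarrow> 'm \<Rightarrow> (mono \<Rightarrow>\<^sub>0 'n)) \<Rightarrow> (mono \<Rightarrow>\<^sub>0 'm::zero) \<Rightarrow> (mono \<Rightarrow>\<^sub>0 'n)" where
  "lin_ext L N f \<Omega> =
     (\<Sum>a \<in> Poly_Mapping.keys \<Omega>.
        cmul L N (Poly_Mapping.single a 1) (tot f (Poly_Mapping.lookup \<Omega> a)))"

definition inf_morphism ::
    "('k::real_normed_field, 'g::ab_group_add) dgla \<Rightarrow> ('k, 'm::ab_group_add) infmod \<Rightarrow>
     ('k, 'n::ab_group_add) infmod \<Rightarrow> (nat \<Rightarrow> 'm \<Rightarrow> (mono \<Rightarrow>\<^sub>0 'n)) \<Rightarrow> bool" where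
  "inf_morphism L M N f \<longleftrightarrow>
     cochain_family L M N 0 f \<and> (\<forall>k m. m \<notin> car M \<longrightarrow> f k m = 0) \<and>
     (\<forall>\<Omega> \<in> car (coch L M). lin_ext L N f (d_tot L M \<Omega>) = d_tot L N (lin_ext L N f \<Omega>))"

text \<open>The infinity-morphism with extension \<open>lin_ext L P g \<circ> lin_ext L N f\<close>, for \<open>f\<close> with target \<open>N\<close>.\<close>

definition inf_comp ::
    "('k::real_normed_field, 'g) dgla \<Rightarrow> ('k, 'p::ab_group_add) infmod \<Rightarrow>
     (nat \<Rightarrow> 'n \<Rightarrow> (mono \<Rightarrow>\<^sub>0 'p)) \<Rightarrow> (nat \<Rightarrow> 'm \<Rightarrow> (mono \<Rightarrow>\<^sub>0 'n::ab_group_add)) \<Rightarrow>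
     (nat \<Rightarrow> 'm \<Rightarrow> (mono \<Rightarrow>\<^sub>0 'p))" where
  "inf_comp L P g f = (\<lambda>k m. arity_part k (lin_ext L P g (tot f m)))"

definition strict ::
    "('k, 'm::ab_group_add) infmod \<Rightarrow> ('m \<Rightarrow> 'n::ab_group_add) \<Rightarrow> (nat \<Rightarrow> 'm \<Rightarrow> (mono \<Rightarrow>\<^sub>0 'n))" where
  "strict M h = (\<lambda>k m. if k = 0 \<and> m \<in> car M then Poly_Mapping.single 0 (h m) else 0)"

definition adjoint ::
    "('k::real_normed_field, 'g::ab_group_add) dgla \<Rightarrow> ('k, 'g) infmod" where
  "adjoint L =
     \<lparr>scl = scl L, gr = gr L,
      act = (\<lambda>k y. if k = 0 then Poly_Mapping.single 0 (ldiff L y)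
                   else if k = 1 then
                     (\<Sum>i<ldim L. Poly_Mapping.single (Poly_Mapping.single i 1) (lbr L (bas L ! i) y))
                   else 0)\<rparr>"


section \<open>The category of weak Loday-Pirashvili modules; homotopy\<close>

text \<open>The data of a category; functors and isomorphisms are expressed in terms of these data.\<close>

record ('o, 'a) cat =
  Obj :: "'o set"
  Hom :: "'o \<Rightarrow> 'o \<Rightarrow> 'a set"
  Idn :: "'o \<Rightarrow> 'a"
  Cmp :: "'o \<Rightarrow> 'o \<Rightarrow> 'o \<Rightarrow> 'a \<Rightarrow> 'a \<Rightarrow> 'a"  \<comment> \<open>\<open>Cmp X Y Z g f\<close> is \<open>g \<circ> f\<close> for \<open>f: X \<rightarrow> Y\<close>, \<open>g: Y \<rightarrow> Z\<close>\<close>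

definition is_functor ::
    "('o, 'a) cat \<Rightarrow> ('p, 'b) cat \<Rightarrow> ('o \<Rightarrow> 'p) \<Rightarrow> ('o \<Rightarrow> 'o \<Rightarrow> 'a \<Rightarrow> 'b) \<Rightarrow> bool" where
  "is_functor C D F\<^sub>o F\<^sub>a \<longleftrightarrow>
     (\<forall>X \<in> Obj C. F\<^sub>o X \<in> Obj D) \<and>
     (\<forall>X \<in> Obj C. \<forall>Y \<in> Obj C. \<forall>f \<in> Hom C X Y. F\<^sub>a X Y f \<in> Hom D (F\<^sub>o X) (F\<^sub>o Y)) \<and>
     (\<forall>X \<in> Obj C. F\<^sub>a X X (Idn C X) = Idn D (F\<^sub>o X)) \<and>
     (\<forall>X \<in> Obj C. \<forall>Y \<in> Obj C. \<forall>Z \<in> Obj C. \<forall>f \<in> Hom C X Y. \<forall>g \<in> Hom C Y Z.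
        F\<^sub>a X Z (Cmp C X Y Z g f) = Cmp D (F\<^sub>o X) (F\<^sub>o Y) (F\<^sub>o Z) (F\<^sub>a Y Z g) (F\<^sub>a X Y f))"

definition isomorphic :: "('o, 'a) cat \<Rightarrow> 'o \<Rightarrow> 'o \<Rightarrow> bool" where
  "isomorphic C X Y \<longleftrightarrow>
     (\<exists>f \<in> Hom C X Y. \<exists>g \<in> Hom C Y X. Cmp C X Y X g f = Idn C X \<and> Cmp C Y X Y f g = Idn C Y)"

type_synonym ('k, 'g, 'm) wLP_object = "('k, 'm) infmod \<times> (nat \<Rightarrow> 'm \<Rightarrow> (mono \<Rightarrow>\<^sub>0 'g))"

definition weak_LP_module ::
    "('k::real_normed_field, 'g::ab_group_add) dgla \<Rightarrow> ('k, 'm::ab_group_add) infmod \<Rightarrow>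
     (nat \<Rightarrow> 'm \<Rightarrow> (mono \<Rightarrow>\<^sub>0 'g)) \<Rightarrow> bool" where
  "weak_LP_module L M f \<longleftrightarrow> inf_module L M \<and> inf_morphism L M (adjoint L) f"

definition wLP ::
    "('k::real_normed_field, 'g::ab_group_add) dgla \<Rightarrow>
     (('k, 'g, 'm::ab_group_add) wLP_object, nat \<Rightarrow> 'm \<Rightarrow> (mono \<Rightarrow>\<^sub>0 'm)) cat" where
  "wLP L =
     \<lparr>Obj = {(M, f). weak_LP_module L M f},
      Hom = (\<lambda>(M, f) (N, g). {\<phi>. inf_morphism L M N \<phi> \<and> inf_comp L (adjoint L) g \<phi> = f}),
      Idn = (\<lambda>(M, f). strict M (\<lambda>m. m)),
      Cmp = (\<lambda>X Y Z. inf_comp L (fst Z))\<rparr>"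

text \<open>
  \<open>J(N) = J \<otimes> N\<close>, the triple \<open>(n\<^sub>0, n\<^sub>1, u)\<close> standing for \<open>n\<^sub>0 + t n\<^sub>1 + dt u\<close>. The identification
  \<open>J \<otimes> C(\<gg>, N) \<cong> C(\<gg>, J(N))\<close> takes \<open>dt \<otimes> \<omega> \<otimes> u\<close> to \<open>(-1)\<^bsup>|\<omega>|\<^esup> \<omega> \<otimes> dt \<otimes> u\<close>, whence
  \<open>d (dt u) = - dt (\<Sum>\<^sub>k d\<^sub>k u)\<close> acquires the additional sign \<open>(-1)\<^bsup>|\<omega>|\<^esup>\<close>.
\<close>

definition J_module ::
    "('k::real_normed_field, 'g) dgla \<Rightarrow> ('k, 'n::ab_group_add) infmod \<Rightarrow>
     ('k, 'n \<times> 'n \<times> 'n) infmod" where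
  "J_module L N =
     \<lparr>scl = (\<lambda>c (n\<^sub>0, n\<^sub>1, u). (scl N c n\<^sub>0, scl N c n\<^sub>1, scl N c u)),
      gr = (\<lambda>i. gr N i \<times> gr N i \<times> gr N (i - 1)),
      act = (\<lambda>k (n\<^sub>0, n\<^sub>1, u).
        Poly_Mapping.map (\<lambda>y. (y, 0, 0)) (act N k n\<^sub>0) +
        Poly_Mapping.map (\<lambda>y. (0, y, 0)) (act N k n\<^sub>1) +
        (if k = 0 then Poly_Mapping.single 0 (0, 0, n\<^sub>1) else 0) -
        (\<Sum>a \<in> Poly_Mapping.keys (act N k u).
           Poly_Mapping.single a (0, 0, scl N (ksign (mdeg L a)) (Poly_Mapping.lookup (act N k u) a))))\<rparr>"

definition homotopic ::
    "('k::real_normed_field, 'g::ab_group_add) dgla \<Rightarrow> ('k, 'm::ab_group_add) infmod \<Rightarrow>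
     (nat \<Rightarrow> 'm \<Rightarrow> (mono \<Rightarrow>\<^sub>0 'g)) \<Rightarrow> (nat \<Rightarrow> 'm \<Rightarrow> (mono \<Rightarrow>\<^sub>0 'g)) \<Rightarrow> bool" where
  "homotopic L M f f' \<longleftrightarrow>
     (\<exists>H. inf_morphism L M (J_module L (adjoint L)) H \<and>
          inf_comp L (adjoint L) (strict (J_module L (adjoint L)) (\<lambda>(n\<^sub>0, n\<^sub>1, u). n\<^sub>0)) H = f \<and>
          inf_comp L (adjoint L) (strict (J_module L (adjoint L)) (\<lambda>(n\<^sub>0, n\<^sub>1, u). n\<^sub>0 + n\<^sub>1)) H = f')"


section \<open>Leibniz-infinity[1] algebras over a commutative dg algebra\<close>

text \<open>
  A multilinear map \<open>U\<^bsup>\<otimes>n\<^esup> \<rightarrow> W\<close>, \<open>n \<ge> 1\<close>, is a function on lists of length \<open>n\<close>; one function on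
  lists comprises the components of all arities. Arguments are numbered from 0, so the
  \<open>k\<close>-th argument in the mathematical formulas is \<open>xs ! (k - 1)\<close>.
\<close>

definition homogeneous :: "('k, 'u, 'z) gspace_scheme \<Rightarrow> 'u list \<Rightarrow> int list \<Rightarrow> bool" where
  "homogeneous U xs ds \<longleftrightarrow> list_all2 (\<lambda>x d. x \<in> gr U d) xs ds"

definition multilinear_deg ::
    "('k, 'u::ab_group_add, 'y) gspace_scheme \<Rightarrow> ('k, 'w::ab_group_add, 'z) gspace_scheme \<Rightarrow>
     int \<Rightarrow> ('u list \<Rightarrow> 'w) \<Rightarrow> bool" where
  "multilinear_deg U W p F \<longleftrightarrow>
     (\<forall>xs i x y c. set xs \<subseteq> car U \<longrightarrow> i < length xs \<longrightarrow> x \<in> car U \<longrightarrow> y \<in> car U \<longrightarrow>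
        F (xs[i := x + y]) = F (xs[i := x]) + F (xs[i := y]) \<and>
        F (xs[i := scl U c x]) = scl W c (F (xs[i := x]))) \<and>
     (\<forall>xs ds. xs \<noteq> [] \<longrightarrow> homogeneous U xs ds \<longrightarrow> F xs \<in> gr W (sum_list ds + p))"

definition sh :: "nat \<Rightarrow> nat \<Rightarrow> (nat \<Rightarrow> nat) set" where
  "sh p q = {\<sigma>. \<sigma> permutes {..<p + q} \<and> strict_mono_on {..<p} \<sigma> \<and> strict_mono_on {p..<p + q} \<sigma>}"

definition koszul :: "int list \<Rightarrow> nat \<Rightarrow> (nat \<Rightarrow> nat) \<Rightarrow> 'k::real_normed_field" where
  "koszul ds n \<sigma> = ksign (\<Sum>(i, j) | i < j \<and> j < n \<and> \<sigma> j < \<sigma> i. ds ! \<sigma> i * ds ! \<sigma> j)"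

text \<open>
  \<open>leib_sum W F \<lambda> xs ds\<close> is the left side of the Leibniz-infinity[1] identity for homogeneous
  arguments \<open>xs\<close> of degrees \<open>ds\<close>, with inner maps \<open>\<lambda>\<close> and outer maps \<open>F\<close> with values in \<open>W\<close>.
\<close>

definition leib_sum ::
    "('k::real_normed_field, 'w::ab_group_add, 'z) gspace_scheme \<Rightarrow> ('u list \<Rightarrow> 'w) \<Rightarrow>
     ('u list \<Rightarrow> 'u) \<Rightarrow> 'u list \<Rightarrow> int list \<Rightarrow> 'w" where
  "leib_sum W F l xs ds =
     (let n = length xs in
      \<Sum>j = 1..n. \<Sum>k = j..n. \<Sum>\<sigma> \<in> sh (k - j) (j - 1).
        scl W (koszul ds (k - 1) \<sigma> * ksign (\<Sum>i<k - j. ds ! \<sigma> i))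
          (F (map (\<lambda>i. xs ! \<sigma> i) [0..<k - j] @
              [l (map (\<lambda>i. xs ! \<sigma> i) [k - j..<k - 1] @ [xs ! (k - 1)])] @
              drop k xs)))"

definition compositions :: "nat \<Rightarrow> nat list set" where
  "compositions n = {is. sum_list is = n \<and> 0 \<notin> set is}"

text \<open>
  Block \<open>r\<close> of an \<open>(i\<^sub>1, \<dots>, i\<^sub>q)\<close>-shuffle is \<open>{sum_list (take r is)..<sum_list (take (Suc r) is)}\<close>.
\<close>

definition ordered_shuffles :: "nat list \<Rightarrow> (nat \<Rightarrow> nat) set" where
  "ordered_shuffles is =
     {\<sigma>. \<sigma> permutes {..<sum_list is} \<and>
         (\<forall>r<length is. strict_mono_on {sum_list (take r is)..<sum_list (take (Suc r) is)} \<sigma>) \<and>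
         strict_mono_on {..<length is} (\<lambda>r. \<sigma> (sum_list (take (Suc r) is) - 1))}"

definition comp_sum ::
    "('k::real_normed_field, 'w::ab_group_add, 'z) gspace_scheme \<Rightarrow> ('v list \<Rightarrow> 'w) \<Rightarrow>
     ('u list \<Rightarrow> 'v) \<Rightarrow> 'u list \<Rightarrow> int list \<Rightarrow> 'w" where
  "comp_sum W t \<phi> xs ds =
     (\<Sum>is \<in> compositions (length xs). \<Sum>\<sigma> \<in> ordered_shuffles is.
        scl W (koszul ds (length xs) \<sigma>)
          (t (map (\<lambda>r. \<phi> (map (\<lambda>i. xs ! \<sigma> i) [sum_list (take r is)..<sum_list (take (Suc r) is)]))
                  [0..<length is])))"

record ('k, 'a, 'u) leib = "('k, 'u) gspace" +
  amul :: "'a \<Rightarrow> 'u \<Rightarrow> 'u"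
  brk :: "'u list \<Rightarrow> 'u"

definition graded_module ::
    "('k::real_normed_field, 'a::ab_group_add) dga \<Rightarrow> ('k, 'a, 'u::ab_group_add) leib \<Rightarrow> bool" where
  "graded_module A U \<longleftrightarrow>
     graded_space U \<and>
     (\<forall>p. \<forall>a \<in> gr A p. linear_deg U U p (amul U a)) \<and>
     (\<forall>a \<in> car A. \<forall>b \<in> car A. \<forall>u \<in> car U.
        amul U (a + b) u = amul U a u + amul U b u \<and>
        amul U (amult A a b) u = amul U a (amul U b u)) \<and>
     (\<forall>c. \<forall>a \<in> car A. \<forall>u \<in> car U. amul U (scl A c a) u = scl U c (amul U a u)) \<and>
     (\<forall>u \<in> car U. amul U (aone A) u = u)"

definition A_multilinear ::
    "('k::real_normed_field, 'a) dga \<Rightarrow> ('k, 'a, 'u) leib \<Rightarrow> ('k, 'a, 'w) leib \<Rightarrow> int \<Rightarrow>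
     ('u list \<Rightarrow> 'w) \<Rightarrow> nat \<Rightarrow> bool" where
  "A_multilinear A U W p F n \<longleftrightarrow>
     (\<forall>xs ds i q. \<forall>a \<in> gr A q. length xs = n \<longrightarrow> i < n \<longrightarrow> homogeneous U xs ds \<longrightarrow>
        F (xs[i := amul U a (xs ! i)]) =
          scl W (ksign (q * (p + (\<Sum>j<i. ds ! j)))) (amul W a (F xs)))"

definition leib_algebra ::
    "('k::real_normed_field, 'a::ab_group_add) dga \<Rightarrow> ('k, 'a, 'u::ab_group_add) leib \<Rightarrow> bool" where
  "leib_algebra A U \<longleftrightarrow>
     graded_module A U \<and> multilinear_deg U U 1 (brk U) \<and>
     (\<forall>p. \<forall>a \<in> gr A p. \<forall>u \<in> car U.
        brk U [amul U a u] = amul U (adiff A a) u + scl U (ksign p) (amul U a (brk U [u]))) \<and>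
     (\<forall>n\<ge>2. A_multilinear A U U 1 (brk U) n) \<and>
     (\<forall>xs ds. xs \<noteq> [] \<longrightarrow> homogeneous U xs ds \<longrightarrow> leib_sum U (brk U) (brk U) xs ds = 0)"

definition leib_morphism ::
    "('k::real_normed_field, 'a::ab_group_add) dga \<Rightarrow> ('k, 'a, 'u::ab_group_add) leib \<Rightarrow>
     ('k, 'a, 'w::ab_group_add) leib \<Rightarrow> ('u list \<Rightarrow> 'w) \<Rightarrow> bool" where
  "leib_morphism A U W \<phi> \<longleftrightarrow>
     multilinear_deg U W 0 \<phi> \<and> (\<forall>xs. xs = [] \<or> \<not> set xs \<subseteq> car U \<longrightarrow> \<phi> xs = 0) \<and>
     (\<forall>n\<ge>1. A_multilinear A U W 0 \<phi> n) \<and>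
     (\<forall>xs ds. xs \<noteq> [] \<longrightarrow> homogeneous U xs ds \<longrightarrow>
        leib_sum W \<phi> (brk U) xs ds = comp_sum W (brk W) \<phi> xs ds)"

text \<open>The formula for the composite on homogeneous arguments, extended multilinearly.\<close>

definition leib_comp ::
    "('k::real_normed_field, 'a, 'u::ab_group_add) leib \<Rightarrow> ('k, 'a, 'w::ab_group_add) leib \<Rightarrow>
     ('v list \<Rightarrow> 'w) \<Rightarrow> ('u list \<Rightarrow> 'v) \<Rightarrow> ('u list \<Rightarrow> 'w)" where
  "leib_comp U W \<psi> \<phi> =
     (\<lambda>xs. \<Sum>ds \<in> listset (map (hsupp U) xs). comp_sum W \<psi> \<phi> (map2 (hcomp U) xs ds) ds)"

definition Leib ::
    "('k::real_normed_field, 'a::ab_group_add) dga \<Rightarrow>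
     (('k, 'a, 'u::ab_group_add) leib, 'u list \<Rightarrow> 'u) cat" where
  "Leib A =
     \<lparr>Obj = {U. leib_algebra A U},
      Hom = (\<lambda>U W. {\<phi>. leib_morphism A U W \<phi>}),
      Idn = (\<lambda>U xs. if length xs = 1 \<and> hd xs \<in> car U then hd xs else 0),
      Cmp = (\<lambda>U V W. leib_comp U W)\<rparr>"


section \<open>The brackets of a weak Loday-Pirashvili module\<close>

text \<open>
  The bracket of \<open>m\<^sub>1[1], \<dots>, m\<^sub>n[1]\<close>, \<open>n \<ge> 2\<close>, for \<open>ms = [m\<^sub>1, \<dots>, m\<^sub>n]\<close> with \<open>m\<^sub>i \<in> M\<close> of degree
  \<open>es ! (i - 1)\<close>; \<open>(\<omega> \<otimes> m)[1]\<close> is \<open>\<omega> \<otimes> m[1]\<close>.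
\<close>

definition lambda_gen ::
    "('k::real_normed_field, 'g::ab_group_add) dgla \<Rightarrow> ('k, 'm::ab_group_add) infmod \<Rightarrow>
     (nat \<Rightarrow> 'm \<Rightarrow> (mono \<Rightarrow>\<^sub>0 'g)) \<Rightarrow> 'm list \<Rightarrow> int list \<Rightarrow> (mono \<Rightarrow>\<^sub>0 'm)" where
  "lambda_gen L M f ms es =
     scl (coch L M) (ksign (sum_list (butlast es) - int (length ms) + 1))
       (foldr (\<lambda>m. contr_coch L M (tot f m)) (butlast ms) (tot (\<lambda>k. act M (Suc k)) (last ms)))"

text \<open>
  Its \<open>C(\<gg>)\<close>-multilinear extension. Each argument is a sum of terms \<open>x\<^sup>a \<otimes> m[1]\<close> with \<open>m\<close>
  homogeneous; moving \<open>x\<^sup>a\<close> to the front of the bracket passes the bracket, of degree 1, and all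
  earlier \<open>m\<^sub>j[1]\<close>, of degree \<open>|m\<^sub>j| - 1\<close>.
\<close>

definition lambda_ext ::
    "('k::real_normed_field, 'g::ab_group_add) dgla \<Rightarrow> ('k, 'm::ab_group_add) infmod \<Rightarrow>
     (nat \<Rightarrow> 'm \<Rightarrow> (mono \<Rightarrow>\<^sub>0 'g)) \<Rightarrow> (mono \<Rightarrow>\<^sub>0 'm) list \<Rightarrow> (mono \<Rightarrow>\<^sub>0 'm)" where
  "lambda_ext L M f \<Omega>s =
     (\<Sum>as \<in> listset (map Poly_Mapping.keys \<Omega>s).
      \<Sum>es \<in> listset (map (hsupp M) (map2 Poly_Mapping.lookup \<Omega>s as)).
        scl (coch L M)
          (ksign (\<Sum>i<length \<Omega>s. mdeg L (as ! i) * (1 + (\<Sum>j<i. es ! j - 1))))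
          (foldr (\<lambda>a. cmul L M (Poly_Mapping.single a 1)) as
             (lambda_gen L M f (map2 (hcomp M) (map2 Poly_Mapping.lookup \<Omega>s as) es) es)))"

definition G_object ::
    "('k::real_normed_field, 'g::ab_group_add) dgla \<Rightarrow> ('k, 'g, 'm::ab_group_add) wLP_object \<Rightarrow>
     ('k, mono \<Rightarrow>\<^sub>0 'k, mono \<Rightarrow>\<^sub>0 'm) leib" where
  "G_object L = (\<lambda>(M, f).
     \<lparr>scl = scl (coch L (shift 1 M)), gr = gr (coch L (shift 1 M)),
      amul = cmul L (shift 1 M),
      brk = (\<lambda>\<Omega>s. if \<Omega>s = [] then 0
                   else if length \<Omega>s = 1 then d_tot L (shift 1 M) (hd \<Omega>s)
                   else lambda_ext L M f \<Omega>s)\<rparr>)"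

end

(*
 Let A = C(g). On A (x) T(M[1]) a letter m acts by th_m, left multiplication by m plus the
 derivation of A that contracts with f(m). There is an operator Q of degree 1 with
 Q (th_m x) = th_{d m} x +- th_m (Q x), where d m is the total differential of m, which extends
 d_CE; it squares to zero because d_tot does and because f commutes with the differentials.
 The brackets are the part of Q in word length one. Q is compatible with the half coproduct
 that splits words into two subwords, the second containing the last letter, so Q is determined
 by this part, and
 Q (Q w) = 0 read in word length one is the Leibniz-infinity identity for w.
 A morphism phi replaces each letter m by phi(m); the resulting map commutes with Q and with
 the half coproduct, and its part in word length one is the image of phi under the functor.
 A homotopy with components h corrects the letter operators by the commutator of Q with the
 derivation along h. The resulting map is unipotent for word length, hence an isomorphism.
*)
theory Submission
 imports Defs "HOL-Library.Infinite_Set"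
begin

text \<open>Shuffles and Koszul signs are confined to one place. The half coproduct of a product of
  length one elements is a signed sum over the subsets of all factors but the last
  (\<open>dl_Wd\<close>), and the structure sums obey the matching recursion in their last argument
  (\<open>leib_sum_snoc\<close>, \<open>comp_sum_snoc\<close>). Everything else concerns operators
  on words over A. These are not A-linear: a letter also differentiates coefficients, through a
  vector field on A. In these terms the compatibility of f with the differentials reads [d_CE, F_m]
  = F_(dm), because the total differential of the adjoint module is the commutator with d_CE
  (\<open>cmp_d_tot\<close>). That d_CE squares to zero is read off from d_tot on a nonzero module,
  so the zero module is handled separately. For a homotopy the commutator alone is not enough: the
  vector fields of f' and f differ by [d_CE, E_m] and by a further field E_(dm). Both have to be
  subtracted to restore the action of m on coefficients; neither changes the value on the empty
  word.\<close>

abbreviation "lookup \<equiv> Poly_Mapping.lookup"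
abbreviation "keys \<equiv> Poly_Mapping.keys"
abbreviation "single \<equiv> Poly_Mapping.single"

type_synonym 'v coc = "mono \<Rightarrow>\<^sub>0 'v"

section \<open>Linear algebra on finitely supported functions\<close>

lemma ksign_0 [simp]: "ksign 0 = 1"
 by (simp add: ksign_def)

lemma ksign_add: "ksign (m + n) = (ksign m * ksign n :: 'k::real_normed_field)"
 by (simp add: ksign_def)

lemma ksign_mult_self [simp]: "ksign m * ksign m = (1 :: 'k::real_normed_field)"
 by (simp add: ksign_def)

lemma ksign_cong: "even (m - n) ==> (ksign m :: 'k::real_normed_field) = ksign n"
 by (auto simp: ksign_def)

lemma ksign_minus [simp]: "ksign (- m) = ksign m"
 by (simp add: ksign_def)

definition sc :: "'k::real_normed_field => ('b \<Rightarrow>\<^sub>0 'k) => ('b \<Rightarrow>\<^sub>0 'k)" where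
 "sc c = Poly_Mapping.map ((*) c)"

abbreviation sk :: "int => ('b \<Rightarrow>\<^sub>0 'k) => ('b \<Rightarrow>\<^sub>0 'k::real_normed_field)" where
 "sk n \<equiv> sc (ksign n)"

definition bs :: "'b => ('b \<Rightarrow>\<^sub>0 'k::real_normed_field)" where
 "bs b = Poly_Mapping.single b 1"

lemma lookup_sc [simp]: "lookup (sc c x) b = c * lookup x b"
 by (simp add: sc_def Poly_Mapping.map.rep_eq when_def)

lemma sc_add: "sc c (x + y) = sc c x + sc c y"
 by (rule poly_mapping_eqI) (simp add: lookup_add algebra_simps)

lemma sc_add_left: "sc (c + d) x = sc c x + sc d x"
 by (rule poly_mapping_eqI) (simp add: lookup_add algebra_simps)

lemma sc_sc [simp]: "sc c (sc d x) = sc (c * d) x"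
 by (rule poly_mapping_eqI) (simp add: algebra_simps)

lemma sc_1 [simp]: "sc 1 x = x"
 by (rule poly_mapping_eqI) simp

lemma sc_0 [simp]: "sc 0 x = 0"
 by (rule poly_mapping_eqI) simp

lemma sc_zero [simp]: "sc c 0 = 0"
 by (rule poly_mapping_eqI) simp

lemma sc_minus_left: "sc (- c) x = - sc c x"
 by (rule poly_mapping_eqI) simp

lemma sc_diff: "sc c (x - y) = sc c x - sc c y"
 by (rule poly_mapping_eqI) (simp add: lookup_minus algebra_simps)

lemma sc_sum: "sc c (sum f A) = (\<Sum>a\<in>A. sc c (f a))"
 by (induction A rule: infinite_finite_induct) (auto simp: sc_add)

lemma sc_single: "sc c (Poly_Mapping.single b x) = Poly_Mapping.single b (c * x)"
 by (rule poly_mapping_eqI) (simp add: lookup_single when_def)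

lemma single_bs: "Poly_Mapping.single b x = sc x (bs b)"
 by (simp add: bs_def sc_single)

lemma keys_sc: "keys (sc c x) <= keys x"
 by (auto simp: in_keys_iff)

lemma keys_bs [simp]: "keys (bs b :: 'b \<Rightarrow>\<^sub>0 'k::real_normed_field) = {b}"
 by (simp add: bs_def)

lemma lookup_bs: "lookup (bs b :: 'b \<Rightarrow>\<^sub>0 'k::real_normed_field) c = (if b = c then 1 else 0)"
 by (simp add: bs_def lookup_single when_def)

lemma poly_mapping_expand: "x = (\<Sum>b\<in>keys x. sc (lookup x b) (bs b))"
proof (rule poly_mapping_eqI)
 fix c
 have "lookup (\<Sum>b\<in>keys x. sc (lookup x b) (bs b)) c = (\<Sum>b\<in>keys x. lookup x b * lookup (bs b) c)"
  by (simp add: lookup_sum)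
 also have "\<dots> = (\<Sum>b\<in>keys x. if b = c then lookup x b else 0)"
  by (rule sum.cong) (auto simp: lookup_bs)
 also have "\<dots> = lookup x c" by (auto simp: in_keys_iff)
 finally show "lookup x c = lookup (\<Sum>b\<in>keys x. sc (lookup x b) (bs b)) c" by simp
qed

section \<open>Linear maps and their values on basis vectors\<close>

definition klin :: "(('b \<Rightarrow>\<^sub>0 'k::real_normed_field) => ('c \<Rightarrow>\<^sub>0 'k)) => bool" where
 "klin f \<longleftrightarrow> (\<forall>x y. f (x + y) = f x + f y) \<and> (\<forall>c x. f (sc c x) = sc c (f x))"

lemma klinI: "(!!x y. f (x + y) = f x + f y) ==> (!!c x. f (sc c x) = sc c (f x)) ==> klin f"
 by (simp add: klin_def)

lemma klin_add: "klin f ==> f (x + y) = f x + f y"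
 by (simp add: klin_def)

lemma klin_sc: "klin f ==> f (sc c x) = sc c (f x)"
 by (simp add: klin_def)

lemma klin_0: "klin f ==> f 0 = 0"
 using klin_sc[of f 0 0] by simp

lemma klin_sum: "klin f ==> f (sum g A) = (\<Sum>a\<in>A. f (g a))"
 by (induction A rule: infinite_finite_induct) (auto simp: klin_add klin_0)

lemma klin_uminus: "klin f ==> f (- x) = - f x"
 using klin_sc[of f "-1" x] by (simp add: sc_minus_left)

lemma klin_diff: "klin f ==> f (x - y) = f x - f y"
 using klin_add[of f x "- y"] by (simp add: klin_uminus)

lemma klin_id [intro]: "klin (%x. x)"
 and klin_const0 [intro]: "klin (%x. 0)"
 and klin_plus [intro]: "klin f ==> klin g ==> klin (%x. f x + g x)"
 and klin_minus [intro]: "klin f ==> klin g ==> klin (%x. f x - g x)"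
 and klin_scal [intro]: "klin f ==> klin (%x. sc c (f x))"
 and klin_sumfun [intro]: "(!!i. i \<in> I ==> klin (h i)) ==> klin (%x. \<Sum>i\<in>I. h i x)"
 by (simp_all add: klin_def sc_add sc_diff sc_sum sum.distrib mult.commute[of _ c])

lemma klin_comp: "klin f ==> klin g ==> klin (%x. f (g x))"
 by (auto simp: klin_def)

lemma klin_expand: "klin f ==> f x = (\<Sum>b\<in>keys x. sc (lookup x b) (f (bs b)))"
 by (subst poly_mapping_expand[of x]) (simp add: klin_sum klin_sc)

text \<open>Only basis vectors in the support of \<open>x\<close> are compared, so that a support
  condition on \<open>x\<close>, such as \<open>rc\<close>, is available for them. Nearly all
  identities below are reduced to basis vectors in this way.\<close>

lemma klin_eqI:
 assumes "klin f" "klin g" "!!b. b \<in> keys x ==> f (bs b) = g (bs b)"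
 shows "f x = g x"
 using assms by (simp add: klin_expand[of f x] klin_expand[of g x])

lemma keys_subset_add: "keys x <= S ==> keys y <= S ==> keys (x + y) <= S"
 using Poly_Mapping.keys_add[of x y] by blast

lemma keys_subset_sc: "keys x <= S ==> keys (sc c x) <= S"
 using keys_sc[of c x] by blast

lemma keys_subset_diff: "keys x <= S ==> keys y <= S ==> keys (x - y :: _ \<Rightarrow>\<^sub>0 'k::ab_group_add) <= S"
proof
 fix b assume *: "keys x <= S" "keys y <= S" "b \<in> keys (x - y)"
 hence "b \<in> keys x \<or> b \<in> keys y" by (auto simp: in_keys_iff lookup_minus)
 with * show "b \<in> S" by blast
qed

lemma keys_subset_sum: "(!!i. i \<in> I ==> keys (f i) <= S) ==> keys (sum f I) <= S"
 by (induction I rule: infinite_finite_induct) (simp_all add: keys_subset_add)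

text \<open>Degree, admissibility of monomials and shape of words are all expressed by supports;
  this carries any of these conditions through a linear map.\<close>

lemma keys_subset_klin:
 assumes "klin f" "keys x <= S" "!!b. b \<in> S ==> keys (f (bs b)) <= T"
 shows "keys (f x) <= T"
 unfolding klin_expand[OF assms(1), of x]
 using assms by (intro keys_subset_sum keys_subset_sc) auto

definition ext :: "('b => ('c \<Rightarrow>\<^sub>0 'k::real_normed_field)) => ('b \<Rightarrow>\<^sub>0 'k) => ('c \<Rightarrow>\<^sub>0 'k)" where
 "ext g x = (\<Sum>b\<in>keys x. sc (lookup x b) (g b))"

lemma ext_superset: "finite S ==> keys x <= S ==> ext g x = (\<Sum>b\<in>S. sc (lookup x b) (g b))"
 unfolding ext_def by (rule sum.mono_neutral_left) (auto simp: in_keys_iff)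

lemma klin_ext [intro]:
 fixes g :: "'b => ('c \<Rightarrow>\<^sub>0 'k::real_normed_field)"
 shows "klin (ext g)"
proof (rule klinI)
 fix x y :: "'b \<Rightarrow>\<^sub>0 'k"
 have "keys (x + y) <= keys x \<union> keys y" by (rule Poly_Mapping.keys_add)
 thus "ext g (x + y) = ext g x + ext g y"
  by (simp add: ext_superset[of "keys x \<union> keys y"] lookup_add sc_add_left sum.distrib)
next
 fix c and x :: "'b \<Rightarrow>\<^sub>0 'k"
 show "ext g (sc c x) = sc c (ext g x)"
  using keys_sc[of c x] by (simp add: ext_superset[of "keys x"] sc_sum)
qed

lemma ext_bs [simp]: "ext g (bs b) = g b"
 by (simp add: ext_def lookup_bs)

lemma klin_ext_fun: "(!!b. klin (%y. g y b)) ==> klin (%y. ext (g y) x)"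
 unfolding ext_def by (rule klin_sumfun) (rule klin_scal)

section \<open>Signed products\<close>

text \<open>
 Words carry a degree and a bilinear sign exponent, so that lists (the tensor algebra)
 and pairs of lists (its tensor square, as a super algebra) are treated uniformly.
\<close>

class graded_word =
 fixes wmul :: "'a => 'a => 'a" and wone :: 'a and wdeg :: "'a => int" and wsgn :: "'a => 'a => int"
 assumes wmul_assoc: "wmul (wmul u v) w = wmul u (wmul v w)"
  and wmul_one [simp]: "wmul u wone = u" "wmul wone u = u"
  and wdeg_mul: "wdeg (wmul u v) = wdeg u + wdeg v"
  and wdeg_one [simp]: "wdeg wone = 0"
  and wsgn_mul: "wsgn (wmul u v) w = wsgn u w + wsgn v w" "wsgn u (wmul v w) = wsgn u v + wsgn u w"
  and wsgn_one [simp]: "wsgn u wone = 0" "wsgn wone u = 0"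

text \<open>The degree is stored in the letter: \<open>graded_letter\<close> wants a degree that
  depends on the letter alone, whereas the degree of a vector depends on the graded space around it.
  Hence there are letters without meaning in a given module, see \<open>real_ltr\<close>.\<close>

datatype 'm letter = Letter (lval: 'm) (ldeg: int)

type_synonym ('w, 'k) galg = "mono \<times> 'w \<Rightarrow>\<^sub>0 'k"
type_synonym ('m, 'k) walg = "('m letter list, 'k) galg"
type_synonym ('m, 'k) walg2 = "('m letter list \<times> 'm letter list, 'k) galg"

instantiation prod :: (graded_word, graded_word) graded_word
begin
definition "wmul p q = (wmul (fst p) (fst q), wmul (snd p) (snd q))"
definition "wone = (wone, wone)"
definition "wdeg p = wdeg (fst p) + wdeg (snd p)"
text \<open>The first summand is the Koszul sign for moving the second factor of \<open>p\<close>
  past the first factor of \<open>q\<close>.\<close>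

definition "wsgn p q = wdeg (snd p) * wdeg (fst q) + wsgn (fst p) (fst q) + wsgn (snd p) (snd q)"
instance
 by standard
  (auto simp: wmul_prod_def wone_prod_def wdeg_prod_def wsgn_prod_def wmul_assoc wdeg_mul wsgn_mul
    algebra_simps)
end

class graded_letter =
 fixes gdeg :: "'a => int"

instantiation letter :: (type) graded_letter
begin
definition "gdeg = ldeg"
instance ..
end

instantiation list :: (graded_letter) graded_word
begin
definition "wmul u v = u @ v"
definition "wone = []"
definition "wdeg u = sum_list (map gdeg u)"
definition wsgn_list :: "'a list => 'a list => int" where "wsgn_list u v = 0"
instance by standard (auto simp: wmul_list_def wone_list_def wdeg_list_def wsgn_list_def)
end

section \<open>Monomials of C(g) and the signs of their products\<close>

lemma mons_0 [simp]: "0 \<in> mons L"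
 by (simp add: mons_def)

lemma mons_add_iff:
 "a + b \<in> mons L \<longleftrightarrow> keys a <= {..<ldim L} \<and> keys b <= {..<ldim L} \<and>
   (\<forall>i. odd (wt L i) \<longrightarrow> lookup a i + lookup b i \<le> 1)"
proof -
 have "keys (a + b) = keys a \<union> keys b" by (auto simp: in_keys_iff lookup_add)
 thus ?thesis by (simp add: mons_def lookup_add)
qed

lemma mons_addD: "a + b \<in> mons L ==> a \<in> mons L \<and> b \<in> mons L"
proof -
 assume *: "a + b \<in> mons L"
 have "lookup a i \<le> 1 \<and> lookup b i \<le> 1" if "odd (wt L i)" for i
  using * that unfolding mons_add_iff by (metis add_leE)
 with * show ?thesis unfolding mons_add_iff by (simp add: mons_def)
qed

lemma mdeg_superset: "finite S ==> keys a <= S ==> mdeg L a = (\<Sum>i\<in>S. int (lookup a i) * wt L i)"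
 unfolding mdeg_def by (rule sum.mono_neutral_left) (auto simp: in_keys_iff)

lemma mdeg_add [simp]: "mdeg L (a + b) = mdeg L a + mdeg L b"
 using Poly_Mapping.keys_add[of a b]
 by (simp add: mdeg_superset[of "keys a \<union> keys b"] lookup_add algebra_simps sum.distrib)

lemma mdeg_0 [simp]: "mdeg L 0 = 0"
 by (simp add: mdeg_def)

lemma mdeg_single [simp]: "mdeg L (Poly_Mapping.single i n) = int n * wt L i"
 by (simp add: mdeg_def)

definition mexp :: "('k::real_normed_field, 'g) dgla => mono => mono => int" where
 "mexp L a b = (\<Sum>i<ldim L. \<Sum>j<i. int (lookup a i) * int (lookup b j) * wt L i * wt L j)"

lemma msign_mexp: "msign L a b = ksign (mexp L a b)"
 by (simp add: msign_def mexp_def)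

lemma mexp_add: "mexp L (a + b) c = mexp L a c + mexp L b c" "mexp L a (b + c) = mexp L a b + mexp L a c"
 by (simp_all add: mexp_def lookup_add algebra_simps sum.distrib)

lemma mexp_0 [simp]: "mexp L 0 a = 0" "mexp L a 0 = 0"
 by (simp_all add: mexp_def)

text \<open>The structure constants of C(g). They vanish when an odd generator would be repeated,
  which spares a case distinction in every product.\<close>

definition mcoef :: "('k::real_normed_field, 'g) dgla => mono => mono => 'k" where
 "mcoef L a b = (if a + b \<in> mons L then msign L a b else 0)"

lemma mcoef_0 [simp]: "a \<in> mons L ==> mcoef L 0 a = 1" "a \<in> mons L ==> mcoef L a 0 = 1"
 by (simp_all add: mcoef_def msign_mexp)

text \<open>The three sums run over i > j, i < j and i = j; together they fill the square of all
  pairs, over which the sum factors.\<close>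

lemma mexp_swap:
 assumes "keys a <= {..<ldim L}" "keys b <= {..<ldim L}"
 shows "mexp L a b + mexp L b a + (\<Sum>i<ldim L. int (lookup a i) * int (lookup b i) * wt L i * wt L i)
  = mdeg L a * mdeg L b"
proof -
 let ?A = "%i. int (lookup a i) * wt L i" and ?B = "%i. int (lookup b i) * wt L i"
 have *: "(\<Sum>i<n. \<Sum>j<i. ?A i * ?B j) + (\<Sum>i<n. \<Sum>j<i. ?B i * ?A j) + (\<Sum>i<n. ?A i * ?B i)
   = sum ?A {..<n} * sum ?B {..<n}" for n
  by (induction n) (auto simp: algebra_simps sum_distrib_left sum_distrib_right)
 show ?thesis
  unfolding mexp_def mdeg_superset[OF _ assms(1), simplified] mdeg_superset[OF _ assms(2), simplified]
   *[symmetric]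
  by (simp add: mult_ac)
qed

text \<open>Graded commutativity of C(g). The diagonal terms of \<open>mexp_swap\<close> are even,
  since an odd generator cannot occur in both factors of a nonzero product.\<close>

lemma mcoef_swap: "mcoef L b a = ksign (mdeg L a * mdeg L b) * mcoef L a b"
proof (cases "a + b \<in> mons L")
 case True
 hence k: "keys a <= {..<ldim L}" "keys b <= {..<ldim L}" and
  o: "!!i. odd (wt L i) ==> lookup a i + lookup b i \<le> 1" by (auto simp: mons_add_iff)
 have "even (\<Sum>i<ldim L. int (lookup a i) * int (lookup b i) * wt L i * wt L i)"
 proof (rule dvd_sum)
  fix i
  show "even (int (lookup a i) * int (lookup b i) * wt L i * wt L i)"
   using o[of i] by (cases "odd (wt L i)") (auto simp: le_Suc_eq add_is_1)
 qed
 hence "(ksign (mdeg L a * mdeg L b) :: 'a) = ksign (mexp L a b) * ksign (mexp L b a)"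
  unfolding mexp_swap[OF k, symmetric] ksign_add[symmetric] by (intro ksign_cong) auto
 thus ?thesis using True by (simp add: mcoef_def msign_mexp add.commute mult_ac)
qed (simp add: mcoef_def add.commute)

declare One_nat_def [simp del]

section \<open>The algebra of words with coefficients in C(g)\<close>

definition bdeg :: "('k::real_normed_field, 'g) dgla => mono \<times> 'w::graded_word => int" where
 "bdeg L b = mdeg L (fst b) + wdeg (snd b)"

text \<open>The graded tensor product of C(g) with the algebra of words: the sign moves the word of
  the left factor past the monomial of the right one.\<close>

definition prd :: "('k::real_normed_field, 'g) dgla => ('w::graded_word, 'k) galg =>
  ('w, 'k) galg => ('w, 'k) galg" where
 "prd L x y = ext (%b. ext (%c.
   sc (mcoef L (fst b) (fst c) * ksign (wdeg (snd b) * mdeg L (fst c) + wsgn (snd b) (snd c)))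
    (bs (fst b + fst c, wmul (snd b) (snd c)))) y) x"

definition inA :: "'k::real_normed_field coc => ('w::graded_word, 'k) galg" where
 "inA = ext (%a. bs (a, wone))"

abbreviation "sm L a == prd L (inA a)"

text \<open>With the sign expressed by this operator, graded Leibniz and commutation rules can be
  stated for inhomogeneous elements.\<close>

definition sgno :: "('k::real_normed_field, 'g) dgla => int => ('w::graded_word, 'k) galg =>
  ('w, 'k) galg" where
 "sgno L p = ext (%b. sk (p * bdeg L b) (bs b))"

definition pre :: "('k::real_normed_field, 'g) dgla => nat => mono => int" where
 "pre L i a = (\<Sum>j<i. int (lookup a j) * wt L j)"

text \<open>The sign moves the generator with index \<open>i\<close> to the front of the monomial. A
  common sign for all copies suffices, because an odd generator occurs at most once in an admissible
  monomial.\<close>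

definition pdc :: "('k::real_normed_field, 'g) dgla => nat => mono => 'k" where
 "pdc L i a = of_nat (lookup a i) * ksign (wt L i * pre L i a)"

text \<open>Only coefficients are differentiated; words are constants for this operator and for
  every vector field \<open>vf\<close>.\<close>

definition pd :: "('k::real_normed_field, 'g) dgla => nat => ('w::graded_word, 'k) galg =>
  ('w, 'k) galg" where
 "pd L i = ext (%b. sc (pdc L i (fst b)) (bs (fst b - single i 1, snd b)))"

definition vf :: "('k::real_normed_field, 'g) dgla => (nat => 'k coc) =>
  ('w::graded_word, 'k) galg => ('w, 'k) galg" where
 "vf L v x = (\<Sum>i<ldim L. sm L (v i) (pd L i x))"

text \<open>The type of exponents contains monomials that are not basis elements of C(g);
  \<open>rc\<close> excludes them.\<close>

abbreviation "rc L x \<equiv> keys x <= {b. fst b \<in> mons L}"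
abbreviation "hom L n x \<equiv> keys x <= {b. bdeg L b = n}"
abbreviation "rcA L x \<equiv> keys x <= mons L"
abbreviation "homA L n x \<equiv> keys x <= {a. mdeg L a = n}"

lemma klin_prd_left [intro]: "klin f ==> klin (%x. prd L (f x) y)"
 unfolding prd_def by (rule klin_comp[OF klin_ext])

lemma klin_prd_right [intro]: "klin f ==> klin (%x. prd L y (f x))"
 unfolding prd_def by (rule klin_ext_fun, rule klin_comp[OF klin_ext])

lemma klin_inA [intro]: "klin f ==> klin (%x. inA (f x))"
 unfolding inA_def by (rule klin_comp[OF klin_ext])

lemma klin_sgno [intro]: "klin f ==> klin (%x. sgno L p (f x))"
 unfolding sgno_def by (rule klin_comp[OF klin_ext])

lemma klin_pd [intro]: "klin f ==> klin (%x. pd L i (f x))"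
 unfolding pd_def by (rule klin_comp[OF klin_ext])

lemma klin_vf [intro]: "klin f ==> klin (%x. vf L v (f x))"
 unfolding vf_def by (intro klin_sumfun klin_prd_right klin_pd)

lemmas klin_intros = klin_id klin_const0 klin_plus klin_minus klin_scal klin_sumfun
 klin_prd_left klin_prd_right klin_inA klin_sgno klin_pd klin_vf

lemmas prd_add_left = klin_add[OF klin_prd_left[OF klin_id]]
lemmas prd_add_right = klin_add[OF klin_prd_right[OF klin_id]]
lemmas prd_diff_left = klin_diff[OF klin_prd_left[OF klin_id]]
lemmas prd_diff_right = klin_diff[OF klin_prd_right[OF klin_id]]
lemmas prd_sc_left = klin_sc[OF klin_prd_left[OF klin_id]]
lemmas prd_sc_right = klin_sc[OF klin_prd_right[OF klin_id]]
lemmas prd_sum_left = klin_sum[OF klin_prd_left[OF klin_id]]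
lemmas prd_sum_right = klin_sum[OF klin_prd_right[OF klin_id]]
lemmas prd_0_left [simp] = klin_0[OF klin_prd_left[OF klin_id]]
lemmas prd_0_right [simp] = klin_0[OF klin_prd_right[OF klin_id]]
lemmas inA_0 [simp] = klin_0[OF klin_inA[OF klin_id]]
lemmas inA_add = klin_add[OF klin_inA[OF klin_id]]
lemmas inA_sc = klin_sc[OF klin_inA[OF klin_id]]
lemmas inA_sum = klin_sum[OF klin_inA[OF klin_id]]
lemmas sgno_add = klin_add[OF klin_sgno[OF klin_id]]
lemmas sgno_sc = klin_sc[OF klin_sgno[OF klin_id]]
lemmas sgno_0 [simp] = klin_0[OF klin_sgno[OF klin_id]]
lemmas vf_add = klin_add[OF klin_vf[OF klin_id]]
lemmas vf_sc = klin_sc[OF klin_vf[OF klin_id]]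
lemmas vf_0 [simp] = klin_0[OF klin_vf[OF klin_id]]
lemmas vf_sum = klin_sum[OF klin_vf[OF klin_id]]

lemmas pd_add = klin_add[OF klin_pd[OF klin_id]]
lemmas pd_sc = klin_sc[OF klin_pd[OF klin_id]]

lemma prd_bs: "prd L (bs (a, u)) (bs (b, v)) =
  sc (mcoef L a b * ksign (wdeg u * mdeg L b + wsgn u v)) (bs (a + b, wmul u v))"
 by (simp add: prd_def)

lemma inA_bs [simp]: "inA (bs a) = bs (a, wone)"
 by (simp add: inA_def)

lemma sgno_bs: "sgno L p (bs b) = sk (p * bdeg L b) (bs b)"
 by (simp add: sgno_def)

lemma pd_bs: "pd L i (bs (a, u)) = sc (pdc L i a) (bs (a - single i 1, u))"
 by (simp add: pd_def)

lemma bdeg_pair [simp]: "bdeg L (a, u) = mdeg L a + wdeg u"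
 by (simp add: bdeg_def)

text \<open>No admissibility is assumed: if the total monomial is inadmissible both sides vanish,
  and otherwise all partial products are admissible and the sign exponents are bilinear.\<close>

lemma prd_assoc: "prd L (prd L x y) z = prd L x (prd L y z)"
proof (rule klin_eqI[where f = "%x. prd L (prd L x y) z"])
 fix b assume "b \<in> keys x"
 show "prd L (prd L (bs b) y) z = prd L (bs b) (prd L y z)"
 proof (rule klin_eqI[where f = "%y. prd L (prd L (bs b) y) z"])
  fix c assume "c \<in> keys y"
  show "prd L (prd L (bs b) (bs c)) z = prd L (bs b) (prd L (bs c) z)"
  proof (rule klin_eqI[where f = "%z. prd L (prd L (bs b) (bs c)) z"])
   fix d assume "d \<in> keys z"
   obtain a1 u1 where b: "b = (a1, u1)" by (cases b)
   obtain a2 u2 where c: "c = (a2, u2)" by (cases c)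
   obtain a3 u3 where d: "d = (a3, u3)" by (cases d)
   show "prd L (prd L (bs b) (bs c)) (bs d) = prd L (bs b) (prd L (bs c) (bs d))"
    using mons_addD[of "a1 + a2" a3 L] mons_addD[of a1 "a2 + a3" L]
    by (cases "a1 + (a2 + a3) \<in> mons L")
     (auto simp: b c d prd_bs prd_sc_left prd_sc_right mcoef_def msign_mexp mexp_add wmul_assoc
      wdeg_mul wsgn_mul add.assoc distrib_left distrib_right ksign_add mult_ac)
  qed (intro klin_intros)+
 qed (intro klin_intros)+
qed (intro klin_intros)+

lemma prd_one_left: "rc L x ==> prd L (bs (0, wone)) x = x"
 by (rule klin_eqI[where f = "%x. prd L (bs (0, wone)) x"]) (auto intro: klin_intros simp: prd_bs)

lemma prd_one_right: "rc L x ==> prd L x (bs (0, wone)) = x"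
 by (rule klin_eqI[where f = "%x. prd L x (bs (0, wone))"]) (auto intro: klin_intros simp: prd_bs)

lemma keys_prd:
 assumes "keys x <= S" "keys y <= T"
  "!!a u b v. (a, u) \<in> S ==> (b, v) \<in> T ==> a + b \<in> mons L ==> (a + b, wmul u v) \<in> U"
 shows "keys (prd L x y) <= U"
proof (rule keys_subset_klin[where f = "%x. prd L x y", OF _ assms(1)])
 fix b assume b: "b \<in> S"
 show "keys (prd L (bs b) y) <= U"
 proof (rule keys_subset_klin[where f = "%y. prd L (bs b) y", OF _ assms(2)])
  fix c assume "c \<in> T"
  thus "keys (prd L (bs b) (bs c)) <= U"
   using assms(3) b keys_sc by (cases b; cases c) (fastforce simp: prd_bs mcoef_def in_keys_iff lookup_bs split: if_splits)
 qed (intro klin_intros)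
qed (intro klin_intros)

lemma rc_prd [simp]: "rc L (prd L x y)"
 by (rule keys_prd[where S = UNIV and T = UNIV]) auto

lemma hom_prd: "hom L m x ==> hom L n y ==> hom L (m + n) (prd L x y)"
 by (erule keys_prd, assumption) (auto simp: wdeg_mul)

lemma keys_inA: "keys (inA x) <= (%a. (a, wone)) ` keys x"
 by (rule keys_subset_klin[OF klin_inA[OF klin_id], of _ "keys x"]) auto

lemma rc_inA: "rcA L x ==> rc L (inA x)"
 and hom_inA: "homA L n x ==> hom L n (inA x)"
 using keys_inA[of x] by (force simp: bdeg_def)+

lemma keys_sgno: "keys (sgno L p x) <= keys x"
 by (rule keys_subset_klin[OF klin_sgno[OF klin_id], of _ "keys x"]) (auto simp: sgno_bs intro!: keys_subset_sc)

lemma rc_sgno: "rc L x ==> rc L (sgno L p x)"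
 and hom_sgno: "hom L n x ==> hom L n (sgno L p x)"
 using keys_sgno[of L p x] by blast+

lemma sgno_hom: "hom L n x ==> sgno L p x = sk (p * n) x"
 by (rule klin_eqI[where f = "sgno L p"]) (auto intro!: klin_intros simp: sgno_bs)

lemma sgno_sgno: "sgno L p (sgno L q x) = sgno L (p + q) x"
 by (rule klin_eqI[where f = "%x. sgno L p (sgno L q x)"])
  (auto intro!: klin_intros simp: sgno_bs sgno_sc ksign_add algebra_simps)

lemma sgno_even: "even p ==> sgno L p x = x"
 by (rule klin_eqI[where f = "sgno L p"]) (auto intro!: klin_intros simp: sgno_bs ksign_def)

lemma sgno_prd: "sgno L p (prd L x y) = prd L (sgno L p x) (sgno L p y)"
proof (rule klin_eqI[where f = "%x. sgno L p (prd L x y)"])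
 fix b assume "b \<in> keys x"
 show "sgno L p (prd L (bs b) y) = prd L (sgno L p (bs b)) (sgno L p y)"
 proof (rule klin_eqI[where f = "%y. sgno L p (prd L (bs b) y)"])
  fix c
  show "sgno L p (prd L (bs b) (bs c)) = prd L (sgno L p (bs b)) (sgno L p (bs c))"
   by (cases b; cases c) (simp add: sgno_bs prd_bs prd_sc_left prd_sc_right sgno_sc wdeg_mul ksign_add
    distrib_left mult_ac)
 qed (intro klin_intros)+
qed (intro klin_intros)+

text \<open>Coefficients are central in the graded sense, because words pass monomials with the
  Koszul sign and C(g) is graded commutative.\<close>

lemma inA_commute: "homA L q u ==> sm L u x = prd L (sgno L q x) (inA u)"
proof (rule klin_eqI[where f = "%u. sm L u x"])
 fix a assume "homA L q u" "a \<in> keys u"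
 hence a: "mdeg L a = q" by auto
 show "sm L (bs a) x = prd L (sgno L q x) (inA (bs a))"
 proof (rule klin_eqI[where f = "%x. sm L (bs a) x"])
  fix b
  show "sm L (bs a) (bs b) = prd L (sgno L q (bs b)) (inA (bs a))"
   using mcoef_swap[of L a "fst b"]
   by (cases b) (simp add: a[symmetric] prd_bs sgno_bs prd_sc_left ksign_add add.commute distrib_left mult_ac,
    simp add: ksign_def mult.commute)
 qed (intro klin_intros)+
qed (intro klin_intros)+

lemma inA_cmul: "inA (cmul L ground u v) = sm L u (inA v)"
proof -
 have "inA (cmul L ground u v) = (\<Sum>a\<in>keys u. \<Sum>b\<in>keys v.
   sc (lookup u a * lookup v b) (sc (mcoef L a b) (bs (a + b, wone))))"
  unfolding cmul_def inA_sum
  by (intro sum.cong refl) (auto simp: mcoef_def ground_def single_bs inA_sc mult_ac)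
 also have "\<dots> = sm L u (inA v)"
  unfolding klin_expand[OF klin_inA[OF klin_id], of u] klin_expand[OF klin_inA[OF klin_id], of v]
  unfolding prd_sum_left
  by (intro sum.cong refl) (simp add: prd_sum_right prd_sc_left prd_sc_right prd_bs sc_sum mult_ac)
 finally show ?thesis .
qed

subsection \<open>Derivations along the coefficients\<close>

lemma mexp_single_left: "i < ldim L ==> mexp L (single i 1) b = wt L i * pre L i b"
proof -
 assume i: "i < ldim L"
 have "mexp L (single i 1) b = (\<Sum>k<ldim L. if k = i then (\<Sum>j<i. int (lookup b j) * wt L i * wt L j) else 0)"
  unfolding mexp_def by (rule sum.cong) (auto simp: lookup_single when_def)
 thus ?thesis using i by (simp add: pre_def sum_distrib_left mult_ac)
qed

lemma mexp_single_right:
 assumes "i < ldim L" "keys a <= {..<ldim L}"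
 shows "mexp L a (single i 1) = wt L i * (mdeg L a - pre L i a - int (lookup a i) * wt L i)"
proof -
 let ?f = "%k. int (lookup a k) * wt L k"
 have "mexp L a (single i 1) = (\<Sum>k<ldim L. if i < k then ?f k * wt L i else 0)"
  unfolding mexp_def
 proof (rule sum.cong)
  fix k
  have "(\<Sum>j<k. int (lookup a k) * int (lookup (single i 1) j) * wt L k * wt L j)
   = (\<Sum>j<k. if j = i then ?f k * wt L i else 0)"
   by (rule sum.cong) (auto simp: lookup_single when_def)
  thus "(\<Sum>j<k. int (lookup a k) * int (lookup (single i 1) j) * wt L k * wt L j)
   = (if i < k then ?f k * wt L i else 0)" by simp
 qed simp
 also have "\<dots> = (\<Sum>k\<in>{Suc i..<ldim L}. ?f k * wt L i)"
  by (rule sum.mono_neutral_cong_right) auto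
 finally have 1: "mexp L a (single i 1) = wt L i * sum ?f {Suc i..<ldim L}"
  by (simp add: sum_distrib_left mult.commute)
 have "mdeg L a = sum ?f {0..<ldim L}"
  unfolding lessThan_atLeast0[symmetric] by (rule mdeg_superset[OF finite_lessThan assms(2)])
 also have "\<dots> = sum ?f {0..<i} + sum ?f {i..<ldim L}"
  using assms(1) by (intro sum.atLeastLessThan_concat[symmetric]) simp_all
 also have "sum ?f {i..<ldim L} = ?f i + sum ?f {Suc i..<ldim L}"
  by (rule sum.atLeast_Suc_lessThan[OF assms(1)])
 finally have "mdeg L a - pre L i a - ?f i = sum ?f {Suc i..<ldim L}"
  unfolding pre_def lessThan_atLeast0 by linarith
 with 1 show ?thesis by simp
qed

lemma pre_add: "pre L i (a + b) = pre L i a + pre L i b"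
 by (simp add: pre_def lookup_add algebra_simps sum.distrib)

lemma minus_single_add: "0 < lookup a i ==> a - single i 1 + single i (1::nat) = a"
 by (rule poly_mapping_eqI) (auto simp: lookup_add lookup_minus lookup_single when_def)

text \<open>The Leibniz rule for a partial derivative on monomials, at the level of structure
  constants. If the product of the monomials is nonzero, all terms carry one common sign. If it
  vanishes, the terms on the right vanish too, or cancel.\<close>

lemma pdc_mcoef:
 fixes L :: "('k::real_normed_field, 'g) dgla"
 assumes i: "i < ldim L" and a: "a \<in> mons L" and b: "b \<in> mons L"
 shows "pdc L i (a + b) * mcoef L a b =
  pdc L i a * mcoef L (a - single i 1) b + ksign (wt L i * mdeg L a) * pdc L i b * mcoef L a (b - single i 1)"
proof -
 let ?e = "single i (1::nat)"
 let ?w = "wt L i"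
 have ka: "keys a <= {..<ldim L}" using a by (simp add: mons_def)
 have ma: "mexp L (a - ?e) b = mexp L a b - ?w * pre L i b" if "0 < lookup a i"
 proof -
  have "mexp L a b = mexp L (a - ?e + ?e) b" using minus_single_add[OF that] by simp
  thus ?thesis by (simp add: mexp_add mexp_single_left[OF i])
 qed
 have mb: "mexp L a (b - ?e) = mexp L a b - ?w * (mdeg L a - pre L i a - int (lookup a i) * ?w)"
  if "0 < lookup b i"
 proof -
  have "mexp L a b = mexp L a (b - ?e + ?e)" using minus_single_add[OF that] by simp
  thus ?thesis by (simp add: mexp_add mexp_single_right[OF i ka])
 qed
 have am: "a - ?e + b = a + b - ?e" if "0 < lookup a i"
  using that by (intro poly_mapping_eqI) (auto simp: lookup_add lookup_minus lookup_single when_def)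
 have bm: "a + (b - ?e) = a + b - ?e" if "0 < lookup b i"
  using that by (intro poly_mapping_eqI) (auto simp: lookup_add lookup_minus lookup_single when_def)
 have sub: "a + b - ?e \<in> mons L" if "a + b \<in> mons L" "0 < lookup a i \<or> 0 < lookup b i"
  using mons_addD[of "a + b - ?e" ?e L] minus_single_add[of "a + b" i] that by (simp add: lookup_add)
 show ?thesis
 proof (cases "a + b \<in> mons L")
  case True
  have o: "odd ?w ==> lookup a i + lookup b i \<le> 1" using True by (simp add: mons_add_iff)
  have A: "pdc L i a * mcoef L (a - ?e) b = of_nat (lookup a i) * ksign (?w * pre L i (a + b) + mexp L a b)"
  proof (cases "lookup a i = 0")
   case False
   hence 1: "pdc L i a * mcoef L (a - ?e) b
     = of_nat (lookup a i) * (ksign (?w * pre L i a) * ksign (mexp L (a - ?e) b))"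
    using True sub am by (simp add: pdc_def mcoef_def msign_mexp)
   have "(ksign (?w * pre L i a) * ksign (mexp L (a - ?e) b) :: 'k)
     = ksign (?w * pre L i (a + b) + mexp L a b)"
    unfolding ksign_add[symmetric] using False by (intro ksign_cong) (simp add: ma pre_add distrib_left)
   with 1 show ?thesis by simp
  qed (simp add: pdc_def)
  have B: "ksign (?w * mdeg L a) * pdc L i b * mcoef L a (b - ?e)
    = of_nat (lookup b i) * ksign (?w * pre L i (a + b) + mexp L a b)"
  proof (cases "lookup b i = 0")
   case False
   have e: "even (int (lookup a i) * ?w * ?w)"
   proof (cases "odd ?w")
    case True
    hence "lookup a i = 0" using o False by linarith
    thus ?thesis by simp
   qed simp
   have 1: "ksign (?w * mdeg L a) * pdc L i b * mcoef L a (b - ?e)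
     = of_nat (lookup b i) * (ksign (?w * mdeg L a) * ksign (?w * pre L i b) * ksign (mexp L a (b - ?e)))"
    using False True sub bm by (simp add: pdc_def mcoef_def msign_mexp mult_ac)
   have "(ksign (?w * mdeg L a) * ksign (?w * pre L i b) * ksign (mexp L a (b - ?e)) :: 'k)
     = ksign (?w * pre L i (a + b) + mexp L a b)"
    unfolding ksign_add[symmetric] using False e
    by (intro ksign_cong) (simp add: mb pre_add algebra_simps)
   with 1 show ?thesis by simp
  qed (simp add: pdc_def)
  have C: "pdc L i (a + b) * mcoef L a b =
    of_nat (lookup a i + lookup b i) * ksign (?w * pre L i (a + b) + mexp L a b)"
   using True by (simp only: pdc_def mcoef_def msign_mexp lookup_add ksign_add if_True mult.assoc)
  show ?thesis unfolding A B C by (simp only: of_nat_add distrib_right)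
 next
  case False
  show ?thesis
  proof (cases "a + b - ?e \<in> mons L \<and> 0 < lookup a i + lookup b i")
   case True
   \<comment> \<open>Removing one factor of index \<open>i\<close> repairs the product, so
     \<open>i\<close> is the only repeated odd index. It occurs once in each monomial, and the two
     terms of the Leibniz rule cancel.\<close>
   have j: "odd ?w \<and> 1 < lookup a i + lookup b i"
   proof (rule ccontr)
    assume "\<not> ?thesis"
    moreover have "keys b <= {..<ldim L}" using b by (simp add: mons_def)
    moreover have "lookup a j + lookup b j \<le> 1" if "odd (wt L j)" "j ~= i" for j
     using True that by (auto simp: mons_def lookup_add lookup_minus lookup_single when_def)
    ultimately have "a + b \<in> mons L" using ka unfolding mons_add_iff by (metis not_less)
    with False show False by simp
   qed
   have "lookup a i \<le> 1" "lookup b i \<le> 1" using a b j by (simp_all add: mons_def)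
   with j have l: "lookup a i = 1" "lookup b i = 1" by linarith+
   have "(ksign (?w * mdeg L a) * ksign (?w * pre L i b) * ksign (mexp L a (b - ?e)) :: 'k)
     = ksign (?w * pre L i a) * ksign (mexp L (a - ?e) b) * ksign 1"
    unfolding ksign_add[symmetric] using j l
    by (intro ksign_cong) (simp add: ma mb algebra_simps)
   hence "ksign (?w * mdeg L a) * pdc L i b * mcoef L a (b - ?e) = - (pdc L i a * mcoef L (a - ?e) b)"
    using True l am bm by (simp add: pdc_def mcoef_def msign_mexp) (simp add: ksign_def)
   thus ?thesis using False by (simp add: mcoef_def)
  next
   case F2: False
   have "pdc L i a * mcoef L (a - ?e) b = 0"
    using F2 am by (cases "lookup a i = 0") (auto simp: pdc_def mcoef_def)
   moreover have "pdc L i b * mcoef L a (b - ?e) = 0"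
    using F2 bm by (cases "lookup b i = 0") (auto simp: pdc_def mcoef_def)
   moreover have "mcoef L a b = 0" using False by (simp add: mcoef_def)
   ultimately show ?thesis by (simp only: mult.assoc mult_zero_right add_0)
  qed
 qed
qed

lemma single_minus_comm: "(a :: mono) - single i 1 - single j 1 = a - single j 1 - single i 1"
 by (rule poly_mapping_eqI) (simp add: lookup_minus)

lemma minus_single_plus: "0 < lookup a i ==> a - single i 1 + b = a + b - single i (1::nat)"
 by (rule poly_mapping_eqI) (auto simp: lookup_add lookup_minus lookup_single when_def)

lemma plus_minus_single: "0 < lookup b i ==> a + (b - single i 1) = a + b - single i (1::nat)"
 by (rule poly_mapping_eqI) (auto simp: lookup_add lookup_minus lookup_single when_def)

lemma mdeg_minus_single: "0 < lookup a i ==> mdeg L (a - single i 1) = mdeg L a - wt L i"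
 using mdeg_add[of L "a - single i 1" "single i 1"] by (simp add: minus_single_add)

lemma pdc_0: "lookup a i = 0 ==> pdc L i a = 0"
 by (simp add: pdc_def)

lemma pd_prd:
 fixes L :: "('k::real_normed_field, 'g) dgla" and x y :: "('w::graded_word, 'k) galg"
 assumes i: "i < ldim L" and x: "rc L x" and y: "rc L y"
 shows "pd L i (prd L x y) = prd L (pd L i x) y + prd L (sgno L (wt L i) x) (pd L i y)"
proof (rule klin_eqI[where f = "%x. pd L i (prd L x y)"])
 fix b assume b: "b \<in> keys x"
 show "pd L i (prd L (bs b) y) = prd L (pd L i (bs b)) y + prd L (sgno L (wt L i) (bs b)) (pd L i y)"
 proof (rule klin_eqI[where f = "%y. pd L i (prd L (bs b) y)"])
  fix c assume c: "c \<in> keys y"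
  obtain a1 u1 where [simp]: "b = (a1, u1)" by (cases b)
  obtain a2 u2 where [simp]: "c = (a2, u2)" by (cases c)
  have m: "a1 \<in> mons L" "a2 \<in> mons L" using b c x y by auto
  let ?K = "ksign (wdeg u1 * mdeg L a2 + wsgn u1 u2) :: 'k"
  let ?e = "single i (1::nat)"
  let ?z = "bs (a1 + a2 - ?e, wmul u1 u2) :: ('w, 'k) galg"
  have 1: "pd L i (prd L (bs b) (bs c)) = sc (pdc L i (a1 + a2) * mcoef L a1 a2 * ?K) ?z"
   by (simp add: prd_bs pd_bs pd_sc mult_ac)
  have 2: "prd L (pd L i (bs b)) (bs c) = sc (pdc L i a1 * mcoef L (a1 - ?e) a2 * ?K) ?z"
   by (cases "lookup a1 i = 0") (simp_all add: prd_bs pd_bs prd_sc_left pdc_0 minus_single_plus mult_ac)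
  have 3: "prd L (sgno L (wt L i) (bs b)) (pd L i (bs c))
   = sc (ksign (wt L i * mdeg L a1) * pdc L i a2 * mcoef L a1 (a2 - ?e) * ?K) ?z"
  proof (cases "lookup a2 i = 0")
   case False
   let ?k1 = "ksign (wt L i * (mdeg L a1 + wdeg u1)) :: 'k"
    and ?k2 = "ksign (wdeg u1 * (mdeg L a2 - wt L i) + wsgn u1 u2) :: 'k"
   have *: "?k1 * ?k2 = ksign (wt L i * mdeg L a1) * ?K"
    unfolding ksign_add[symmetric] by (rule ksign_cong) (simp add: algebra_simps)
   have "pdc L i a2 * (?k1 * (mcoef L a1 (a2 - ?e) * ?k2)) = pdc L i a2 * mcoef L a1 (a2 - ?e) * (?k1 * ?k2)"
    by (simp only: mult_ac)
   also have "\<dots> = ksign (wt L i * mdeg L a1) * pdc L i a2 * mcoef L a1 (a2 - ?e) * ?K"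
    unfolding * by (simp only: mult_ac)
   finally have **: "pdc L i a2 * (?k1 * (mcoef L a1 (a2 - ?e) * ?k2)) = \<dots>" .
   show ?thesis using False
    by (simp add: prd_bs pd_bs prd_sc_left prd_sc_right sgno_bs plus_minus_single mdeg_minus_single)
     (simp only: **)
  qed (simp add: pd_bs pdc_0)
  show "pd L i (prd L (bs b) (bs c)) =
    prd L (pd L i (bs b)) (bs c) + prd L (sgno L (wt L i) (bs b)) (pd L i (bs c))"
   unfolding 1 2 3 sc_add_left[symmetric] pdc_mcoef[OF i m] by (simp only: distrib_right)
 qed (intro klin_intros)+
qed (intro klin_intros)+

lemma pre_minus_single:
 "0 < lookup a j ==> pre L i (a - single j 1) = pre L i a - (if j < i then wt L j else 0)"
proof -
 assume "0 < lookup a j"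
 hence "pre L i a = pre L i (a - single j 1) + pre L i (single j 1)"
  by (simp add: pre_add[symmetric] minus_single_add)
 moreover have "pre L i (single j 1) = (\<Sum>k<i. if k = j then wt L j else 0)"
  unfolding pre_def by (rule sum.cong) (auto simp: lookup_single when_def)
 ultimately show ?thesis by simp
qed

text \<open>For distinct indices the sign arises because the generator removed first is no longer
  passed by the other. For equal odd indices both sides vanish, since the generator occurs at most
  once.\<close>

lemma pd_comm:
 fixes L :: "('k::real_normed_field, 'g) dgla"
 assumes "rc L x"
 shows "pd L i (pd L j x) = sk (wt L i * wt L j) (pd L j (pd L i x))"
proof (rule klin_eqI[where f = "%x. pd L i (pd L j x)"])
 fix b assume b: "b \<in> keys x"
 obtain a u where [simp]: "b = (a, u)" by (cases b)
 have a: "a \<in> mons L" using b assms by auto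
 have "pdc L j a * pdc L i (a - single j 1) = ksign (wt L i * wt L j) * (pdc L i a * pdc L j (a - single i 1))"
 proof (cases "i = j \<or> lookup a i = 0 \<or> lookup a j = 0")
  case True
  moreover have "lookup a i \<le> 1" if "odd (wt L i)" using a that by (simp add: mons_def)
  ultimately show ?thesis
   by (cases "odd (wt L i)") (auto simp: pdc_0 pdc_def lookup_minus lookup_single when_def ksign_def)
 next
  case False
  have "(ksign (wt L j * pre L j a) * ksign (wt L i * pre L i (a - single j 1)) :: 'k)
   = ksign (wt L i * wt L j) * ksign (wt L i * pre L i a) * ksign (wt L j * pre L j (a - single i 1))"
   unfolding ksign_add[symmetric] using False
   by (intro ksign_cong) (auto simp: pre_minus_single algebra_simps)
  hence "of_nat (lookup a i) * of_nat (lookup a j) *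
    (ksign (wt L j * pre L j a) * ksign (wt L i * pre L i (a - single j 1)) :: 'k)
   = of_nat (lookup a i) * of_nat (lookup a j) *
    (ksign (wt L i * wt L j) * ksign (wt L i * pre L i a) * ksign (wt L j * pre L j (a - single i 1)))"
   by simp
  thus ?thesis using False
   by (simp add: pdc_def lookup_minus lookup_single mult_ac)
 qed
 thus "pd L i (pd L j (bs b)) = sk (wt L i * wt L j) (pd L j (pd L i (bs b)))"
  by (simp add: pd_bs pd_sc single_minus_comm)
qed (intro klin_intros)+

lemma minus_single_mons: "a \<in> mons L ==> a - single i 1 \<in> mons L"
 by (cases "lookup a i = 0")
  (auto simp: mons_def lookup_minus in_keys_iff lookup_single when_def subset_iff intro: le_trans[OF diff_le_self])

lemma rc_pd: "rc L x ==> rc L (pd L i x)"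
 by (erule keys_subset_klin[OF klin_pd[OF klin_id]], unfold pd_def ext_bs, rule keys_subset_sc)
  (simp add: minus_single_mons)

lemma hom_pd: "hom L n x ==> hom L (n - wt L i) (pd L i x)"
proof (rule keys_subset_klin[OF klin_pd[OF klin_id]])
 fix b assume b: "b \<in> {b. bdeg L b = n}"
 show "hom L (n - wt L i) (pd L i (bs b))"
 proof (cases "lookup (fst b) i = 0")
  case False
  with b show ?thesis
   by (cases b) (auto simp: pd_bs mdeg_minus_single intro!: keys_subset_sc)
 qed (simp add: pd_def pdc_0)
qed

section \<open>Vector fields on C(g) and their commutators\<close>

lemma sgno_cong: "even (p - q) ==> sgno L p = sgno L q"
 by (rule ext, rule klin_eqI[where f = "sgno L p"])
  (auto intro!: klin_intros simp: sgno_bs ksign_def)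

text \<open>\<open>vfdeg L p v\<close>: the vector field \<open>\<Sum> v i \<partial>\<^sub>i\<close> has degree \<open>p\<close>.\<close>

definition vfdeg :: "('k::real_normed_field, 'g) dgla => int => (nat => 'k coc) => bool" where
 "vfdeg L p v \<longleftrightarrow> (\<forall>i<ldim L. homA L (p + wt L i) (v i) \<and> rcA L (v i))"

text \<open>The component \<open>v i\<close> of degree \<open>p + wt L i\<close> and the derivative
  of parity \<open>wt L i\<close> both pass \<open>x\<close>; the two contributions of
  \<open>wt L i\<close> cancel and the sign of degree \<open>p\<close> remains.\<close>

lemma vf_prd:
 assumes v: "vfdeg L p v" and x: "rc L x" and y: "rc L y"
 shows "vf L v (prd L x y) = prd L (vf L v x) y + prd L (sgno L p x) (vf L v y)"
proof -
 have "sm L (v i) (pd L i (prd L x y)) =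
   prd L (sm L (v i) (pd L i x)) y + prd L (sgno L p x) (sm L (v i) (pd L i y))"
  if "i < ldim L" for i
 proof -
  have h: "homA L (p + wt L i) (v i)" using v that by (simp add: vfdeg_def)
  have "sm L (v i) (prd L (sgno L (wt L i) x) (pd L i y))
   = prd L (prd L (sgno L (p + wt L i + wt L i) x) (inA (v i))) (pd L i y)"
   by (simp only: prd_assoc[symmetric] inA_commute[OF h] sgno_sgno)
  also have "sgno L (p + wt L i + wt L i) x = sgno L p x"
   by (rule fun_cong[OF sgno_cong]) simp
  finally show ?thesis by (simp add: pd_prd[OF that x y] prd_add_right prd_assoc)
 qed
 thus ?thesis by (simp add: vf_def sum.distrib prd_sum_left prd_sum_right)
qed

lemma rc_vf [simp]: "rc L (vf L v x)"
 unfolding vf_def by (rule keys_subset_sum) (rule rc_prd)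

lemma hom_vf:
 fixes x :: "('w::graded_word, 'k::real_normed_field) galg"
 assumes "vfdeg L p v" "hom L n x"
 shows "hom L (p + n) (vf L v x)"
 unfolding vf_def
proof (rule keys_subset_sum)
 fix i assume "i \<in> {..<ldim L}"
 with assms have "hom L (p + wt L i) (inA (v i) :: ('w, 'k) galg)" "hom L (n - wt L i) (pd L i x)"
  by (auto simp: vfdeg_def intro!: hom_inA hom_pd)
 from hom_prd[OF this] show "hom L (p + n) (sm L (v i) (pd L i x))" by (simp add: algebra_simps)
qed

definition vfA :: "('k::real_normed_field, 'g) dgla => (nat => 'k coc) => 'k coc => 'k coc" where
 "vfA L v a = (\<Sum>i<ldim L. cmul L ground (v i) (contr_bas L ground i a))"

lemma inA_contr_bas: "inA (contr_bas L ground i u) = pd L i (inA u)"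
proof -
 have "inA (contr_bas L ground i u)
   = (\<Sum>a\<in>keys u. sc (lookup u a) (sc (pdc L i a) (bs (a - single i 1, wone))))"
  unfolding contr_bas_def inA_sum
  by (intro sum.cong refl) (simp add: ground_def single_bs inA_sc pdc_def pre_def mult_ac)
 also have "\<dots> = pd L i (inA u)"
  by (simp add: klin_expand[OF klin_pd[OF klin_inA[OF klin_id]], of L i u] pd_bs)
 finally show ?thesis .
qed

lemma inA_vfA: "inA (vfA L v a) = vf L v (inA a)"
 by (simp add: vfA_def vf_def inA_sum inA_cmul inA_contr_bas)

lemma vf_lin: "vf L (%j. v j + w j) x = vf L v x + vf L w x"
 "vf L (%j. v j - w j) x = vf L v x - vf L w x"
 "vf L (%j. sc c (v j)) x = sc c (vf L v x)"
 by (simp_all add: vf_def inA_add prd_add_left sum.distrib inA_sc prd_sc_left sc_sum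
  klin_diff[OF klin_inA[OF klin_id]] prd_diff_left sum_subtractf)

lemma vf_cong: "(!!j. j < ldim L ==> v j = w j) ==> vf L v = vf L w"
 by (auto simp: vf_def fun_eq_iff)

text \<open>The commutator of two vector fields is a vector field: each field differentiates the
  components of the other, and the second-order parts cancel.\<close>

lemma vf_commutator:
 fixes L :: "('k::real_normed_field, 'g) dgla"
 assumes v: "vfdeg L p v" and w: "vfdeg L q w" and x: "rc L x"
 shows "vf L v (vf L w x) - sk (p * q) (vf L w (vf L v x)) =
  vf L (%j. vfA L v (w j) - sk (p * q) (vfA L w (v j))) x"
proof -
 have expand: "vf L v (vf L w x) = (\<Sum>j<ldim L. sm L (vfA L v (w j)) (pd L j x)) +
   (\<Sum>j<ldim L. \<Sum>i<ldim L. sk (p * (q + wt L j)) (sm L (w j) (sm L (v i) (pd L i (pd L j x)))))"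
  if v: "vfdeg L p v" and w: "vfdeg L q w" for p q v w
 proof -
  have "vf L v (sm L (w j) (pd L j x)) = sm L (vfA L v (w j)) (pd L j x)
    + (\<Sum>i<ldim L. sk (p * (q + wt L j)) (sm L (w j) (sm L (v i) (pd L i (pd L j x)))))"
   if j: "j < ldim L" for j
  proof -
   have h: "homA L (q + wt L j) (w j)" "rcA L (w j)" using w j by (auto simp: vfdeg_def)
   show ?thesis
    by (simp add: vf_prd[OF v rc_inA[OF h(2)] rc_pd[OF x]] inA_vfA sgno_hom[OF hom_inA[OF h(1)]]
      vf_def[of L v "pd L j x"] prd_sum_right prd_sc_left sc_sum)
  qed
  thus ?thesis by (simp add: vf_def[of L w x] vf_sum sum.distrib)
 qed
 \<comment> \<open>The second-order terms of the two composites agree up to the sign of the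
   commutator, since both the components and the partial derivatives commute in the graded
   sense.\<close>
 have second: "sk (p * (q + wt L j)) (sm L (w j) (sm L (v i) (pd L i (pd L j x))))
   = sk (p * q) (sk (q * (p + wt L i)) (sm L (v i) (sm L (w j) (pd L j (pd L i x)))))"
  if i: "i < ldim L" and j: "j < ldim L" for i j
 proof -
  have hv: "homA L (p + wt L i) (v i)" and hw: "homA L (q + wt L j) (w j)"
   using v w i j by (auto simp: vfdeg_def)
  have "sm L (v i) (sm L (w j) (pd L j (pd L i x)))
    = prd L (prd L (sgno L (p + wt L i) (inA (w j))) (inA (v i))) (pd L j (pd L i x))"
   by (simp only: prd_assoc[symmetric] inA_commute[OF hv])
  also have "\<dots> = sc (ksign ((p + wt L i) * (q + wt L j)) * ksign (wt L j * wt L i))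
    (sm L (w j) (sm L (v i) (pd L i (pd L j x))))"
   by (simp add: sgno_hom[OF hom_inA[OF hw]] prd_sc_left prd_assoc pd_comm[OF x, of j i] prd_sc_right mult.commute)
  finally have *: "sm L (v i) (sm L (w j) (pd L j (pd L i x))) = \<dots>" .
  have "(ksign (p * q) * (ksign (q * (p + wt L i)) * (ksign ((p + wt L i) * (q + wt L j)) * ksign (wt L j * wt L i))) :: 'k)
    = ksign (p * (q + wt L j))"
   unfolding ksign_add[symmetric] by (rule ksign_cong) (simp add: algebra_simps)
  thus ?thesis unfolding * by (simp only: sc_sc)
 qed
 have "sk (p * q) (vf L w (vf L v x)) = (\<Sum>j<ldim L. sm L (sk (p * q) (vfA L w (v j))) (pd L j x)) +
   (\<Sum>i<ldim L. \<Sum>j<ldim L. sk (p * q) (sk (q * (p + wt L i)) (sm L (v i) (sm L (w j) (pd L j (pd L i x))))))"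
  unfolding expand[OF w v] sc_add sc_sum inA_sc prd_sc_left ..
 also have "(\<Sum>i<ldim L. \<Sum>j<ldim L. sk (p * q) (sk (q * (p + wt L i)) (sm L (v i) (sm L (w j) (pd L j (pd L i x))))))
  = (\<Sum>j<ldim L. \<Sum>i<ldim L. sk (p * (q + wt L j)) (sm L (w j) (sm L (v i) (pd L i (pd L j x)))))"
  by (subst sum.swap) (intro sum.cong refl, simp only: lessThan_iff second)
 finally show ?thesis
  unfolding expand[OF v w] vf_lin(2) by (simp add: vf_def)
qed

declare inA_bs [simp del]

section \<open>The smash product attached to a module\<close>

lemma commute_inA: "hom L n x ==> prd L x (inA u) = prd L (sgno L n (inA u)) x"
proof (rule klin_eqI[where f = "%u. prd L x (inA u)"])
 fix a assume x: "hom L n x"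
 have "sm L (bs a) x = sk (n * mdeg L a) (prd L x (inA (bs a)))"
  using inA_commute[where L = L and q = "mdeg L a" and u = "bs a" and x = x] sgno_hom[OF x, of "mdeg L a"]
  by (simp add: prd_sc_left mult.commute)
 thus "prd L x (inA (bs a)) = prd L (sgno L n (inA (bs a))) x"
  by (simp add: sgno_bs prd_sc_left inA_bs)
qed (intro klin_intros)+

lemma bs_split: "a \<in> mons L ==> bs (a, w) = sm L (bs a) (bs (0, w))"
 by (simp add: prd_bs inA_bs)

text \<open>Basis elements are written as coefficient times pure word, so that rules for
  coefficients (such as \<open>th_sym\<close> and \<open>Q_sym\<close>) and facts about pure words
  can be applied separately.\<close>

lemma rc_eqI:
 assumes "klin f" "klin g" "rc L x"
  and "!!a w. a \<in> mons L ==> (a, w) \<in> keys x ==> f (sm L (bs a) (bs (0, w))) = g (sm L (bs a) (bs (0, w)))"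
 shows "f x = g x"
proof (rule klin_eqI[OF assms(1,2)])
 fix b assume "b \<in> keys x"
 thus "f (bs b) = g (bs b)"
  using assms(3) assms(4)[of "fst b" "snd b"] by (cases b) (auto simp: bs_split[symmetric])
qed

lemma sgno_vf:
 assumes "vfdeg L p v"
 shows "sgno L q (vf L v x) = sk (p * q) (vf L v (sgno L q x))"
proof (rule klin_eqI[where f = "%x. sgno L q (vf L v x)"])
 fix b assume "b \<in> keys x"
 have "hom L (p + bdeg L b) (vf L v (bs b))" by (rule hom_vf[OF assms]) simp
 thus "sgno L q (vf L v (bs b)) = sk (p * q) (vf L v (sgno L q (bs b)))"
  by (simp add: sgno_hom sgno_bs vf_sc ksign_add[symmetric] algebra_simps)
qed (intro klin_intros)+

lemma vf_fst_0: "keys x <= {b. fst b = 0} ==> vf L v x = 0"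
proof (rule klin_eqI[where f = "vf L v" and g = "%_. 0"])
 fix b assume "keys x <= {b. fst b = 0}" "b \<in> keys x"
 thus "vf L v (bs b) = 0"
  by (cases b) (auto simp: vf_def pd_bs pdc_0)
qed (intro klin_intros)+

lemma vf_word [simp]: "vf L v (bs (0, w)) = 0"
 by (rule vf_fst_0) simp

lemma rc_bs [simp]: "rc L (bs (a, w)) \<longleftrightarrow> a \<in> mons L"
 by simp

lemma vf_split:
 "vfdeg L p v ==> a \<in> mons L ==> vf L v (sm L (bs a) (bs (0, w))) = prd L (vf L v (inA (bs a))) (bs (0, w))"
 by (subst vf_prd) (auto simp: inA_bs)

section \<open>Elements of word length one and the derivations that they induce\<close>

definition lt :: "'m letter => ('m, 'k::real_normed_field) walg" where
 "lt m = bs (0, [m])"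

abbreviation "wds S x \<equiv> keys x <= {b. snd b \<in> S}"
abbreviation "el L x \<equiv> keys x <= {(a, [m]) |a m. a \<in> mons L}"

lemma rc_lt [simp]: "rc L (lt m)"
 and el_lt [simp]: "el L (lt m)"
 and hom_lt [simp]: "hom L (gdeg m) (lt m)"
 by (simp_all add: lt_def wdeg_list_def)

lemma lt_word: "prd L (lt m) (bs (0, w)) = bs (0, m # w)"
 by (simp add: lt_def prd_bs wmul_list_def wsgn_list_def)

lemma bs_Cons: "a \<in> mons L ==> bs (a, [m]) = sm L (bs a) (lt m)"
 unfolding lt_def by (rule bs_split)

lemma el_rc: "el L x ==> rc L x"
 by auto

lemma el_eqI:
 assumes "klin f" "klin g" "el L e"
  and "!!a m. a \<in> mons L ==> (a, [m]) \<in> keys e ==> f (sm L (bs a) (lt m)) = g (sm L (bs a) (lt m))"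
 shows "f e = g e"
proof (rule klin_eqI[OF assms(1,2)])
 fix b assume b: "b \<in> keys e"
 then obtain a m where "b = (a, [m])" "a \<in> mons L"
  using assms(3) by blast
 thus "f (bs b) = g (bs b)"
  using b assms(4)[of a m] by (simp add: bs_Cons)
qed

lemma wds_prd: "wds S x ==> wds T y ==> (!!u v. u \<in> S ==> v \<in> T ==> wmul u v \<in> U) ==> wds U (prd L x y)"
 by (erule keys_prd, assumption) auto

lemma wds_inA: "wds {wone} (inA a)"
 using keys_inA[of a] by auto

lemma wds_prd_inA: "wds S x ==> wds S (sm L a x)"
 by (rule wds_prd[OF wds_inA]) auto

lemma wds_pd: "wds S x ==> wds S (pd L i x)"
 by (erule keys_subset_klin[OF klin_pd[OF klin_id]], unfold pd_def ext_bs, rule keys_subset_sc) simp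

lemma wds_vf: "wds S x ==> wds S (vf L v x)"
 unfolding vf_def by (rule keys_subset_sum, rule wds_prd_inA, rule wds_pd)

text \<open>The covariant derivative along the vector field that \<open>F\<close> attaches to \<open>e\<close>.\<close>

definition nab :: "('k::real_normed_field, 'g) dgla => ('m letter => nat => 'k coc) =>
  ('m, 'k) walg => ('w::graded_word, 'k) galg => ('w, 'k) galg" where
 "nab L F e x = ext (%b. if length (snd b) = 1 then sm L (bs (fst b)) (vf L (F (hd (snd b))) x) else 0) e"

lemma keys_if: "keys x <= S ==> keys (if P then x else 0) <= S"
 by (cases P) simp_all

lemma klin_if: "klin f ==> klin (%x. if P then f x else 0)"
 by (cases P) auto

lemma klin_nab_left [intro]: "klin f ==> klin (%e. nab L F (f e) x)"
 unfolding nab_def by (rule klin_comp[OF klin_ext])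

lemma klin_nab_right [intro]: "klin f ==> klin (%x. nab L F e (f x))"
 unfolding nab_def
 by (rule klin_ext_fun, rule klin_if) (intro klin_intros, assumption)+

lemma nab_bs: "nab L F (bs (a, w)) x = (if length w = 1 then sm L (bs a) (vf L (F (hd w)) x) else 0)"
 by (simp add: nab_def)

lemma nab_lt: "nab L F (lt m) x = vf L (F m) x"
 using prd_one_left[OF rc_vf, of L "F m" x] by (simp add: lt_def nab_bs inA_bs)

lemma nab_inA:
 fixes e :: "('m, 'k::real_normed_field) walg"
  and x :: "('w::graded_word, 'k) galg"
 shows "nab L F (sm L u e) x = sm L u (nab L F e x)"
proof (rule klin_eqI[where f = "%u. nab L F (sm L u e) x"])
 fix a
 show "nab L F (sm L (bs a) e) x = sm L (bs a) (nab L F e x)"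
 proof (rule klin_eqI[where f = "%e. nab L F (sm L (bs a) e) x"])
  fix b :: "mono \<times> 'm letter list"
  obtain c :: mono and w where b: "b = (c, w)" by (cases b)
  have "prd L (bs (a, wone)) (bs (c, wone)) = (sc (mcoef L a c) (bs (a + c, wone)) :: ('w, 'k) galg)"
   by (simp add: prd_bs)
  thus "nab L F (sm L (bs a) (bs b)) x = sm L (bs a) (nab L F (bs b) x)"
   by (simp add: b prd_bs inA_bs nab_bs klin_sc[OF klin_nab_left[OF klin_id]] prd_assoc[symmetric] prd_sc_left
     wone_list_def wmul_list_def wdeg_list_def wsgn_list_def)
 qed (intro klin_intros klin_nab_left klin_nab_right)+
qed (intro klin_intros klin_nab_left)+

lemma rc_nab [simp]: "rc L (nab L F e x)"
proof (rule keys_subset_klin[OF klin_nab_left[OF klin_id], of _ UNIV])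
 fix b
 show "rc L (nab L F (bs b) x)"
  unfolding nab_def ext_bs by (rule keys_if) (rule rc_prd)
qed simp

lemma wds_nab: "wds S x ==> wds S (nab L F e x)"
proof (rule keys_subset_klin[OF klin_nab_left[OF klin_id], of _ UNIV])
 fix b
 assume x: "wds S x"
 show "wds S (nab L F (bs b) x)"
  unfolding nab_def ext_bs by (rule keys_if) (rule wds_prd_inA[OF wds_vf[OF x]])
qed simp

lemma hom_nab:
 assumes F: "!!m. vfdeg L (gdeg m) (F m)" and e: "el L e" "hom L n e" and x: "hom L k x"
 shows "hom L (n + k) (nab L F e x)"
proof (rule keys_subset_klin[OF klin_nab_left[OF klin_id], where S = "keys e"])
 fix b assume b: "b \<in> keys e"
 then obtain a m where bm: "b = (a, [m])" "a \<in> mons L"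
  using e(1) by blast
 hence n: "mdeg L a + gdeg m = n"
  using b e(2) by (auto simp: wdeg_list_def)
 have "hom L (mdeg L a + (gdeg m + k)) (sm L (bs a) (vf L (F m) x))"
  by (rule hom_prd[OF hom_inA hom_vf[OF F x]]) simp
 thus "hom L (n + k) (nab L F (bs b) x)"
  using bm by (simp add: nab_bs add.assoc n[symmetric])
qed simp

text \<open>For an element x^a m, the coefficient x^a has to pass \<open>x\<close> in addition to
  the field of the letter m; this turns the sign of degree |m| into that of degree
  \<open>n\<close>.\<close>

lemma nab_prd:
 assumes F: "!!m. vfdeg L (gdeg m) (F m)" and e: "el L e" "hom L n e" and x: "rc L x" and y: "rc L y"
 shows "nab L F e (prd L x y) = prd L (nab L F e x) y + prd L (sgno L n x) (nab L F e y)"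
proof (rule el_eqI[OF _ _ e(1)])
 fix a m assume a: "a \<in> mons L" "(a, [m]) \<in> keys e"
 hence n: "n = mdeg L a + gdeg m" using e by (auto simp: wdeg_list_def)
 show "nab L F (sm L (bs a) (lt m)) (prd L x y) =
   prd L (nab L F (sm L (bs a) (lt m)) x) y +
   prd L (sgno L n x) (nab L F (sm L (bs a) (lt m)) y)"
  using inA_commute[where L = L and q = "mdeg L a" and u = "bs a" and x = "sgno L (gdeg m) x"]
  by (simp add: nab_inA nab_lt vf_prd[OF F x y] prd_add_right prd_assoc[symmetric] sgno_sgno n)
qed (intro klin_intros klin_nab_left)+

section \<open>The differential\<close>

text \<open>The module in terms of letters: \<open>dg\<close> are the components of d_CE,
  \<open>D m\<close> is the total differential of the letter m, and \<open>F m\<close> is the vector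
  field of contraction with f(m). \<open>F_dg\<close> is the form taken by the compatibility of f
  with the differentials.\<close>

locale ce_module =
 fixes L :: "('k::real_normed_field, 'g) dgla"
  and dg :: "nat => 'k coc"
  and D :: "'m letter => ('m, 'k) walg"
  and F :: "'m letter => nat => 'k coc"
 assumes dg: "vfdeg L 1 dg"
  and D_el: "el L (D m)" and D_hom: "hom L (gdeg m + 1) (D m)"
  and F: "vfdeg L (gdeg m) (F m)"
  and F_dg: "rc L x ==> vf L dg (vf L (F m) x) - sk (gdeg m) (vf L (F m) (vf L dg x))
   = nab L F (D m) (x :: ('m, 'k) walg)"
begin

definition th :: "('m, 'k) walg => ('m, 'k) walg => ('m, 'k) walg" where
 "th e x = prd L e x + nab L F e x"

fun qw :: "'m letter list => ('m, 'k) walg" where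
 "qw [] = 0"
| "qw (m # w) = th (D m) (bs (0, w)) + sk (gdeg m) (th (lt m) (qw w))"

text \<open>The first term differentiates the coefficient alone, the second applies
  \<open>qw\<close> behind it. That the recursion of \<open>qw\<close> persists when coefficients
  are present is not built in; it is \<open>Q_th_lt\<close>.\<close>

definition Q :: "('m, 'k) walg => ('m, 'k) walg" where
 "Q = ext (%b. vf L dg (bs b) + sk (mdeg L (fst b)) (sm L (bs (fst b)) (qw (snd b))))"

lemma klin_th_left [intro]: "klin f ==> klin (%e. th (f e) x)"
 and klin_th_right [intro]: "klin f ==> klin (%x. th e (f x))"
 unfolding th_def by (intro klin_intros klin_nab_left klin_nab_right; assumption)+

lemma klin_Q [intro]: "klin f ==> klin (%x. Q (f x))"
 unfolding Q_def by (rule klin_comp[OF klin_ext])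

lemmas kl = klin_intros klin_th_left klin_th_right klin_nab_left klin_nab_right klin_Q
lemmas th_add_right = klin_add[OF klin_th_right[OF klin_id]]
lemmas th_add_left = klin_add[OF klin_th_left[OF klin_id]]

lemmas th_sc_left = klin_sc[OF klin_th_left[OF klin_id]]
lemmas th_0_left [simp] = klin_0[OF klin_th_left[OF klin_id]]
lemmas th_0_right [simp] = klin_0[OF klin_th_right[OF klin_id]]
lemmas Q_add = klin_add[OF klin_Q[OF klin_id]]
lemmas Q_sc = klin_sc[OF klin_Q[OF klin_id]]
lemmas Q_0 [simp] = klin_0[OF klin_Q[OF klin_id]]

lemma rc_th [simp]: "rc L (th e x)"
 unfolding th_def by (intro keys_subset_add) simp_all

lemma th_inA: "th (sm L a e) x = sm L a (th e x)"
 by (simp add: th_def nab_inA prd_add_right prd_assoc)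

text \<open>The relation of a smash product: an element of length one passes a coefficient up to
  sign and also differentiates it.\<close>

lemma th_sym:
 assumes e: "el L e" "hom L n e" and a: "rcA L a" and x: "rc L x"
 shows "th e (sm L a x) = prd L (nab L F e (inA a)) x + prd L (sgno L n (inA a)) (th e x)"
 using commute_inA[OF e(2), of a]
 by (simp add: th_def nab_prd[OF F e rc_inA[OF a] x] prd_add_right prd_assoc[symmetric])

lemma nab_word [simp]: "nab L F e (bs (0, w)) = 0"
 by (rule klin_eqI[where f = "%e. nab L F e (bs (0, w))" and g = "%_. 0"])
  (auto intro!: kl simp: nab_def)

lemma th_lt_word: "th (lt m) (bs (0, w)) = bs (0, m # w)"
 by (simp add: th_def lt_word)

lemma hom_th: "el L e ==> hom L n e ==> hom L k x ==> hom L (n + k) (th e x)"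
 unfolding th_def by (intro keys_subset_add hom_prd hom_nab[OF F])

lemma rc_qw [simp]: "rc L (qw w)"
 by (cases w) (simp_all add: keys_subset_add keys_subset_sc)

lemma hom_qw: "hom L (wdeg w + 1) (qw w)"
proof (induction w)
 case (Cons m w)
 have "hom L (gdeg m + 1 + wdeg w) (th (D m) (bs (0, w)))"
  by (rule hom_th[OF D_el D_hom]) simp
 moreover have "hom L (gdeg m + (wdeg w + 1)) (th (lt m) (qw w))"
  by (rule hom_th[OF el_lt hom_lt Cons])
 moreover have "gdeg m + 1 + wdeg w = wdeg (m # w) + 1" "gdeg m + (wdeg w + 1) = wdeg (m # w) + 1"
  by (simp_all add: wdeg_list_def)
 ultimately show ?case unfolding qw.simps
  by (intro keys_subset_add keys_subset_sc) simp_all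
qed simp

lemma Q_split:
 assumes a: "a \<in> mons L"
 shows "Q (sm L (bs a) (bs (0, w))) =
  prd L (vf L dg (inA (bs a))) (bs (0, w)) + prd L (sgno L 1 (inA (bs a))) (qw w)"
proof -
 have "Q (bs (a, w)) = vf L dg (bs (a, w)) + prd L (sgno L 1 (inA (bs a))) (qw w)"
  by (simp add: Q_def sgno_bs prd_sc_left inA_bs)
 thus ?thesis unfolding vf_split[OF dg a, symmetric] bs_split[OF a, symmetric] .
qed

lemma Q_inA_word: "rcA L a ==> Q (sm L a (bs (0, w))) =
  prd L (vf L dg (inA a)) (bs (0, w)) + prd L (sgno L 1 (inA a)) (qw w)"
 by (rule klin_eqI[where f = "%a. Q (sm L a (bs (0, w)))"])
  (auto intro!: kl Q_split)

lemma Q_word [simp]: "Q (bs (0, w)) = qw w"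
 using Q_split[of 0 w] prd_one_left[OF rc_qw, of w] prd_one_left[where L = L and x = "bs (0, w)"]
 by (simp add: sgno_bs inA_bs)

lemma rcA_cmul: "rcA L (cmul L ground a b)"
 unfolding cmul_def by (intro keys_subset_sum) (simp add: ground_def)

lemma Q_sym:
 assumes u: "rcA L u" and x: "rc L x"
 shows "Q (sm L u x) = prd L (vf L dg (inA u)) x + prd L (sgno L 1 (inA u)) (Q x)"
proof (rule rc_eqI[OF _ _ x])
 fix a :: mono and w assume a: "a \<in> mons L"
 let ?b = "inA (bs a) :: ('m, 'k) walg"
 have "Q (sm L u (prd L ?b (bs (0, w)))) = Q (sm L (cmul L ground u (bs a)) (bs (0, w)))"
  by (simp only: inA_cmul prd_assoc)
 also have "\<dots> = prd L (vf L dg (sm L u ?b)) (bs (0, w)) + prd L (sgno L 1 (sm L u ?b)) (qw w)"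
  unfolding Q_inA_word[OF rcA_cmul] by (simp only: inA_cmul)
 also have "\<dots> = prd L (vf L dg (inA u)) (prd L ?b (bs (0, w)))
   + prd L (sgno L 1 (inA u)) (Q (prd L ?b (bs (0, w))))"
  using a by (subst vf_prd[OF dg rc_inA[OF u]], simp add: inA_bs)
   (simp only: Q_split sgno_prd prd_add_left prd_add_right prd_assoc add.assoc)
 finally show "Q (sm L u (prd L ?b (bs (0, w)))) = \<dots>" .
qed (intro kl)+

lemma rcA_vfA [simp]: "rcA L (vfA L v a)"
 unfolding vfA_def by (intro keys_subset_sum rcA_cmul)

text \<open>A coefficient with changed signs is again a coefficient, so the rules for coefficients
  still apply to it.\<close>

lemma sgno_inA: "\<exists>b. sgno L p (inA u) = inA b \<and> (rcA L u \<longrightarrow> rcA L b)"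
proof -
 have "sgno L p (inA u) = inA (ext (%a. sk (p * mdeg L a) (bs a)) u)"
  by (rule klin_eqI[where f = "%u. sgno L p (inA u)"])
   (auto intro!: kl klin_comp[OF _ klin_ext] simp: sgno_bs inA_sc inA_bs)
 moreover have "rcA L u ==> rcA L (ext (%a. sk (p * mdeg L a) (bs a)) u)"
  by (erule keys_subset_klin[OF klin_ext], unfold ext_bs, rule keys_subset_sc) simp
 ultimately show ?thesis by blast
qed

text \<open>On pure words this is the definition of \<open>qw\<close>. For a coefficient a in front,
  the extra terms are d_CE F_m a and F_m d_CE a; their signed difference is the action of
  \<open>D m\<close> on a, by \<open>F_dg\<close>.\<close>

lemma Q_th_lt:
 assumes x: "rc L x"
 shows "Q (th (lt m) x) = th (D m) x + sk (gdeg m) (th (lt m) (Q x))"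
proof (rule rc_eqI[OF _ _ x])
 fix a :: mono and w assume a: "a \<in> mons L"
 define A where "A = (inA (bs a) :: ('m, 'k) walg)"
 define W where "W = (bs (0, w) :: ('m, 'k) walg)"
 have A: "rcA L (bs a :: mono \<Rightarrow>\<^sub>0 'k)" using a by simp
 have W: "rc L W" by (simp add: W_def)
 have rA: "rc L A" using a by (simp add: A_def inA_bs)
 obtain b where b: "sgno L (gdeg m) A = inA b" "rcA L b" using sgno_inA[of "gdeg m" "bs a"] A unfolding A_def by blast
 obtain c where c: "sgno L 1 A = inA c" "rcA L c" using sgno_inA[of 1 "bs a"] A unfolding A_def by blast
 have FA: "vf L (F m) A = inA (vfA L (F m) (bs a))" and dA: "vf L dg A = inA (vfA L dg (bs a))"
  unfolding A_def by (simp_all only: inA_vfA)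
 have thl: "th (lt m) (sm L u y) = prd L (vf L (F m) (inA u)) y + prd L (sgno L (gdeg m) (inA u)) (th (lt m) y)"
  if "rcA L u" "rc L y" for u y
  using th_sym[OF el_lt hom_lt that] by (simp add: nab_lt)
 have mw: "th (lt m) W = bs (0, m # w)" unfolding W_def by (rule th_lt_word)
 have "Q (th (lt m) (prd L A W)) = Q (prd L (vf L (F m) A) W) + Q (prd L (sgno L (gdeg m) A) (bs (0, m # w)))"
  by (simp only: A_def thl[OF A W] Q_add mw)
 also have "Q (prd L (vf L (F m) A) W) = prd L (vf L dg (vf L (F m) A)) W + prd L (sgno L 1 (vf L (F m) A)) (qw w)"
  unfolding FA W_def by (rule Q_inA_word) simp
 also have "Q (prd L (sgno L (gdeg m) A) (bs (0, m # w))) =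
   prd L (vf L dg (sgno L (gdeg m) A)) (bs (0, m # w)) + prd L (sgno L 1 (sgno L (gdeg m) A)) (qw (m # w))"
  unfolding b by (rule Q_inA_word[OF b(2)])
 finally have l: "Q (th (lt m) (prd L A W)) =
   prd L (vf L dg (vf L (F m) A)) W + prd L (sgno L 1 (vf L (F m) A)) (qw w) +
   (prd L (vf L dg (sgno L (gdeg m) A)) (bs (0, m # w)) +
    prd L (sgno L 1 (sgno L (gdeg m) A)) (qw (m # w)))" .
 have Q: "Q (prd L A W) = sm L (vfA L dg (bs a)) W + prd L (sgno L 1 A) (qw w)"
  unfolding W_def A_def Q_inA_word[OF A] inA_vfA ..
 have n: "nab L F (D m) A = vf L dg (vf L (F m) A) - sk (gdeg m) (vf L (F m) (vf L dg A))"
  using F_dg[OF rA] by simp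
 have r1: "th (D m) (prd L A W) = prd L (nab L F (D m) A) W + prd L (sgno L (gdeg m + 1) A) (th (D m) W)"
  unfolding A_def by (rule th_sym[OF D_el D_hom A W])
 have r2: "th (lt m) (Q (prd L A W)) = prd L (vf L (F m) (vf L dg A)) W + prd L (sgno L (gdeg m) (vf L dg A)) (bs (0, m # w))
   + (prd L (vf L (F m) (sgno L 1 A)) (qw w) + prd L (sgno L (gdeg m + 1) A) (th (lt m) (qw w)))"
  unfolding Q th_add_right thl[OF rcA_vfA W] c(1) thl[OF c(2) rc_qw] mw
  unfolding c(1)[symmetric] sgno_sgno dA ..
 have s1: "sgno L 1 (vf L (F m) A) = sk (gdeg m) (vf L (F m) (sgno L 1 A))"
  using sgno_vf[OF F, of 1 m A] by simp
 have s2: "vf L dg (sgno L (gdeg m) A) = sk (gdeg m) (sgno L (gdeg m) (vf L dg A))"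
  using sgno_vf[OF dg, of "gdeg m" A] by simp
 have "Q (th (lt m) (prd L A W)) = th (D m) (prd L A W) + sk (gdeg m) (th (lt m) (Q (prd L A W)))"
  unfolding l r1 r2 n s1 s2 sgno_sgno qw.simps W_def[symmetric] prd_add_right
  by (simp add: prd_sc_left prd_sc_right sc_add prd_diff_left add.commute add.left_commute)
 thus "Q (th (lt m) (sm L (bs a) (bs (0, w)))) =
   th (D m) (sm L (bs a) (bs (0, w))) + sk (gdeg m) (th (lt m) (Q (sm L (bs a) (bs (0, w)))))"
  unfolding A_def W_def .
qed (intro kl)+

lemma el_prd_inA:
 fixes x :: "mono \<times> 'c::graded_letter list \<Rightarrow>\<^sub>0 'k"
 assumes "el L x"
 shows "el L (sm L al x)"
proof (rule keys_prd[OF keys_inA assms])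
 fix a b :: mono and u v :: "'c list" assume "(a, u) \<in> (%a. (a, wone)) ` keys al" "(b, v) \<in> {(a, [m]) |a m. a \<in> mons L}" "a + b \<in> mons L"
 thus "(a + b, wmul u v) \<in> {(a, [m]) |a m. a \<in> mons L}" by auto
qed

lemma qw_lt [simp]: "qw [m] = D m"
 using prd_one_right[OF el_rc[OF D_el], of m] by (simp add: wone_list_def) (simp add: th_def)

lemma rc_Q [simp]: "rc L (Q x)"
 unfolding Q_def ext_def by (intro keys_subset_sum keys_subset_sc keys_subset_add rc_vf rc_prd)

lemma hom_Q: "hom L n x ==> hom L (n + 1) (Q x)"
proof (rule keys_subset_klin[OF klin_Q[OF klin_id]])
 fix b :: "mono \<times> 'm letter list" assume b: "b \<in> {b. bdeg L b = n}"
 have "hom L (1 + n) (vf L dg (bs b))" using b by (intro hom_vf[OF dg]) simp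
 moreover have "hom L (mdeg L (fst b) + (wdeg (snd b) + 1)) (sm L (bs (fst b)) (qw (snd b)))"
  by (intro hom_prd hom_qw hom_inA) simp
 ultimately show "hom L (n + 1) (Q (bs b))"
  using b unfolding Q_def ext_bs by (intro keys_subset_add keys_subset_sc) (auto simp: bdeg_def subset_iff)
qed

text \<open>Both sides are additive in \<open>e\<close>. For x^a m the new term with d_CE(x^a) is
  absorbed into \<open>Q e\<close>.\<close>

lemma Q_th:
 assumes e: "el L e" "hom L n e" and x: "rc L x"
 shows "Q (th e x) = th (Q e) x + sk n (th e (Q x))"
proof (rule el_eqI[OF _ _ e(1)])
 fix a m assume a: "a \<in> mons L" "(a, [m]) \<in> keys e"
 hence n: "n = mdeg L a + gdeg m" using e by (auto simp: wdeg_list_def)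
 have A: "rcA L (bs a :: mono \<Rightarrow>\<^sub>0 'k)" using a by simp
 have q: "Q (sm L (bs a) (lt m)) = prd L (vf L dg (inA (bs a))) (lt m) + prd L (sgno L 1 (inA (bs a))) (D m)"
  unfolding Q_sym[OF A rc_lt] by (simp add: lt_def del: qw.simps)
 show "Q (th (sm L (bs a) (lt m)) x) =
   th (Q (sm L (bs a) (lt m))) x + sk n (th (sm L (bs a) (lt m)) (Q x))"
  unfolding q th_inA Q_sym[OF A rc_th] Q_th_lt[OF x] th_add_left inA_vfA[symmetric]
  by (simp add: th_inA prd_add_right sgno_bs inA_bs prd_sc_left prd_sc_right th_sc_left n ksign_add sc_add)
   (simp add: th_inA[of "bs a", unfolded inA_bs] add.assoc mult.commute)
qed (intro kl)+

text \<open>On pure words by induction: Q applied to the two terms of \<open>qw (m # w)\<close>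
  gives \<open>th (D m)\<close> of \<open>qw w\<close> twice, with opposite signs. Coefficients
  contribute nothing but the square of d_CE.\<close>

lemma Q_Q:
 assumes d2: "!!x :: ('m, 'k) walg. rc L x ==> vf L dg (vf L dg x) = 0"
  and DD: "!!m. Q (D m) = 0" and x: "rc L x"
 shows "Q (Q x) = 0"
proof -
 have w: "Q (qw w) = 0" for w
 proof (induction w)
  case (Cons m w)
  thus ?case
   by (simp add: Q_add Q_sc Q_th_lt Q_th[OF D_el D_hom] DD ksign_add sc_add)
    (simp add: ksign_def sc_minus_left)
 qed simp
 show ?thesis
 proof (rule rc_eqI[where f = "%x. Q (Q x)" and g = "%_. 0", OF _ _ x])
  fix a :: mono and v assume a: "a \<in> mons L"
  have A: "rcA L (bs a :: mono \<Rightarrow>\<^sub>0 'k)" using a by simp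
  obtain c where c: "sgno L 1 (inA (bs a)) = (inA c :: ('m, 'k) walg)" "rcA L c"
   using sgno_inA[of 1 "bs a"] A by blast
  have s: "vf L dg (inA c) = - sgno L 1 (vf L dg (inA (bs a)) :: ('m, 'k) walg)"
   using sgno_vf[OF dg, of 1 "inA (bs a) :: ('m, 'k) walg"] unfolding c by (simp add: ksign_def sc_minus_left)
  show "Q (Q (sm L (bs a) (bs (0, v)))) = 0"
   unfolding Q_split[OF a] Q_add c(1) Q_sym[OF c(2) rc_qw] w
   unfolding inA_vfA[symmetric] Q_inA_word[OF rcA_vfA]
   unfolding inA_vfA s
   using d2[OF rc_inA[OF A]] by (simp add: klin_uminus[OF klin_prd_left[OF klin_id]])
 qed (intro kl)+
qed

lemma wds_th: "wds S e ==> wds T x ==> T <= U ==> (!!u v. u \<in> S ==> v \<in> T ==> u @ v \<in> U) ==> wds U (th e x)"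
 unfolding th_def
 by (intro keys_subset_add wds_prd[where S = S and T = T] order_trans[OF wds_nab[of x T]])
  (auto simp: wmul_list_def)

lemma wds_Q:
 assumes "wds S x" "!!w. w \<in> S ==> wds S (qw w)"
 shows "wds S (Q x)"
proof (rule keys_subset_klin[OF klin_Q[OF klin_id] assms(1)])
 fix b :: "mono \<times> 'm letter list" assume "b \<in> {b. snd b \<in> S}"
 thus "wds S (Q (bs b))"
  unfolding Q_def ext_bs by (intro keys_subset_add keys_subset_sc wds_vf wds_prd_inA assms) auto
qed

end

section \<open>The tensor square and the half coproduct\<close>

lemma ksign_cancel [simp]: "ksign m * (ksign m * x) = (x :: 'k::real_normed_field)"
 by (simp add: mult.assoc[symmetric])

text \<open>\<open>j1\<close> and \<open>j2\<close> are x \<mapsto> x \<otimes> 1 and x \<mapsto> 1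
  \<otimes> x. The tensor square is taken over C(g): a basis element has one common
  coefficient.\<close>

definition j1 :: "('m, 'k::real_normed_field) walg => ('m, 'k) walg2" where
 "j1 = ext (%b. bs (fst b, (snd b, [])))"

definition j2 :: "('m, 'k::real_normed_field) walg => ('m, 'k) walg2" where
 "j2 = ext (%b. bs (fst b, ([], snd b)))"

lemma klin_j1 [intro]: "klin f ==> klin (%x. j1 (f x))"
 and klin_j2 [intro]: "klin f ==> klin (%x. j2 (f x))"
 unfolding j1_def j2_def by (rule klin_comp[OF klin_ext], assumption)+

lemma j_bs: "j1 (bs (a, w)) = bs (a, (w, []))" "j2 (bs (a, w)) = bs (a, ([], w))"
 by (simp_all add: j1_def j2_def)

lemmas word_defs = wone_list_def wmul_list_def wsgn_list_def wone_prod_def wmul_prod_def wsgn_prod_def wdeg_prod_def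

lemma wdeg_Nil [simp]: "wdeg [] = 0"
 by (simp add: wdeg_list_def)

lemma j_inA [simp]: "j1 (inA a) = inA a" "j2 (inA a) = inA a"
 by (rule klin_eqI[where x = a]; auto intro!: klin_intros klin_j1 klin_j2 simp: inA_bs j_bs word_defs)+

lemma j_prd: "j1 (prd L x y) = prd L (j1 x) (j1 y)" "j2 (prd L x y) = prd L (j2 x) (j2 y)"
proof -
 have 1: "j1 (prd L (bs b) y) = prd L (j1 (bs b)) (j1 y)" for b
 proof (rule klin_eqI[where x = y])
  fix c
  show "j1 (prd L (bs b) (bs c)) = prd L (j1 (bs b)) (j1 (bs c))"
   by (cases b; cases c; simp add: prd_bs j_bs klin_sc[OF klin_j1[OF klin_id]] word_defs)
 qed (intro klin_intros klin_j1)+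
 have 2: "j2 (prd L (bs b) y) = prd L (j2 (bs b)) (j2 y)" for b
 proof (rule klin_eqI[where x = y])
  fix c
  show "j2 (prd L (bs b) (bs c)) = prd L (j2 (bs b)) (j2 (bs c))"
   by (cases b; cases c; simp add: prd_bs j_bs klin_sc[OF klin_j2[OF klin_id]] word_defs)
 qed (intro klin_intros klin_j2)+
 show "j1 (prd L x y) = prd L (j1 x) (j1 y)"
  by (rule klin_eqI[where x = x], (intro klin_intros klin_j1)+, rule 1)
 show "j2 (prd L x y) = prd L (j2 x) (j2 y)"
  by (rule klin_eqI[where x = x], (intro klin_intros klin_j2)+, rule 2)
qed

lemma j_rc: "rc L x ==> rc L (j1 x)" "rc L x ==> rc L (j2 x)"
 by (erule keys_subset_klin[OF klin_j1[OF klin_id]], simp add: j1_def)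
  (erule keys_subset_klin[OF klin_j2[OF klin_id]], simp add: j2_def)

lemma j_hom: "hom L n x ==> hom L n (j1 x)" "hom L n x ==> hom L n (j2 x)"
 by (erule keys_subset_klin[OF klin_j1[OF klin_id]], simp add: j1_def bdeg_def word_defs)
  (erule keys_subset_klin[OF klin_j2[OF klin_id]], simp add: j2_def bdeg_def word_defs)

lemma j_sgno: "sgno L p (j1 x) = j1 (sgno L p x)" "sgno L p (j2 x) = j2 (sgno L p x)"
 by (rule klin_eqI[where x = x];
  auto intro!: klin_intros klin_j1 klin_j2 simp: sgno_bs j_bs klin_sc[OF klin_j1[OF klin_id]] klin_sc[OF klin_j2[OF klin_id]] word_defs)+

lemma j_pd: "j1 (pd L i x) = pd L i (j1 x)" "j2 (pd L i x) = pd L i (j2 x)"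
 by (rule klin_eqI[where x = x];
  auto intro!: klin_intros klin_j1 klin_j2 simp: pd_bs j_bs klin_sc[OF klin_j1[OF klin_id]] klin_sc[OF klin_j2[OF klin_id]])+

lemma j_vf: "j1 (vf L v x) = vf L v (j1 x)" "j2 (vf L v x) = vf L v (j2 x)"
 by (simp_all add: vf_def klin_sum[OF klin_j1[OF klin_id]] klin_sum[OF klin_j2[OF klin_id]] j_prd j_pd)

lemma j_nab: "j1 (nab L F e x) = nab L F e (j1 x)" "j2 (nab L F e x) = nab L F e (j2 x)"
proof -
 have "j1 (nab L F (bs b) x) = nab L F (bs b) (j1 x) \<and> j2 (nab L F (bs b) x) = nab L F (bs b) (j2 x)" for b
  by (simp add: nab_def j_prd j_vf klin_0[OF klin_j1[OF klin_id]] klin_0[OF klin_j2[OF klin_id]])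
 note 1 = conjunct1[OF this] and 2 = conjunct2[OF this]
 show "j1 (nab L F e x) = nab L F e (j1 x)"
  by (rule klin_eqI[where x = e], (intro klin_id klin_j1 klin_nab_left)+, rule 1)
 show "j2 (nab L F e x) = nab L F e (j2 x)"
  by (rule klin_eqI[where x = e], (intro klin_id klin_j2 klin_nab_left)+, rule 2)
qed

lemma j2_j1_commute:
 fixes e x :: "('m, 'k::real_normed_field) walg"
 assumes e: "hom L n e"
 shows "prd L (j2 e) (j1 x) = prd L (j1 (sgno L n x)) (j2 e)"
proof (rule klin_eqI[where x = e])
 fix b :: "mono \<times> 'm letter list" assume "b \<in> keys e"
 hence n: "bdeg L b = n" using e by auto
 show "prd L (j2 (bs b)) (j1 x) = prd L (j1 (sgno L n x)) (j2 (bs b))"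
 proof (rule klin_eqI[where x = x])
  fix c :: "mono \<times> 'm letter list"
  obtain a u d v where bc: "b = (a, u)" "c = (d, v)" by (cases b; cases c)
  have "(ksign (wdeg u * mdeg L d + wdeg u * wdeg v) :: 'k)
   = ksign ((mdeg L a + wdeg u) * (mdeg L d + wdeg v)) * ksign (mdeg L d * mdeg L a) * ksign (wdeg v * mdeg L a)"
   unfolding ksign_add[symmetric] by (rule ksign_cong) (simp add: algebra_simps)
  thus "prd L (j2 (bs b)) (j1 (bs c)) = prd L (j1 (sgno L n (bs c))) (j2 (bs b))"
   unfolding n[symmetric] bc using mcoef_swap[of L a d]
   by (simp add: prd_bs j_bs sgno_bs klin_sc[OF klin_j1[OF klin_id]] prd_sc_left word_defs mult_ac add.commute)
 qed (intro klin_intros klin_j1 klin_j2)+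
qed (intro klin_intros klin_j1 klin_j2)+

lemma bs_pair: "a \<in> mons L ==> bs (a, (u, v)) = prd L (j1 (sm L (bs a) (bs (0, u)))) (j2 (bs (0, v)))"
 by (simp add: bs_split[symmetric] j_bs prd_bs word_defs)

lemma pair_eqI:
 assumes "klin f" "klin g" "rc L x"
  and "!!a u v. a \<in> mons L ==> f (prd L (j1 (sm L (bs a) (bs (0, u)))) (j2 (bs (0, v)))) =
   g (prd L (j1 (sm L (bs a) (bs (0, u)))) (j2 (bs (0, v))))"
 shows "f x = g x"
proof (rule klin_eqI[OF assms(1,2)])
 fix b assume "b \<in> keys x"
 thus "f (bs b) = g (bs b)"
  using assms(3) assms(4)[of "fst b" "fst (snd b)" "snd (snd b)"] by (cases b) (auto simp: bs_pair)
qed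

text \<open>
 The half coproduct \<open>w \<mapsto> \<Sum> w\<^sub>S\<^sub>' \<otimes> w\<^sub>S\<close> over the subwords \<open>w\<^sub>S\<close> that contain the last letter.
\<close>

fun dlw :: "('k::real_normed_field, 'g) dgla => 'm letter list =>
  ('m, 'k) walg2" where
 "dlw L [] = 0"
| "dlw L (m # w) = (if w = [] then j2 (lt m) else prd L (j1 (lt m) + j2 (lt m)) (dlw L w))"

definition dl :: "('k::real_normed_field, 'g) dgla => ('m, 'k) walg =>
  ('m, 'k) walg2" where
 "dl L = ext (%b. sm L (bs (fst b)) (dlw L (snd b)))"

text \<open>A left inverse of the half coproduct: among the splittings of a word, only the one that
  leaves its last letter alone in the second factor has a second factor of length one, and
  concatenation then restores the word.\<close>

definition kap :: "('m, 'k::real_normed_field) walg2 => ('m, 'k) walg" where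
 "kap = ext (%b. if length (snd (snd b)) = 1 then bs (fst b, fst (snd b) @ snd (snd b)) else 0)"

definition pr1 :: "('m, 'k::real_normed_field) walg => ('m, 'k) walg" where
 "pr1 = ext (%b. if length (snd b) = 1 then bs b else 0)"

abbreviation "ne L x \<equiv> keys x <= {b. fst b \<in> mons L \<and> snd b ~= []}"

lemma klin_dl [intro]: "klin f ==> klin (%x. dl L (f x))"
 and klin_kap [intro]: "klin f' ==> klin (%x. kap (f' x))"
 and klin_pr1 [intro]: "klin f'' ==> klin (%x. pr1 (f'' x))"
 unfolding dl_def kap_def pr1_def by (rule klin_comp[OF klin_ext], assumption)+

lemmas klj = klin_intros klin_j1 klin_j2 klin_dl klin_kap klin_pr1 klin_nab_left klin_nab_right
lemmas j1_add = klin_add[OF klin_j1[OF klin_id]] and j2_add = klin_add[OF klin_j2[OF klin_id]]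
lemmas j1_sc = klin_sc[OF klin_j1[OF klin_id]] and j2_sc = klin_sc[OF klin_j2[OF klin_id]]
lemmas dl_add = klin_add[OF klin_dl[OF klin_id]] and dl_sc = klin_sc[OF klin_dl[OF klin_id]]
lemmas kap_add = klin_add[OF klin_kap[OF klin_id]] and kap_sc = klin_sc[OF klin_kap[OF klin_id]]

lemma ne_rc: "ne L x ==> rc L x"
 by auto

lemma el_ne: "el L x ==> ne L x"
 by auto

lemma rc_dlw [simp]: "rc L (dlw L w)"
 by (induction w) (simp_all add: j_rc)

lemma dl_bs: "dl L (bs (a, w)) = sm L (bs a) (dlw L w)"
 by (simp add: dl_def)

lemma dl_word [simp]: "dl L (bs (0, w)) = dlw L w"
 using prd_one_left[OF rc_dlw, of L w] by (simp add: dl_bs inA_bs)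

lemma dl_inA:
 fixes x :: "('m, 'k::real_normed_field) walg"
 shows "dl L (sm L u x) = sm L u (dl L x)"
proof (rule klin_eqI[where x = u])
 fix a
 show "dl L (sm L (bs a) x) = sm L (bs a) (dl L x)"
 proof (rule klin_eqI[where x = x])
  fix b :: "mono \<times> 'm letter list"
  obtain c w where b: "b = (c, w)" by (cases b)
  show "dl L (sm L (bs a) (bs b)) = sm L (bs a) (dl L (bs b))"
   unfolding b dl_bs prd_assoc[symmetric] inA_bs prd_bs by (simp add: dl_sc dl_bs inA_bs prd_sc_left)
 qed (intro klj)+
qed (intro klj)+

lemma dlw_fst_0: "keys (dlw L w) <= {b. fst b = 0}"
proof (induction w)
 case (Cons m w)
 have "keys (j1 (lt m) + j2 (lt m)) <= {b. fst b = 0}"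
  by (intro keys_subset_add) (simp_all add: lt_def j_bs)
 hence "keys (prd L (j1 (lt m) + j2 (lt m)) (dlw L w)) <= {b. fst b = 0}"
  by (rule keys_prd[OF _ Cons]) auto
 thus ?case by (simp add: lt_def j_bs)
qed simp

lemma dl_vf:
 assumes v: "vfdeg L p v" and x: "rc L x"
 shows "dl L (vf L v x) = vf L v (dl L x)"
proof (rule rc_eqI[OF _ _ x])
 fix a :: mono and w assume a: "a \<in> mons L"
 have A: "rc L (inA (bs a))" using a by (simp add: inA_bs)
 show "dl L (vf L v (sm L (bs a) (bs (0, w)))) = vf L v (dl L (sm L (bs a) (bs (0, w))))"
  unfolding vf_split[OF v a] inA_vfA[symmetric] dl_inA vf_prd[OF v A rc_dlw] dl_word
  by (simp add: vf_fst_0[OF dlw_fst_0])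
qed (intro klj)+

lemma dl_nab:
 assumes F: "!!m. vfdeg L (gdeg m) (F m)" and x: "rc L x"
 shows "dl L (nab L F e x) = nab L F e (dl L x)"
proof (rule klin_eqI[where x = e])
 fix b
 show "dl L (nab L F (bs b) x) = nab L F (bs b) (dl L x)"
  by (simp add: nab_def dl_inA dl_vf[OF F x] klin_0[OF klin_dl[OF klin_id]])
qed (intro klj)+

lemma j_lt_hom: "hom L (gdeg m) (j1 (lt m) + j2 (lt m))"
 by (intro keys_subset_add j_hom hom_lt)

text \<open>The rule fails on the empty word, as the single letter of \<open>[m]\<close> must go to
  the second factor. For this reason compatibility with the half coproduct is stated for
  \<open>ne\<close> elements.\<close>

lemma dl_lt:
 assumes x: "ne L x"
 shows "dl L (prd L (lt m) x) = prd L (j1 (lt m) + j2 (lt m)) (dl L x)"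
proof (rule rc_eqI[OF _ _ ne_rc[OF x]])
 fix a w assume a: "a \<in> mons L" "(a, w) \<in> keys x"
 then obtain n v where w: "w = n # v" using x by (cases w) auto
 have "dl L (prd L (lt m) (sm L (bs a) (bs (0, w)))) = dl L (prd L (sgno L (gdeg m) (inA (bs a))) (bs (0, m # w)))"
  by (simp only: prd_assoc[symmetric] commute_inA[OF hom_lt]) (simp only: prd_assoc lt_word)
 also have "\<dots> = prd L (sgno L (gdeg m) (inA (bs a))) (dlw L (m # w))"
  unfolding inA_bs sgno_bs bdeg_pair wdeg_one prd_sc_left dl_sc
  using dl_inA[of L "bs a" "bs (0, m # w)"] by (simp add: inA_bs del: dlw.simps)
 also have "\<dots> = prd L (prd L (sgno L (gdeg m) (inA (bs a))) (j1 (lt m) + j2 (lt m))) (dlw L w)"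
  unfolding prd_assoc by (simp add: w)
 also have "\<dots> = prd L (j1 (lt m) + j2 (lt m)) (dl L (sm L (bs a) (bs (0, w))))"
  unfolding commute_inA[OF j_lt_hom, symmetric] prd_assoc dl_inA dl_word ..
 finally show "dl L (prd L (lt m) (sm L (bs a) (bs (0, w)))) = \<dots>" .
qed (intro klj)+

lemma dl_el:
 assumes e: "el L e" and x: "ne L x"
 shows "dl L (prd L e x) = prd L (j1 e + j2 e) (dl L x)"
proof (rule el_eqI[OF _ _ e])
 fix a m
 show "dl L (prd L (sm L (bs a) (lt m)) x) =
  prd L (j1 (sm L (bs a) (lt m)) + j2 (sm L (bs a) (lt m))) (dl L x)"
  by (simp add: prd_assoc dl_inA dl_lt[OF x] j_prd prd_add_right prd_add_left)
qed (intro klj)+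

lemma dl_el_self: "el L e ==> dl L e = j2 e"
proof (rule el_eqI)
 fix a m
 show "dl L (sm L (bs a) (lt m)) = j2 (sm L (bs a) (lt m))"
  by (simp add: dl_inA j_prd lt_def)
qed (auto intro: klj)

lemma rc_dl [simp]: "rc L (dl L x)"
 unfolding dl_def ext_def by (intro keys_subset_sum keys_subset_sc rc_prd)

lemma kap_j1:
 fixes x :: "('d, 'k::real_normed_field) walg"
 shows "kap (prd L (j1 x) y) = prd L x (kap y)"
proof (rule klin_eqI[where x = x])
 fix b :: "mono \<times> 'd letter list"
 show "kap (prd L (j1 (bs b)) y) = prd L (bs b) (kap y)"
 proof (rule klin_eqI[where x = y])
  fix c :: "mono \<times> 'd letter list \<times> 'd letter list"
  obtain a u d v w where bc: "b = (a, u)" "c = (d, (v, w))" by (cases b; cases c) auto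
  show "kap (prd L (j1 (bs b)) (bs c)) = prd L (bs b) (kap (bs c))"
   unfolding bc by (simp add: prd_bs j_bs kap_sc word_defs) (simp add: kap_def prd_bs word_defs)
 qed (intro klj)+
qed (intro klj)+

lemma kap_j2: "kap (j2 y) = pr1 y"
 by (rule klin_eqI[where x = y], (intro klj)+) (simp add: kap_def pr1_def j2_def)

lemma kap_0: "keys x <= {b. 2 \<le> length (snd (snd b))} ==> kap x = 0"
 by (rule klin_eqI[where x = x and g = "%_. 0"], (intro klj)+) (auto simp: kap_def)

lemma dlw_snd: "keys (dlw L w) <= {b. snd (snd b) ~= []}"
proof (induction w)
 case (Cons m w)
 have "keys (prd L (j1 (lt m) + j2 (lt m)) (dlw L w)) <= {b. snd (snd b) ~= []}"
  by (rule keys_prd[OF _ Cons, of _ UNIV]) (auto simp: word_defs)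
 thus ?case by (simp add: lt_def j_bs)
qed simp

text \<open>A first letter put into the second factor joins the last letter there and makes its
  length at least two, where \<open>kap\<close> vanishes.\<close>

lemma kap_dl:
 assumes x: "ne L x"
 shows "kap (dl L x) = x"
proof -
 have w: "kap (dlw L w) = bs (0, w)" if "w ~= []" for w :: "'a letter list"
  using that
 proof (induction w)
  case (Cons m w)
  have "keys (prd L (j2 (lt m)) (dlw L w)) <= {b. 2 \<le> length (snd (snd b))}"
  proof (rule keys_prd[OF _ dlw_snd])
   show "keys (j2 (lt m)) <= {b. length (snd (snd b)) = 1}" by (simp add: lt_def j_bs)
  qed (auto simp: word_defs Suc_le_eq)
  thus ?case using Cons
   by (cases "w = []") (simp_all add: kap_j2 pr1_def prd_add_left kap_add kap_j1 kap_0 lt_word, simp add: lt_def)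
 qed simp
 have k: "kap (sm L u y) = sm L u (kap y)" for u and y :: "mono \<times> 'a letter list \<times> 'a letter list \<Rightarrow>\<^sub>0 'b"
  using kap_j1[of L "inA u" y] by simp
 show ?thesis
 proof (rule rc_eqI[where g = "%x. x", OF _ _ ne_rc[OF x]])
  fix a v assume a: "a \<in> mons L" "(a, v) \<in> keys x"
  hence "v ~= []" using x by auto
  thus "kap (dl L (sm L (bs a) (bs (0, v)))) = sm L (bs a) (bs (0, v))"
   by (simp add: dl_inA k w)
 qed (intro klj)+
qed

section \<open>Primitive operators\<close>

text \<open>\<open>T2\<close> is T \<otimes> 1 + 1 \<otimes> T with Koszul signs, so
  \<open>T\<close> is a coderivation for the half coproduct. Existence is part of
  \<open>prim\<close> because on a tensor square over C(g) this formula is not automatically well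
  defined when \<open>T\<close> is not C(g)-linear.\<close>

definition lift2 :: "('k::real_normed_field, 'g) dgla => int =>
  (('m, 'k) walg => ('m, 'k) walg) =>
  (('m, 'k) walg2 => ('m, 'k) walg2) => bool" where
 "lift2 L p T T2 \<longleftrightarrow> klin T2 \<and>
   (\<forall>x y. rc L x \<longrightarrow> rc L y \<longrightarrow>
    T2 (prd L (j1 x) (j2 y)) = prd L (j1 (T x)) (j2 y) + prd L (j1 (sgno L p x)) (j2 (T y))) \<and>
   (\<forall>x. ne L x \<longrightarrow> dl L (T x) = T2 (dl L x))"

definition prim :: "('k::real_normed_field, 'g) dgla => int =>
  (('m, 'k) walg => ('m, 'k) walg) => bool" where
 "prim L p T \<longleftrightarrow> klin T \<and> (\<forall>x. rc L x \<longrightarrow> rc L (T x)) \<and> (\<forall>x. ne L x \<longrightarrow> ne L (T x)) \<and>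
   (\<forall>n x. hom L n x \<longrightarrow> hom L (n + p) (T x)) \<and> (\<exists>T2. lift2 L p T T2)"

lemma primD:
 assumes "prim L p T"
 shows "klin T" "rc L x ==> rc L (T x)" "ne L x ==> ne L (T x)" "hom L n x ==> hom L (n + p) (T x)"
  "\<exists>T2. lift2 L p T T2"
 using assms unfolding prim_def by simp_all

lemma hom_sgno_op:
 assumes "klin T" "!!n x. hom L n x ==> hom L (n + p) (T x)"
 shows "sgno L q (T x) = sk (p * q) (T (sgno L q x))"
proof (rule klin_eqI[where x = x])
 fix b assume "b \<in> keys x"
 have "hom L (bdeg L b + p) (T (bs b))" by (rule assms) simp
 thus "sgno L q (T (bs b)) = sk (p * q) (T (sgno L q (bs b)))"
  by (simp add: sgno_hom sgno_bs klin_sc[OF assms(1)] ksign_add[symmetric] algebra_simps)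
qed (intro klin_intros klin_comp[OF assms(1)])+

lemma prim_diff:
 fixes S T :: "('m, 'k::real_normed_field) walg => ('m, 'k) walg"
 assumes "prim L p S" "prim L p T"
 shows "prim L p (%x. S x - T x)"
proof -
 obtain S2 where S2: "lift2 L p S S2" using primD(5)[OF assms(1)] ..
 obtain T2 where T2: "lift2 L p T T2" using primD(5)[OF assms(2)] ..
 have *: "klin S2" "klin T2"
  "!!x y. rc L x ==> rc L y ==> S2 (prd L (j1 x) (j2 y)) = prd L (j1 (S x)) (j2 y) + prd L (j1 (sgno L p x)) (j2 (S y))"
  "!!x y. rc L x ==> rc L y ==> T2 (prd L (j1 x) (j2 y)) = prd L (j1 (T x)) (j2 y) + prd L (j1 (sgno L p x)) (j2 (T y))"
  "!!x. ne L x ==> dl L (S x) = S2 (dl L x)" "!!x. ne L x ==> dl L (T x) = T2 (dl L x)"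
  using S2 T2 unfolding lift2_def by simp_all
 have k: "klin S" "klin T" and r: "!!x. rc L x ==> rc L (S x)" "!!x. rc L x ==> rc L (T x)"
  and n: "!!x. ne L x ==> ne L (S x)" "!!x. ne L x ==> ne L (T x)"
  and h: "!!n x. hom L n x ==> hom L (n + p) (S x)" "!!n x. hom L n x ==> hom L (n + p) (T x)"
  using primD[OF assms(1)] primD[OF assms(2)] by simp_all
 show ?thesis
  unfolding prim_def lift2_def
 proof (intro conjI allI impI exI[of _ "%x. S2 x - T2 x"])
  fix x y :: "('m, 'k) walg" assume "rc L x" "rc L y"
  thus "S2 (prd L (j1 x) (j2 y)) - T2 (prd L (j1 x) (j2 y)) =
   prd L (j1 (S x - T x)) (j2 y) + prd L (j1 (sgno L p x)) (j2 (S y - T y))"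
   by (simp add: *(3,4) klin_diff[OF klin_j1[OF klin_id]] klin_diff[OF klin_j2[OF klin_id]] prd_diff_left prd_diff_right)
 next
  fix x :: "('m, 'k) walg" assume x: "ne L x"
  show "ne L (S x - T x)" by (rule keys_subset_diff[OF n(1)[OF x] n(2)[OF x]])
  show "dl L (S x - T x) = S2 (dl L x) - T2 (dl L x)"
   by (simp add: klin_diff[OF klin_dl[OF klin_id]] *(5)[OF x] *(6)[OF x])
 next
  fix x :: "('m, 'k) walg" assume x: "rc L x"
  show "rc L (S x - T x)" by (rule keys_subset_diff[OF r(1)[OF x] r(2)[OF x]])
 next
  fix x :: "('m, 'k) walg" and n assume x: "hom L n x"
  show "hom L (n + p) (S x - T x)" by (rule keys_subset_diff[OF h(1)[OF x] h(2)[OF x]])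
 qed (rule klin_minus k *(1,2))+
qed

text \<open>The lift is the commutator of the lifts: the mixed terms, in which \<open>S\<close> and
  \<open>T\<close> act on different factors, cancel.\<close>

lemma prim_commutator:
 fixes S T :: "('m, 'k::real_normed_field) walg => ('m, 'k) walg"
 assumes S: "prim L p S" and T: "prim L q T"
 shows "prim L (p + q) (%x. S (T x) - sk (p * q) (T (S x)))"
proof -
 obtain S2 where S2: "lift2 L p S S2" using primD(5)[OF assms(1)] ..
 obtain T2 where T2: "lift2 L q T T2" using primD(5)[OF assms(2)] ..
 have *: "klin S2" "klin T2"
  "!!x y. rc L x ==> rc L y ==> S2 (prd L (j1 x) (j2 y)) = prd L (j1 (S x)) (j2 y) + prd L (j1 (sgno L p x)) (j2 (S y))"
  "!!x y. rc L x ==> rc L y ==> T2 (prd L (j1 x) (j2 y)) = prd L (j1 (T x)) (j2 y) + prd L (j1 (sgno L q x)) (j2 (T y))"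
  "!!x. ne L x ==> dl L (S x) = S2 (dl L x)" "!!x. ne L x ==> dl L (T x) = T2 (dl L x)"
  using S2 T2 unfolding lift2_def by simp_all
 have k: "klin S" "klin T" and r: "!!x. rc L x ==> rc L (S x)" "!!x. rc L x ==> rc L (T x)"
  and n: "!!x. ne L x ==> ne L (S x)" "!!x. ne L x ==> ne L (T x)"
  and h: "!!n x. hom L n x ==> hom L (n + p) (S x)" "!!n x. hom L n x ==> hom L (n + q) (T x)"
  using primD[OF assms(1)] primD[OF assms(2)] by simp_all
 show ?thesis
  unfolding prim_def lift2_def
 proof (intro conjI allI impI exI[of _ "%x. S2 (T2 x) - sk (p * q) (T2 (S2 x))"])
  fix x y :: "('m, 'k) walg" assume x: "rc L x" and y: "rc L y"
  have 1: "S2 (T2 (prd L (j1 x) (j2 y))) =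
    (prd L (j1 (S (T x))) (j2 y) + prd L (j1 (sgno L p (T x))) (j2 (S y))) +
    (prd L (j1 (S (sgno L q x))) (j2 (T y)) + prd L (j1 (sgno L (p + q) x)) (j2 (S (T y))))"
   by (simp add: *(3)[OF r(2)[OF x] y] *(3)[OF rc_sgno[OF x] r(2)[OF y]] *(4)[OF x y] klin_add[OF *(1)] sgno_sgno)
  have 2: "T2 (S2 (prd L (j1 x) (j2 y))) =
    (prd L (j1 (T (S x))) (j2 y) + prd L (j1 (sgno L q (S x))) (j2 (T y))) +
    (prd L (j1 (T (sgno L p x))) (j2 (S y)) + prd L (j1 (sgno L (p + q) x)) (j2 (T (S y))))"
   by (simp add: *(4)[OF r(1)[OF x] y] *(4)[OF rc_sgno[OF x] r(1)[OF y]] *(3)[OF x y] klin_add[OF *(2)] sgno_sgno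
    add.commute[of q p])
  have s: "sgno L p (T x) = sk (p * q) (T (sgno L p x))" "sgno L q (S x) = sk (p * q) (S (sgno L q x))"
   using hom_sgno_op[OF k(2) h(2), of p x] hom_sgno_op[OF k(1) h(1), of q x] by (simp_all add: mult.commute)
  show "S2 (T2 (prd L (j1 x) (j2 y))) - sk (p * q) (T2 (S2 (prd L (j1 x) (j2 y)))) =
    prd L (j1 (S (T x) - sk (p * q) (T (S x)))) (j2 y) +
    prd L (j1 (sgno L (p + q) x)) (j2 (S (T y) - sk (p * q) (T (S y))))"
   unfolding 1 2 s
   by (simp add: klin_diff[OF klin_j1[OF klin_id]] klin_diff[OF klin_j2[OF klin_id]] prd_diff_left prd_diff_right
    j1_sc j2_sc prd_sc_left prd_sc_right sc_add)
 next
  fix x :: "('m, 'k) walg" and m assume x: "hom L m x"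
  have "hom L (m + q + p) (S (T x))" "hom L (m + p + q) (T (S x))" using h x by blast+
  thus "hom L (m + (p + q)) (S (T x) - sk (p * q) (T (S x)))"
   by (intro keys_subset_diff keys_subset_sc) (simp_all add: add.assoc add.commute[of q p])
 next
  show "klin (%x. S (T x) - sk (p * q) (T (S x)))"
   by (rule klin_minus[OF klin_comp[OF k] klin_scal[OF klin_comp[OF k(2,1)]]])
  show "klin (%x. S2 (T2 x) - sk (p * q) (T2 (S2 x)))"
   by (rule klin_minus[OF klin_comp[OF *(1,2)] klin_scal[OF klin_comp[OF *(2,1)]]])
 next
  fix x :: "('m, 'k) walg" assume x: "ne L x"
  show "dl L (S (T x) - sk (p * q) (T (S x))) = S2 (T2 (dl L x)) - sk (p * q) (T2 (S2 (dl L x)))"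
   using x n by (simp add: klin_diff[OF klin_dl[OF klin_id]] dl_sc *(5,6))
  show "ne L (S (T x) - sk (p * q) (T (S x)))"
   using x n by (intro keys_subset_diff keys_subset_sc) blast+
 next
  fix x :: "('m, 'k) walg" assume x: "rc L x"
  show "rc L (S (T x) - sk (p * q) (T (S x)))"
   using x r by (intro keys_subset_diff keys_subset_sc) blast+
 qed
qed

lemma ne_iff: "ne L x \<longleftrightarrow> rc L x \<and> wds {w. w ~= []} x"
 by auto

lemma prim_vf:
 fixes L :: "('k::real_normed_field, 'g) dgla"
 assumes v: "vfdeg L p v"
 shows "prim L p (vf L v :: ('m, 'k) walg => _)"
 unfolding prim_def lift2_def
proof (intro conjI allI impI exI[of _ "vf L v"])
 fix x y :: "('m, 'k) walg" assume "rc L x" "rc L y"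
 thus "vf L v (prd L (j1 x) (j2 y)) = prd L (j1 (vf L v x)) (j2 y) + prd L (j1 (sgno L p x)) (j2 (vf L v y))"
  by (simp add: vf_prd[OF v] j_rc j_vf j_sgno)
next
 fix n and x :: "('m, 'k) walg" assume "hom L n x"
 thus "hom L (n + p) (vf L v x)" using hom_vf[OF v] by (simp add: add.commute)
next
 fix x :: "('m, 'k) walg" assume "ne L x"
 thus "ne L (vf L v x)" using wds_vf[of x "{w. w ~= []}" L v] unfolding ne_iff by simp
 show "dl L (vf L v x) = vf L v (dl L x)" using \<open>ne L x\<close> dl_vf[OF v ne_rc] by blast
qed (auto intro: klin_intros dest: subsetD[OF rc_vf])

context ce_module
begin

lemma ne_th:
 assumes "el L e" "ne L x"
 shows "ne L (th e x)"
 unfolding ne_iff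
proof
 show "wds {w. w ~= []} (th e x)"
  using assms by (intro wds_th[where S = "{[m] | m. True}" and T = "{w. w ~= []}"]) auto
qed simp

text \<open>Left multiplication puts \<open>e\<close> into either factor, and the derivation acts on
  the common coefficient. Moving \<open>e\<close> past the first factor produces the sign demanded
  of a lift.\<close>

lemma prim_th:
 assumes e: "el L e" "hom L n e"
 shows "prim L n (th e)"
 unfolding prim_def lift2_def
proof (intro conjI allI impI exI[of _ "%x. prd L (j1 e + j2 e) x + nab L F e x"])
 fix x y :: "('m, 'k) walg" assume x: "rc L x" and y: "rc L y"
 have "prd L (j2 e) (prd L (j1 x) (j2 y)) = prd L (j1 (sgno L n x)) (prd L (j2 e) (j2 y))"
  by (simp only: prd_assoc[symmetric] j2_j1_commute[OF e(2)])
 thus "prd L (j1 e + j2 e) (prd L (j1 x) (j2 y)) + nab L F e (prd L (j1 x) (j2 y)) =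
   prd L (j1 (th e x)) (j2 y) + prd L (j1 (sgno L n x)) (j2 (th e y))"
  unfolding nab_prd[OF F e j_rc(1)[OF x] j_rc(2)[OF y]]
  by (simp add: th_def j1_add j2_add j_prd j_nab j_sgno prd_add_left prd_add_right prd_assoc add.assoc add.left_commute)
next
 fix k and x :: "('m, 'k) walg" assume "hom L k x"
 thus "hom L (k + n) (th e x)" using hom_th[OF e] by (simp add: add.commute)
next
 fix x :: "('m, 'k) walg" assume x: "ne L x"
 show "dl L (th e x) = prd L (j1 e + j2 e) (dl L x) + nab L F e (dl L x)"
  by (simp only: th_def dl_add dl_el[OF e(1) x] dl_nab[OF F ne_rc[OF x]])
 show "ne L (th e x)" by (rule ne_th[OF e(1) x])
qed (simp | rule klin_id klin_th_right klin_plus klin_prd_right klin_nab_right)+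

text \<open>The common coefficient must be differentiated only once. The lift is therefore given on
  basis elements, and \<open>Q2_j\<close> identifies it with Q \<otimes> 1 + 1 \<otimes> Q.\<close>

definition Q2 :: "('m, 'k) walg2 => ('m, 'k) walg2" where
 "Q2 = ext (%b. vf L dg (bs b) + sk (mdeg L (fst b)) (sm L (bs (fst b))
   (prd L (j1 (qw (fst (snd b)))) (j2 (bs (0, snd (snd b)))) +
   sk (wdeg (fst (snd b))) (prd L (j1 (bs (0, fst (snd b)))) (j2 (qw (snd (snd b))))))))"

lemma klin_Q2: "klin f ==> klin (%x. Q2 (f x))"
 unfolding Q2_def by (rule klin_comp[OF klin_ext])

lemma Q2_j:
 assumes x: "rc L x" and y: "rc L y"
 shows "Q2 (prd L (j1 x) (j2 y)) = prd L (j1 (Q x)) (j2 y) + prd L (j1 (sgno L 1 x)) (j2 (Q y))"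
proof (rule klin_eqI[where x = x])
 fix b assume b: "b \<in> keys x"
 show "Q2 (prd L (j1 (bs b)) (j2 y)) = prd L (j1 (Q (bs b))) (j2 y) + prd L (j1 (sgno L 1 (bs b))) (j2 (Q y))"
 proof (rule klin_eqI[where x = y])
  fix c assume c: "c \<in> keys y"
  obtain a u d v where bc: "b = (a, u)" "c = (d, v)" by (cases b; cases c)
  have m: "a \<in> mons L" "d \<in> mons L" using b c x y bc by auto
  define A :: "('m, 'k) walg2" where "A = inA (bs a)"
  define B :: "('m, 'k) walg2" where "B = inA (bs d)"
  define U :: "('m, 'k) walg2" where "U = j1 (bs (0, u))"
  define V :: "('m, 'k) walg2" where "V = j2 (bs (0, v))"
  define QU where "QU = j1 (qw u)"
  define QV where "QV = j2 (qw v)"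
  have rA: "rc L A" "rc L B" "rc L U" "rc L V" using m by (simp_all add: A_def B_def U_def V_def inA_bs j_bs)
  have hU: "hom L (wdeg u) U" "hom L (wdeg u + 1) QU"
   unfolding U_def QU_def by (rule j_hom, simp) (rule j_hom[OF hom_qw])
  have swap: "prd L X (prd L B Y) = sk (k * mdeg L d) (prd L B (prd L X Y))" if "hom L k X" for k X Y
   unfolding prd_assoc[symmetric] B_def commute_inA[OF that] by (simp add: inA_bs sgno_bs prd_sc_left)
  have AU: "j1 (bs (a, u)) = prd L A U" and BV: "j2 (bs (d, v)) = prd L B V"
   unfolding bs_split[OF m(1)] bs_split[OF m(2)] j_prd j_inA A_def B_def U_def V_def by simp_all
  \<comment> \<open>With both coefficients collected at the front the definition of
    \<open>Q2\<close> applies; their product may be zero. The Leibniz rule for d_CE then distributes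
    the result over the two factors.\<close>
  have key: "Q2 (prd L (prd L A B) (prd L U V)) = prd L (vf L dg (prd L A B)) (prd L U V) +
    prd L (sgno L 1 (prd L A B)) (prd L QU V + sk (wdeg u) (prd L U QV))"
  proof -
   have ab: "prd L A B = sc (mcoef L a d) (inA (bs (a + d)))"
    by (simp add: A_def B_def inA_bs prd_bs)
   show ?thesis
   proof (cases "a + d \<in> mons L")
    case True
    have uv: "sm L (bs (a + d)) (prd L U V) = bs (a + d, (u, v))"
     unfolding bs_pair[OF True] j_prd by (simp add: U_def V_def prd_assoc)
    have "Q2 (bs (a + d, (u, v))) = vf L dg (bs (a + d, (u, v))) +
      prd L (sgno L 1 (inA (bs (a + d)))) (prd L QU V + sk (wdeg u) (prd L U QV))"
     unfolding Q2_def ext_bs by (simp add: inA_bs sgno_bs prd_sc_left QU_def QV_def U_def V_def)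
    moreover have "vf L dg (bs (a + d, (u, v))) = prd L (vf L dg (inA (bs (a + d)))) (prd L U V)"
    proof -
     have "keys (prd L U V) <= {b. fst b = 0}"
      by (rule keys_prd[of _ "{b. fst b = 0}" _ "{b. fst b = 0}"]) (auto simp: U_def V_def j_bs)
     thus ?thesis using True unfolding uv[symmetric]
      by (subst vf_prd[OF dg]) (simp_all add: inA_bs vf_fst_0)
    qed
    moreover have "Q2 (prd L (prd L A B) (prd L U V)) = sc (mcoef L a d) (Q2 (bs (a + d, (u, v))))"
     unfolding ab prd_sc_left uv by (rule klin_sc[OF klin_Q2[OF klin_id]])
    ultimately show ?thesis
     unfolding ab vf_sc sgno_sc prd_sc_left by (simp only: sc_add)
   qed (simp add: ab mcoef_def klin_0[OF klin_ext, folded Q2_def] Q2_def klin_0[OF klin_ext])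
  qed
  have ABs: "vf L dg (prd L A B) = prd L (vf L dg A) B + prd L (sgno L 1 A) (vf L dg B)"
   by (rule vf_prd[OF dg rA(1,2)])
  have l: "prd L (j1 (bs b)) (j2 (bs c)) = sk (wdeg u * mdeg L d) (prd L (prd L A B) (prd L U V))"
   unfolding bc AU BV prd_assoc swap[OF hU(1)] prd_sc_right ..
  have r1: "prd L (j1 (Q (bs b))) (j2 (bs c)) = sk (wdeg u * mdeg L d) (prd L (vf L dg A) (prd L B (prd L U V)))
    + sk ((wdeg u + 1) * mdeg L d) (prd L (sgno L 1 A) (prd L B (prd L QU V)))"
   unfolding bc BV bs_split[OF m(1)] Q_split[OF m(1)] j1_add j_prd j_vf j_sgno[symmetric] j_inA
    A_def[symmetric] U_def[symmetric] QU_def[symmetric] prd_add_left prd_assoc swap[OF hU(1)] swap[OF hU(2)] prd_sc_right ..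
  have vB: "vf L dg B = inA (vfA L dg (bs d))" by (simp add: B_def inA_vfA)
  have hvB: "hom L (mdeg L d + 1) (vf L dg B)"
   using hom_vf[OF dg, where n = "mdeg L d" and x = B] by (simp add: B_def inA_bs add.commute)
  have swap2: "prd L U (prd L (vf L dg B) Y) = sk (wdeg u * (mdeg L d + 1)) (prd L (vf L dg B) (prd L U Y))" for Y
  proof -
   have "sgno L (wdeg u) (vf L dg B) = sk (wdeg u * (mdeg L d + 1)) (vf L dg B)"
    by (rule sgno_hom[OF hvB])
   thus ?thesis unfolding prd_assoc[symmetric] vB commute_inA[OF hU(1)] by (simp add: prd_sc_left)
  qed
  have sB: "sgno L 1 B = sk (mdeg L d) B" by (simp add: B_def inA_bs sgno_bs)
  have sU: "sgno L 1 U = sk (wdeg u) U" using sgno_hom[OF hU(1), of 1] by simp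
  have r2: "prd L (j1 (sgno L 1 (bs b))) (j2 (Q (bs c))) =
    sc (ksign (wdeg u) * ksign (wdeg u * (mdeg L d + 1))) (prd L (sgno L 1 A) (prd L (vf L dg B) (prd L U V)))
    + sc (ksign (wdeg u) * ksign (wdeg u * mdeg L d) * ksign (mdeg L d)) (prd L (sgno L 1 A) (prd L B (prd L U QV)))"
   unfolding bc bs_split[OF m(2)] Q_split[OF m(2)] j_sgno[symmetric] AU sgno_prd sU j2_add j_prd j_vf j_inA
    B_def[symmetric] V_def[symmetric] QV_def[symmetric] prd_add_right
   by (simp add: j_sgno[symmetric] j_vf B_def[symmetric] sB prd_sc_left prd_sc_right prd_assoc swap2 swap[OF hU(1)] mult_ac)
  show "Q2 (prd L (j1 (bs b)) (j2 (bs c))) =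
    prd L (j1 (Q (bs b))) (j2 (bs c)) + prd L (j1 (sgno L 1 (bs b))) (j2 (Q (bs c)))"
   unfolding l r1 r2 klin_sc[OF klin_ext, of _ _ "prd L (prd L A B) (prd L U V)", folded Q2_def]
   using key unfolding ABs sgno_prd sB
   by (simp add: Q2_def klin_sc[OF klin_ext] prd_add_left prd_add_right prd_assoc sc_add prd_sc_left prd_sc_right
    ksign_add distrib_left distrib_right mult_ac add_ac)
 qed (intro klin_Q2 klj kl)+
qed (intro klin_Q2 klj kl)+

end

section \<open>Compatibility of the differential with the half coproduct\<close>

context ce_module
begin

definition th2 :: "('m, 'k) walg => ('m, 'k) walg2 =>
  ('m, 'k) walg2" where
 "th2 e y = prd L (j1 e + j2 e) y + nab L F e y"

lemma klin_th2_right: "klin f ==> klin (%y. th2 e (f y))"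
 unfolding th2_def by (intro klin_plus klin_prd_right klin_nab_right)

lemma th2_j:
 assumes e: "el L e" "hom L n e" and x: "rc L x" and y: "rc L y"
 shows "th2 e (prd L (j1 x) (j2 y)) = prd L (j1 (th e x)) (j2 y) + prd L (j1 (sgno L n x)) (j2 (th e y))"
proof -
 have "prd L (j2 e) (prd L (j1 x) (j2 y)) = prd L (j1 (sgno L n x)) (prd L (j2 e) (j2 y))"
  by (simp only: prd_assoc[symmetric] j2_j1_commute[OF e(2)])
 thus ?thesis
  unfolding th2_def nab_prd[OF F e j_rc(1)[OF x] j_rc(2)[OF y]]
  by (simp add: th_def j1_add j2_add j_prd j_nab j_sgno prd_add_left prd_add_right prd_assoc add.assoc add.left_commute)
qed

lemma dl_th: "el L e ==> ne L x ==> dl L (th e x) = th2 e (dl L x)"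
 by (simp only: th_def th2_def dl_add dl_el dl_nab[OF F ne_rc])

lemma sgno_Q: "sgno L q (Q x) = sk q (Q (sgno L q x))"
 using hom_sgno_op[where T = Q and p = 1 and L = L, OF klin_Q[OF klin_id] hom_Q, of q x] by simp

lemma sgno_th: "el L e ==> hom L n e ==> sgno L q (th e x) = sk (n * q) (th e (sgno L q x))"
 by (rule hom_sgno_op[where T = "th e", OF klin_th_right[OF klin_id]]) (simp only: add.commute[of _ n] hom_th)

text \<open>The recursion \<open>Q_th_lt\<close> on the tensor square: it holds in each factor, and
  the terms in which Q and the letter act on different factors agree on both sides.\<close>

lemma Q2_th2:
 assumes y: "rc L y"
 shows "Q2 (th2 (lt m) y) = th2 (D m) y + sk (gdeg m) (th2 (lt m) (Q2 y))"
proof (rule pair_eqI[OF _ _ y])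
 fix a :: mono and u v assume a: "a \<in> mons L"
 define x where "x = (sm L (bs a) (bs (0, u)) :: ('m, 'k) walg)"
 define z where "z = (bs (0, v) :: ('m, 'k) walg)"
 have x: "rc L x" and z: "rc L z" by (simp_all add: x_def z_def)
 have 1: "Q2 (th2 (lt m) (prd L (j1 x) (j2 z))) =
   (prd L (j1 (Q (th (lt m) x))) (j2 z) + prd L (j1 (sgno L 1 (th (lt m) x))) (j2 (Q z))) +
   (prd L (j1 (Q (sgno L (gdeg m) x))) (j2 (th (lt m) z)) + prd L (j1 (sgno L (1 + gdeg m) x)) (j2 (Q (th (lt m) z))))"
  by (simp only: th2_j[OF el_lt hom_lt x z] klin_add[OF klin_Q2[OF klin_id]] Q2_j rc_th x z rc_sgno sgno_sgno)
 have 2: "th2 (lt m) (Q2 (prd L (j1 x) (j2 z))) =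
   (prd L (j1 (th (lt m) (Q x))) (j2 z) + prd L (j1 (sgno L (gdeg m) (Q x))) (j2 (th (lt m) z))) +
   (prd L (j1 (th (lt m) (sgno L 1 x))) (j2 (Q z)) + prd L (j1 (sgno L (1 + gdeg m) x)) (j2 (th (lt m) (Q z))))"
  by (simp only: th2_j[OF el_lt hom_lt] klin_add[OF klin_th2_right[OF klin_id]] Q2_j rc_Q x z rc_sgno sgno_sgno add.commute)
 have s: "sgno L 1 (th (lt m) x) = sk (gdeg m) (th (lt m) (sgno L 1 x))"
  using sgno_th[OF el_lt hom_lt, of 1 m x] by simp
 show "Q2 (th2 (lt m) (prd L (j1 x) (j2 z))) =
   th2 (D m) (prd L (j1 x) (j2 z)) + sk (gdeg m) (th2 (lt m) (Q2 (prd L (j1 x) (j2 z))))"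
  unfolding 1 2 th2_j[OF D_el D_hom x z] s sgno_Q Q_th_lt[OF x] Q_th_lt[OF z]
  by (simp add: j1_add j2_add j1_sc j2_sc prd_add_left prd_add_right prd_sc_left prd_sc_right sc_add add_ac)
qed (intro klin_Q2 klin_th2_right klin_plus klin_scal klin_id)+

lemma Q2_j2: "rc L y ==> Q2 (j2 y) = j2 (Q y)"
 using Q2_j[of "bs (0, [])" y] prd_one_left[of "j2 y" L] prd_one_left[of "j2 (Q y)" L]
 by (simp add: j_bs j_rc sgno_bs word_defs klin_0[OF klin_j1[OF klin_id]])

lemma Q2_inA:
 assumes al: "rcA L al" and y: "rc L y"
 shows "Q2 (sm L al y) = prd L (vf L dg (inA al)) y + prd L (sgno L 1 (inA al)) (Q2 y)"
proof (rule pair_eqI[OF _ _ y])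
 fix a :: mono and u v
 define x where "x = (sm L (bs a) (bs (0, u)) :: ('m, 'k) walg)"
 define z where "z = (bs (0, v) :: ('m, 'k) walg)"
 have x: "rc L x" and z: "rc L z" by (simp_all add: x_def z_def)
 have "sm L al (prd L (j1 x) (j2 z)) = prd L (j1 (sm L al x)) (j2 z)"
  by (simp add: j_prd prd_assoc)
 hence "Q2 (sm L al (prd L (j1 x) (j2 z))) =
   prd L (j1 (Q (sm L al x))) (j2 z) + prd L (j1 (sgno L 1 (sm L al x))) (j2 (Q z))"
  by (simp only: Q2_j[OF rc_prd z])
 also have "\<dots> = prd L (vf L dg (inA al)) (prd L (j1 x) (j2 z))
   + prd L (sgno L 1 (inA al)) (Q2 (prd L (j1 x) (j2 z)))"
  unfolding Q2_j[OF x z] Q_sym[OF al x]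
  by (simp add: sgno_prd j1_add j_prd prd_add_left prd_add_right prd_assoc j_vf j_sgno[symmetric])
 finally show "Q2 (sm L al (prd L (j1 x) (j2 z))) = \<dots>" .
qed (intro klin_Q2 klin_intros)+

lemma wds_el_prd: "el L e ==> wds {w. w ~= []} (prd L e x)"
 by (rule wds_prd[where S = "{[m] | m. True}" and T = UNIV]) (auto simp: wmul_list_def)

lemma wds_qw: "wds {w. w ~= []} (qw w)"
proof (induction w)
 case (Cons m w)
 thus ?case
  unfolding qw.simps th_def nab_word
  by (intro keys_subset_add keys_subset_sc wds_el_prd[OF D_el] wds_el_prd[OF el_lt] wds_nab) simp
qed simp

text \<open>Both sides satisfy the same recursion in the first letter, by \<open>dl_th\<close> and
  \<open>Q2_th2\<close>.\<close>

lemma dl_qw: "w ~= [] ==> dl L (qw w) = Q2 (dlw L w)"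
proof (induction w)
 case (Cons m w)
 show ?case
 proof (cases "w = []")
  case True
  thus ?thesis using qw_lt[of m] Q2_j2[OF rc_lt, of m] dl_el_self[OF D_el, of m]
   by (simp add: lt_def del: qw.simps)
 next
  case False
  have ne: "ne L (bs (0, w) :: ('m, 'k) walg)" using False by simp
  have nq: "ne L (qw w)" unfolding ne_iff using wds_qw[of w] by simp
  have t: "th2 (lt m) (dlw L w) = dlw L (m # w)"
   using False by (simp add: th2_def nab_lt vf_fst_0[OF dlw_fst_0])
  show ?thesis
   unfolding qw.simps dl_add dl_sc dl_th[OF D_el ne] dl_th[OF el_lt nq] Cons(1)[OF False] dl_word t[symmetric] Q2_th2[OF rc_dlw] ..
 qed
qed simp

lemma prim_Q: "prim L 1 Q"
 unfolding prim_def lift2_def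
proof (intro conjI allI impI exI[of _ Q2])
 fix x :: "('m, 'k) walg" assume x: "ne L x"
 show "ne L (Q x)"
  using wds_Q[of x "{w. w ~= []}"] x wds_qw unfolding ne_iff by simp
 show "dl L (Q x) = Q2 (dl L x)"
 proof (rule rc_eqI[OF _ _ ne_rc[OF x]])
  fix a w assume a: "a \<in> mons L" "(a, w) \<in> keys x"
  hence w: "w ~= []" using x by auto
  have A: "rcA L (bs a :: mono \<Rightarrow>\<^sub>0 'k)" using a by simp
  obtain \<gamma> where \<gamma>: "sgno L 1 (inA (bs a)) = (inA \<gamma> :: ('m, 'k) walg)"
   using sgno_inA[of 1 "bs a"] by blast
  have \<gamma>2: "sgno L 1 (inA (bs a)) = (inA \<gamma> :: ('m, 'k) walg2)"
   using arg_cong[OF \<gamma>, of j1] by (simp add: j_sgno[symmetric])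
  show "dl L (Q (sm L (bs a) (bs (0, w)))) = Q2 (dl L (sm L (bs a) (bs (0, w))))"
   unfolding Q_split[OF a(1)] dl_add dl_inA dl_word Q2_inA[OF A rc_dlw] \<gamma> \<gamma>2 inA_vfA[symmetric] dl_qw[OF w] ..
 qed (intro klin_dl klin_Q klin_Q2 klin_id)+
next
 fix n and x :: "('m, 'k) walg" assume "hom L n x"
 thus "hom L (n + 1) (Q x)" by (rule hom_Q)
qed (simp_all add: Q2_j | rule klin_Q klin_Q2 klin_id)+

end

section \<open>Comultiplicative maps\<close>

text \<open>The counterpart of coalgebra morphisms for the half coproduct, with
  \<open>\<Phi>2\<close> in the role of \<Phi> \<otimes> \<Phi>.\<close>

definition comul :: "('k::real_normed_field, 'g) dgla =>
  (('m, 'k) walg => ('m, 'k) walg) => bool" where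
 "comul L \<Phi> \<longleftrightarrow> klin \<Phi> \<and> (\<forall>a x. rcA L a \<longrightarrow> rc L x \<longrightarrow> \<Phi> (sm L a x) = sm L a (\<Phi> x)) \<and>
   (\<forall>x. rc L x \<longrightarrow> rc L (\<Phi> x)) \<and> (\<forall>x. ne L x \<longrightarrow> ne L (\<Phi> x)) \<and> (\<forall>n x. hom L n x \<longrightarrow> hom L n (\<Phi> x)) \<and>
   \<Phi> (bs (0, [])) = bs (0, []) \<and>
   (\<exists>\<Phi>2. klin \<Phi>2 \<and>
    (\<forall>x y. rc L x \<longrightarrow> rc L y \<longrightarrow> \<Phi>2 (prd L (j1 x) (j2 y)) = prd L (j1 (\<Phi> x)) (j2 (\<Phi> y))) \<and>
    (\<forall>x. ne L x \<longrightarrow> dl L (\<Phi> x) = \<Phi>2 (dl L x)))"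

lemma comulD:
 assumes "comul L \<Phi>"
 shows "klin \<Phi>" "rcA L a ==> rc L x ==> \<Phi> (sm L a x) = sm L a (\<Phi> x)"
  "rc L x ==> rc L (\<Phi> x)" "ne L x ==> ne L (\<Phi> x)" "hom L n x ==> hom L n (\<Phi> x)" "\<Phi> (bs (0, [])) = bs (0, [])"
  "\<exists>\<Phi>2. klin \<Phi>2 \<and>
    (\<forall>x y. rc L x \<longrightarrow> rc L y \<longrightarrow> \<Phi>2 (prd L (j1 x) (j2 y)) = prd L (j1 (\<Phi> x)) (j2 (\<Phi> y))) \<and>
    (\<forall>x. ne L x \<longrightarrow> dl L (\<Phi> x) = \<Phi>2 (dl L x))"
 using assms unfolding comul_def by simp_all

text \<open>On tensors \<open>j1 x * j2 y\<close>, \<open>ext2 L \<Phi>\<close> is \<open>\<Phi> \<otimes> \<Phi>\<close> if \<open>\<Phi>\<close> is linear over the coefficients.\<close>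

definition ext2 :: "('k::real_normed_field, 'g) dgla =>
  (('m, 'k) walg => ('m, 'k) walg) =>
  ('m, 'k) walg2 => ('m, 'k) walg2" where
 "ext2 L \<Phi> = ext (%b. sm L (bs (fst b)) (prd L (j1 (\<Phi> (bs (0, fst (snd b))))) (j2 (\<Phi> (bs (0, snd (snd b)))))))"

text \<open>Because \<Phi> is linear over C(g) and preserves degrees, a coefficient passes the image
  of a word with the same sign as the word itself.\<close>

lemma ext2_j:
 fixes \<Phi> :: "('m, 'k::real_normed_field) walg => ('m, 'k) walg"
 assumes k: "klin \<Phi>" and A: "!!al x. rcA L al ==> rc L x ==> \<Phi> (sm L al x) = sm L al (\<Phi> x)"
  and h: "!!n x. hom L n x ==> hom L n (\<Phi> x)" and x: "rc L x" and y: "rc L y"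
 shows "ext2 L \<Phi> (prd L (j1 x) (j2 y)) = prd L (j1 (\<Phi> x)) (j2 (\<Phi> y))"
proof (rule rc_eqI[OF _ _ x])
 fix a :: mono and u assume a: "a \<in> mons L"
 show "ext2 L \<Phi> (prd L (j1 (sm L (bs a) (bs (0, u)))) (j2 y)) =
   prd L (j1 (\<Phi> (sm L (bs a) (bs (0, u))))) (j2 (\<Phi> y))"
 proof (rule rc_eqI[OF _ _ y])
  fix d :: mono and v assume d: "d \<in> mons L"
  define U :: "('m, 'k) walg2" where "U = j1 (bs (0, u))"
  define V :: "('m, 'k) walg2" where "V = j2 (bs (0, v))"
  define A :: "('m, 'k) walg2" where "A = inA (bs a)"
  define B :: "('m, 'k) walg2" where "B = inA (bs d)"
  define U' where "U' = j1 (\<Phi> (bs (0, u)))"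
  define V' where "V' = j2 (\<Phi> (bs (0, v)))"
  have hU: "hom L (wdeg u) U" "hom L (wdeg u) U'"
   unfolding U_def U'_def by (rule j_hom, simp) (rule j_hom, rule h, simp)
  have swap: "prd L X (prd L B Y) = sk (k * mdeg L d) (prd L B (prd L X Y))" if "hom L k X" for k X Y
   unfolding prd_assoc[symmetric] B_def commute_inA[OF that] by (simp add: inA_bs sgno_bs prd_sc_left)
  have e: "ext2 L \<Phi> (prd L (prd L A B) (prd L U V)) = prd L (prd L A B) (prd L U' V')"
  proof -
   have ab: "prd L A B = sc (mcoef L a d) (inA (bs (a + d)))"
    by (simp add: A_def B_def inA_bs prd_bs)
   show ?thesis
   proof (cases "a + d \<in> mons L")
    case True
    have uv: "sm L (bs (a + d)) (prd L U V) = bs (a + d, (u, v))"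
     unfolding bs_pair[OF True] j_prd by (simp add: U_def V_def prd_assoc)
    have "ext2 L \<Phi> (prd L (prd L A B) (prd L U V)) = sc (mcoef L a d) (ext2 L \<Phi> (bs (a + d, (u, v))))"
     unfolding ab prd_sc_left uv ext2_def by (rule klin_sc[OF klin_ext])
    thus ?thesis by (simp add: ext2_def ab prd_sc_left U'_def V'_def)
   qed (simp add: ab mcoef_def ext2_def klin_0[OF klin_ext])
  qed
  have "prd L (j1 (sm L (bs a) (bs (0, u)))) (j2 (sm L (bs d) (bs (0, v)))) =
    sk (wdeg u * mdeg L d) (prd L (prd L A B) (prd L U V))"
   unfolding j_prd j_inA A_def[symmetric] B_def[symmetric] U_def[symmetric] V_def[symmetric] prd_assoc swap[OF hU(1)]
    prd_sc_right ..
  moreover have "prd L (j1 (\<Phi> (sm L (bs a) (bs (0, u))))) (j2 (\<Phi> (sm L (bs d) (bs (0, v))))) =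
    sk (wdeg u * mdeg L d) (prd L (prd L A B) (prd L U' V'))"
   using a d
   by (simp add: A j_prd A_def[symmetric] B_def[symmetric] U'_def[symmetric] V'_def[symmetric] prd_assoc swap[OF hU(2)]
    prd_sc_right)
  ultimately show "ext2 L \<Phi> (prd L (j1 (sm L (bs a) (bs (0, u)))) (j2 (sm L (bs d) (bs (0, v))))) =
   prd L (j1 (\<Phi> (sm L (bs a) (bs (0, u))))) (j2 (\<Phi> (sm L (bs d) (bs (0, v)))))"
   using e unfolding ext2_def by (simp add: klin_sc[OF klin_ext])
 qed (unfold ext2_def, (intro klin_comp[OF klin_ext] klin_comp[OF k] klj)+)
qed (unfold ext2_def, (intro klin_comp[OF klin_ext] klin_comp[OF k] klj)+)

text \<open>For operators indexed by letters this is the C(g)-linear extension in the letter, in the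
  manner in which \<open>nab\<close> extends vector fields.\<close>

definition opx :: "('k::real_normed_field, 'g) dgla =>
  ('m letter => ('m, 'k) walg => ('m, 'k) walg) =>
  ('m, 'k) walg => ('m, 'k) walg => ('m, 'k) walg" where
 "opx L T e x = ext (%b. if length (snd b) = 1 then sm L (bs (fst b)) (T (hd (snd b)) x) else 0) e"

lemma klin_opx: "klin f ==> klin (%e. opx L T (f e) x)"
 unfolding opx_def by (rule klin_comp[OF klin_ext])

lemma opx_inA_lt: "a \<in> mons L ==> opx L T (sm L (bs a) (lt m)) x = sm L (bs a) (T m x)"
 by (simp add: bs_Cons[symmetric] opx_def)

text \<open>\<open>Op m\<close> is the action of the letter \<open>m\<close> of the source on the target of the map to be constructed.\<close>

locale ce_comparison = M: ce_module L dg D F + N: ce_module L dg D' F'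
 for L :: "('k::real_normed_field, 'g) dgla" and dg
  and D :: "'m letter => ('m, 'k) walg" and F
  and D' :: "'m letter => ('m, 'k) walg" and F' +
 fixes Op :: "'m letter => ('m, 'k) walg => ('m, 'k) walg"
 assumes Op_prim: "prim L (gdeg m) (Op m)"
  and Op_inA: "rcA L \<alpha> ==> rc L x ==>
   Op m (sm L \<alpha> x) = prd L (vf L (F m) (inA \<alpha>)) x + prd L (sgno L (gdeg m) (inA \<alpha>)) (Op m x)"
  and Op_one: "el L (Op m (bs (0, [])))"
  and Op_Q: "rc L x ==> N.Q (Op m x) = opx L Op (D m) x + sk (gdeg m) (Op m (N.Q x))"
begin

lemmas Op_klin = primD(1)[OF Op_prim] and Op_rc = primD(2)[OF Op_prim] and Op_ne = primD(3)[OF Op_prim]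
 and Op_hom = primD(4)[OF Op_prim]

text \<open>These values are forced by Phi(1) = 1 and by the requirement that Phi turn the action of
  a letter into its operator.\<close>

fun ow :: "'m letter list => ('m, 'k) walg" where
 "ow [] = bs (0, [])"
| "ow (m # w) = Op m (ow w)"

definition Phi :: "('m, 'k) walg => ('m, 'k) walg" where
 "Phi = ext (%b. sm L (bs (fst b)) (ow (snd b)))"

lemma klin_Phi: "klin f ==> klin (%x. Phi (f x))"
 unfolding Phi_def by (rule klin_comp[OF klin_ext])

lemmas Phi_add = klin_add[OF klin_Phi[OF klin_id]] and Phi_sc = klin_sc[OF klin_Phi[OF klin_id]]
lemmas klp = klin_intros klin_Phi klin_opx M.klin_th_left M.klin_th_right M.klin_Q N.klin_Q klin_comp[OF Op_klin]

lemma rc_ow: "rc L (ow w)"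
 by (induction w) (simp_all add: Op_rc)

lemma ne_ow: "w ~= [] ==> ne L (ow w)"
proof (induction w)
 case (Cons m w)
 thus ?case using el_ne[OF Op_one] by (cases "w = []") (simp_all add: Op_ne)
qed simp

lemma hom_ow: "hom L (wdeg w) (ow w)"
proof (induction w)
 case (Cons m w)
 thus ?case using Op_hom[where n = "wdeg w" and x = "ow w" and m = m] by (simp add: wdeg_list_def add.commute)
qed simp

lemma Phi_word [simp]: "Phi (bs (0, w)) = ow w"
 using prd_one_left[OF rc_ow, of w] by (simp add: Phi_def inA_bs)

lemma Phi_inA: "Phi (sm L u x) = sm L u (Phi x)"
proof (rule klin_eqI[where x = u])
 fix a
 show "Phi (sm L (bs a) x) = sm L (bs a) (Phi x)"
 proof (rule klin_eqI[where x = x])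
  fix b :: "mono \<times> 'm letter list"
  obtain c w where b: "b = (c, w)" by (cases b)
  show "Phi (sm L (bs a) (bs b)) = sm L (bs a) (Phi (bs b))"
   by (simp add: b Phi_def prd_assoc[symmetric] prd_bs inA_bs klin_sc[OF klin_ext] prd_sc_left word_defs)
 qed (intro klp)+
qed (intro klp)+

lemma rc_Phi: "rc L (Phi x)"
 unfolding Phi_def ext_def by (intro keys_subset_sum keys_subset_sc rc_prd)

lemma hom_Phi: "hom L n x ==> hom L n (Phi x)"
proof (rule keys_subset_klin[OF klin_Phi[OF klin_id]])
 fix b :: "mono \<times> 'm letter list" assume b: "b \<in> {b. bdeg L b = n}"
 have "hom L (mdeg L (fst b) + wdeg (snd b)) (sm L (bs (fst b)) (ow (snd b)))"
  by (intro hom_prd hom_ow hom_inA) simp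
 thus "hom L n (Phi (bs b))" using b by (simp add: Phi_def bdeg_def)
qed

lemma wds_Phi:
 assumes "wds S x" "!!w. w \<in> S ==> wds T (ow w)"
 shows "wds T (Phi x)"
proof (rule keys_subset_klin[OF klin_Phi[OF klin_id] assms(1)])
 fix b :: "mono \<times> 'm letter list" assume "b \<in> {b. snd b \<in> S}"
 thus "wds T (Phi (bs b))" unfolding Phi_def ext_bs by (intro wds_prd_inA assms(2)) simp
qed

lemma ne_Phi: "ne L x ==> ne L (Phi x)"
 using wds_Phi[of x "{w. w ~= []}" "{w. w ~= []}"] ne_ow rc_Phi unfolding ne_iff by simp

text \<open>By \<open>Op_inA\<close> the operator differentiates coefficients as the source letter
  does, so the identity extends from pure words to words with coefficients.\<close>

lemma Phi_th_lt:
 assumes x: "rc L x"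
 shows "Phi (M.th (lt m) x) = Op m (Phi x)"
proof (rule rc_eqI[OF _ _ x])
 fix a :: mono and w assume a: "a \<in> mons L"
 have A: "rcA L (bs a :: mono \<Rightarrow>\<^sub>0 'k)" using a by simp
 have W: "rc L (bs (0, w) :: ('m, 'k) walg)" by simp
 obtain c where c: "sgno L (gdeg m) (inA (bs a)) = (inA c :: ('m, 'k) walg)"
  using M.sgno_inA[of "gdeg m" "bs a"] by blast
 have "Phi (M.th (lt m) (sm L (bs a) (bs (0, w)))) =
   sm L (vfA L (F m) (bs a)) (ow w) + sm L c (ow (m # w))"
  unfolding M.th_sym[OF el_lt hom_lt A W] nab_lt M.th_lt_word c inA_vfA[symmetric] Phi_add Phi_inA Phi_word ..
 also have "\<dots> = Op m (Phi (sm L (bs a) (bs (0, w))))"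
  unfolding Phi_inA Phi_word Op_inA[OF A rc_ow] c inA_vfA by simp
 finally show "Phi (M.th (lt m) (sm L (bs a) (bs (0, w)))) = \<dots>" .
qed (intro klp)+

lemma Phi_th:
 assumes e: "el L e" and x: "rc L x"
 shows "Phi (M.th e x) = opx L Op e (Phi x)"
proof (rule el_eqI[OF _ _ e])
 fix a m assume "a \<in> mons L"
 thus "Phi (M.th (sm L (bs a) (lt m)) x) = opx L Op (sm L (bs a) (lt m)) (Phi x)"
  by (simp add: M.th_inA Phi_inA Phi_th_lt[OF x] opx_inA_lt)
qed (intro klp)+

text \<open>\<open>Op_Q\<close> is the recursion that defines \<open>qw\<close>, with letters
  replaced by their operators.\<close>

lemma Phi_qw: "Phi (M.qw w) = N.Q (ow w)"
proof (induction w)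
 case (Cons m w)
 show ?case
  unfolding M.qw.simps Phi_add Phi_sc Phi_th[OF M.D_el, of "bs (0, w)", simplified] Phi_th_lt[OF M.rc_qw] Cons
   ow.simps Op_Q[OF rc_ow] by simp
qed (simp add: klin_0[OF klin_Phi[OF klin_id]])

lemma Phi_Q:
 assumes x: "rc L x"
 shows "Phi (M.Q x) = N.Q (Phi x)"
proof (rule rc_eqI[OF _ _ x])
 fix a :: mono and w assume a: "a \<in> mons L"
 have A: "rcA L (bs a :: mono \<Rightarrow>\<^sub>0 'k)" using a by simp
 obtain c where c: "sgno L 1 (inA (bs a)) = (inA c :: ('m, 'k) walg)"
  using M.sgno_inA[of 1 "bs a"] by blast
 show "Phi (M.Q (sm L (bs a) (bs (0, w)))) = N.Q (Phi (sm L (bs a) (bs (0, w))))"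
  unfolding M.Q_split[OF a] Phi_add c inA_vfA[symmetric] Phi_inA Phi_word Phi_qw N.Q_sym[OF A rc_ow] ..
qed (intro klp)+

lemma Phi_lt: "Phi (lt m) = Op m (bs (0, []))"
 by (simp add: lt_def)

text \<open>\<open>Op m\<close> is a coderivation, and \<Phi> \<otimes> \<Phi> intertwines its lift
  with the lift of the letter m. Induction on the first letter then compares the half
  coproducts.\<close>

lemma dl_ow: "w ~= [] ==> dl L (ow w) = ext2 L Phi (dlw L w)"
proof (induction w)
 case (Cons m w)
 have e2: "ext2 L Phi (prd L (j1 x) (j2 y)) = prd L (j1 (Phi x)) (j2 (Phi y))" if "rc L x" "rc L y" for x y
  by (rule ext2_j[OF klin_Phi[OF klin_id] Phi_inA hom_Phi that])
 have k2: "klin f ==> klin (%x. ext2 L Phi (f x))" for f :: "('m, 'k) walg2 => _"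
  unfolding ext2_def by (rule klin_comp[OF klin_ext])
 show ?case
 proof (cases "w = []")
  case True
  have one: "prd L (bs (0, ([], []))) (j2 y) = j2 y" if "rc L y" for y :: "('m, 'k) walg"
   using prd_one_left[OF j_rc(2)[OF that]] by (simp add: word_defs)
  have "ext2 L Phi (j2 (lt m)) = j2 (Phi (lt m))"
   using e2[of "bs (0, [])" "lt m"] one[OF rc_Phi, of "lt m"] one[OF rc_lt, of m]
   by (simp add: j_bs)
  thus ?thesis using True dl_el_self[OF Op_one] by (simp add: Phi_lt)
 next
  case False
  obtain T2 where T2: "lift2 L (gdeg m) (Op m) T2" using primD(5)[OF Op_prim] ..
  have T2k: "klin T2" and T2j: "!!x y. rc L x ==> rc L y ==> T2 (prd L (j1 x) (j2 y)) =
    prd L (j1 (Op m x)) (j2 y) + prd L (j1 (sgno L (gdeg m) x)) (j2 (Op m y))"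
   and T2d: "!!x. ne L x ==> dl L (Op m x) = T2 (dl L x)"
   using T2 unfolding lift2_def by simp_all
  have sP: "sgno L q (Phi x) = Phi (sgno L q x)" for q x
   using hom_sgno_op[where T = Phi and p = 0 and L = L, OF klin_Phi[OF klin_id], of q x] hom_Phi by simp
  have key: "ext2 L Phi (M.th2 (lt m) y) = T2 (ext2 L Phi y)" if y: "rc L y" for y
  proof (rule pair_eqI[OF _ _ y])
   fix a :: mono and u v
   define x where "x = (sm L (bs a) (bs (0, u)) :: ('m, 'k) walg)"
   define z where "z = (bs (0, v) :: ('m, 'k) walg)"
   have x: "rc L x" and z: "rc L z" by (simp_all add: x_def z_def)
   show "ext2 L Phi (M.th2 (lt m) (prd L (j1 x) (j2 z))) = T2 (ext2 L Phi (prd L (j1 x) (j2 z)))"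
    unfolding M.th2_j[OF el_lt hom_lt x z] klin_add[OF k2[OF klin_id]] e2[OF x z] e2[OF M.rc_th z]
     e2[OF rc_sgno[OF x] M.rc_th] T2j[OF rc_Phi rc_Phi] Phi_th_lt[OF x] Phi_th_lt[OF z] sP ..
  qed (intro k2 M.klin_th2_right klin_comp[OF T2k] klin_id)+
  have "dl L (ow (m # w)) = T2 (ext2 L Phi (dlw L w))"
   using Cons False by (simp add: T2d[OF ne_ow])
  also have "\<dots> = ext2 L Phi (M.th2 (lt m) (dlw L w))" by (rule key[OF rc_dlw, symmetric])
  also have "M.th2 (lt m) (dlw L w) = dlw L (m # w)"
   using False by (simp add: M.th2_def nab_lt vf_fst_0[OF dlw_fst_0])
  finally show ?thesis .
 qed
qed simp

lemma comul_Phi: "comul L Phi"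
 unfolding comul_def
proof (intro conjI allI impI exI[of _ "ext2 L Phi"])
 have k2: "klin f ==> klin (%x. ext2 L Phi (f x))" for f :: "('m, 'k) walg2 => _"
  unfolding ext2_def by (rule klin_comp[OF klin_ext])
 show "klin (ext2 L Phi)" by (rule k2[OF klin_id])
 fix x y :: "('m, 'k) walg" assume x: "rc L x"
 {
  assume y: "rc L y"
  show "ext2 L Phi (prd L (j1 x) (j2 y)) = prd L (j1 (Phi x)) (j2 (Phi y))"
   by (rule ext2_j[OF klin_Phi[OF klin_id] Phi_inA hom_Phi x y])
 }
next
 fix x :: "('m, 'k) walg" assume x: "ne L x"
 show "ne L (Phi x)" by (rule ne_Phi[OF x])
 have e2A: "ext2 L Phi (sm L al y) = sm L al (ext2 L Phi y)" if y: "rc L y" for al y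
 proof (rule pair_eqI[OF _ _ y])
  fix a :: mono and u v
  define x where "x = (sm L (bs a) (bs (0, u)) :: ('m, 'k) walg)"
  define z where "z = (bs (0, v) :: ('m, 'k) walg)"
  have xz: "rc L x" "rc L z" by (simp_all add: x_def z_def)
  have "sm L al (prd L (j1 x) (j2 z)) = prd L (j1 (sm L al x)) (j2 z)"
   by (simp add: j_prd prd_assoc)
  hence "ext2 L Phi (sm L al (prd L (j1 x) (j2 z))) = prd L (j1 (Phi (sm L al x))) (j2 (Phi z))"
   by (simp only: ext2_j[OF klin_Phi[OF klin_id] Phi_inA hom_Phi rc_prd xz(2)])
  thus "ext2 L Phi (sm L al (prd L (j1 x) (j2 z))) = sm L al (ext2 L Phi (prd L (j1 x) (j2 z)))"
   by (simp only: ext2_j[OF klin_Phi[OF klin_id] Phi_inA hom_Phi xz] Phi_inA j_prd j_inA prd_assoc)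
 qed (unfold ext2_def, (intro klin_comp[OF klin_ext] klin_intros)+)
 show "dl L (Phi x) = ext2 L Phi (dl L x)"
 proof (rule rc_eqI[OF _ _ ne_rc[OF x]])
  fix a w assume "a \<in> mons L" "(a, w) \<in> keys x"
  hence w: "w ~= []" using x by auto
  show "dl L (Phi (sm L (bs a) (bs (0, w)))) = ext2 L Phi (dl L (sm L (bs a) (bs (0, w))))"
   unfolding Phi_inA dl_inA dl_word Phi_word dl_ow[OF w] e2A[OF rc_dlw] ..
 qed (unfold ext2_def, (intro klin_comp[OF klin_ext] klin_dl klin_Phi klin_id)+)
qed (simp_all add: Phi_inA rc_Phi hom_Phi klin_Phi[OF klin_id])

end

subsection \<open>Inverses of unipotent comultiplicative maps\<close>

text \<open>A Neumann series: 1 - \<Phi> strictly lowers word length, so the sum of its powers is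
  finite on every word. The last conclusion hands down to the inverse every support condition that
  is stable under \<Phi>.\<close>

lemma comul_inverse:
 fixes \<Phi> :: "('m, 'k::real_normed_field) walg => ('m, 'k) walg"
 assumes c: "comul L \<Phi>"
  and low: "!!w. keys (\<Phi> (bs (0, w)) - bs (0, w)) <= {b. length (snd b) < length w}"
 obtains X where "comul L X" "!!x. rc L x ==> \<Phi> (X x) = x" "!!x. rc L x ==> X (\<Phi> x) = x"
  "!!K x. (!!x. keys x <= K ==> keys (\<Phi> x) <= K) ==> keys x <= K ==> keys (X x) <= K"
proof -
 define M where "M = (%x. x - \<Phi> x)"
 \<comment> \<open>On a word of length n the power n + 1 of \<open>M\<close> vanishes, so n + 1
   terms suffice.\<close>
 define X where "X = ext (%b. \<Sum>k<Suc (length (snd b)). (M ^^ k) (bs b))"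
 note k = comulD(1)[OF c]
 have kM: "klin M" unfolding M_def by (intro klin_minus klin_id k)
 have kMk: "klin (M ^^ k)" for k
  by (induction k) (simp_all add: klin_id id_def comp_def klin_comp[OF kM])
 have kX: "klin X" unfolding X_def by (rule klin_ext)
 let ?fil = "%n. {b. fst b \<in> mons L \<and> length (snd b) < n}"
 have fil: "keys (M x) <= ?fil (n - 1)" if "keys x <= ?fil n" for x n
 proof (rule keys_subset_klin[OF kM that])
  fix b :: "mono \<times> 'm letter list" assume b: "b \<in> ?fil n"
  obtain a w where aw: "b = (a, w)" by (cases b)
  with b have a: "a \<in> mons L" and l: "length w < n" by auto
  have "M (bs (a, w)) = sm L (bs a) (bs (0, w) - \<Phi> (bs (0, w)))"
   unfolding M_def bs_split[OF a] using a by (simp add: comulD(2)[OF c] prd_diff_right)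
  moreover have "wds {v. length v < length w} (bs (0, w) - \<Phi> (bs (0, w)))"
   using low[of w] by (simp add: in_keys_iff lookup_minus subset_iff) metis
  ultimately have "wds {v. length v < length w} (M (bs (a, w)))"
   using wds_prd_inA by metis
  moreover have "rc L (M (bs (a, w)))"
   unfolding M_def using a by (intro keys_subset_diff comulD(3)[OF c]) simp_all
  ultimately show "keys (M (bs b)) <= ?fil (n - 1)" using l unfolding aw by fastforce
 qed
 have nil: "(M ^^ n) x = 0" if "keys x <= ?fil n" for n x
  using that
 proof (induction n arbitrary: x)
  case (Suc n)
  have "(M ^^ n) (M x) = 0" using fil[OF Suc(2)] by (intro Suc(1)) simp
  thus ?case by (simp only: funpow_Suc_right comp_apply)
 qed simp
 have nil': "(M ^^ m) x = 0" if "keys x <= ?fil n" "n \<le> m" for n m x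
  using that by (intro nil) fastforce
 have Xsum: "X x = (\<Sum>k<n. (M ^^ k) x)" if "keys x <= ?fil n" for n x
 proof (rule klin_eqI[OF kX klin_sumfun[OF kMk]])
  fix b assume "b \<in> keys x"
  hence b: "fst b \<in> mons L" "Suc (length (snd b)) \<le> n" using that by auto
  have "(\<Sum>k<Suc (length (snd b)). (M ^^ k) (bs b)) = (\<Sum>k<n. (M ^^ k) (bs b))"
   using b nil'[of "bs b" "Suc (length (snd b))"] by (intro sum.mono_neutral_left) simp_all
  thus "X (bs b) = (\<Sum>k<n. (M ^^ k) (bs b))" by (simp only: X_def ext_bs)
 qed
 have bound: "\<exists>n. keys x <= ?fil n" if x: "rc L x" for x :: "('m, 'k) walg"
 proof -
  have "finite ((length \<circ> snd) ` keys x)" by simp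
  then obtain n where "\<forall>i \<in> (length \<circ> snd) ` keys x. i < n"
   unfolding finite_nat_set_iff_bounded by blast
  thus ?thesis using x by (intro exI[of _ n]) auto
 qed
 have telescope: "(\<Sum>k<n. (M ^^ k) x) - (\<Sum>k<n. (M ^^ Suc k) x) = x" if "keys x <= ?fil n" for n x
  using sum_lessThan_telescope[of "%k. - (M ^^ k) x" n] nil[OF that]
  by (simp add: sum_subtractf[symmetric] sum_negf algebra_simps)
 have PX: "\<Phi> (X x) = x" if x: "rc L x" for x
 proof -
  obtain n where n: "keys x <= ?fil n" using bound[OF x] by blast
  have "\<Phi> (X x) = X x - M (X x)" by (simp add: M_def)
  thus ?thesis using telescope[OF n] by (simp add: Xsum[OF n] klin_sum[OF kM])
 qed
 have XP: "X (\<Phi> x) = x" if x: "rc L x" for x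
 proof -
  obtain n where n: "keys x <= ?fil n" using bound[OF x] by blast
  have n': "keys (M x) <= ?fil n" using fil[OF n] by fastforce
  have "X (\<Phi> x) = X x - X (M x)" by (simp add: M_def klin_diff[OF kX])
  also have "X (M x) = (\<Sum>k<n. (M ^^ Suc k) x)"
   unfolding Xsum[OF n'] by (simp only: funpow_Suc_right comp_apply)
  finally show ?thesis using telescope[OF n] by (simp add: Xsum[OF n])
 qed
 have keysX: "keys (X x) <= K" if K: "!!x. keys x <= K ==> keys (\<Phi> x) <= K" and x: "keys x <= K" for K x
 proof (rule keys_subset_klin[OF kX x])
  fix b assume "b \<in> K"
  hence "keys ((M ^^ k) (bs b)) <= K" for k
   by (induction k) (simp_all add: M_def keys_subset_diff K)
  thus "keys (X (bs b)) <= K" unfolding X_def ext_bs by (intro keys_subset_sum)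
 qed
 have rcX: "rc L x ==> rc L (X x)" for x by (rule keysX[OF comulD(3)[OF c]])
 have homX: "hom L n x ==> hom L n (X x)" for n x by (rule keysX[OF comulD(5)[OF c]])
 have neX: "ne L x ==> ne L (X x)" for x by (rule keysX[OF comulD(4)[OF c]])
 have AX: "X (sm L al x) = sm L al (X x)" if "rcA L al" "rc L x" for al x
  using XP[of "sm L al (X x)"] comulD(2)[OF c that(1) rcX[OF that(2)]] PX[OF that(2)] by simp
 have X2: "ext2 L X (prd L (j1 x) (j2 y)) = prd L (j1 (X x)) (j2 (X y))" if "rc L x" "rc L y" for x y
  by (rule ext2_j[OF kX AX homX that])
 obtain P2 where P2: "klin P2" "!!x y. rc L x ==> rc L y ==> P2 (prd L (j1 x) (j2 y)) = prd L (j1 (\<Phi> x)) (j2 (\<Phi> y))"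
  "!!x. ne L x ==> dl L (\<Phi> x) = P2 (dl L x)"
  using comulD(7)[OF c] by auto
 have k2: "klin (ext2 L X)" unfolding ext2_def by (rule klin_ext)
 \<comment> \<open>X \<otimes> X is left inverse to the lift of \<Phi>; applied to the half
   coproduct of \<Phi>(X x) this gives compatibility of X.\<close>
 have XP2: "ext2 L X (P2 y) = y" if y: "rc L y" for y
 proof (rule pair_eqI[where g = "%y. y", OF _ _ y])
  fix a :: mono and u v
  define x where "x = (sm L (bs a) (bs (0, u)) :: ('m, 'k) walg)"
  define z where "z = (bs (0, v) :: ('m, 'k) walg)"
  have xz: "rc L x" "rc L z" by (simp_all add: x_def z_def)
  show "ext2 L X (P2 (prd L (j1 x) (j2 z))) = prd L (j1 x) (j2 z)"
   by (simp add: P2(2)[OF xz] X2 comulD(3)[OF c] xz XP)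
 qed (intro klin_comp[OF k2] P2 klin_id)+
 have d: "dl L (X x) = ext2 L X (dl L x)" if x: "ne L x" for x
  using P2(3)[OF neX[OF x]] PX[OF ne_rc[OF x]] XP2[OF rc_dl, of "X x"] by simp
 have "X (bs (0, [])) = bs (0, [])"
  using XP[of "bs (0, [])"] comulD(6)[OF c] by simp
 hence cX: "comul L X"
  unfolding comul_def by (intro conjI allI impI exI[of _ "ext2 L X"] kX AX rcX neX homX k2 X2 d)
 show thesis by (rule that[OF cX PX XP keysX])
qed

declare One_nat_def [simp]

section \<open>Shuffles as subsets\<close>

lemma nths_eq_map_filter: "nths xs S = map ((!) xs) (filter (%i. i \<in> S) [0..<length xs])"
proof (induction xs rule: rev_induct)
 case (snoc x xs)
 have "map ((!) (xs @ [x])) (filter (%i. i \<in> S) [0..<length xs]) = map ((!) xs) (filter (%i. i \<in> S) [0..<length xs])"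
  by (rule map_cong) (auto simp: nth_append)
 with snoc show ?case by (simp add: nths_append nth_append)
qed simp

text \<open>Shuffles are traded for subsets: the permutation first lists \<open>S\<close> and then
  its complement, both increasingly, and is determined by \<open>S\<close>.\<close>

definition unshuffling :: "nat => nat set => (nat => nat) => bool" where
 "unshuffling n S s \<longleftrightarrow> s permutes {..<n} \<and> strict_mono_on {..<card S} s \<and>
   strict_mono_on {card S..<n} s \<and> s ` {..<card S} = S"

lemma map_strict_mono_eq_filter:
 assumes "strict_mono_on {a..<b} s" "s ` {a..<b} = {i. i < n \<and> P i}"
 shows "map s [a..<b] = filter P [0..<n]"
proof -
 have "sorted_wrt (<) (map s [a..<b])"
  unfolding sorted_wrt_map
  by (rule sorted_wrt_mono_rel[OF _ sorted_wrt_upt]) (use assms(1) in \<open>auto simp: strict_mono_on_def\<close>)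
 moreover have "sorted_wrt (<) (filter P [0..<n])" by (simp add: sorted_wrt_filter)
 moreover have "set (map s [a..<b]) = set (filter P [0..<n])" using assms(2) by auto
 ultimately show ?thesis by (simp only: strict_sorted_iff sorted_distinct_set_unique)
qed

lemma unshuffling_map:
 assumes "unshuffling n S s" "S <= {..<n}"
 shows "map s [0..<card S] = filter (%i. i \<in> S) [0..<n]"
  "map s [card S..<n] = filter (%i. i \<notin> S) [0..<n]"
  "s ` {card S..<n} = {..<n} - S"
proof -
 have p: "s permutes {..<n}" and i: "s ` {..<card S} = S" using assms by (auto simp: unshuffling_def)
 have c: "card S \<le> n" using card_mono[OF finite_lessThan assms(2)] by simp
 have e: "{card S..<n} = {..<n} - {..<card S}" by auto
 show im: "s ` {card S..<n} = {..<n} - S"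
  unfolding e image_set_diff[OF permutes_inj[OF p]] permutes_image[OF p] i ..
 show "map s [0..<card S] = filter (%i. i \<in> S) [0..<n]"
  using assms i by (intro map_strict_mono_eq_filter) (auto simp: unshuffling_def lessThan_atLeast0)
 show "map s [card S..<n] = filter (%i. i \<notin> S) [0..<n]"
  using assms im by (intro map_strict_mono_eq_filter) (auto simp: unshuffling_def)
qed

lemma unshuffling_nths:
 assumes "unshuffling (length xs) S s" "S <= {..<length xs}"
 shows "map (%i. xs ! s i) [0..<card S] = nths xs S"
  "map (%i. xs ! s i) [card S..<length xs] = nths xs (- S)"
 using arg_cong[OF unshuffling_map(1)[OF assms], of "map ((!) xs)"]
  arg_cong[OF unshuffling_map(2)[OF assms], of "map ((!) xs)"]
 by (simp_all add: nths_eq_map_filter comp_def)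

lemma unshuffling_unique:
 assumes s: "unshuffling n S r" and t: "unshuffling n S ta" and S: "S <= {..<n}"
 shows "r = ta"
proof
 fix k
 have "map r [0..<card S] = map ta [0..<card S]" "map r [card S..<n] = map ta [card S..<n]"
  by (simp_all only: unshuffling_map[OF s S] unshuffling_map[OF t S])
 hence "r k = ta k" if "k < n" using that by (cases "k < card S") (auto simp: map_eq_conv)
 moreover have "r k = k \<and> ta k = k" if "\<not> k < n"
  using s t that by (auto simp: unshuffling_def permutes_def)
 ultimately show "r k = ta k" by metis
qed

lemma unshuffling_exists:
 assumes S: "S <= {..<n}"
 shows "\<exists>\<sigma>. unshuffling n S \<sigma>"
proof -
 have f: "finite S" using S finite_subset by blast
 obtain h where h: "bij_betw h {..<card S} S" "strict_mono_on {..<card S} h"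
  using ex_bij_betw_strict_mono_card[OF f] .
 have "finite ({..<n} - S)" by simp
 then obtain g where g: "bij_betw g {..<card ({..<n} - S)} ({..<n} - S)" "strict_mono_on {..<card ({..<n} - S)} g"
  by (rule ex_bij_betw_strict_mono_card)
 have cn: "card ({..<n} - S) = n - card S" and c: "card S \<le> n"
  using card_Diff_subset[OF f S] card_mono[OF finite_lessThan S] by simp_all
 define \<sigma> where "\<sigma> k = (if k < card S then h k else if k < n then g (k - card S) else k)" for k
 have 1: "bij_betw \<sigma> {..<card S} S"
  using h(1) by (rule bij_betw_cong[THEN iffD1, rotated]) (simp add: \<sigma>_def)
 have "bij_betw (%k. k - card S) {card S..<n} {..<n - card S}"
  by (rule bij_betw_byWitness[where f' = "%k. k + card S"]) auto
 from bij_betw_trans[OF this g(1)[unfolded cn]]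
 have 2: "bij_betw \<sigma> {card S..<n} ({..<n} - S)"
  by (rule bij_betw_cong[THEN iffD1, rotated]) (simp add: \<sigma>_def)
 have "bij_betw \<sigma> ({..<card S} \<union> {card S..<n}) (S \<union> ({..<n} - S))"
  by (rule bij_betw_combine[OF 1 2]) auto
 moreover have "{..<card S} \<union> {card S..<n} = {..<n}" "S \<union> ({..<n} - S) = {..<n}" using c S by auto
 ultimately have "\<sigma> permutes {..<n}"
  using c by (intro bij_imp_permutes) (auto simp: \<sigma>_def)
 moreover have "strict_mono_on {..<card S} \<sigma>" using h(2) by (auto simp: strict_mono_on_def \<sigma>_def)
 moreover have "strict_mono_on {card S..<n} \<sigma>" using g(2) unfolding strict_mono_on_def \<sigma>_def cn
  by (auto intro!: g(2)[unfolded cn strict_mono_on_def, rule_format])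
 ultimately show ?thesis using 1 by (auto simp: unshuffling_def bij_betw_def)
qed

definition ush :: "nat => nat set => (nat => nat)" where
 "ush n S = (SOME s. unshuffling n S s)"

lemma ush: "S <= {..<n} ==> unshuffling n S (ush n S)"
 unfolding ush_def using unshuffling_exists by (rule someI_ex)

lemma ush_eqI: "unshuffling n S s ==> S <= {..<n} ==> ush n S = s"
 using unshuffling_unique ush by blast

lemma sh_unshuffling:
 assumes "s \<in> sh p q"
 shows "unshuffling (p + q) (s ` {..<p}) s" "card (s ` {..<p}) = p" "s ` {..<p} <= {..<p + q}"
proof -
 have p: "s permutes {..<p + q}" using assms by (simp add: sh_def)
 show c: "card (s ` {..<p}) = p" using permutes_inj_on[OF p] by (simp add: card_image)
 show "s ` {..<p} <= {..<p + q}" using permutes_in_image[OF p] by (simp add: image_subset_iff)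
 show "unshuffling (p + q) (s ` {..<p}) s" using assms unfolding unshuffling_def c by (simp add: sh_def)
qed

lemma ush_sh: "S <= {..<n} ==> ush n S \<in> sh (card S) (n - card S)"
 using ush[of S n] card_mono[OF finite_lessThan, of S n] by (simp add: unshuffling_def sh_def)

lemma finite_sh: "finite (sh p q)"
 by (rule finite_subset[OF _ finite_permutations[of "{..<p + q}"]]) (auto simp: sh_def)

text \<open>A shuffle is recovered from the set of its first \<open>p\<close> values; letting
  \<open>p\<close> vary exhausts all subsets.\<close>

lemma sum_sh:
 "(\<Sum>p\<le>n. \<Sum>r\<in>sh p (n - p). g p r) = (\<Sum>S\<in>Pow {..<n}. g (card S) (ush n S))"
proof -
 have "(\<Sum>p\<le>n. \<Sum>r\<in>sh p (n - p). g p r) = (\<Sum>(p, r)\<in>(SIGMA p:{..n}. sh p (n - p)). g p r)"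
  by (rule sum.Sigma) (simp_all add: finite_sh)
 also have "\<dots> = (\<Sum>S\<in>Pow {..<n}. g (card S) (ush n S))"
 proof (rule sum.reindex_bij_witness[of _ "%S. (card S, ush n S)" "%(p, r). r ` {..<p}"])
  fix a assume "a \<in> (SIGMA p:{..n}. sh p (n - p))"
  then obtain p r where a: "a = (p, r)" "p \<le> n" "r \<in> sh p (n - p)" by auto
  note s = sh_unshuffling[OF a(3)]
  from a(2) s have u: "ush n (r ` {..<p}) = r" by (intro ush_eqI) simp_all
  show "(case a of (p, r) => r ` {..<p}) \<in> Pow {..<n}" using s(3) a by simp
  show "(card (case a of (p, r) => r ` {..<p}), ush n (case a of (p, r) => r ` {..<p})) = a"
   using s u a by simp
  show "g (card (case a of (p, r) => r ` {..<p})) (ush n (case a of (p, r) => r ` {..<p})) =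
    (case a of (p, r) => g p r)" using s u a by simp
 next
  fix S assume S: "S \<in> Pow {..<n}"
  thus "(case (card S, ush n S) of (p, r) => r ` {..<p}) = S"
   using ush[of S n] by (simp add: unshuffling_def)
  show "(card S, ush n S) \<in> (SIGMA p:{..n}. sh p (n - p))"
   using S ush_sh[of S n] card_mono[OF finite_lessThan, of S n] by simp
 qed
 finally show ?thesis .
qed

text \<open>The Koszul sign exponent of moving the arguments with index in \<open>S\<close> to the front.\<close>

definition uexp :: "int list => nat => nat set => int" where
 "uexp ds n S = (\<Sum>(a, b)\<in>{(a, b). a < b \<and> b < n \<and> a \<notin> S \<and> b \<in> S}. ds ! a * ds ! b)"

text \<open>Inversions within the first block are those of \<open>ta\<close>, as
  \<open>ush n S\<close> is increasing there; the second block has none. An inversion across the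
  blocks is a pair of an element outside \<open>S\<close> below one in \<open>S\<close>, which is
  what \<open>uexp\<close> counts.\<close>

lemma koszul_ush_comp:
 assumes S: "S <= {..<n}" and t: "ta permutes {..<card S}" and n: "length ds = n"
 shows "koszul ds n (ush n S \<circ> ta) = (ksign (uexp ds n S) * koszul (nths ds S) (card S) ta :: 'k::real_normed_field)"
proof -
 let ?s = "ush n S \<circ> ta" and ?p = "card S"
 let ?I = "{(i, j). i < j \<and> j < n \<and> ?s j < ?s i}"
 let ?I1 = "{(i, j). i < j \<and> j < ?p \<and> ta j < ta i}"
 let ?I2 = "{(i, j). i < ?p \<and> ?p \<le> j \<and> j < n \<and> ?s j < ?s i}"
 have u: "ush n S permutes {..<n}" "strict_mono_on {..<?p} (ush n S)" "strict_mono_on {?p..<n} (ush n S)"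
  "ush n S ` {..<?p} = S"
  using ush[OF S] by (simp_all add: unshuffling_def)
 have p: "?p \<le> n" using card_mono[OF finite_lessThan S] by simp
 have t1: "i < ?p ==> ta i < ?p" for i using permutes_in_image[OF t, of i] by simp
 have t2: "?p \<le> i ==> ta i = i" for i using t by (simp add: permutes_def)
 have m1: "i < ?p ==> j < ?p ==> ?s j < ?s i \<longleftrightarrow> ta j < ta i" for i j
  using strict_mono_on_less[OF u(2)] t1 by simp
 have m2: "?p \<le> i ==> i < j ==> j < n ==> ?s i < ?s j" for i j
  using strict_mono_onD[OF u(3), of i j] t2[of i] t2[of j] by simp
 have I: "?I = ?I1 \<union> ?I2"
 proof (intro equalityI subsetI)
  fix x assume "x \<in> ?I"
  then obtain i j where x: "x = (i, j)" "i < j" "j < n" "?s j < ?s i" by auto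
  show "x \<in> ?I1 \<union> ?I2"
  proof (cases "j < ?p")
   case True
   thus ?thesis using x m1[of i j] by simp
  next
   case False
   thus ?thesis using x m2[of i j] by (cases "i < ?p") auto
  qed
 next
  fix x assume "x \<in> ?I1 \<union> ?I2"
  thus "x \<in> ?I" using m1 p by auto
 qed
 have fin: "finite ?I1" "finite ?I2"
  by (rule finite_subset[of _ "{..<n} \<times> {..<n}"], use p in auto)+
 have disj: "?I1 \<inter> ?I2 = {}" by auto
 have nt: "nths ds S ! i = ds ! ush n S i" if "i < ?p" for i
  using arg_cong[OF unshuffling_nths(1)[of ds S "ush n S"], of "%l. l ! i"] ush[OF S] S n that by simp
 have s1: "(\<Sum>(i, j)\<in>?I1. ds ! ?s i * ds ! ?s j) = (\<Sum>(i, j)\<in>?I1. nths ds S ! ta i * nths ds S ! ta j)"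
  by (rule sum.cong) (use nt t1 in auto)
 have ps: "?s permutes {..<n}"
  using p by (intro permutes_compose[OF permutes_subset[OF t] u(1)]) simp
 have iS: "?s ` {..<?p} = S" unfolding image_comp[symmetric] permutes_image[OF t] by (rule u(4))
 have is2: "?s j \<notin> S" if "?p \<le> j" for j
 proof
  assume "?s j \<in> S"
  hence "?s j \<in> ?s ` {..<?p}" by (simp only: iS)
  then obtain i where "i < ?p" "?s j = ?s i" by auto
  thus False using injD[OF permutes_inj[OF ps], of j i] that by simp
 qed
 have s2: "(\<Sum>(i, j)\<in>?I2. ds ! ?s i * ds ! ?s j) = uexp ds n S"
  unfolding uexp_def
 proof (rule sum.reindex_bij_witness[of _ "%(a, b). (inv ?s b, inv ?s a)" "%(i, j). (?s j, ?s i)"])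
  fix x assume "x \<in> ?I2"
  then obtain i j where x: "x = (i, j)" "i < ?p" "?p \<le> j" "j < n" "?s j < ?s i" by auto
  have "?s i < n" using permutes_in_image[OF ps, of i] x p by simp
  moreover have "?s i \<in> S" using iS x by blast
  ultimately show "(case x of (i, j) => (?s j, ?s i)) \<in> {(a, b). a < b \<and> b < n \<and> a \<notin> S \<and> b \<in> S}"
   using x is2[of j] by simp
  show "(case case x of (i, j) => (?s j, ?s i) of (a, b) => (inv ?s b, inv ?s a)) = x"
   using x permutes_inverses(2)[OF ps] by simp
  show "(case case x of (i, j) => (?s j, ?s i) of (a, b) => ds ! a * ds ! b) = (case x of (i, j) => ds ! ?s i * ds ! ?s j)"
   using x by simp
 next
  fix x assume "x \<in> {(a, b). a < b \<and> b < n \<and> a \<notin> S \<and> b \<in> S}"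
  then obtain a b where x: "x = (a, b)" "a < b" "b < n" "a \<notin> S" "b \<in> S" by auto
  show "(case case x of (a, b) => (inv ?s b, inv ?s a) of (i, j) => (?s j, ?s i)) = x"
   using x permutes_inverses(1)[OF ps] by simp
  have b: "inv ?s b < ?p"
  proof -
   obtain i where i: "i < ?p" "b = ?s i" using x(5) iS by blast
   thus ?thesis using permutes_inverses(2)[OF ps] by simp
  qed
  have a: "?p \<le> inv ?s a"
  proof (rule ccontr)
   assume "\<not> ?p \<le> inv ?s a"
   hence "?s (inv ?s a) \<in> S" using iS by (metis imageI lessThan_iff not_le)
   thus False using x permutes_inverses(1)[OF ps] by simp
  qed
  have "inv ?s a < n" using permutes_in_image[OF permutes_inv[OF ps], of a] x by simp
  thus "(case x of (a, b) => (inv ?s b, inv ?s a)) \<in> ?I2"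
   using x a b permutes_inverses(1)[OF ps] by simp
 qed
 have "koszul ds n ?s = (ksign (\<Sum>(i, j)\<in>?I1 \<union> ?I2. ds ! ?s i * ds ! ?s j) :: 'k)"
  unfolding koszul_def I ..
 also have "(\<Sum>(i, j)\<in>?I1 \<union> ?I2. ds ! ?s i * ds ! ?s j) =
   uexp ds n S + (\<Sum>(i, j)\<in>?I1. nths ds S ! ta i * nths ds S ! ta j)"
  unfolding sum.union_disjoint[OF fin disj] s1 s2 by simp
 finally show ?thesis unfolding ksign_add koszul_def .
qed

lemma koszul_ush: "S <= {..<n} ==> length ds = n ==> koszul ds n (ush n S) = (ksign (uexp ds n S) :: 'k::real_normed_field)"
proof -
 assume S: "S <= {..<n}" "length ds = n"
 have e: "{(i, j). i < j \<and> j < card S \<and> id j < id i} = {}" by auto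
 have "koszul (nths ds S) (card S) id = (1 :: 'k)" unfolding koszul_def e by simp
 thus ?thesis using koszul_ush_comp[OF S(1) permutes_id S(2), where 'k = 'k] by simp
qed

section \<open>Recursions for the structure sums\<close>

lemma koszul_cong:
 assumes "s permutes {..<n}" "!!i. i < n ==> ds ! i = ds' ! i"
 shows "koszul ds n s = koszul ds' n s"
proof -
 have "i < n ==> s i < n" for i using permutes_in_image[OF assms(1), of i] by simp
 thus ?thesis unfolding koszul_def
  by (intro arg_cong[where f = ksign] sum.cong) (auto simp: assms(2))
qed

text \<open>Either the inner bracket ends before \<open>x\<close>, and \<open>x\<close> stays the
  last argument of the outer map, or the inner bracket ends with \<open>x\<close>; then the shuffle
  selects the set \<open>S\<close> of arguments outside it.\<close>

lemma leib_sum_snoc: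
 fixes W :: "('k::real_normed_field, 'w::ab_group_add, 'z) gspace_scheme"
 assumes n: "length xs = n" "length ds = n"
 shows "leib_sum W F l (xs @ [x]) (ds @ [d]) = leib_sum W (%ys. F (ys @ [x])) l xs ds +
  (\<Sum>S\<in>Pow {..<n}. scl W (ksign (uexp ds n S) * ksign (sum_list (nths ds S)))
    (F (nths xs S @ [l (nths xs (- S) @ [x])])))"
proof -
 define T where "T j k r = scl W (koszul (ds @ [d]) (k - 1) r * ksign (\<Sum>i<k - j. (ds @ [d]) ! r i))
   (F (map (%i. (xs @ [x]) ! r i) [0..<k - j] @
     [l (map (%i. (xs @ [x]) ! r i) [k - j..<k - 1] @ [(xs @ [x]) ! (k - 1)])] @ drop k (xs @ [x])))" for j k r
 have "leib_sum W F l (xs @ [x]) (ds @ [d]) = (\<Sum>j = 1..Suc n. \<Sum>k = j..Suc n. \<Sum>r\<in>sh (k - j) (j - 1). T j k r)"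
  by (simp add: leib_sum_def T_def n Let_def)
 also have "\<dots> = (\<Sum>j = 1..Suc n. (\<Sum>k = j..n. \<Sum>r\<in>sh (k - j) (j - 1). T j k r) + (\<Sum>r\<in>sh (Suc n - j) (j - 1). T j (Suc n) r))"
  by (rule sum.cong) (auto simp: le_Suc_eq)
 also have "\<dots> = (\<Sum>j = 1..n. \<Sum>k = j..n. \<Sum>r\<in>sh (k - j) (j - 1). T j k r) + (\<Sum>j = 1..Suc n. \<Sum>r\<in>sh (Suc n - j) (j - 1). T j (Suc n) r)"
  by (simp add: sum.distrib)
 also have "(\<Sum>j = 1..n. \<Sum>k = j..n. \<Sum>r\<in>sh (k - j) (j - 1). T j k r) = leib_sum W (%ys. F (ys @ [x])) l xs ds"
  unfolding leib_sum_def Let_def n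
 proof (intro sum.cong refl)
  fix j k r assume j: "j \<in> {1..n}" and k: "k \<in> {j..n}" and s: "r \<in> sh (k - j) (j - 1)"
  have p: "r permutes {..<k - 1}" using s j k by (simp add: sh_def)
  have lt: "i < k - 1 ==> r i < n" for i using permutes_in_image[OF p, of i] k by auto
  have 1: "koszul (ds @ [d]) (k - 1) r = koszul ds (k - 1) r"
   by (rule koszul_cong[OF p]) (use k n j in \<open>auto simp: nth_append\<close>)
  have 2: "(\<Sum>i<k - j. (ds @ [d]) ! r i) = (\<Sum>i<k - j. ds ! r i)"
   by (rule sum.cong) (use lt j n in \<open>auto simp: nth_append\<close>)
  have 3: "map (%i. (xs @ [x]) ! r i) [0..<k - j] = map (%i. xs ! r i) [0..<k - j]"
   "map (%i. (xs @ [x]) ! r i) [k - j..<k - 1] = map (%i. xs ! r i) [k - j..<k - 1]"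
   using lt j n by (auto simp: nth_append)
  show "T j k r = scl W (koszul ds (k - 1) r * ksign (\<Sum>i<k - j. ds ! r i))
     (F ((map (%i. xs ! r i) [0..<k - j] @
       [l (map (%i. xs ! r i) [k - j..<k - 1] @ [xs ! (k - 1)])] @ drop k xs) @ [x]))"
  proof -
   have "k - 1 < n" "j \<le> k" "k \<le> n" using j k by auto
   thus ?thesis unfolding T_def 1 2 3 using n by (simp add: nth_append)
  qed
 qed
 \<comment> \<open>An inner bracket of arity j that ends with the last argument leaves p = n + 1 - j
   arguments outside.\<close>
 also have "(\<Sum>j = 1..Suc n. \<Sum>r\<in>sh (Suc n - j) (j - 1). T j (Suc n) r) = (\<Sum>p\<le>n. \<Sum>r\<in>sh p (n - p). T (Suc n - p) (Suc n) r)"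
  by (rule sum.reindex_bij_witness[of _ "%p. Suc n - p" "%j. Suc n - j"]) auto
 also have "\<dots> = (\<Sum>S\<in>Pow {..<n}. T (Suc n - card S) (Suc n) (ush n S))"
  by (rule sum_sh)
 also have "\<dots> = (\<Sum>S\<in>Pow {..<n}. scl W (ksign (uexp ds n S) * ksign (sum_list (nths ds S)))
    (F (nths xs S @ [l (nths xs (- S) @ [x])])))"
 proof (rule sum.cong)
  fix S assume "S \<in> Pow {..<n}"
  hence S: "S <= {..<n}" by simp
  have c: "card S \<le> n" using card_mono[OF finite_lessThan S] by simp
  have p: "ush n S permutes {..<n}" using ush[OF S] by (simp add: unshuffling_def)
  have lt: "i < n ==> ush n S i < n" for i using permutes_in_image[OF p, of i] by simp
  have "koszul (ds @ [d]) n (ush n S) = (koszul ds n (ush n S) :: 'k)"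
   by (rule koszul_cong[OF p]) (use n in \<open>simp add: nth_append\<close>)
  hence 1: "koszul (ds @ [d]) n (ush n S) = (ksign (uexp ds n S) :: 'k)"
   by (simp only: koszul_ush[OF S n(2)])
  have "map (%i. (ds @ [d]) ! ush n S i) [0..<card S] = nths ds S"
   unfolding unshuffling_nths(1)[OF ush, of S ds, unfolded n, OF S S, symmetric]
   using lt c n by (auto simp: nth_append)
  hence 2: "(\<Sum>i<card S. (ds @ [d]) ! ush n S i) = sum_list (nths ds S)"
   by (metis atLeast0LessThan interv_sum_list_conv_sum_set_nat set_upt)
  have 3: "map (%i. (xs @ [x]) ! ush n S i) [0..<card S] = nths xs S"
   unfolding unshuffling_nths(1)[OF ush, of S xs, unfolded n, OF S S, symmetric]
   using lt c n by (auto simp: nth_append)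
  have 4: "map (%i. (xs @ [x]) ! ush n S i) [card S..<n] = nths xs (- S)"
   unfolding unshuffling_nths(2)[OF ush, of S xs, unfolded n, OF S S, symmetric]
   using lt c n by (auto simp: nth_append)
  show "T (Suc n - card S) (Suc n) (ush n S) = scl W (ksign (uexp ds n S) * ksign (sum_list (nths ds S)))
    (F (nths xs S @ [l (nths xs (- S) @ [x])]))"
   unfolding T_def using c n by (simp add: 1 2 3 4) (simp add: nth_append)
 qed simp
 finally show ?thesis .
qed

lemma finite_compositions: "finite (compositions n)"
proof (rule finite_subset)
 show "compositions n <= {is. set is <= {..n} \<and> length is \<le> n}"
 proof
  fix "is" assume i: "is \<in> compositions n"
  have "length is \<le> sum_list is" if "0 \<notin> set is" for "is" :: "nat list"
   using that by (induction "is") auto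
  thus "is \<in> {is. set is <= {..n} \<and> length is \<le> n}"
   using i member_le_sum_list[of _ "is"] by (auto simp: compositions_def)
 qed
 show "finite {is. set is <= {..n} \<and> length is \<le> n}"
  by (rule finite_lists_length_le) simp
qed

lemma finite_ordered_shuffles: "finite (ordered_shuffles is)"
 by (rule finite_subset[OF _ finite_permutations[of "{..<sum_list is}"]]) (auto simp: ordered_shuffles_def)

abbreviation "psum is r \<equiv> sum_list (take r is)"

lemma sum_list_take_le: "psum xs r \<le> sum_list (xs :: nat list)"
 by (metis append_take_drop_id le_add1 sum_list_append)

lemma sum_list_take_pos:
 assumes "0 \<notin> set is" "r < length is"
 shows "psum is r < sum_list (take (Suc r) (is :: nat list))"
proof -
 have "is ! r ~= 0" using assms nth_mem by metis
 thus ?thesis using assms by (simp add: take_Suc_conv_app_nth)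
qed

text \<open>Since the last entries of the blocks increase, the largest value can only be the last
  entry of the last block.\<close>

lemma ordered_shuffle_last:
 assumes s: "sg \<in> ordered_shuffles is" and z: "0 \<notin> set is" and n: "sum_list is = Suc n"
 shows "sg n = n"
proof (rule ccontr)
 assume ne: "sg n ~= n"
 have p: "sg permutes {..<Suc n}"
  and b: "!!r. r < length is ==> strict_mono_on {psum is r..<psum is (Suc r)} sg"
  and l: "strict_mono_on {..<length is} (%r. sg (psum is (Suc r) - 1))"
  using s n by (auto simp: ordered_shuffles_def)
 obtain k where k: "k < Suc n" "sg k = n"
  using permutes_image[OF p] by (metis imageE lessI lessThan_iff)
 hence kn: "k < n" using ne by (cases "k = n") auto
 \<comment> \<open>The block that contains the position \<open>k\<close> of the largest value. Its
   last entry is at least that value, and the last entries of later blocks are no smaller.\<close>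
 define r where "r = (LEAST r. k < psum is (Suc r))"
 have ex: "k < sum_list (take (Suc (length is)) is)" using k n by simp
 have r1: "k < psum is (Suc r)" unfolding r_def by (rule LeastI[of "%r. k < psum is (Suc r)", OF ex])
 have r2: "psum is r \<le> k"
 proof (cases r)
  case (Suc r')
  thus ?thesis using not_less_Least[of r' "%r. k < psum is (Suc r)"] unfolding r_def[symmetric] by simp
 qed simp
 have rl: "r < length is"
  using r1 r2 by (metis leD le_less_linear le_Suc_eq take_all)
 let ?e = "psum is (Suc r) - 1"
 have e: "?e \<le> n" using sum_list_take_le[of "Suc r" "is"] n by simp
 have ke: "n \<le> sg ?e"
 proof (cases "k = ?e")
  case False
  hence "sg k < sg ?e" using r1 r2 by (intro strict_mono_onD[OF b[OF rl]]) auto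
  thus ?thesis using k by simp
 qed (use k in simp)
 have lt: "sg i < Suc n" if "i < Suc n" for i using permutes_in_image[OF p, of i] that by simp
 have "sg ?e \<le> sg n"
 proof (cases "Suc r = length is")
  case True
  thus ?thesis using n by simp
 next
  case False
  let ?q = "length is - 1"
  have "sg (psum is (Suc r) - 1) < sg (sum_list (take (Suc ?q) is) - 1)"
   using rl False by (intro strict_mono_onD[OF l]) auto
  moreover have "Suc ?q = length is" using rl by simp
  ultimately show ?thesis using n by simp
 qed
 with ke ne lt[of n] show False by simp
qed

text \<open>The last block contains the last argument by \<open>ordered_shuffle_last\<close>.
  \<open>S\<close> collects the arguments of the other blocks, which form an arbitrary ordered
  shuffle of \<open>S\<close>.\<close>

lemma comp_sum_snoc:
 fixes W :: "('k::real_normed_field, 'w::ab_group_add, 'z) gspace_scheme"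
 assumes n: "length xs = n" "length ds = n"
  and W: "vector_space (scl W)"
 shows "comp_sum W t \<phi> (xs @ [x]) (ds @ [d]) =
  (\<Sum>S\<in>Pow {..<n}. scl W (ksign (uexp ds n S))
    (comp_sum W (%ys. t (ys @ [\<phi> (nths xs (- S) @ [x])])) \<phi> (nths xs S) (nths ds S)))"
proof -
 note W' = W[unfolded module_iff_vector_space[symmetric]]
 let ?N = "Suc n"
 let ?T = "%is sg. scl W (koszul (ds @ [d]) ?N sg)
   (t (map (%r. \<phi> (map (%i. (xs @ [x]) ! sg i) [psum is r..<psum is (Suc r)])) [0..<length is]))"
 let ?U = "%S is sg. scl W (ksign (uexp ds n S) * koszul (nths ds S) (card S) sg)
   (t (map (%r. \<phi> (map (%i. nths xs S ! sg i) [psum is r..<psum is (Suc r)])) [0..<length is]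
    @ [\<phi> (nths xs (- S) @ [x])]))"
 let ?A = "SIGMA is:compositions ?N. ordered_shuffles is"
 let ?B = "SIGMA S:Pow {..<n}. SIGMA is:compositions (card S). ordered_shuffles is"
 let ?f = "%(S, (is, sg)). (is @ [?N - card S], ush ?N S \<circ> sg)"
 let ?g = "%(is, sg). let S = sg ` {..<sum_list (butlast is)} in (S, (butlast is, inv (ush ?N S) \<circ> sg))"
 have lenS: "length (nths xs S) = card S" "length (nths ds S) = card S" if "S <= {..<n}" for S
 proof -
  have "{i. i < n \<and> i \<in> S} = S" using that by auto
  thus "length (nths xs S) = card S" "length (nths ds S) = card S" using n by (simp_all add: length_nths)
 qed
 have "comp_sum W t \<phi> (xs @ [x]) (ds @ [d]) = (\<Sum>(is, sg)\<in>?A. ?T is sg)"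
  unfolding comp_sum_def using n by (simp add: sum.Sigma[symmetric] finite_compositions finite_ordered_shuffles)
 also have "\<dots> = (\<Sum>(S, (is, sg))\<in>?B. ?U S is sg)"
 proof (rule sum.reindex_bij_witness[of ?B ?g ?f ?A, symmetric])
  \<comment> \<open>From \<open>S\<close> and an ordered shuffle of it: the complement of
    \<open>S\<close>, which contains n, is appended as the last block.\<close>
  fix a assume "a \<in> ?B"
  then obtain S js ta where a: "a = (S, (js, ta))" and S: "S <= {..<n}" and j: "js \<in> compositions (card S)"
   and t: "ta \<in> ordered_shuffles js" by auto
  let ?p = "card S"
  have SN: "S <= {..<?N}" using S by auto
  have pn: "?p \<le> n" using card_mono[OF finite_lessThan S] by simp
  have js: "sum_list js = ?p" "0 \<notin> set js" using j by (auto simp: compositions_def)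
  have u: "ush ?N S permutes {..<?N}" "strict_mono_on {..<?p} (ush ?N S)" "strict_mono_on {?p..<?N} (ush ?N S)"
   "ush ?N S ` {..<?p} = S"
   using ush[OF SN] by (simp_all add: unshuffling_def)
  have tp: "ta permutes {..<?p}"
   and tb: "!!r. r < length js ==> strict_mono_on {psum js r..<psum js (Suc r)} ta"
   and tl: "strict_mono_on {..<length js} (%r. ta (psum js (Suc r) - 1))"
   using t js by (auto simp: ordered_shuffles_def)
  have t1: "i < ?p ==> ta i < ?p" for i using permutes_in_image[OF tp, of i] by simp
  have t2: "?p \<le> i ==> ta i = i" for i using tp by (simp add: permutes_def)
  let ?s = "ush ?N S \<circ> ta" and ?is = "js @ [?N - ?p]"
  have img: "?s ` {..<?p} = S" unfolding image_comp[symmetric] permutes_image[OF tp] by (rule u(4))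
  have sp: "?s permutes {..<?N}"
   using pn by (intro permutes_compose[OF permutes_subset[OF tp] u(1)]) simp
  have un: "ush ?N S n = n"
  proof -
   have "n \<in> ush ?N S ` {?p..<?N}" unfolding unshuffling_map(3)[OF ush[OF SN] SN] using S by auto
   then obtain k where k: "?p \<le> k" "k < ?N" "ush ?N S k = n" by auto
   have "ush ?N S n < ?N" using permutes_in_image[OF u(1), of n] by simp
   moreover have "ush ?N S k < ush ?N S n" if "k ~= n"
    using k that pn by (intro strict_mono_onD[OF u(3)]) simp_all
   ultimately show ?thesis using k by (cases "k = n") auto
  qed
  have ois: "?s \<in> ordered_shuffles ?is"
   unfolding ordered_shuffles_def mem_Collect_eq
  proof (intro conjI allI impI)
   show "?s permutes {..<sum_list ?is}" using sp js pn by simp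
  next
   fix r assume r: "r < length ?is"
   show "strict_mono_on {psum ?is r..<psum ?is (Suc r)} ?s"
   proof (cases "r < length js")
    case True
    have "psum js (Suc r) \<le> ?p" using sum_list_take_le[of "Suc r" js] js by simp
    thus ?thesis using True tb[OF True] t1 strict_mono_on_less[OF u(2)]
     by (simp add: strict_mono_on_def)
   next
    case False
    hence "r = length js" using r by simp
    thus ?thesis using u(3) js t2 pn by (simp add: strict_mono_on_def)
   qed
  next
   show "strict_mono_on {..<length ?is} (%r. ?s (psum ?is (Suc r) - 1))"
    unfolding strict_mono_on_def
   proof (intro allI impI)
    fix q r assume qr: "q \<in> {..<length ?is} \<and> r \<in> {..<length ?is} \<and> q < r"
    hence q: "q < length js" by simp
    have last: "psum js (Suc q) - 1 < ?p" if "q < length js" for q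
     using sum_list_take_le[of "Suc q" js] sum_list_take_pos[OF js(2) that] js by simp
    show "?s (psum ?is (Suc q) - 1) < ?s (psum ?is (Suc r) - 1)"
    proof (cases "r < length js")
     case True
     have "ta (psum js (Suc q) - 1) < ta (psum js (Suc r) - 1)"
      using qr q True by (intro strict_mono_onD[OF tl]) auto
     thus ?thesis using q True t1[OF last[OF q]] t1[OF last[OF True]] strict_mono_on_less[OF u(2)]
      by simp
    next
     case False
     hence r: "r = length js" using qr by simp
     have "?s (psum js (Suc q) - 1) \<in> S" using img last[OF q] by blast
     hence "?s (psum js (Suc q) - 1) < n" using S by auto
     thus ?thesis using r q js pn t2[OF pn] un by simp
    qed
   qed
  qed
  show "?f a \<in> ?A" using a ois js pn by (auto simp: compositions_def)
  show "?g (?f a) = a"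
   using a img js permutes_inv_o(2)[OF u(1)] by (simp add: Let_def comp_assoc[symmetric] del: comp_apply)
  have xsn: "(xs @ [x]) ! ?s i = nths xs S ! ta i" if "i < ?p" for i
  proof -
   have "nths (xs @ [x]) S ! ta i = (xs @ [x]) ! ush ?N S (ta i)"
    using arg_cong[OF unshuffling_nths(1)[of "xs @ [x]" S "ush ?N S"], of "%l. l ! ta i"] ush[OF SN] SN n t1[OF that] by simp
   moreover have "nths (xs @ [x]) S = nths xs S" using S n by (auto simp: nths_append)
   ultimately show ?thesis by simp
  qed
  have last: "map (%i. (xs @ [x]) ! ?s i) [?p..<?N] = nths xs (- S) @ [x]"
  proof -
   have "map (%i. (xs @ [x]) ! ?s i) [?p..<?N] = map (%i. (xs @ [x]) ! ush ?N S i) [?p..<?N]"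
    using t2 by (auto intro!: map_cong)
   also have "\<dots> = nths (xs @ [x]) (- S)"
    using unshuffling_nths(2)[of "xs @ [x]" S "ush ?N S"] ush[OF SN] SN n by simp
   also have "\<dots> = nths xs (- S) @ [x]" using S n by (auto simp: nths_append)
   finally show ?thesis .
  qed
  have mp: "map (%r. \<phi> (map (%i. (xs @ [x]) ! ?s i) [psum ?is r..<psum ?is (Suc r)])) [0..<length ?is]
   = map (%r. \<phi> (map (%i. nths xs S ! ta i) [psum js r..<psum js (Suc r)])) [0..<length js]
    @ [\<phi> (nths xs (- S) @ [x])]"
  proof -
   have 1: "map (%r. \<phi> (map (%i. (xs @ [x]) ! ?s i) [psum js r..<psum js (Suc r)])) [0..<length js]
     = map (%r. \<phi> (map (%i. nths xs S ! ta i) [psum js r..<psum js (Suc r)])) [0..<length js]"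
   proof (intro map_cong refl arg_cong[where f = \<phi>])
    fix q i assume "i \<in> set [psum js q..<psum js (Suc q)]"
    hence "i < ?p" using sum_list_take_le[of "Suc q" js] js by simp
    thus "(xs @ [x]) ! ?s i = nths xs S ! ta i" by (rule xsn)
   qed
   have 2: "map f [0..<length ?is] = map f [0..<length js] @ [f (length js)]" for f :: "nat => 'b"
    by simp
   have 3: "map (%r. \<phi> (map (%i. (xs @ [x]) ! ?s i) [psum ?is r..<psum ?is (Suc r)])) [0..<length js]
    = map (%r. \<phi> (map (%i. (xs @ [x]) ! ?s i) [psum js r..<psum js (Suc r)])) [0..<length js]"
    by (intro map_cong refl) simp
   have 4: "psum ?is (length js) = ?p" "sum_list (take (Suc (length js)) ?is) = ?N"
    using js pn by simp_all
   show ?thesis unfolding 2 3 1 4 last ..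
  qed
  have "nths (ds @ [d]) S = nths ds S" using S n by (auto simp: nths_append)
  moreover have "uexp (ds @ [d]) ?N S = uexp ds n S"
   unfolding uexp_def using S n
   by (intro sum.cong) (auto simp: nth_append less_Suc_eq)
  ultimately have "koszul (ds @ [d]) ?N ?s = (ksign (uexp ds n S) * koszul (nths ds S) ?p ta :: 'k)"
   using koszul_ush_comp[OF SN tp, of "ds @ [d]", where 'k = 'k] n by simp
  thus "(case ?f a of (is, sg) => ?T is sg) = (case a of (S, (is, sg)) => ?U S is sg)"
   unfolding a prod.case mp by simp
 next
  \<comment> \<open>Conversely, the values of all blocks but the last form \<open>S\<close>. On the
    last block the given permutation and \<open>ush\<close> enumerate the same set increasingly, so
    their quotient moves only the earlier positions.\<close>
  fix a assume "a \<in> ?A"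
  then obtain "is" sg where a: "a = (is, sg)" and i: "is \<in> compositions ?N" and s: "sg \<in> ordered_shuffles is" by auto
  have is1: "sum_list is = ?N" "0 \<notin> set is" using i by (auto simp: compositions_def)
  hence nemp: "is ~= []" by auto
  define js where "js = butlast is"
  define p where "p = sum_list js"
  define S where "S = sg ` {..<p}"
  have isj: "is = js @ [last is]" using nemp by (simp add: js_def)
  hence pl: "p + last is = ?N" using is1 by (metis p_def sum_list.Cons sum_list.Nil sum_list_append add_0_right)
  have "last is ~= 0" using is1 nemp by (metis last_in_set)
  hence pn: "p \<le> n" and li: "last is = ?N - p" using pl by simp_all
  have jz: "0 \<notin> set js" using is1 isj by (metis Un_iff set_append)
  have sp: "sg permutes {..<?N}"
   and sb: "!!r. r < length is ==> strict_mono_on {psum is r..<psum is (Suc r)} sg"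
   and sl: "strict_mono_on {..<length is} (%r. sg (psum is (Suc r) - 1))"
   using s is1 by (auto simp: ordered_shuffles_def)
  have lenis: "length is = Suc (length js)" using isj by (metis length_append_singleton)
  have tk: "take r is = take r js" if "r \<le> length js" for r using isj that by (metis append_Nil2 diff_is_0_eq take_0 take_append)
  have sn: "sg n = n" by (rule ordered_shuffle_last[OF s is1(2,1)])
  have cS: "card S = p" unfolding S_def using permutes_inj_on[OF sp] by (simp add: card_image)
  have SN: "S <= {..<?N}" unfolding S_def
  proof
   fix k assume "k \<in> sg ` {..<p}"
   then obtain i where "k = sg i" "i < p" by auto
   thus "k \<in> {..<?N}" using permutes_in_image[OF sp, of i] pn by simp
  qed
  have Sn: "S <= {..<n}"
  proof
   fix k assume k: "k \<in> S"
   then obtain i where i: "k = sg i" "i < p" unfolding S_def by auto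
   have "k ~= n"
   proof
    assume "k = n"
    hence "i = n" using i sn injD[OF permutes_inj[OF sp], of i n] by simp
    thus False using i pn by simp
   qed
   moreover have "k < ?N" using SN k by blast
   ultimately show "k \<in> {..<n}" by simp
  qed
  have u: "ush ?N S permutes {..<?N}" "strict_mono_on {..<p} (ush ?N S)"
   using ush[OF SN] by (simp_all add: unshuffling_def cS)
  have last_mono: "strict_mono_on {p..<?N} sg"
   using sb[of "length js"] lenis tk[of "length js"] is1 by (simp add: p_def)
  have up: "ush ?N S permutes {..<?N}" by (rule u(1))
  have eqhi: "sg k = ush ?N S k" if k: "p \<le> k" for k
  proof (cases "k < ?N")
   case True
   have e: "{p..<?N} = {..<?N} - {..<p}" by auto
   have "sg ` {p..<?N} = {i. i < ?N \<and> i \<notin> S}"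
    unfolding e image_set_diff[OF permutes_inj[OF sp]] permutes_image[OF sp] S_def by auto
   from map_strict_mono_eq_filter[OF last_mono this]
   have "map sg [p..<?N] = map (ush ?N S) [p..<?N]"
    using unshuffling_map(2)[OF ush[OF SN] SN] cS by simp
   thus ?thesis using True k by (auto simp: map_eq_conv simp del: upt_Suc)
  next
   case False
   thus ?thesis using sp up by (simp add: permutes_def)
  qed
  let ?t = "inv (ush ?N S) \<circ> sg"
  have st: "ush ?N S \<circ> ?t = sg" using permutes_inv_o(1)[OF up] by (simp add: comp_assoc[symmetric] del: comp_apply)
  have st': "ush ?N S (?t i) = sg i" for i using fun_cong[OF st, of i] by simp
  have tp: "?t permutes {..<p}"
  proof (rule permutes_superset[OF permutes_compose[OF sp permutes_inv[OF up]]])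
   fix k assume "k \<in> {..<?N} - {..<p}"
   thus "?t k = k" using eqhi[of k] permutes_inverses(2)[OF up] by simp
  qed
  have tlt: "i < p ==> ?t i < p" for i using permutes_in_image[OF tp, of i] by simp
  have tmono: "?t i < ?t j" if "i < p" "j < p" "sg i < sg j" for i j
  proof (rule ccontr)
   assume "\<not> ?t i < ?t j"
   hence "ush ?N S (?t j) \<le> ush ?N S (?t i)"
    using tlt[OF that(1)] tlt[OF that(2)] by (intro strict_mono_on_leD[OF u(2)]) simp_all
   thus False using that st' by simp
  qed
  have tsh: "?t \<in> ordered_shuffles js"
   unfolding ordered_shuffles_def mem_Collect_eq p_def[symmetric]
  proof (intro conjI allI impI tp)
   fix r assume r: "r < length js"
   have "psum js (Suc r) \<le> p" using sum_list_take_le[of "Suc r" js] by (simp add: p_def)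
   thus "strict_mono_on {psum js r..<psum js (Suc r)} ?t"
    using sb[of r] r lenis tk[of r] tk[of "Suc r"] unfolding strict_mono_on_def
    by (auto intro!: tmono simp del: comp_apply)
  next
   show "strict_mono_on {..<length js} (%r. ?t (psum js (Suc r) - 1))"
    unfolding strict_mono_on_def
   proof (intro allI impI)
    fix q r assume qr: "q \<in> {..<length js} \<and> r \<in> {..<length js} \<and> q < r"
    have lst: "psum js (Suc q) - 1 < p" if "q < length js" for q
     using sum_list_take_le[of "Suc q" js] sum_list_take_pos[OF jz that] by (simp add: p_def)
    have "sg (psum is (Suc q) - 1) < sg (psum is (Suc r) - 1)"
     using qr lenis by (intro strict_mono_onD[OF sl]) auto
    thus "?t (psum js (Suc q) - 1) < ?t (psum js (Suc r) - 1)"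
     using qr tk[of "Suc q"] tk[of "Suc r"] by (intro tmono lst) auto
   qed
  qed
  have jc: "js \<in> compositions (card S)" using jz cS by (simp add: compositions_def p_def)
  have ga: "?g a = (S, (js, ?t))" by (simp add: a Let_def js_def[symmetric] p_def[symmetric] S_def[symmetric])
  show "?g a \<in> ?B" unfolding ga using Sn jc tsh by simp
  show "?f (?g a) = a" unfolding ga using st isj li cS a by simp
 qed
 also have "\<dots> = (\<Sum>S\<in>Pow {..<n}. \<Sum>is\<in>compositions (card S). \<Sum>sg\<in>ordered_shuffles is. ?U S is sg)"
  by (simp add: sum.Sigma finite_compositions finite_ordered_shuffles finite_SigmaI)
 also have "\<dots> = (\<Sum>S\<in>Pow {..<n}. scl W (ksign (uexp ds n S))
    (comp_sum W (%ys. t (ys @ [\<phi> (nths xs (- S) @ [x])])) \<phi> (nths xs S) (nths ds S)))"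
  unfolding comp_sum_def by (intro sum.cong refl) (simp add: module.scale_scale[OF W'] module.scale_sum_right[OF W'] lenS)
 finally show ?thesis .
qed

section \<open>Expansion of the structure maps\<close>

lemma sum_Pow_Suc:
 fixes f :: "nat set => 'b::comm_monoid_add"
 shows "(\<Sum>S\<in>Pow {..<Suc n}. f S) = (\<Sum>S\<in>Pow {..<n}. f (insert 0 (Suc ` S)) + f (Suc ` S))"
proof -
 let ?A = "(%S. insert 0 (Suc ` S)) ` Pow {..<n}" and ?B = "(%S. Suc ` S) ` Pow {..<n}"
 have P: "Pow {..<Suc n} = ?A \<union> ?B"
 proof (intro equalityI subsetI)
  fix S assume S: "S \<in> Pow {..<Suc n}"
  define S' where "S' = {j. Suc j \<in> S}"
  have S': "S' \<in> Pow {..<n}" using S by (auto simp: S'_def)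
  have "S = (if 0 \<in> S then insert 0 (Suc ` S') else Suc ` S')"
   by (auto simp: S'_def image_iff) (metis not0_implies_Suc)+
  thus "S \<in> ?A \<union> ?B" using S' by (metis UnCI image_eqI)
 qed auto
 have i: "inj_on (%S. insert 0 (Suc ` S)) (Pow {..<n})" "inj_on (%S. Suc ` S) (Pow {..<n})"
 proof -
  show "inj_on (%S. Suc ` S) (Pow {..<n})" by (simp add: inj_on_def inj_image_eq_iff)
  show "inj_on (%S. insert 0 (Suc ` S)) (Pow {..<n})"
  proof (rule inj_onI)
   fix S T assume "insert 0 (Suc ` S) = insert 0 (Suc ` T)"
   hence "Suc ` S = Suc ` T" by (subst (asm) insert_ident) simp_all
   thus "S = T" by (simp add: inj_image_eq_iff)
  qed
 qed
 have "sum f (?A \<union> ?B) = sum f ?A + sum f ?B" by (rule sum.union_disjoint) auto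
 thus ?thesis unfolding P by (simp add: sum.reindex[OF i(1)] sum.reindex[OF i(2)] sum.distrib)
qed

lemma sum_list_nths: "sum_list (nths ds S) = (\<Sum>j | j < length ds \<and> j \<in> S. ds ! j :: int)"
proof -
 have "sum_list (nths ds S) = sum_list (map ((!) ds) (filter (%i. i \<in> S) [0..<length ds]))"
  by (simp only: nths_eq_map_filter)
 also have "\<dots> = sum ((!) ds) (set (filter (%i. i \<in> S) [0..<length ds]))"
  by (rule sum_list_distinct_conv_sum_set) simp
 also have "set (filter (%i. i \<in> S) [0..<length ds]) = {j. j < length ds \<and> j \<in> S}" by auto
 finally show ?thesis .
qed

text \<open>If 0 lies outside \<open>S\<close>, every element of \<open>S\<close> has to pass it on
  the way to the front; if it lies in \<open>S\<close>, it is already in front.\<close>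

lemma uexp_Cons:
 assumes n: "length ds = n"
 shows "uexp (d # ds) (Suc n) S =
  (if 0 \<in> S then 0 else d * sum_list (nths ds {j. Suc j \<in> S})) + uexp ds n {j. Suc j \<in> S}"
proof -
 let ?S = "{j. Suc j \<in> S}"
 let ?A = "if 0 \<in> S then {} else (%b. (0, Suc b)) ` {j. j < n \<and> j \<in> ?S}"
 let ?B = "(%(a, b). (Suc a, Suc b)) ` {(a, b). a < b \<and> b < n \<and> a \<notin> ?S \<and> b \<in> ?S}"
 have e: "{(a, b). a < b \<and> b < Suc n \<and> a \<notin> S \<and> b \<in> S} = ?A \<union> ?B"
 proof (intro equalityI subsetI)
  fix x assume "x \<in> {(a, b). a < b \<and> b < Suc n \<and> a \<notin> S \<and> b \<in> S}"
  then obtain a b where x: "x = (a, Suc b)" "a < Suc b" "b < n" "a \<notin> S" "Suc b \<in> S"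
   by (auto simp: less_Suc_eq_0_disj)
  thus "x \<in> ?A \<union> ?B" by (cases a) auto
 qed (auto split: if_splits)
 have fin: "finite ?A" "finite ?B"
 proof -
  have "finite {(a, b). a < b \<and> b < n \<and> a \<notin> ?S \<and> b \<in> ?S}"
   by (rule finite_subset[of _ "{..<n} \<times> {..<n}"]) auto
  thus "finite ?A" "finite ?B" by auto
 qed
 have i: "inj_on (%(a, b). (Suc a, Suc b)) X" "inj_on (%b. (0 :: nat, Suc b)) Y" for X Y
  by (auto simp: inj_on_def)
 have "uexp (d # ds) (Suc n) S = (\<Sum>(a, b)\<in>?A. (d # ds) ! a * (d # ds) ! b) + (\<Sum>(a, b)\<in>?B. (d # ds) ! a * (d # ds) ! b)"
  unfolding uexp_def e by (rule sum.union_disjoint[OF fin]) auto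
 also have "(\<Sum>(a, b)\<in>?B. (d # ds) ! a * (d # ds) ! b) = uexp ds n ?S"
  unfolding uexp_def by (subst sum.reindex[OF i(1)]) (auto intro!: sum.cong)
 also have "(\<Sum>(a, b)\<in>?A. (d # ds) ! a * (d # ds) ! b) = (if 0 \<in> S then 0 else d * sum_list (nths ds ?S))"
  unfolding sum_list_nths n by (simp add: sum.reindex[OF i(2)] sum_distrib_left)
 finally show ?thesis .
qed

lemma uexp_all: "uexp ds n {..<n} = 0"
proof -
 have "{(a, b). a < b \<and> b < n \<and> a \<notin> {..<n} \<and> b \<in> {..<n}} = {}" by auto
 thus ?thesis unfolding uexp_def by (simp only: sum.empty)
qed

lemma list_all2_nths: "list_all2 P xs ys ==> list_all2 P (nths xs S) (nths ys S)"
 by (induction xs ys arbitrary: S rule: list_all2_induct) (simp_all add: nths_Cons)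

section \<open>Products of elements of length one and their expansion over subsets\<close>

definition Wd :: "('k::real_normed_field, 'g) dgla => ('m, 'k) walg list => ('m, 'k) walg" where
 "Wd L es = foldr (prd L) es (bs (0, []))"

abbreviation "elh L \<equiv> list_all2 (%e d. el L e \<and> hom L d e)"

lemma Wd_Nil [simp]: "Wd L [] = bs (0, [])"
 and Wd_Cons: "Wd L (e # es) = prd L e (Wd L es)"
 by (simp_all add: Wd_def)

lemma rc_Wd [simp]: "rc L (Wd L es)"
 by (cases es) (simp_all add: Wd_Cons)

lemma one_prd: "rc L x ==> prd L (bs (0, [])) x = x"
 and prd_one: "rc L x ==> prd L x (bs (0, [])) = x"
 using prd_one_left[of x L] prd_one_right[of x L] by (simp_all add: wone_list_def)

lemma Wd_single: "rc L e ==> Wd L [e] = e"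
 by (simp add: Wd_Cons prd_one)

lemma Wd_append: "Wd L (es @ fs) = prd L (Wd L es) (Wd L fs)"
 by (induction es) (simp_all add: Wd_Cons prd_assoc one_prd)

lemma Wd_snoc: "rc L e ==> Wd L (es @ [e]) = prd L (Wd L es) e"
 by (simp add: Wd_append Wd_single)

lemma hom_Wd: "elh L es ds ==> hom L (sum_list ds) (Wd L es)"
proof (induction es ds rule: list_all2_induct)
 case (Cons e es d ds)
 thus ?case unfolding Wd_Cons sum_list.Cons by (intro hom_prd) simp_all
qed simp

lemma wds_Wd: "list_all (el L) es ==> wds {w. length w = length es} (Wd L es)"
proof (induction es)
 case (Cons e es)
 hence "wds {w. length w = 1} e" by auto
 with Cons show ?case unfolding Wd_Cons
  by (intro wds_prd[where S = "{w. length w = 1}" and T = "{w. length w = length es}"]) (simp_all add: wmul_list_def)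
qed simp

lemma elh_el: "elh L es ds ==> list_all (el L) es"
 by (induction es ds rule: list_all2_induct) simp_all

lemma ne_Wd: "list_all (el L) es ==> es ~= [] ==> ne L (Wd L es)"
 unfolding ne_iff using wds_Wd[of L es] by (cases es) auto

text \<open>Every factor but the last goes to either side. A factor sent to the second side has to
  pass those of \<open>S\<close> to its right, which is the recursion \<open>uexp_Cons\<close>. This
  is where shuffle signs meet products.\<close>

lemma dl_Wd:
 assumes "elh L es ds" "el L e"
 shows "dl L (Wd L (es @ [e])) = (\<Sum>S\<in>Pow {..<length es}. sk (uexp ds (length es) S)
   (prd L (j1 (Wd L (nths es S))) (j2 (Wd L (nths es (- S) @ [e])))))"
 using assms(1)
proof (induction es ds rule: list_all2_induct)
 case Nil
 have "uexp [] 0 {} = 0" by (simp add: uexp_def)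
 moreover have "prd L (bs (0, ([], []))) (j2 e) = j2 e"
  using prd_one_left[OF j_rc(2)[OF el_rc[OF assms(2)]]] by (simp add: word_defs)
 ultimately show ?case
  by (simp add: Wd_single el_rc[OF assms(2)] dl_el_self[OF assms(2)] j_bs)
next
 case (Cons f es d ds)
 have fe: "el L f" "hom L d f" using Cons by auto
 have len: "length ds = length es" using Cons by (simp add: list_all2_lengthD)
 have le: "list_all (el L) (es @ [e])" using elh_el[OF Cons(2)] assms(2) by simp
 let ?n = "length es"
 let ?T = "%S. prd L (j1 (Wd L (nths es S))) (j2 (Wd L (nths es (- S) @ [e])))"
 have nt: "nths (f # es) (insert 0 (Suc ` S)) = f # nths es S" "nths (f # es) (- insert 0 (Suc ` S)) = nths es (- S)"
  "nths (f # es) (Suc ` S) = nths es S" "nths (f # es) (- (Suc ` S)) = f # nths es (- S)"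
  "{j. Suc j \<in> insert 0 (Suc ` S)} = S" "{j. Suc j \<in> Suc ` S} = S" for S
  by (auto simp: nths_Cons intro!: arg_cong[where f = "nths es"])
 have 1: "prd L (j1 f) (?T S) = prd L (j1 (Wd L (f # nths es S))) (j2 (Wd L (nths es (- S) @ [e])))" for S
  by (simp only: Wd_Cons j_prd prd_assoc)
 have 2: "prd L (j2 f) (?T S) = sk (d * sum_list (nths ds S))
   (prd L (j1 (Wd L (nths es S))) (j2 (Wd L (f # nths es (- S) @ [e]))))" for S
 proof -
  have "hom L (sum_list (nths ds S)) (Wd L (nths es S))"
   by (rule hom_Wd[OF list_all2_nths[OF Cons(2)]])
  hence "prd L (j2 f) (j1 (Wd L (nths es S))) = sk (d * sum_list (nths ds S)) (prd L (j1 (Wd L (nths es S))) (j2 f))"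
   by (simp add: j2_j1_commute[OF fe(2)] sgno_hom j1_sc prd_sc_left)
  thus ?thesis by (simp only: Wd_Cons j_prd prd_assoc[symmetric] prd_sc_left)
 qed
 have "dl L (Wd L ((f # es) @ [e])) = prd L (j1 f + j2 f) (dl L (Wd L (es @ [e])))"
  using dl_el[OF fe(1) ne_Wd[OF le]] by (simp add: Wd_Cons)
 also have "\<dots> = (\<Sum>S\<in>Pow {..<?n}. sk (uexp ds ?n S) (prd L (j1 f) (?T S)) + sk (uexp ds ?n S) (prd L (j2 f) (?T S)))"
  by (simp add: Cons prd_sum_right prd_sc_right prd_add_left sc_add sum.distrib)
 also have "\<dots> = (\<Sum>S\<in>Pow {..<length (f # es)}. sk (uexp (d # ds) (length (f # es)) S)
   (prd L (j1 (Wd L (nths (f # es) S))) (j2 (Wd L (nths (f # es) (- S) @ [e])))))"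
  unfolding length_Cons sum_Pow_Suc nt uexp_Cons[OF len] 1 2 append_Cons
  by (intro sum.cong refl) (simp add: ksign_add mult.commute image_iff)
 finally show ?case .
qed

text \<open>\<open>kap\<close> inverts the half coproduct, so \<Phi> of a product is recovered from
  \<Phi> of shorter products and the length one part of \<Phi>.\<close>

lemma expand_comul:
 assumes c: "comul L \<Phi>" and es: "elh L es ds" and e: "el L e"
 shows "\<Phi> (Wd L (es @ [e])) = (\<Sum>S\<in>Pow {..<length es}. sk (uexp ds (length es) S)
   (prd L (\<Phi> (Wd L (nths es S))) (pr1 (\<Phi> (Wd L (nths es (- S) @ [e]))))))"
proof -
 have le: "list_all (el L) (es @ [e])" using elh_el[OF es] e by simp
 have ne: "ne L (Wd L (es @ [e]))" by (rule ne_Wd[OF le]) simp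
 obtain P2 where P2: "klin P2" "!!x y. rc L x ==> rc L y ==> P2 (prd L (j1 x) (j2 y)) = prd L (j1 (\<Phi> x)) (j2 (\<Phi> y))"
  "!!x. ne L x ==> dl L (\<Phi> x) = P2 (dl L x)"
  using comulD(7)[OF c] by auto
 have "\<Phi> (Wd L (es @ [e])) = kap (P2 (dl L (Wd L (es @ [e]))))"
  using kap_dl[OF comulD(4)[OF c ne]] P2(3)[OF ne] by simp
 thus ?thesis
  unfolding dl_Wd[OF es e] by (simp add: klin_sum[OF P2(1)] klin_sc[OF P2(1)] klin_sum[OF klin_kap[OF klin_id]] kap_sc P2(2)
    kap_j1 kap_j2)
qed

lemma pr1_el: "el L e ==> pr1 e = e"
 by (rule klin_eqI[where x = e and g = "%x. x"], (intro klj)+) (auto simp: pr1_def)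

lemma pr1_0: "wds {w. length w ~= 1} x ==> pr1 x = 0"
 by (rule klin_eqI[where x = x and g = "%_. 0"], (intro klj)+) (auto simp: pr1_def)

text \<open>As in \<open>expand_comul\<close>. Where \<open>T\<close> acts on the first factor, the
  untouched second factor must already have length one; this leaves only the full set, giving the
  first summand.\<close>

lemma expand_prim:
 assumes T: "prim L p T" and es: "elh L es ds" and e: "el L e"
 shows "T (Wd L (es @ [e])) = prd L (T (Wd L es)) e + (\<Sum>S\<in>Pow {..<length es}. sc (ksign (uexp ds (length es) S) * ksign (p * sum_list (nths ds S)))
   (prd L (Wd L (nths es S)) (pr1 (T (Wd L (nths es (- S) @ [e]))))))"
proof -
 let ?n = "length es"
 have le: "list_all (el L) (es @ [e])" using elh_el[OF es] e by simp
 have ne: "ne L (Wd L (es @ [e]))" by (rule ne_Wd[OF le]) simp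
 obtain T2 where T2: "lift2 L p T T2" using primD(5)[OF T] ..
 have T2k: "klin T2" and T2j: "!!x y. rc L x ==> rc L y ==> T2 (prd L (j1 x) (j2 y)) =
    prd L (j1 (T x)) (j2 y) + prd L (j1 (sgno L p x)) (j2 (T y))"
   and T2d: "!!x. ne L x ==> dl L (T x) = T2 (dl L x)"
  using T2 unfolding lift2_def by simp_all
 have s: "sgno L p (Wd L (nths es S)) = sk (p * sum_list (nths ds S)) (Wd L (nths es S))" for S
  by (rule sgno_hom[OF hom_Wd[OF list_all2_nths[OF es]]])
 have "T (Wd L (es @ [e])) = kap (T2 (dl L (Wd L (es @ [e]))))"
  using kap_dl[OF primD(3)[OF T ne]] T2d[OF ne] by simp
 also have "\<dots> = (\<Sum>S\<in>Pow {..<?n}. sk (uexp ds ?n S) (prd L (T (Wd L (nths es S))) (pr1 (Wd L (nths es (- S) @ [e])))))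
  + (\<Sum>S\<in>Pow {..<?n}. sc (ksign (uexp ds ?n S) * ksign (p * sum_list (nths ds S)))
   (prd L (Wd L (nths es S)) (pr1 (T (Wd L (nths es (- S) @ [e]))))))"
  unfolding dl_Wd[OF es e]
  by (simp add: klin_sum[OF T2k] klin_sc[OF T2k] klin_sum[OF klin_kap[OF klin_id]] kap_sc T2j kap_add sc_add
    kap_j1 kap_j2 s prd_sc_left sum.distrib j1_sc)
 also have "(\<Sum>S\<in>Pow {..<?n}. sk (uexp ds ?n S) (prd L (T (Wd L (nths es S))) (pr1 (Wd L (nths es (- S) @ [e])))))
   = (\<Sum>S\<in>{{..<?n}}. sk (uexp ds ?n S) (prd L (T (Wd L (nths es S))) (pr1 (Wd L (nths es (- S) @ [e])))))"
 proof (rule sum.mono_neutral_right)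
  show "\<forall>S\<in>Pow {..<?n} - {{..<?n}}. sk (uexp ds ?n S) (prd L (T (Wd L (nths es S))) (pr1 (Wd L (nths es (- S) @ [e])))) = 0"
  proof
   fix S assume S: "S \<in> Pow {..<?n} - {{..<?n}}"
   then obtain i where i: "i < ?n" "i \<notin> S" by auto
   hence "es ! i \<in> set (nths es (- S))" by (auto simp: set_nths)
   hence "nths es (- S) ~= []" by auto
   moreover have "list_all (el L) (nths es (- S) @ [e])"
    using le in_set_nthsD[of _ es "- S"] by (auto simp: list_all_iff)
   ultimately have "pr1 (Wd L (nths es (- S) @ [e])) = 0"
    using wds_Wd[of L "nths es (- S) @ [e]"] by (intro pr1_0) (auto simp: One_nat_def)
   thus "sk (uexp ds ?n S) (prd L (T (Wd L (nths es S))) (pr1 (Wd L (nths es (- S) @ [e])))) = 0" by simp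
  qed
 qed auto
 also have "\<dots> = prd L (T (Wd L es)) e"
 proof -
  have "nths es (- {..<?n}) = []" by (simp add: nths_eq_map_filter filter_empty_conv)
  moreover have "nths es {..<?n} = es" by (simp add: nths_all)
  ultimately show ?thesis by (simp add: uexp_all Wd_single[OF el_rc[OF e]] pr1_el[OF e])
 qed
 finally show ?thesis .
qed

text \<open>\<open>leib_sum\<close> and \<open>comp_sum\<close> refer only to the scalar
  multiplication of the target; the grading is a placeholder.\<close>

definition Rsp :: "('k::real_normed_field, ('m, 'k) walg) gspace" where
 "Rsp = \<lparr>scl = sc, gr = (%_. UNIV)\<rparr>"

lemma scl_Rsp [simp]: "scl Rsp = sc"
 by (simp add: Rsp_def)

lemma vector_space_sc: "vector_space (sc :: 'k::real_normed_field => ('b \<Rightarrow>\<^sub>0 'k) => _)"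
 by standard (simp_all add: sc_add sc_add_left)

lemma leib_sum_linear:
 assumes "!!x y. T (x + y) = T x + T y" "T 0 = 0" "!!c x. T (scl W c x) = scl W' c (T x)"
 shows "T (leib_sum W F l xs ds) = leib_sum W' (%ys. T (F ys)) l xs ds"
proof -
 have s: "T (sum g A) = (\<Sum>a\<in>A. T (g a))" for g and A :: "'c set"
  by (induction A rule: infinite_finite_induct) (simp_all add: assms)
 have s2: "T (sum g A) = (\<Sum>a\<in>A. T (g a))" for g and A :: "nat set"
  by (induction A rule: infinite_finite_induct) (simp_all add: assms)
 have s3: "T (sum g A) = (\<Sum>a\<in>A. T (g a))" for g and A :: "(nat => nat) set"
  by (induction A rule: infinite_finite_induct) (simp_all add: assms)
 show ?thesis unfolding leib_sum_def Let_def by (simp only: s2 s3 assms(3))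
qed

lemma comp_sum_linear:
 assumes "!!x y. T (x + y) = T x + T y" "T 0 = 0" "!!c x. T (scl W c x) = scl W' c (T x)"
 shows "T (comp_sum W F \<phi> xs ds) = comp_sum W' (%ys. T (F ys)) \<phi> xs ds"
proof -
 have s2: "T (sum g A) = (\<Sum>a\<in>A. T (g a))" for g and A :: "nat list set"
  by (induction A rule: infinite_finite_induct) (simp_all add: assms)
 have s3: "T (sum g A) = (\<Sum>a\<in>A. T (g a))" for g and A :: "(nat => nat) set"
  by (induction A rule: infinite_finite_induct) (simp_all add: assms)
 show ?thesis unfolding comp_sum_def by (simp only: s2 s3 assms(3))
qed

text \<open>\<open>leib_sum_snoc\<close> and \<open>expand_prim\<close> are the same recursion in
  the last factor, so a coderivation is assembled from its length one part by the Leibniz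
  sum.\<close>

lemma prim_leib_sum:
 assumes T: "prim L 1 T" "T (bs (0, [])) = 0" and es: "elh L es ds"
  and l: "!!fs ds. elh L fs ds ==> fs ~= [] ==> el L (pr1 (T (Wd L fs)))"
 shows "leib_sum Rsp (Wd L) (%fs. pr1 (T (Wd L fs))) es ds = T (Wd L es)"
 using es
proof (induction es arbitrary: ds rule: rev_induct)
 case Nil
 thus ?case using T by (simp add: leib_sum_def)
next
 case (snoc e es)
 then obtain ds' d where ds: "ds = ds' @ [d]" and es: "elh L es ds'" and e: "el L e" "hom L d e"
  by (auto simp: list_all2_append1 list_all2_Cons1 length_Suc_conv)
 have len: "length ds' = length es" using es by (simp add: list_all2_lengthD)
 have "leib_sum Rsp (Wd L) (%fs. pr1 (T (Wd L fs))) (es @ [e]) (ds' @ [d]) =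
   leib_sum Rsp (%ys. prd L (Wd L ys) e) (%fs. pr1 (T (Wd L fs))) es ds' +
   (\<Sum>S\<in>Pow {..<length es}. sc (ksign (uexp ds' (length es) S) * ksign (sum_list (nths ds' S)))
    (prd L (Wd L (nths es S)) (pr1 (T (Wd L (nths es (- S) @ [e]))))))"
 proof -
  have "rc L (pr1 (T (Wd L (nths es (- S) @ [e]))))" for S
   by (rule el_rc, rule l[of _ "nths ds' (- S) @ [d]"]) (use list_all2_nths[OF es] e in \<open>auto intro: list_all2_appendI\<close>)
  thus ?thesis
   unfolding leib_sum_snoc[OF refl len] by (simp add: Wd_snoc[OF el_rc[OF e(1)]] Wd_snoc)
 qed
 also have "leib_sum Rsp (%ys. prd L (Wd L ys) e) (%fs. pr1 (T (Wd L fs))) es ds' =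
   prd L (leib_sum Rsp (Wd L) (%fs. pr1 (T (Wd L fs))) es ds') e"
  by (rule leib_sum_linear[symmetric]) (simp_all add: prd_add_left prd_sc_left)
 finally show ?case unfolding ds expand_prim[OF T(1) es e(1)] snoc(1)[OF es] by simp
qed

text \<open>\<open>comp_sum_snoc\<close> and \<open>expand_comul\<close> are the same recursion. The
  induction is on the length because the subsets produce arbitrary shorter sublists.\<close>

lemma comul_comp_sum:
 assumes c: "comul L \<Phi>" and es: "elh L es ds"
  and l: "!!fs ds. elh L fs ds ==> fs ~= [] ==> el L (pr1 (\<Phi> (Wd L fs)))"
 shows "comp_sum Rsp (Wd L) (%fs. pr1 (\<Phi> (Wd L fs))) es ds = \<Phi> (Wd L es)"
 using es
proof (induction "length es" arbitrary: es ds rule: less_induct)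
 case less
 show ?case
 proof (cases es rule: rev_cases)
  case Nil
  have "is = []" if "is \<in> compositions 0" for "is"
   using that by (cases "is") (auto simp: compositions_def)
  moreover have "[] \<in> compositions 0" by (simp add: compositions_def)
  ultimately have c0: "compositions 0 = {[]}" by blast
  have o0: "ordered_shuffles [] = {id}" by (auto simp: ordered_shuffles_def strict_mono_on_def)
  have k: "koszul ds 0 id = (1 :: 'a)" by (simp add: koszul_def)
  show ?thesis unfolding Nil comp_sum_def using comulD(6)[OF c] by (simp add: c0 o0 k)
 next
  case (snoc es' e)
  then obtain ds' d where ds: "ds = ds' @ [d]" and es: "elh L es' ds'" and e: "el L e" "hom L d e"
   using less(2) by (auto simp: list_all2_append1 list_all2_Cons1 length_Suc_conv)
  have len: "length ds' = length es'" using es by (simp add: list_all2_lengthD)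
  have "comp_sum Rsp (Wd L) (%fs. pr1 (\<Phi> (Wd L fs))) (es' @ [e]) (ds' @ [d]) =
    (\<Sum>S\<in>Pow {..<length es'}. sk (uexp ds' (length es') S)
    (prd L (\<Phi> (Wd L (nths es' S))) (pr1 (\<Phi> (Wd L (nths es' (- S) @ [e]))))))"
  proof -
   have step: "comp_sum Rsp (%ys. Wd L (ys @ [pr1 (\<Phi> (Wd L (nths es' (- S) @ [e])))])) (%fs. pr1 (\<Phi> (Wd L fs))) (nths es' S) (nths ds' S)
     = prd L (\<Phi> (Wd L (nths es' S))) (pr1 (\<Phi> (Wd L (nths es' (- S) @ [e]))))" if "S \<in> Pow {..<length es'}" for S
   proof -
    have r: "rc L (pr1 (\<Phi> (Wd L (nths es' (- S) @ [e]))))"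
     by (rule el_rc, rule l[of _ "nths ds' (- S) @ [d]"]) (use list_all2_nths[OF es] e in \<open>auto intro: list_all2_appendI\<close>)
    have "length (nths es' S) \<le> length es'" by (simp add: length_nths card_mono[of "{..<length es'}", simplified] subset_iff)
    hence "length (nths es' S) < length es" by (simp add: snoc)
    hence ih: "comp_sum Rsp (Wd L) (%fs. pr1 (\<Phi> (Wd L fs))) (nths es' S) (nths ds' S) = \<Phi> (Wd L (nths es' S))"
     by (rule less(1)) (rule list_all2_nths[OF es])
    show ?thesis unfolding Wd_snoc[OF r] ih[symmetric]
     by (rule comp_sum_linear[symmetric]) (simp_all add: prd_add_left prd_sc_left)
   qed
   show ?thesis
    by (subst comp_sum_snoc[OF refl len]) (simp_all add: vector_space_sc step)
  qed
  thus ?thesis unfolding snoc ds expand_comul[OF c es e(1)] .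
 qed
qed

section \<open>Graded spaces and homogeneous bases\<close>

lemma graded_spaceD:
 assumes "graded_space V"
 shows "vector_space (scl V)" "module (scl V)" "module.subspace (scl V) (gr V i)"
  "is_decomp V v c ==> is_decomp V v c' ==> c = c'"
 using assms by (auto simp: graded_space_def module_iff_vector_space)

lemma is_decompI:
 "(!!i. c i \<in> gr V i) ==> finite F ==> (!!i. i \<notin> F ==> c i = 0) ==> v = (\<Sum>i\<in>F. c i) ==> is_decomp V v c"
 unfolding is_decomp_def
 by (auto intro: finite_subset[of _ F] sum.mono_neutral_right)

lemma is_decompD:
 assumes "is_decomp V v c" "finite F" "{i. c i ~= 0} <= F"
 shows "v = (\<Sum>i\<in>F. c i)"
 using assms unfolding is_decomp_def by (auto intro: sum.mono_neutral_left)

context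
 fixes V :: "('k::real_normed_field, 'v::ab_group_add, 'z) gspace_scheme"
 assumes gs: "graded_space V"
begin

lemma gr_0 [simp]: "0 \<in> gr V i"
 by (rule module.subspace_0[OF graded_spaceD(2)[OF gs] graded_spaceD(3)[OF gs]])

lemma gr_add: "x \<in> gr V i ==> y \<in> gr V i ==> x + y \<in> gr V i"
 by (rule module.subspace_add[OF graded_spaceD(2)[OF gs] graded_spaceD(3)[OF gs]])

lemma gr_scl: "x \<in> gr V i ==> scl V c x \<in> gr V i"
 by (rule module.subspace_scale[OF graded_spaceD(2)[OF gs] graded_spaceD(3)[OF gs]])

lemma gr_sum: "(!!a. a \<in> A ==> f a \<in> gr V i) ==> sum f A \<in> gr V i"
 by (rule module.subspace_sum[OF graded_spaceD(2)[OF gs] graded_spaceD(3)[OF gs]])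

lemma decomp_add:
 assumes "is_decomp V v c" "is_decomp V w d"
 shows "is_decomp V (v + w) (%i. c i + d i)"
proof (rule is_decompI)
 let ?F = "{i. c i ~= 0} \<union> {i. d i ~= 0}"
 show "finite ?F" using assms by (simp add: is_decomp_def)
 thus "v + w = (\<Sum>i\<in>?F. c i + d i)"
  using is_decompD[OF assms(1), of ?F] is_decompD[OF assms(2), of ?F] by (simp add: sum.distrib)
qed (use assms in \<open>auto simp: is_decomp_def gr_add\<close>)

lemma decomp_scl:
 assumes "is_decomp V v c"
 shows "is_decomp V (scl V a v) (%i. scl V a (c i))"
proof (rule is_decompI)
 interpret vector_space "scl V" by (rule graded_spaceD(1)[OF gs])
 show "finite {i. c i ~= 0}" using assms by (simp add: is_decomp_def)
 show "scl V a v = (\<Sum>i | c i ~= 0. scl V a (c i))"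
  using assms by (simp add: is_decomp_def scale_sum_right)
qed (use assms module.scale_zero_right[OF graded_spaceD(2)[OF gs]] in \<open>auto simp: is_decomp_def gr_scl\<close>)

lemma decomp_gr: "x \<in> gr V i ==> is_decomp V x (%j. if j = i then x else 0)"
 by (rule is_decompI[of _ _ "{i}"]) auto

lemma gr_car: "x \<in> gr V i ==> x \<in> car V"
 using decomp_gr by (auto simp: car_def)

lemma car_0 [simp]: "0 \<in> car V"
 by (rule gr_car[OF gr_0])

lemma car_add: "x \<in> car V ==> y \<in> car V ==> x + y \<in> car V"
 unfolding car_def mem_Collect_eq using decomp_add by blast

lemma car_scl: "x \<in> car V ==> scl V c x \<in> car V"
 unfolding car_def mem_Collect_eq using decomp_scl by blast

lemma car_sum: "(!!a. a \<in> A ==> f a \<in> car V) ==> sum f A \<in> car V"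
 by (induction A rule: infinite_finite_induct) (simp_all add: car_add)

lemma hcomp_decomp: "v \<in> car V ==> is_decomp V v (hcomp V v)"
proof -
 assume "v \<in> car V"
 then obtain c where "is_decomp V v c" by (auto simp: car_def)
 moreover have "hcomp V v = (THE c. is_decomp V v c)" using \<open>v \<in> car V\<close> by (simp add: hcomp_def)
 ultimately show ?thesis using theI[of "is_decomp V v" c] graded_spaceD(4)[OF gs] by metis
qed

lemma hcomp_eqI: "is_decomp V v c ==> hcomp V v = c"
 using hcomp_decomp[of v] graded_spaceD(4)[OF gs, of v] unfolding car_def by blast

lemma hcomp_gr_mem: "hcomp V v i \<in> gr V i"
 using hcomp_decomp[of v] by (cases "v \<in> car V") (auto simp: is_decomp_def hcomp_def)

lemma hcomp_gr: "x \<in> gr V i ==> hcomp V x = (%j. if j = i then x else 0)"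
 by (rule hcomp_eqI[OF decomp_gr])

lemma finite_hsupp: "finite (hsupp V v)"
 using hcomp_decomp[of v] by (cases "v \<in> car V") (auto simp: is_decomp_def hcomp_def hsupp_def)

lemma hcomp_sum: "v \<in> car V ==> v = (\<Sum>i\<in>hsupp V v. hcomp V v i)"
 using hcomp_decomp[of v] by (simp add: is_decomp_def hsupp_def)

lemma gr_inter: "x \<in> gr V i ==> x \<in> gr V j ==> x ~= 0 ==> i = j"
 using hcomp_gr[of x i] hcomp_gr[of x j] by (metis)

lemma car_eq_span: "car V = module.span (scl V) (\<Union>i. gr V i)"
proof -
 interpret vector_space "scl V" by (rule graded_spaceD(1)[OF gs])
 show ?thesis
 proof (intro equalityI subsetI)
  fix v assume "v \<in> car V"
  then obtain c where c: "is_decomp V v c" by (auto simp: car_def)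
  hence "v = (\<Sum>i | c i ~= 0. c i)" "!!i. c i \<in> span (\<Union>i. gr V i)"
   by (auto simp: is_decomp_def intro: span_base)
  thus "v \<in> span (\<Union>i. gr V i)" by (metis span_sum)
 next
  have "subspace (car V)" by (rule subspaceI) (simp_all add: car_add car_scl)
  moreover have "(\<Union>i. gr V i) <= car V" using gr_car by blast
  ultimately show "!!v. v \<in> span (\<Union>i. gr V i) ==> v \<in> car V" using span_minimal by blast
 qed
qed

text \<open>A maximal independent set of homogeneous vectors spans the whole space, and a finite
  spanning set bounds its size.\<close>

lemma homogeneous_basis:
 assumes "fin_dim V"
 obtains B where "finite B" "B <= (\<Union>i. gr V i)" "\<not> module.dependent (scl V) B" "module.span (scl V) B = car V"
proof -
 interpret vector_space "scl V" by (rule graded_spaceD(1)[OF gs])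
 obtain B where B: "B <= (\<Union>i. gr V i)" "independent B" "(\<Union>i. gr V i) <= span B"
  using maximal_independent_subset[of "\<Union>i. gr V i"] by metis
 have "span B = car V"
  unfolding car_eq_span using B(1,3) by (metis span_eq span_mono span_span subset_antisym)
 moreover obtain C where "finite C" "span C = car V" using assms by (auto simp: fin_dim_def)
 ultimately have "finite B"
  using independent_span_bound[of C B] B(2) span_superset[of B] by simp
 with B \<open>span B = car V\<close> show thesis by (intro that) auto
qed

end

lemma shift_simps [simp]: "scl (shift p V) = scl V" "gr (shift p V) i = gr V (i + p)"
 by (simp_all add: shift_def)

lemma act_shift [simp]: "act (shift p M) = act M"
 by (simp add: shift_def)

lemma decomp_shift: "is_decomp V v c ==> is_decomp (shift p V) v (%i. c (i + p))"
proof (rule is_decompI[where F = "(%i. i - p) ` {i. c i ~= 0}"])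
 assume c: "is_decomp V v c"
 show "v = (\<Sum>i\<in>(%i. i - p) ` {i. c i ~= 0}. c (i + p))"
  using c by (subst sum.reindex) (auto simp: is_decomp_def inj_on_def)
 show "c (i + p) = 0" if "i \<notin> (%i. i - p) ` {i. c i ~= 0}" for i
  using that by (force simp: image_iff)
qed (auto simp: is_decomp_def)

lemma shift_shift: "shift (- p) (shift p V) = V" for V :: "('k, 'v, 'z) gspace_scheme"
 by (cases V) (simp add: shift_def fun_eq_iff)

lemma car_shift [simp]: "car (shift p V) = car V"
proof -
 have "car V <= car (shift p V)" for p and V :: "('p, 'q::ab_group_add, 'r) gspace_scheme"
  using decomp_shift unfolding car_def by blast
 from this[of V p] this[of "shift p V" "- p"] show ?thesis by (simp add: shift_shift)
qed

lemma graded_space_shift: "graded_space V ==> graded_space (shift p V)"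
 unfolding graded_space_def
proof (intro conjI allI impI)
 fix v c c'
 assume V: "vector_space (scl V) \<and> (\<forall>i. module.subspace (scl V) (gr V i)) \<and>
   (\<forall>v c c'. is_decomp V v c \<longrightarrow> is_decomp V v c' \<longrightarrow> c = c')"
  and c: "is_decomp (shift p V) v c" and c': "is_decomp (shift p V) v c'"
 from decomp_shift[OF c, of "- p"] decomp_shift[OF c', of "- p"] V
 have "(%i. c (i + - p)) = (%i. c' (i + - p))" unfolding shift_shift by blast
 thus "c = c'" by (metis add.commute add_minus_cancel ext)
qed auto

subsection \<open>Cochains\<close>

abbreviation (input) "carC L V \<equiv> car (coch L V)"

lemma scl_coch: "scl (coch L V) c = Poly_Mapping.map (scl V c)"
 by (simp add: coch_def)

lemma lookup_scl_coch:
 assumes "graded_space V"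
 shows "lookup (scl (coch L V) c X) a = scl V c (lookup X a)"
 using module.scale_zero_right[OF graded_spaceD(2)[OF assms]]
 by (simp add: scl_coch Poly_Mapping.map.rep_eq when_def)

lemma gr_coch: "gr (coch L V) n = {X. keys X <= mons L \<and> (\<forall>a. lookup X a \<in> gr V (n - mdeg L a))}"
 by (simp add: coch_def)

lemma vector_space_coch:
 assumes gs: "graded_space V"
 shows "vector_space (scl (coch L V))"
proof -
 interpret vector_space "scl V" by (rule graded_spaceD(1)[OF gs])
 show ?thesis
  by (unfold_locales; rule poly_mapping_eqI)
   (simp_all add: lookup_scl_coch[OF gs] lookup_add scale_right_distrib scale_left_distrib)
qed

text \<open>The coefficient at x^a of the component of degree i has degree i - |x^a|; hence
  directness of the grading is inherited coefficient by coefficient.\<close>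

lemma decomp_coch:
 assumes gs: "graded_space V" and c: "is_decomp (coch L V) X c"
 shows "is_decomp V (lookup X a) (%i. lookup (c (i + mdeg L a)) a)"
proof (rule is_decompI[where F = "(%i. i - mdeg L a) ` {i. c i ~= 0}"])
 show "lookup (c (i + mdeg L a)) a \<in> gr V i" for i
 proof -
  have "c (i + mdeg L a) \<in> gr (coch L V) (i + mdeg L a)" using c by (simp add: is_decomp_def)
  hence "lookup (c (i + mdeg L a)) a \<in> gr V (i + mdeg L a - mdeg L a)" unfolding gr_coch by blast
  thus ?thesis by simp
 qed
 show "finite ((%i. i - mdeg L a) ` {i. c i ~= 0})" using c by (simp add: is_decomp_def)
 show "lookup (c (i + mdeg L a)) a = 0" if "i \<notin> (%i. i - mdeg L a) ` {i. c i ~= 0}" for i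
 proof -
  have "c (i + mdeg L a) = 0" using that by (force simp: image_iff)
  thus ?thesis by simp
 qed
 have "X = (\<Sum>i | c i ~= 0. c i)" using c by (simp add: is_decomp_def)
 hence "lookup X a = (\<Sum>i | c i ~= 0. lookup (c i) a)" by (metis lookup_sum)
 also have "\<dots> = (\<Sum>i\<in>(%i. i - mdeg L a) ` {i. c i ~= 0}. lookup (c (i + mdeg L a)) a)"
  by (subst sum.reindex) (auto simp: inj_on_def)
 finally show "lookup X a = \<dots>" .
qed

lemma graded_space_coch:
 assumes gs: "graded_space V"
 shows "graded_space (coch L V)"
 unfolding graded_space_def
proof (intro conjI allI impI)
 show "vector_space (scl (coch L V))" by (rule vector_space_coch[OF gs])
 hence m: "module (scl (coch L V))" by (simp add: module_iff_vector_space)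
 fix i
 show "module.subspace (scl (coch L V)) (gr (coch L V) i)"
 proof (rule module.subspaceI[OF m])
  fix x y c assume x: "x \<in> gr (coch L V) i"
  have "keys (scl (coch L V) c x) <= keys x"
   using module.scale_zero_right[OF graded_spaceD(2)[OF gs]]
   by (auto simp: in_keys_iff lookup_scl_coch[OF gs])
  thus "scl (coch L V) c x \<in> gr (coch L V) i"
   using x by (auto simp: gr_coch lookup_scl_coch[OF gs] gr_scl[OF gs])
  assume "y \<in> gr (coch L V) i"
  thus "x + y \<in> gr (coch L V) i"
   using x keys_subset_add[of x "mons L" y] by (simp add: gr_coch lookup_add gr_add[OF gs])
 qed (simp add: gr_coch gr_0[OF gs])
next
 fix X c c' assume c: "is_decomp (coch L V) X c" "is_decomp (coch L V) X c'"
 show "c = c'"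
 proof (intro ext poly_mapping_eqI)
  fix n a
  have "(%i. lookup (c (i + mdeg L a)) a) = (%i. lookup (c' (i + mdeg L a)) a)"
   using decomp_coch[OF gs c(1)] decomp_coch[OF gs c(2)] by (rule graded_spaceD(4)[OF gs])
  from fun_cong[OF this, of "n - mdeg L a"] show "lookup (c n) a = lookup (c' n) a" by simp
 qed
qed

lemma single_gr_coch:
 "graded_space V ==> a \<in> mons L ==> v \<in> gr V i ==> single a v \<in> gr (coch L V) (mdeg L a + i)"
 by (auto simp: gr_coch lookup_single when_def gr_0)

lemma single_sum: "single a (sum f A) = (\<Sum>i\<in>A. single a (f i))"
 by (rule poly_mapping_eqI) (simp add: lookup_sum lookup_single when_def)

lemma poly_mapping_sum_single: "X = (\<Sum>a\<in>keys X. single a (lookup X a))"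
proof (rule poly_mapping_eqI)
 fix b
 have "lookup (\<Sum>a\<in>keys X. single a (lookup X a)) b = (\<Sum>a\<in>keys X. if a = b then lookup X a else 0)"
  by (simp add: lookup_sum lookup_single when_def)
 also have "\<dots> = lookup X b" by (auto simp: in_keys_iff)
 finally show "lookup X b = lookup (\<Sum>a\<in>keys X. single a (lookup X a)) b" by simp
qed

lemma car_coch:
 assumes gs: "graded_space V"
 shows "carC L V = {X. keys X <= mons L \<and> (\<forall>a. lookup X a \<in> car V)}"
proof (intro equalityI subsetI)
 fix X assume "X \<in> carC L V"
 then obtain c where c: "is_decomp (coch L V) X c" by (auto simp: car_def)
 have "keys X <= mons L"
  using c unfolding is_decomp_def by (auto simp only: gr_coch intro!: keys_subset_sum)
 thus "X \<in> {X. keys X <= mons L \<and> (\<forall>a. lookup X a \<in> car V)}"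
  using decomp_coch[OF gs c] by (auto simp: car_def)
next
 note gc = graded_space_coch[OF gs]
 fix X assume O: "X \<in> {X. keys X <= mons L \<and> (\<forall>a. lookup X a \<in> car V)}"
 have "single a (lookup X a) \<in> carC L V" if a: "a \<in> keys X" for a
 proof -
  have "single a (lookup X a) = (\<Sum>i\<in>hsupp V (lookup X a). single a (hcomp V (lookup X a) i))"
   using hcomp_sum[OF gs, of "lookup X a"] O by (simp add: single_sum[symmetric])
  also have "\<dots> \<in> carC L V"
  proof (rule car_sum[OF gc])
   fix i
   have "a \<in> mons L" using O a by blast
   from single_gr_coch[OF gs this hcomp_gr_mem[OF gs]]
   show "single a (hcomp V (lookup X a) i) \<in> carC L V" by (rule gr_car[OF gc])
  qed
  finally show ?thesis .
 qed
 thus "X \<in> carC L V"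
  by (subst poly_mapping_sum_single) (rule car_sum[OF gc])
qed

section \<open>Homogeneous bases and coordinates of cochains\<close>

definition mdg :: "('k, 'v, 'z) gspace_scheme => 'v => int" where
 "mdg V b = (THE j. b \<in> gr V j)"

locale gbasis =
 fixes V :: "('k::real_normed_field, 'v::ab_group_add, 'z) gspace_scheme" and B :: "'v set"
 assumes gs: "graded_space V" and fin: "finite B" and hom_B: "B <= (\<Union>i. gr V i)"
  and ind: "\<not> module.dependent (scl V) B" and span_B: "module.span (scl V) B = car V"
begin

sublocale vs: vector_space "scl V" by (rule graded_spaceD(1)[OF gs])

lemma rp_add: "v \<in> car V ==> w \<in> car V ==> vs.representation B (v + w) b = vs.representation B v b + vs.representation B w b"
 by (simp add: vs.representation_add[OF ind] span_B)

lemma rp_scl: "v \<in> car V ==> vs.representation B (scl V c v) b = c * vs.representation B v b"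
 by (simp add: vs.representation_scale[OF ind] span_B)

lemma rp_0 [simp]: "vs.representation B 0 b = 0"
 by (simp add: vs.representation_zero)

lemma rp_bas: "b \<in> B ==> vs.representation B b c = (if c = b then 1 else 0)"
 by (simp add: vs.representation_basis[OF ind])

lemma rp_expand: "v \<in> car V ==> v = (\<Sum>b\<in>B. scl V (vs.representation B v b) b)"
 using vs.sum_representation_eq[OF ind _ fin subset_refl, of v] span_B by simp

lemma bas_nz: "b \<in> B ==> b ~= 0"
 using ind vs.dependent_zero by blast

lemma mdg_eq: "b \<in> B ==> b \<in> gr V j ==> mdg V b = j"
 unfolding mdg_def using gr_inter[OF gs] bas_nz by (intro the_equality) blast+

lemma bas_gr: "b \<in> B ==> b \<in> gr V (mdg V b)"
 using hom_B mdg_eq by blast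

lemma bas_car: "b \<in> B ==> b \<in> car V"
 using bas_gr by (rule gr_car[OF gs])

lemma comb_car: "(\<Sum>b\<in>B'. scl V (c b) b) \<in> car V" if "B' <= B"
 using that by (intro car_sum[OF gs] car_scl[OF gs] bas_car) blast

lemma rp_comb:
 assumes "b \<in> B"
 shows "vs.representation B (\<Sum>b\<in>B. scl V (c b) b) b = c b"
proof -
 have "vs.representation B (\<Sum>b\<in>B. scl V (c b) b) = (%b'. \<Sum>b\<in>B. vs.representation B (scl V (c b) b) b')"
  by (rule vs.representation_sum[OF ind]) (simp add: span_B car_scl[OF gs] bas_car)
 also have "\<dots> = (%b'. \<Sum>b\<in>B. c b * (if b' = b then 1 else 0))"
  by (intro ext sum.cong refl) (simp add: rp_scl bas_car rp_bas)
 finally show ?thesis using assms fin by (simp add: if_distrib cong: if_cong)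
qed

text \<open>Grouping the basis expansion of \<open>v\<close> by degree yields a homogeneous
  decomposition; by uniqueness its parts of degree other than \<open>i\<close> vanish.\<close>

lemma rp_gr:
 assumes v: "v \<in> gr V i" and b: "b \<in> B" and nz: "vs.representation B v b ~= 0"
 shows "mdg V b = i"
proof (rule ccontr)
 assume ne: "mdg V b ~= i"
 define r where "r = vs.representation B v"
 define c where "c = (%j. \<Sum>b | b \<in> B \<and> mdg V b = j. scl V (r b) b)"
 have "is_decomp V v c"
 proof (rule is_decompI[where F = "mdg V ` B"])
  show "c j \<in> gr V j" for j
   unfolding c_def using bas_gr by (intro gr_sum[OF gs] gr_scl[OF gs]) auto
  show "finite (mdg V ` B)" using fin by simp
  show "c j = 0" if "j \<notin> mdg V ` B" for j
  proof -
   have "{b. b \<in> B \<and> mdg V b = j} = {}" using that by blast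
   thus ?thesis unfolding c_def by (simp only: sum.empty)
  qed
  have "(\<Sum>j\<in>mdg V ` B. c j) = (\<Sum>b\<in>B. scl V (r b) b)"
   unfolding c_def using sum.image_gen[OF fin, of "%b. scl V (r b) b" "mdg V"] by simp
  thus "v = (\<Sum>j\<in>mdg V ` B. c j)"
   using rp_expand[OF gr_car[OF gs v]] by (simp add: r_def)
 qed
 hence "c (mdg V b) = 0"
  using graded_spaceD(4)[OF gs _ decomp_gr[OF gs v], of c] ne by simp
 hence "(\<Sum>b'\<in>B. scl V (if mdg V b' = mdg V b then r b' else 0) b') = 0"
  unfolding c_def using fin by (simp add: if_distrib[of "%c. scl V c _"] if_distribR sum.If_cases Int_def cong: if_cong)
 from arg_cong[OF this, of "%v. vs.representation B v b"]
 have "r b = 0" unfolding rp_comb[OF b] by simp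
 with nz show False by (simp add: r_def)
qed

end

definition hbas :: "('k::real_normed_field, 'v::ab_group_add, 'z) gspace_scheme => 'v set" where
 "hbas V = (SOME B. finite B \<and> B <= (\<Union>i. gr V i) \<and> \<not> module.dependent (scl V) B \<and> module.span (scl V) B = car V)"

text \<open>The degree is the one in V[1].\<close>

definition ltr :: "('k, 'v, 'z) gspace_scheme => 'v => 'v letter" where
 "ltr V b = Letter b (mdg V b - 1)"

definition crd :: "('k::real_normed_field, 'v::ab_group_add, 'z) gspace_scheme => 'v => 'v => 'k" where
 "crd V v b = module.representation (scl V) (hbas V) v b"

text \<open>\<open>emb\<close> identifies \<open>C(\<gg>, V[1])\<close> with the words of length 1 in the letters \<open>ltr V b\<close>.\<close>

definition emb :: "('k::real_normed_field, 'v::ab_group_add, 'z) gspace_scheme => 'v coc =>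
  ('v, 'k) walg" where
 "emb V X = (\<Sum>a\<in>keys X. \<Sum>b\<in>hbas V. single (a, [ltr V b]) (crd V (lookup X a) b))"

text \<open>Inverse to \<open>emb\<close> on its image. Words of any other form are ignored, so the
  length one part is taken implicitly, see \<open>prm_pr1\<close>.\<close>

definition prm :: "('k::real_normed_field, 'v::ab_group_add, 'z) gspace_scheme =>
  ('v, 'k) walg => 'v coc" where
 "prm V x = (\<Sum>a\<in>fst ` keys x. single a (\<Sum>b\<in>hbas V. scl V (lookup x (a, [ltr V b])) b))"

abbreviation "lel L V x \<equiv> keys x <= {(a, [ltr V b]) |a b. a \<in> mons L \<and> b \<in> hbas V}"

lemma lel_el: "lel L V x ==> el L x"
 by blast

lemma ltr_eq_iff [simp]: "ltr V b = ltr V c \<longleftrightarrow> b = c"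
 by (auto simp: ltr_def)

lemma gdeg_ltr [simp]: "gdeg (ltr V b) = mdg V b - 1"
 by (simp add: gdeg_letter_def ltr_def)

lemma lval_ltr [simp]: "lval (ltr V b) = b"
 by (simp add: ltr_def)

lemma sum_keys_superset:
 assumes "!!a. h a 0 = 0" "finite S" "keys X <= S"
 shows "(\<Sum>a\<in>keys X. h a (lookup X a)) = (\<Sum>a\<in>S. h a (lookup X a))"
 using assms by (intro sum.mono_neutral_left) (auto simp: in_keys_iff)

lemma sum_keys_add:
 assumes 0: "!!a. h a 0 = (0 :: 'z::comm_monoid_add)"
  and add: "!!a. h a (lookup X a + lookup Y a) = h a (lookup X a) + h a (lookup Y a)"
 shows "(\<Sum>a\<in>keys (X + Y). h a (lookup (X + Y) a)) =
  (\<Sum>a\<in>keys X. h a (lookup X a)) + (\<Sum>a\<in>keys Y. h a (lookup Y a))"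
proof -
 let ?S = "keys X \<union> keys Y"
 have "keys (X + Y) <= ?S" by (rule Poly_Mapping.keys_add)
 hence "(\<Sum>a\<in>keys (X + Y). h a (lookup (X + Y) a)) = (\<Sum>a\<in>?S. h a (lookup (X + Y) a))"
  by (intro sum_keys_superset 0) simp_all
 also have "\<dots> = (\<Sum>a\<in>?S. h a (lookup X a)) + (\<Sum>a\<in>?S. h a (lookup Y a))"
  by (simp add: lookup_add add sum.distrib)
 also have "(\<Sum>a\<in>?S. h a (lookup X a)) = (\<Sum>a\<in>keys X. h a (lookup X a))"
  by (rule sum_keys_superset[symmetric]) (simp_all add: 0)
 also have "(\<Sum>a\<in>?S. h a (lookup Y a)) = (\<Sum>a\<in>keys Y. h a (lookup Y a))"
  by (rule sum_keys_superset[symmetric]) (simp_all add: 0)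
 finally show ?thesis .
qed

locale cspace =
 fixes L :: "('k::real_normed_field, 'g) dgla" and V :: "('k, 'v::ab_group_add, 'z) gspace_scheme"
 assumes gs_V: "graded_space V" and fd_V: "fin_dim V"
begin

sublocale gbasis V "hbas V"
proof -
 have "\<exists>B. finite B \<and> B <= (\<Union>i. gr V i) \<and> \<not> module.dependent (scl V) B \<and> module.span (scl V) B = car V"
  using homogeneous_basis[OF gs_V fd_V] by metis
 from someI_ex[OF this] show "gbasis V (hbas V)"
  unfolding hbas_def[symmetric] by unfold_locales (use gs_V in simp_all)
qed

lemma crd_rp: "vs.representation (hbas V) v b = crd V v b"
 by (simp add: crd_def)

lemmas crd_add = rp_add[unfolded crd_rp] and crd_scl = rp_scl[unfolded crd_rp] and crd_0 = rp_0[unfolded crd_rp]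
 and crd_bas = rp_bas[unfolded crd_rp] and crd_expand = rp_expand[unfolded crd_rp]
 and crd_comb = rp_comb[unfolded crd_rp] and crd_gr = rp_gr[unfolded crd_rp]

declare crd_0 [simp]

lemma lookup_emb:
 "lookup (emb V X) (a, w) = (if \<exists>b\<in>hbas V. w = [ltr V b] then crd V (lookup X a) (lval (hd w)) else 0)"
proof -
 have "lookup (emb V X) (a, w) = (\<Sum>a'\<in>keys X. \<Sum>b\<in>hbas V. if a' = a \<and> [ltr V b] = w then crd V (lookup X a') b else 0)"
  by (simp add: emb_def lookup_sum lookup_single when_def)
 also have "\<dots> = (\<Sum>a'\<in>keys X. if a' = a then (if \<exists>b\<in>hbas V. w = [ltr V b] then crd V (lookup X a) (lval (hd w)) else 0) else 0)"
 proof (rule sum.cong[OF refl])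
  fix a'
  show "(\<Sum>b\<in>hbas V. if a' = a \<and> [ltr V b] = w then crd V (lookup X a') b else 0) =
   (if a' = a then (if \<exists>b\<in>hbas V. w = [ltr V b] then crd V (lookup X a) (lval (hd w)) else 0) else 0)"
  proof (cases "\<exists>b\<in>hbas V. w = [ltr V b]")
   case True
   then obtain b where b: "b \<in> hbas V" "w = [ltr V b]" by blast
   thus ?thesis using fin by (simp add: if_distrib cong: if_cong)
  qed (auto intro!: sum.neutral)
 qed
 also have "\<dots> = (if \<exists>b\<in>hbas V. w = [ltr V b] then crd V (lookup X a) (lval (hd w)) else 0)"
  by (auto simp: in_keys_iff)
 finally show ?thesis .
qed

lemma lookup_emb_ltr: "b \<in> hbas V ==> lookup (emb V X) (a, [ltr V b]) = crd V (lookup X a) b"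
 by (simp add: lookup_emb)

lemma keys_emb: "keys (emb V X) <= {(a, [ltr V b]) |a b. a \<in> keys X \<and> b \<in> hbas V}"
 by (auto simp: in_keys_iff lookup_emb split: if_splits)

lemma lookup_prm: "lookup (prm V x) a = (\<Sum>b\<in>hbas V. scl V (lookup x (a, [ltr V b])) b)"
proof -
 have "lookup (prm V x) a = (\<Sum>a'\<in>fst ` keys x. if a' = a then (\<Sum>b\<in>hbas V. scl V (lookup x (a', [ltr V b])) b) else 0)"
  by (simp add: prm_def lookup_sum lookup_single when_def)
 also have "\<dots> = (if a \<in> fst ` keys x then (\<Sum>b\<in>hbas V. scl V (lookup x (a, [ltr V b])) b) else 0)"
  by simp
 also have "\<dots> = (\<Sum>b\<in>hbas V. scl V (lookup x (a, [ltr V b])) b)"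
 proof (cases "a \<in> fst ` keys x")
  case False
  hence "lookup x (a, w) = 0" for w by (force simp: in_keys_iff image_iff)
  thus ?thesis using False by simp
 qed simp
 finally show ?thesis .
qed

lemma prm_add: "prm V (x + y) = prm V x + prm V y"
 by (rule poly_mapping_eqI) (simp add: lookup_prm lookup_add vs.scale_left_distrib sum.distrib)

lemma prm_sc: "prm V (sc c x) = scl (coch L V) c (prm V x)"
 by (rule poly_mapping_eqI) (simp add: lookup_prm lookup_scl_coch[OF gs_V] vs.scale_sum_right)

lemma prm_0 [simp]: "prm V 0 = 0"
 by (simp add: prm_def)

lemma prm_sum: "prm V (sum f A) = (\<Sum>i\<in>A. prm V (f i))"
 by (induction A rule: infinite_finite_induct) (simp_all add: prm_add)

lemmas gs_C = graded_space_coch[OF gs_V, of L]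
lemmas car_C = car_coch[OF gs_V, of L]

lemma prm_car: "rc L x ==> prm V x \<in> carC L V"
proof -
 assume "rc L x"
 hence "keys (prm V x) <= mons L"
  unfolding prm_def by (intro keys_subset_sum) (auto simp: keys_single)
 thus ?thesis unfolding car_C using comb_car[OF subset_refl] by (auto simp: lookup_prm)
qed

lemma lel_emb: "X \<in> carC L V ==> lel L V (emb V X)"
 using keys_emb[of X] unfolding car_C by blast

lemma prm_emb: "X \<in> carC L V ==> prm V (emb V X) = X"
proof (rule poly_mapping_eqI)
 fix a assume "X \<in> carC L V"
 hence "lookup X a \<in> car V" by (simp add: car_C)
 from crd_expand[OF this] show "lookup (prm V (emb V X)) a = lookup X a"
  by (simp add: lookup_prm lookup_emb_ltr)
qed

lemma emb_prm: "lel L V x ==> emb V (prm V x) = x"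
proof (rule poly_mapping_eqI)
 fix p :: "mono \<times> 'v letter list" assume x: "lel L V x"
 obtain a w where p: "p = (a, w)" by force
 show "lookup (emb V (prm V x)) p = lookup x p"
 proof (cases "\<exists>b\<in>hbas V. w = [ltr V b]")
  case True
  then obtain b where "b \<in> hbas V" "w = [ltr V b]" by blast
  thus ?thesis by (simp add: p lookup_emb lookup_prm crd_comb)
 next
  case False
  hence "(a, w) \<notin> keys x" using x by auto
  thus ?thesis using False by (simp add: p lookup_emb in_keys_iff)
 qed
qed

lemma emb_add: "X \<in> carC L V ==> Y \<in> carC L V ==> emb V (X + Y) = emb V X + emb V Y"
proof (rule poly_mapping_eqI)
 fix p :: "mono \<times> 'v letter list" assume "X \<in> carC L V" "Y \<in> carC L V"
 thus "lookup (emb V (X + Y)) p = lookup (emb V X + emb V Y) p"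
  by (cases p) (simp add: lookup_emb lookup_add crd_add car_C)
qed

lemma emb_scl: "X \<in> carC L V ==> emb V (scl (coch L V) c X) = sc c (emb V X)"
proof (rule poly_mapping_eqI)
 fix p :: "mono \<times> 'v letter list" assume "X \<in> carC L V"
 thus "lookup (emb V (scl (coch L V) c X)) p = lookup (sc c (emb V X)) p"
  by (cases p) (simp add: lookup_emb lookup_scl_coch[OF gs_V] crd_scl car_C)
qed

lemma emb_0 [simp]: "emb V 0 = 0"
 by (simp add: emb_def)

lemma emb_sum: "(!!i. i \<in> A ==> f i \<in> carC L V) ==> emb V (sum f A) = (\<Sum>i\<in>A. emb V (f i))"
proof (induction A rule: infinite_finite_induct)
 case (insert i A)
 have "emb V (f i + sum f A) = emb V (f i) + emb V (sum f A)"
  by (rule emb_add) (use insert in \<open>auto intro: car_sum[OF gs_C]\<close>)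
 with insert show ?case by simp
qed simp_all

lemma single_car: "a \<in> mons L ==> v \<in> car V ==> single a v \<in> carC L V"
 by (auto simp: car_C lookup_single when_def car_0[OF gs_V])

lemma scl_single: "scl (coch L V) c (single a v) = single a (scl V c v)"
 by (rule poly_mapping_eqI) (simp add: lookup_scl_coch[OF gs_V] lookup_single when_def)

lemma emb_single_bas: "b \<in> hbas V ==> emb V (single a b) = bs (a, [ltr V b])"
proof (rule poly_mapping_eqI)
 fix p :: "mono \<times> 'v letter list" assume b: "b \<in> hbas V"
 obtain a' w where p: "p = (a', w)" by force
 show "lookup (emb V (single a b)) p = lookup (bs (a, [ltr V b])) p"
  using b by (auto simp: p lookup_emb lookup_single when_def lookup_bs crd_bas)
qed

text \<open>The grading of the right hand side is that of \<open>V[1]\<close>.\<close>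

lemma gr_emb:
 "X \<in> gr (coch L (shift 1 V)) n \<longleftrightarrow> X \<in> carC L V \<and> hom L n (emb V X)"
proof
 assume O: "X \<in> gr (coch L (shift 1 V)) n"
 have "lookup X a \<in> car V" for a
  using O gr_car[OF gs_V] unfolding gr_coch by simp blast
 moreover have "keys X <= mons L" using O unfolding gr_coch by blast
 ultimately have c: "X \<in> carC L V" unfolding car_C by blast
 moreover have "hom L n (emb V X)"
 proof
  fix p assume p: "p \<in> keys (emb V X)"
  then obtain a b where ab: "p = (a, [ltr V b])" "b \<in> hbas V" using keys_emb by blast
  with p have "crd V (lookup X a) b ~= 0" by (simp add: in_keys_iff lookup_emb_ltr)
  moreover have "lookup X a \<in> gr V (n - mdeg L a + 1)" using O unfolding gr_coch by simp
  ultimately have "mdg V b = n - mdeg L a + 1" using crd_gr ab(2) by blast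
  thus "p \<in> {b. bdeg L b = n}" by (simp add: ab(1) wdeg_list_def)
 qed
 ultimately show "X \<in> carC L V \<and> hom L n (emb V X)" by blast
next
 assume "X \<in> carC L V \<and> hom L n (emb V X)"
 hence c: "X \<in> carC L V" and h: "hom L n (emb V X)" by blast+
 have "lookup X a \<in> gr V (n - mdeg L a + 1)" for a
 proof -
  have "lookup X a = (\<Sum>b\<in>hbas V. scl V (crd V (lookup X a) b) b)"
   using c by (intro crd_expand) (simp add: car_C)
  also have "\<dots> \<in> gr V (n - mdeg L a + 1)"
  proof (rule gr_sum[OF gs_V])
   fix b assume b: "b \<in> hbas V"
   show "scl V (crd V (lookup X a) b) b \<in> gr V (n - mdeg L a + 1)"
   proof (cases "crd V (lookup X a) b = 0")
    case False
    hence "(a, [ltr V b]) \<in> keys (emb V X)" using b by (simp add: in_keys_iff lookup_emb_ltr)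
    hence "bdeg L (a, [ltr V b]) = n" using h by blast
    hence "mdg V b = n - mdeg L a + 1" by (simp add: wdeg_list_def)
    thus ?thesis using gr_scl[OF gs_V bas_gr[OF b]] by metis
   qed (simp add: gr_0[OF gs_V])
  qed
  finally show ?thesis .
 qed
 with c show "X \<in> gr (coch L (shift 1 V)) n" by (simp add: gr_coch car_C)
qed

lemma car_C1 [simp]: "car (coch L (shift 1 V)) = carC L V"
 by (simp add: car_C car_coch[OF graded_space_shift[OF gs_V]])

lemma scl_C1 [simp]: "scl (coch L (shift p V)) = scl (coch L V)"
 by (simp add: scl_coch fun_eq_iff)

text \<open>Linearity is required on the carrier only, because that is where \<open>emb\<close> is
  linear; the values at x^a \<otimes> b with basis vectors b then decide.\<close>

lemma coch_eqI:
 fixes f g :: "'v coc => ('w \<Rightarrow>\<^sub>0 'k)"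
 assumes f: "!!x y. x \<in> carC L V ==> y \<in> carC L V ==> f (x + y) = f x + f y"
   "!!c x. x \<in> carC L V ==> f (scl (coch L V) c x) = sc c (f x)"
  and g: "!!x y. x \<in> carC L V ==> y \<in> carC L V ==> g (x + y) = g x + g y"
   "!!c x. x \<in> carC L V ==> g (scl (coch L V) c x) = sc c (g x)"
  and eq: "!!a b. a \<in> mons L ==> b \<in> hbas V ==> f (single a b) = g (single a b)"
  and O: "X \<in> carC L V"
 shows "f X = g X"
proof -
 have fg: "f (sum h A) = g (sum h A)"
  if "finite A" "!!i. i \<in> A ==> h i \<in> carC L V \<and> f (h i) = g (h i)" for h and A :: "'i set"
  using that
 proof (induction A rule: finite_induct)
  case empty
  have "f 0 = 0" "g 0 = 0" using f(1)[of 0 0] g(1)[of 0 0] car_0[OF gs_C] by simp_all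
  thus ?case by simp
 next
  case (insert i A)
  have "sum h A \<in> carC L V" using insert by (intro car_sum[OF gs_C]) blast
  with insert show ?case by (simp add: f(1) g(1))
 qed
 have 1: "single a v \<in> carC L V \<and> f (single a v) = g (single a v)" if a: "a \<in> mons L" and v: "v \<in> car V" for a v
 proof -
  have "single a v = (\<Sum>b\<in>hbas V. scl (coch L V) (crd V v b) (single a b))"
   by (subst crd_expand[OF v]) (simp add: single_sum scl_single)
  moreover have "f (\<Sum>b\<in>hbas V. scl (coch L V) (crd V v b) (single a b)) = g (\<Sum>b\<in>hbas V. scl (coch L V) (crd V v b) (single a b))"
   using a by (intro fg[OF fin]) (simp add: single_car car_scl[OF gs_C] bas_car f(2) g(2) eq)
  ultimately show ?thesis using single_car[OF a v] by simp
 qed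
 have "f (\<Sum>a\<in>keys X. single a (lookup X a)) = g (\<Sum>a\<in>keys X. single a (lookup X a))"
  by (intro fg finite_keys 1) (use O in \<open>auto simp: car_C\<close>)
 thus ?thesis by (simp add: poly_mapping_sum_single[symmetric])
qed

lemma cmul_alt: "cmul L V u X = (\<Sum>a\<in>keys u. \<Sum>b\<in>keys X.
  single (a + b) (scl V (mcoef L a b * lookup u a) (lookup X b)))"
 unfolding cmul_def mcoef_def by (intro sum.cong refl) simp

lemma cmul_shift [simp]: "cmul L (shift p V) = cmul L V"
 by (simp add: cmul_def fun_eq_iff cong: if_cong)

lemma cmul_car: "X \<in> carC L V ==> cmul L V a X \<in> carC L V"
 unfolding cmul_def
 by (intro car_sum[OF gs_C])
  (simp add: car_0[OF gs_C], simp add: car_C car_0[OF gs_V] lookup_single when_def car_scl[OF gs_V])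

lemma cmul_add_right: "cmul L V u (X + Y) = cmul L V u X + cmul L V u Y"
proof -
 have "(\<Sum>b\<in>keys (X + Y). single (a + b) (scl V (mcoef L a b * lookup u a) (lookup (X + Y) b))) =
   (\<Sum>b\<in>keys X. single (a + b) (scl V (mcoef L a b * lookup u a) (lookup X b))) +
   (\<Sum>b\<in>keys Y. single (a + b) (scl V (mcoef L a b * lookup u a) (lookup Y b)))" for a
  by (rule sum_keys_add) (simp_all add: vs.scale_right_distrib single_add)
 thus ?thesis by (simp add: cmul_alt sum.distrib)
qed

lemma cmul_add_left: "cmul L V (a + b) X = cmul L V a X + cmul L V b X"
 unfolding cmul_alt
 by (rule sum_keys_add) (simp_all add: algebra_simps vs.scale_left_distrib single_add sum.distrib)

lemma cmul_scl_right: "cmul L V u (scl (coch L V) c X) = scl (coch L V) c (cmul L V u X)"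
proof -
 have k: "keys (scl (coch L V) c X) <= keys X" by (auto simp: in_keys_iff lookup_scl_coch[OF gs_V])
 have "(\<Sum>b\<in>keys (scl (coch L V) c X). single (a + b) (scl V (mcoef L a b * lookup u a) (lookup (scl (coch L V) c X) b))) =
   (\<Sum>b\<in>keys X. single (a + b) (scl V (mcoef L a b * lookup u a) (lookup (scl (coch L V) c X) b)))" for a
  by (rule sum_keys_superset[OF _ _ k]) simp_all
 thus ?thesis
  unfolding cmul_alt by (simp add: module.scale_sum_right[OF graded_spaceD(2)[OF gs_C]] scl_single lookup_scl_coch[OF gs_V] mult_ac)
qed

lemma cmul_scl_left: "cmul L V (sc c u) X = scl (coch L V) c (cmul L V u X)"
proof -
 have "cmul L V (sc c u) X = (\<Sum>a\<in>keys u. \<Sum>b\<in>keys X.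
  single (a + b) (scl V (mcoef L a b * lookup (sc c u) a) (lookup X b)))"
  unfolding cmul_alt by (rule sum_keys_superset[OF _ _ keys_sc]) simp_all
 also have "\<dots> = scl (coch L V) c (cmul L V u X)"
  unfolding cmul_alt by (simp add: module.scale_sum_right[OF graded_spaceD(2)[OF gs_C]] scl_single mult_ac)
 finally show ?thesis .
qed

lemma emb_cmul:
 assumes O: "X \<in> carC L V"
 shows "emb V (cmul L V u X) = sm L u (emb V X)"
proof (rule coch_eqI[OF _ _ _ _ _ O])
 fix c b assume c: "c \<in> mons L" and b: "b \<in> hbas V"
 hence cb: "single c b \<in> carC L V" by (simp add: single_car bas_car)
 show "emb V (cmul L V u (single c b)) = sm L u (emb V (single c b))"
 proof (rule klin_eqI[of "%u. emb V (cmul L V u (single c b))"])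
  show "klin (%u. emb V (cmul L V u (single c b)))"
   by (rule klinI) (simp_all add: cmul_add_left cmul_scl_left emb_add emb_scl cmul_car cb)
  show "klin (%u. sm L u (emb V (single c b)))" by (intro klin_intros)
  fix a
  have "cmul L V (bs a) (single c b) = scl (coch L V) (mcoef L a c) (single (a + c) b)"
   using bas_nz[OF b] by (simp add: cmul_alt bs_def scl_single)
  moreover have "emb V (scl (coch L V) (mcoef L a c) (single (a + c) b)) = sc (mcoef L a c) (emb V (single (a + c) b))"
  proof (cases "a + c \<in> mons L")
   case True
   thus ?thesis using b by (intro emb_scl single_car bas_car)
  qed (simp add: mcoef_def scl_single)
  ultimately show "emb V (cmul L V (bs a) (single c b)) = sm L (bs a) (emb V (single c b))"
   using b by (simp add: emb_single_bas inA_bs prd_bs wone_list_def wmul_list_def wsgn_list_def)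
 qed
qed (simp_all add: cmul_add_right cmul_scl_right emb_add emb_scl cmul_car prd_add_right prd_sc_right)

lemma cmul_prm: "X \<in> carC L V ==> cmul L V a X = prm V (sm L a (emb V X))"
 using prm_emb[OF cmul_car] emb_cmul by metis

lemma emb_inj: "X \<in> carC L V ==> Y \<in> carC L V ==> emb V X = emb V Y ==> X = Y"
 using prm_emb by metis

end

declare One_nat_def [simp del]

section \<open>Infinity-modules as letter data\<close>

subsection \<open>Cochain families\<close>

locale cfam = M: cspace L M + N: cspace L N
 for L :: "('k::real_normed_field, 'g) dgla" and M :: "('k, 'm::ab_group_add, 'y) gspace_scheme"
  and N :: "('k, 'n::ab_group_add, 'z) gspace_scheme" +
 fixes p :: int and f :: "nat => 'm => 'n coc"
 assumes fam: "cochain_family L M N p f"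
begin

lemma f_add: "x \<in> car M ==> y \<in> car M ==> f k (x + y) = f k x + f k y"
 and f_scl: "x \<in> car M ==> f k (scl M c x) = scl (coch L N) c (f k x)"
 and f_gr: "x \<in> gr M i ==> f k x \<in> gr (coch L N) (i + p)"
 and f_arity: "x \<in> car M ==> has_arity k (f k x)"
 and f_fin: "x \<in> car M ==> \<exists>K. \<forall>k\<ge>K. f k x = 0"
 using fam by (simp_all add: cochain_family_def linear_deg_def)

text \<open>\<open>tot\<close> sums over a support that varies with the argument. Sums up to an
  arbitrary large bound can be compared for different arguments.\<close>

lemma f_supp: "x \<in> car M ==> \<exists>K. \<forall>K'\<ge>K. tot f x = (\<Sum>k<K'. f k x)"
proof -
 assume "x \<in> car M"
 then obtain K where K: "\<forall>k\<ge>K. f k x = 0" using f_fin by blast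
 have "tot f x = (\<Sum>k<K'. f k x)" if "K' \<ge> K" for K'
  unfolding tot_def
 proof (rule sum.mono_neutral_left)
  show "{k. f k x ~= 0} <= {..<K'}"
  proof
   fix k assume "k \<in> {k. f k x ~= 0}"
   hence "\<not> K \<le> k" using K by blast
   thus "k \<in> {..<K'}" using that by simp
  qed
 qed auto
 thus ?thesis by blast
qed

lemma tot_add: "x \<in> car M ==> y \<in> car M ==> tot f (x + y) = tot f x + tot f y"
proof -
 assume x: "x \<in> car M" and y: "y \<in> car M"
 obtain K1 K2 K3 where K: "\<forall>K'\<ge>K1. tot f x = (\<Sum>k<K'. f k x)" "\<forall>K'\<ge>K2. tot f y = (\<Sum>k<K'. f k y)"
  "\<forall>K'\<ge>K3. tot f (x + y) = (\<Sum>k<K'. f k (x + y))"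
  using f_supp[OF x] f_supp[OF y] f_supp[OF car_add[OF M.gs_V x y]] by metis
 let ?K = "max K1 (max K2 K3)"
 have "tot f x = (\<Sum>k<?K. f k x)" "tot f y = (\<Sum>k<?K. f k y)" "tot f (x + y) = (\<Sum>k<?K. f k (x + y))"
  using K by simp_all
 thus ?thesis by (simp add: f_add x y sum.distrib)
qed

lemma tot_scl: "x \<in> car M ==> tot f (scl M c x) = scl (coch L N) c (tot f x)"
proof -
 assume x: "x \<in> car M"
 obtain K1 K2 where K: "\<forall>K'\<ge>K1. tot f x = (\<Sum>k<K'. f k x)"
  "\<forall>K'\<ge>K2. tot f (scl M c x) = (\<Sum>k<K'. f k (scl M c x))"
  using f_supp[OF x] f_supp[OF car_scl[OF M.gs_V x]] by metis
 have "tot f x = (\<Sum>k<max K1 K2. f k x)" "tot f (scl M c x) = (\<Sum>k<max K1 K2. f k (scl M c x))"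
  using K by simp_all
 thus ?thesis by (simp add: f_scl x module.scale_sum_right[OF graded_spaceD(2)[OF N.gs_C]])
qed

lemma tot_0 [simp]: "tot f 0 = 0"
 using tot_add[of 0 0] car_0[OF M.gs_V] by simp

lemma tot_gr: "x \<in> gr M i ==> tot f x \<in> gr (coch L N) (i + p)"
 unfolding tot_def by (intro gr_sum[OF N.gs_C] f_gr)

text \<open>The degree condition speaks of homogeneous arguments; a general one is expanded in the
  homogeneous basis.\<close>

lemma tot_car: "x \<in> car M ==> tot f x \<in> carC L N"
proof -
 assume x: "x \<in> car M"
 have "tot f (\<Sum>b\<in>A. scl M (crd M x b) b) \<in> carC L N" if "A <= hbas M" for A
  using finite_subset[OF that M.fin] that
 proof (induction A rule: finite_induct)
  case empty
  thus ?case by (simp add: car_0[OF N.gs_C])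
 next
  case (insert b A)
  hence b: "b \<in> hbas M" and A: "A <= hbas M" by blast+
  have "tot f (scl M (crd M x b) b) \<in> carC L N"
   using gr_car[OF N.gs_C tot_gr[OF gr_scl[OF M.gs_V M.bas_gr[OF b]]]] .
  moreover have "tot f (\<Sum>b\<in>insert b A. scl M (crd M x b) b) =
    tot f (scl M (crd M x b) b) + tot f (\<Sum>b\<in>A. scl M (crd M x b) b)"
   using insert(1,2) A b by (simp add: tot_add M.comb_car car_scl[OF M.gs_V] M.bas_car)
  ultimately show ?case using insert.IH[OF A] by (simp add: car_add[OF N.gs_C])
 qed
 from this[OF subset_refl] show ?thesis using M.crd_expand[OF x] by metis
qed

end

abbreviation "lin_adj L \<equiv> lin_ext L (adjoint L)"

lemma lin_ext_alt: "lin_ext L N f X = (\<Sum>a\<in>keys X. cmul L N (bs a) (tot f (lookup X a)))"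
 by (simp add: lin_ext_def bs_def)

locale imap = cfam L M N p f
 for L :: "('k::real_normed_field, 'g) dgla" and M :: "('k, 'm::ab_group_add, 'y) gspace_scheme"
  and N :: "('k, 'n::ab_group_add) infmod" and p and f
begin

lemma lin_ext_add:
 "X \<in> carC L M ==> Y \<in> carC L M ==> lin_ext L N f (X + Y) = lin_ext L N f X + lin_ext L N f Y"
 unfolding lin_ext_alt
proof (rule sum_keys_add)
 show "cmul L N (bs a) (tot f 0) = 0" for a by (simp add: cmul_def)
qed (simp add: M.car_C tot_add N.cmul_add_right)

lemma lin_ext_scl:
 "X \<in> carC L M ==> lin_ext L N f (scl (coch L M) c X) = scl (coch L N) c (lin_ext L N f X)"
proof -
 assume O: "X \<in> carC L M"
 have k: "keys (scl (coch L M) c X) <= keys X" by (auto simp: in_keys_iff lookup_scl_coch[OF M.gs_V])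
 have "lin_ext L N f (scl (coch L M) c X) = (\<Sum>a\<in>keys X. cmul L N (bs a) (tot f (lookup (scl (coch L M) c X) a)))"
  unfolding lin_ext_alt by (rule sum_keys_superset[OF _ _ k]) (simp_all add: cmul_def)
 also have "\<dots> = scl (coch L N) c (lin_ext L N f X)"
  using O unfolding lin_ext_alt
  by (simp add: module.scale_sum_right[OF graded_spaceD(2)[OF N.gs_C]] lookup_scl_coch[OF M.gs_V] tot_scl M.car_C N.cmul_scl_right)
 finally show ?thesis .
qed

lemma lin_ext_car: "X \<in> carC L M ==> lin_ext L N f X \<in> carC L N"
 unfolding lin_ext_alt by (intro car_sum[OF N.gs_C] N.cmul_car tot_car) (simp add: M.car_C)

lemma lin_ext_single: "v \<in> car M ==> lin_ext L N f (single a v) = cmul L N (bs a) (tot f v)"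
 by (cases "v = 0") (simp add: lin_ext_alt cmul_def, simp add: lin_ext_alt)

lemma emb_lin_ext_single:
 "v \<in> car M ==> emb N (lin_ext L N f (single a v)) = sm L (bs a) (emb N (tot f v))"
 by (simp add: lin_ext_single N.emb_cmul tot_car)

lemma lin_ext_0 [simp]: "lin_ext L N f 0 = 0"
 by (simp add: lin_ext_def)

lemma emb_lin_ext_add:
 "X \<in> carC L M ==> Y \<in> carC L M ==>
  emb N (lin_ext L N f (X + Y)) = emb N (lin_ext L N f X) + emb N (lin_ext L N f Y)"
 by (simp add: lin_ext_add N.emb_add lin_ext_car)

lemma emb_lin_ext_scl:
 "X \<in> carC L M ==> emb N (lin_ext L N f (scl (coch L M) c X)) = sc c (emb N (lin_ext L N f X))"
 by (simp add: lin_ext_scl N.emb_scl lin_ext_car)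

end

subsection \<open>Contractions\<close>

text \<open>The components of contraction with \<open>b[1]\<close>, regarded as a vector field on
  C(g); see \<open>emb_contr_coch\<close>.\<close>

definition cmp :: "('k::real_normed_field, 'g::ab_group_add) dgla => 'g coc => nat => 'k coc" where
 "cmp L b i = (\<Sum>c\<in>keys b. single c (coord L i (lookup b c)))"

context cspace
begin

lemma contr_bas_alt: "contr_bas L V i X = (\<Sum>a\<in>keys X. single (a - single i 1) (scl V (pdc L i a) (lookup X a)))"
 by (simp add: contr_bas_def pdc_def pre_def)

lemma contr_bas_car: "X \<in> carC L V ==> contr_bas L V i X \<in> carC L V"
 unfolding contr_bas_alt
 by (intro car_sum[OF gs_C] single_car minus_single_mons car_scl[OF gs_V]) (auto simp: car_C)

lemma contr_bas_add: "contr_bas L V i (X + Y) = contr_bas L V i X + contr_bas L V i Y"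
 unfolding contr_bas_alt by (rule sum_keys_add) (simp_all add: vs.scale_right_distrib single_add)

lemma contr_bas_scl: "contr_bas L V i (scl (coch L V) c X) = scl (coch L V) c (contr_bas L V i X)"
proof -
 have k: "keys (scl (coch L V) c X) <= keys X" by (auto simp: in_keys_iff lookup_scl_coch[OF gs_V])
 have "contr_bas L V i (scl (coch L V) c X) =
   (\<Sum>a\<in>keys X. single (a - single i 1) (scl V (pdc L i a) (lookup (scl (coch L V) c X) a)))"
  unfolding contr_bas_alt by (rule sum_keys_superset[OF _ _ k]) simp_all
 also have "\<dots> = scl (coch L V) c (contr_bas L V i X)"
  unfolding contr_bas_alt
  by (simp add: module.scale_sum_right[OF graded_spaceD(2)[OF gs_C]] scl_single lookup_scl_coch[OF gs_V] mult_ac)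
 finally show ?thesis .
qed

lemma emb_contr_bas: "X \<in> carC L V ==> emb V (contr_bas L V i X) = pd L i (emb V X)"
proof (rule coch_eqI)
 fix a b assume a: "a \<in> mons L" and b: "b \<in> hbas V"
 have "contr_bas L V i (single a b) = scl (coch L V) (pdc L i a) (single (a - single i 1) b)"
  using bas_nz[OF b] by (simp add: contr_bas_alt scl_single)
 thus "emb V (contr_bas L V i (single a b)) = pd L i (emb V (single a b))"
  using a b by (simp add: emb_scl single_car minus_single_mons bas_car emb_single_bas pd_bs)
qed (simp_all add: contr_bas_add contr_bas_scl contr_bas_car emb_add emb_scl pd_add pd_sc)

end

lemma (in cspace) contr_car:
 fixes L' :: "('k, 'h::ab_group_add) dgla"
 shows "X \<in> carC L' V ==> contr L' V x X \<in> carC L' V"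
proof -
 interpret c: cspace L' V by unfold_locales (rule gs_V fd_V)+
 show "X \<in> carC L' V ==> contr L' V x X \<in> carC L' V"
  unfolding contr_def by (intro car_sum[OF c.gs_C] car_scl[OF c.gs_C] c.contr_bas_car)
qed

locale gspace_over = cspace L V
 for L :: "('k::real_normed_field, 'g::ab_group_add) dgla" and V :: "('k, 'v::ab_group_add, 'z) gspace_scheme"
begin

lemma contr_coch_car: "X \<in> carC L V ==> contr_coch L V b X \<in> carC L V"
 unfolding contr_coch_def by (intro car_sum[OF gs_C] cmul_car contr_car)

lemma emb_contr:
 "X \<in> carC L V ==> emb V (contr L V x X) = (\<Sum>i<ldim L. sc (coord L i x) (pd L i (emb V X)))"
 unfolding contr_def
 by (subst emb_sum) (simp_all add: car_scl[OF gs_C] contr_bas_car emb_scl emb_contr_bas)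

lemma emb_contr_coch:
 assumes O: "X \<in> carC L V"
 shows "emb V (contr_coch L V b X) = vf L (cmp L b) (emb V X)"
proof -
 have "emb V (contr_coch L V b X) =
   (\<Sum>c\<in>keys b. sm L (bs c) (\<Sum>i<ldim L. sc (coord L i (lookup b c)) (pd L i (emb V X))))"
  unfolding contr_coch_def using O
  by (subst emb_sum) (simp_all add: cmul_car contr_car emb_cmul emb_contr bs_def[symmetric])
 also have "\<dots> = (\<Sum>c\<in>keys b. \<Sum>i<ldim L. sm L (single c (coord L i (lookup b c))) (pd L i (emb V X)))"
  by (simp add: prd_sum_right prd_sc_right single_bs[of _ "coord L _ _"] inA_sc prd_sc_left)
 also have "\<dots> = vf L (cmp L b) (emb V X)"
  unfolding vf_def cmp_def by (subst sum.swap) (simp add: inA_sum prd_sum_left)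
 finally show ?thesis .
qed

end

subsection \<open>The adjoint module\<close>

text \<open>The components of d_CE, regarded as a vector field on C(g).\<close>

definition dgn :: "('k::real_normed_field, 'g::ab_group_add) dgla => nat => 'k coc" where
 "dgn L k = d0_gen L k + d1_gen L k"

lemma d_CE_vfA: "d_CE L = vfA L (dgn L)"
 by (simp add: fun_eq_iff d_CE_def vfA_def dgn_def)

lemma inA_d_CE: "inA (d_CE L a) = vf L (dgn L) (inA a)"
 by (simp add: d_CE_vfA inA_vfA)

lemma inA_inject: "inA x = (inA y :: ('m, 'k::real_normed_field) walg) ==> x = y"
proof -
 have l: "lookup (inA x :: ('m, 'k) walg) (a, []) = lookup x a" for x a
  by (simp add: inA_def ext_def lookup_sum lookup_bs wone_list_def in_keys_iff if_distrib cong: if_cong)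
 show "inA x = (inA y :: ('m, 'k) walg) ==> x = y"
  using l[of x] l[of y] by (intro poly_mapping_eqI) simp
qed

lemma adjoint_simps [simp]: "scl (adjoint L) = scl L" "gr (adjoint L) = gr L"
 by (simp_all add: adjoint_def)

lemma car_adjoint [simp]: "car (adjoint L) = car L"
 by (simp add: car_def is_decomp_def)

lemma coch_adjoint: "coch L (adjoint L) = coch L L"
 by (simp add: coch_def)

lemma cmul_adjoint: "cmul L (adjoint L) = cmul L L"
 by (simp add: cmul_def fun_eq_iff cong: if_cong)

locale dgl =
 fixes L :: "('k::real_normed_field, 'g::ab_group_add) dgla"
 assumes dgl: "dg_lie_algebra L"
begin

lemma gs_L: "graded_space L"
 using dgl by (simp add: dg_lie_algebra_def)

sublocale lb: gbasis L "set (bas L)"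
proof
 have "\<forall>b\<in>set (bas L). \<exists>i. b \<in> gr L i" using dgl unfolding dg_lie_algebra_def by (elim conjE)
 thus "set (bas L) <= (\<Union>i. gr L i)" by blast
 show "\<not> module.dependent (scl L) (set (bas L))" "module.span (scl L) (set (bas L)) = car L"
  using dgl unfolding dg_lie_algebra_def by - (elim conjE, assumption)+
qed (simp_all add: gs_L)

lemma coord_rp: "lb.vs.representation (set (bas L)) x (bas L ! i) = coord L i x"
 by (simp add: coord_def)

lemma coord_add: "x \<in> car L ==> y \<in> car L ==> coord L i (x + y) = coord L i x + coord L i y"
 and coord_scl: "x \<in> car L ==> coord L i (scl L c x) = c * coord L i x"
 and coord_0 [simp]: "coord L i 0 = 0"
 by (simp_all add: coord_def lb.rp_add lb.rp_scl)

lemma dist: "distinct (bas L)"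
 using dgl by (simp add: dg_lie_algebra_def)

lemma coord_expand: "x \<in> car L ==> x = (\<Sum>i<ldim L. scl L (coord L i x) (bas L ! i))"
proof -
 assume "x \<in> car L"
 from lb.rp_expand[OF this]
 have "x = (\<Sum>b\<in>set (bas L). scl L (lb.vs.representation (set (bas L)) x b) b)" .
 also have "\<dots> = (\<Sum>i<ldim L. scl L (lb.vs.representation (set (bas L)) x (bas L ! i)) (bas L ! i))"
  by (rule sum.reindex_bij_betw[OF bij_betw_nth[OF dist refl refl], symmetric])
 finally show ?thesis by (simp add: coord_def)
qed

lemma edeg_mdg: "edeg L i = mdg L (bas L ! i)"
 by (simp add: edeg_def mdg_def)

lemma bas_grL: "i < ldim L ==> bas L ! i \<in> gr L (edeg L i)"
 by (simp add: edeg_mdg lb.bas_gr)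

lemma bas_carL: "i < ldim L ==> bas L ! i \<in> car L"
 by (simp add: lb.bas_car)

lemma coord_gr: "x \<in> gr L j ==> i < ldim L ==> coord L i x ~= 0 ==> edeg L i = j"
 unfolding edeg_mdg coord_def by (rule lb.rp_gr) simp_all

lemma ldiff_gr: "x \<in> gr L i ==> ldiff L x \<in> gr L (i + 1)"
 and lbr_gr: "x \<in> gr L i ==> y \<in> gr L j ==> lbr L x y \<in> gr L (i + j)"
 and lbr_sym: "x \<in> gr L i ==> y \<in> gr L j ==> lbr L x y = scl L (- ksign (i * j)) (lbr L y x)"
proof -
 have 1: "linear_deg L L 1 (ldiff L)" "\<forall>i. \<forall>x\<in>gr L i. linear_deg L L i (lbr L x)"
  and 2: "\<forall>i j. \<forall>x \<in> gr L i. \<forall>y \<in> gr L j.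
    lbr L x y = scl L (- ksign (i * j)) (lbr L y x) \<and>
    ldiff L (lbr L x y) = lbr L (ldiff L x) y + scl L (ksign i) (lbr L x (ldiff L y))"
  using dgl unfolding dg_lie_algebra_def by - (elim conjE, assumption)+
 show "x \<in> gr L i ==> ldiff L x \<in> gr L (i + 1)" using 1(1) unfolding linear_deg_def by blast
 show "lbr L x y \<in> gr L (i + j)" if "x \<in> gr L i" "y \<in> gr L j"
 proof -
  have "\<forall>k. \<forall>y\<in>gr L k. lbr L x y \<in> gr L (k + i)" using 1(2) that unfolding linear_deg_def by blast
  thus ?thesis using that(2) by (metis add.commute)
 qed
 show "x \<in> gr L i ==> y \<in> gr L j ==> lbr L x y = scl L (- ksign (i * j)) (lbr L y x)" using 2 by blast
qed

lemma single_mons: "i < ldim L ==> single i (1::nat) \<in> mons L"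
 by (auto simp: mons_def lookup_single when_def)

lemma homA_single: "(c ~= 0 ==> mdeg L a = n) ==> homA L n (single a c)"
 and rcA_single: "a \<in> mons L ==> rcA L (single a c)"
 by auto

lemma homA_cmul_single:
 "(c ~= 0 ==> mdeg L a + mdeg L b = n) ==> homA L n (cmul L ground (single a c) (single b d))"
 unfolding cmul_def by (intro keys_subset_sum) (auto simp: keys_single split: if_splits)

lemma rcA_cmul_ground: "rcA L (cmul L ground a b)"
 unfolding cmul_def by (intro keys_subset_sum) (auto simp: keys_single)

lemma vfdeg_dgn: "vfdeg L 1 (dgn L)"
 unfolding vfdeg_def
proof (intro allI impI conjI)
 fix k assume k: "k < ldim L"
 have 0: "homA L (1 + wt L k) (d0_gen L k)" unfolding d0_gen_def
 proof (intro keys_subset_sum homA_single)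
  fix j assume j: "j \<in> {..<ldim L}" "ksign (- edeg L k + 1) * coord L k (ldiff L (bas L ! j)) ~= 0"
  hence "edeg L k = edeg L j + 1" using coord_gr[OF ldiff_gr[OF bas_grL] k] by simp
  thus "mdeg L (single j 1) = 1 + wt L k" by (simp add: wt_def)
 qed
 have 1: "homA L (1 + wt L k) (d1_gen L k)" unfolding d1_gen_def
 proof (intro keys_subset_sum homA_cmul_single)
  fix i j assume j: "i \<in> {..<ldim L}" "j \<in> {..<ldim L}"
   "- (1 / 2) * ksign (- edeg L k + 1 + edeg L i) * coord L k (lbr L (bas L ! i) (bas L ! j)) ~= 0"
  hence "edeg L k = edeg L i + edeg L j" using coord_gr[OF lbr_gr[OF bas_grL bas_grL] k] by simp
  thus "mdeg L (single j 1) + mdeg L (single i 1) = 1 + wt L k" by (simp add: wt_def)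
 qed
 show "homA L (1 + wt L k) (dgn L k)" unfolding dgn_def by (rule keys_subset_add[OF 0 1])
 show "rcA L (dgn L k)" unfolding dgn_def d0_gen_def d1_gen_def
  by (intro keys_subset_add keys_subset_sum rcA_single rcA_cmul_ground single_mons) simp
qed

end

text \<open>Identities in C(g) itself are proved inside an algebra of words, over a one-element
  vector type.\<close>

lemma inA_eqI: "inA x = (inA y :: mono \<times> unit letter list \<Rightarrow>\<^sub>0 'k::real_normed_field) ==> x = y"
 by (rule inA_inject)

lemma klin_contr_ground: "klin (contr_bas L ground i)"
 by (rule klinI; rule inA_eqI) (simp_all add: inA_contr_bas inA_add inA_sc pd_add pd_sc)

lemma klin_cmul_ground: "klin (%b. cmul L ground a b)" "klin (%a. cmul L ground a b)"
 by (rule klinI; rule inA_eqI; simp add: inA_cmul inA_add inA_sc prd_add_right prd_sc_right prd_add_left prd_sc_left)+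

lemma klin_vfA: "klin (vfA L v)"
 by (rule klinI; rule inA_eqI) (simp_all add: inA_vfA inA_add inA_sc vf_add vf_sc)

lemma contr_cmul_ground:
 assumes i: "i < ldim L" and a: "rcA L u" "homA L q u" and b: "rcA L v"
 shows "contr_bas L ground i (cmul L ground u v) =
  cmul L ground (contr_bas L ground i u) v + sk (wt L i * q) (cmul L ground u (contr_bas L ground i v))"
 by (rule inA_eqI)
  (simp add: inA_contr_bas inA_cmul pd_prd[OF i rc_inA[OF a(1)] rc_inA[OF b]] inA_add inA_sc
   sgno_hom[OF hom_inA[OF a(2)]] prd_sc_left)

lemma cmul_ground_single:
 "cmul L ground (single a c) (single b d) = single (a + b) (mcoef L a b * c * d)"
 by (cases "c = 0"; cases "d = 0") (auto simp: cmul_def mcoef_def ground_def)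

lemma cmul_ground_one: "rcA L v ==> cmul L ground (single 0 c) v = sc c v"
 "rcA L v ==> cmul L ground v (single 0 c) = sc c v"
proof -
 assume b: "rcA L v"
 show "cmul L ground (single 0 c) v = sc c v"
  by (rule klin_eqI[of _ "sc c"])
   (use b in \<open>auto intro: klin_cmul_ground klinI simp: sc_add mult_ac cmul_ground_single bs_def sc_single\<close>)
 show "cmul L ground v (single 0 c) = sc c v"
  by (rule klin_eqI[of "%v. cmul L ground v (single 0 c)" "sc c"])
   (use b in \<open>auto intro: klin_cmul_ground klinI simp: sc_add mult_ac cmul_ground_single bs_def sc_single\<close>)
qed

lemma pre_single: "pre L i (single k 1) = (if k < i then wt L k else 0)"
 by (simp add: pre_def lookup_single when_def if_distribR if_distrib[of int] if_distrib[of "%x. x * _"] cong: if_cong)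

lemma contr_ground_single: "contr_bas L ground i (single (single k 1) c) = (if i = k then single 0 c else 0)"
proof -
 have "contr_bas L ground i (single (single k 1) c) = sc c (contr_bas L ground i (bs (single k 1)))"
  by (simp only: single_bs[of _ c] klin_sc[OF klin_contr_ground])
 also have "contr_bas L ground i (bs (single k 1)) = (if i = k then bs 0 else 0)"
  by (rule inA_eqI) (simp add: inA_contr_bas inA_bs pd_bs pdc_def lookup_single when_def pre_single)
 finally show ?thesis by (simp add: single_bs[of _ c])
qed

context dgl
begin

sublocale lc: cspace L L
 by unfold_locales (use lb.span_B in \<open>auto simp: gs_L fin_dim_def\<close>)

sublocale ac: cspace L "adjoint L"
 by unfold_locales
  (use gs_L lb.span_B in \<open>auto simp: graded_space_def fin_dim_def is_decomp_def\<close>)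

lemma cmp_add: "cmp L (a + b) i = cmp L a i + cmp L b i"
 if "a \<in> carC L L" "b \<in> carC L L"
 unfolding cmp_def by (rule sum_keys_add) (use that in \<open>simp_all add: lc.car_C coord_add single_add\<close>)

lemma cmp_0 [simp]: "cmp L 0 i = 0"
 by (simp add: cmp_def)

lemma cmp_single: "cmp L (single c v) i = single c (coord L i v)"
 by (cases "v = 0") (simp_all add: cmp_def)

lemma cmp_sum: "(!!a. a \<in> A ==> f a \<in> carC L L) ==> cmp L (sum f A) i = (\<Sum>a\<in>A. cmp L (f a) i)"
proof (induction A rule: infinite_finite_induct)
 case (insert a A)
 have "cmp L (f a + sum f A) i = cmp L (f a) i + cmp L (sum f A) i"
  by (rule cmp_add) (use insert in \<open>auto intro: car_sum[OF lc.gs_C]\<close>)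
 with insert show ?case by simp
qed simp_all

lemma rcA_cmp: "b \<in> carC L L ==> rcA L (cmp L b i)"
 unfolding cmp_def by (intro keys_subset_sum rcA_single) (auto simp: lc.car_C)

lemma cmp_cmul:
 assumes O: "X \<in> carC L L"
 shows "cmp L (cmul L L u X) j = cmul L ground u (cmp L X j)"
proof -
 have c: "single (a + b) (scl L r (lookup X b)) \<in> carC L L" if "a + b \<in> mons L" for a b r
  using that O by (intro lc.single_car car_scl[OF gs_L]) (simp_all add: lc.car_C)
 have "cmul L L u X = (\<Sum>a\<in>keys u. \<Sum>b\<in>keys X. single (a + b) (scl L (mcoef L a b * lookup u a) (lookup X b)))"
  by (rule lc.cmul_alt)
 also have "cmp L \<dots> j = (\<Sum>a\<in>keys u. \<Sum>b\<in>keys X. cmp L (single (a + b) (scl L (mcoef L a b * lookup u a) (lookup X b))) j)"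
 proof (subst cmp_sum)
  have d: "single (a + b) (scl L (mcoef L a b * lookup u a) (lookup X b)) \<in> carC L L" for a b
   by (cases "a + b \<in> mons L") (simp add: c, simp add: mcoef_def car_0[OF lc.gs_C])
  thus "(\<Sum>b\<in>keys X. single (a + b) (scl L (mcoef L a b * lookup u a) (lookup X b))) \<in> carC L L" for a
   by (intro car_sum[OF lc.gs_C])
  show "(\<Sum>a\<in>keys u. cmp L (\<Sum>b\<in>keys X. single (a + b) (scl L (mcoef L a b * lookup u a) (lookup X b))) j) =
   (\<Sum>a\<in>keys u. \<Sum>b\<in>keys X. cmp L (single (a + b) (scl L (mcoef L a b * lookup u a) (lookup X b))) j)"
   by (intro sum.cong refl cmp_sum d)
 qed
 also have "\<dots> = (\<Sum>a\<in>keys u. \<Sum>b\<in>keys X. single (a + b) (mcoef L a b * lookup u a * coord L j (lookup X b)))"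
  using O by (simp add: cmp_single coord_scl lc.car_C)
 also have "\<dots> = (\<Sum>a\<in>keys u. \<Sum>b\<in>keys X. cmul L ground (single a (lookup u a)) (single b (coord L j (lookup X b))))"
  by (simp add: cmul_ground_single)
 also have "\<dots> = cmul L ground (\<Sum>a\<in>keys u. single a (lookup u a)) (cmp L X j)"
  unfolding cmp_def by (subst sum.swap) (simp add: klin_sum[OF klin_cmul_ground(1)] klin_sum[OF klin_cmul_ground(2)])
 finally show ?thesis by (simp add: poly_mapping_sum_single[symmetric])
qed

lemma vfdeg_cmp:
 assumes b: "v \<in> gr (coch L L) n"
 shows "vfdeg L (n - 1) (cmp L v)"
 unfolding vfdeg_def
proof (intro allI impI conjI)
 fix i assume i: "i < ldim L"
 show "rcA L (cmp L v i)" using b by (intro rcA_cmp gr_car[OF lc.gs_C])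
 show "homA L (n - 1 + wt L i) (cmp L v i)" unfolding cmp_def
 proof (intro keys_subset_sum homA_single)
  fix c assume "c \<in> keys v" and nz: "coord L i (lookup v c) ~= 0"
  have "lookup v c \<in> gr L (n - mdeg L c)" using b by (simp add: gr_coch)
  hence "edeg L i = n - mdeg L c" using coord_gr i nz by blast
  thus "mdeg L c = n - 1 + wt L i" by (simp add: wt_def)
 qed
qed

lemma tot_adjoint: "tot (act (adjoint L)) y = single 0 (ldiff L y) +
  (\<Sum>k<ldim L. single (single k 1) (lbr L (bas L ! k) y))"
proof -
 have "tot (act (adjoint L)) y = (\<Sum>k\<in>{0, 1}. act (adjoint L) k y)"
  unfolding tot_def by (rule sum.mono_neutral_left) (auto simp: adjoint_def)
 thus ?thesis by (simp add: adjoint_def)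
qed

lemma ldiff_lin: "x \<in> car L ==> y \<in> car L ==> ldiff L (x + y) = ldiff L x + ldiff L y"
  "x \<in> car L ==> ldiff L (scl L c x) = scl L c (ldiff L x)"
 and lbr_lin: "z \<in> gr L i ==> x \<in> car L ==> y \<in> car L ==> lbr L z (x + y) = lbr L z x + lbr L z y"
  "z \<in> gr L i ==> x \<in> car L ==> lbr L z (scl L c x) = scl L c (lbr L z x)"
proof -
 have 1: "linear_deg L L 1 (ldiff L)" "\<forall>i. \<forall>x\<in>gr L i. linear_deg L L i (lbr L x)"
  using dgl unfolding dg_lie_algebra_def by - (elim conjE, assumption)+
 show "x \<in> car L ==> y \<in> car L ==> ldiff L (x + y) = ldiff L x + ldiff L y"
  "x \<in> car L ==> ldiff L (scl L c x) = scl L c (ldiff L x)"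
  using 1(1) unfolding linear_deg_def by blast+
 show "z \<in> gr L i ==> x \<in> car L ==> y \<in> car L ==> lbr L z (x + y) = lbr L z x + lbr L z y"
  "z \<in> gr L i ==> x \<in> car L ==> lbr L z (scl L c x) = scl L c (lbr L z x)"
  using 1(2) unfolding linear_deg_def by blast+
qed

lemma lin_car:
 assumes T: "!!x y. x \<in> car L ==> y \<in> car L ==> T (x + y) = T x + (T y :: 'z::ab_group_add)"
  and S: "!!c i. i < ldim L ==> T (scl L c (bas L ! i)) = S c i" and y: "y \<in> car L"
 shows "T y = (\<Sum>i<ldim L. S (coord L i y) i)"
proof -
 have 0: "T 0 = 0" using T[of 0 0] by (simp add: car_0[OF gs_L])
 have "T (\<Sum>i\<in>A. scl L (coord L i y) (bas L ! i)) = (\<Sum>i\<in>A. S (coord L i y) i)" if "A <= {..<ldim L}" for A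
  using finite_subset[OF that finite_lessThan] that
 proof (induction A rule: finite_induct)
  case (insert i A)
  have "(\<Sum>i\<in>A. scl L (coord L i y) (bas L ! i)) \<in> car L"
   using insert(4) by (intro car_sum[OF gs_L] car_scl[OF gs_L] bas_carL) auto
  thus ?case using insert by (simp add: T S car_scl[OF gs_L] bas_carL)
 qed (simp add: 0)
 from this[OF subset_refl] show ?thesis using coord_expand[OF y] by metis
qed

lemma ldiff_car: "y \<in> car L ==> ldiff L y \<in> car L"
 by (subst lin_car[where T = "ldiff L"]; (rule ldiff_lin refl)?)
  (auto simp: ldiff_lin bas_carL intro!: car_sum[OF gs_L] car_scl[OF gs_L] gr_car[OF gs_L ldiff_gr[OF bas_grL]])

lemma lbr_car: "z \<in> gr L i ==> y \<in> car L ==> lbr L z y \<in> car L"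
 by (subst lin_car[where T = "lbr L z"]; (rule lbr_lin refl)?)
  (auto simp: lbr_lin bas_carL intro!: car_sum[OF gs_L] car_scl[OF gs_L] gr_car[OF gs_L lbr_gr[OF _ bas_grL]])

lemma tot_adjoint_car: "y \<in> car L ==> tot (act (adjoint L)) y \<in> carC L L"
 unfolding tot_adjoint
 by (intro car_add[OF lc.gs_C] car_sum[OF lc.gs_C] lc.single_car mons_0 single_mons ldiff_car lbr_car[OF bas_grL]) auto

lemma cmp_tot_adjoint: "y \<in> car L ==> cmp L (tot (act (adjoint L)) y) j =
  single 0 (coord L j (ldiff L y)) + (\<Sum>k<ldim L. single (single k 1) (coord L j (lbr L (bas L ! k) y)))"
proof -
 assume y: "y \<in> car L"
 have c: "single (single k 1) (lbr L (bas L ! k) y) \<in> carC L L" if "k < ldim L" for k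
  using that y by (intro lc.single_car single_mons lbr_car[OF bas_grL])
 have 1: "(\<Sum>k<ldim L. single (single k 1) (lbr L (bas L ! k) y)) \<in> carC L L"
  by (intro car_sum[OF lc.gs_C]) (simp add: c)
 have 2: "cmp L (\<Sum>k<ldim L. single (single k 1) (lbr L (bas L ! k) y)) j =
   (\<Sum>k<ldim L. cmp L (single (single k 1) (lbr L (bas L ! k) y)) j)"
  by (rule cmp_sum) (simp add: c)
 show ?thesis unfolding tot_adjoint cmp_add[OF lc.single_car[OF mons_0 ldiff_car[OF y]] 1] 2 cmp_single ..
qed

text \<open>The link between d_CE and the adjoint module: differentiating the components of d_CE by
  the generator dual to e_i returns the adjoint differential of e_i. Both are made of the same
  structure constants, so only signs have to be compared.\<close>

lemma contr_dgn:
 assumes i: "i < ldim L" and j: "j < ldim L"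
 shows "sk (edeg L i) (contr_bas L ground i (dgn L j)) = cmp L (tot (act (adjoint L)) (bas L ! i)) j"
proof -
 let ?e = "%k. bas L ! k"
 define C where "C a b = - (1 / 2) * ksign (- edeg L j + 1 + edeg L a) * coord L j (lbr L (?e a) (?e b))" for a b
 note add = klin_sum[OF klin_contr_ground]
 have 0: "contr_bas L ground i (d0_gen L j) = single 0 (ksign (- edeg L j + 1) * coord L j (ldiff L (?e i)))"
  unfolding d0_gen_def add using i by (simp add: contr_ground_single)
 have 1: "contr_bas L ground i (cmul L ground (single (single b 1) (C a b)) (single (single a 1) 1)) =
   (if i = b then single (single a 1) (C a b) else 0) +
   (if i = a then single (single b 1) (ksign (wt L i * wt L b) * C a b) else 0)"
  if "a < ldim L" "b < ldim L" for a b
  using that i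
  by (subst contr_cmul_ground[where q = "wt L b"])
   (auto simp: contr_ground_single cmul_ground_one single_mons rcA_single sc_single klin_0[OF klin_cmul_ground(1)]
    klin_0[OF klin_cmul_ground(2)] simp del: single_one split: if_splits)
 have "contr_bas L ground i (d1_gen L j) = (\<Sum>a<ldim L. \<Sum>b<ldim L.
   (if i = b then single (single a 1) (C a b) else 0) +
   (if i = a then single (single b 1) (ksign (wt L i * wt L b) * C a b) else 0))"
  unfolding d1_gen_def add C_def[symmetric] by (intro sum.cong refl 1) simp_all
 also have "\<dots> = (\<Sum>a<ldim L. single (single a 1) (C a i)) +
   (\<Sum>a<ldim L. \<Sum>b<ldim L. if i = a then single (single b 1) (ksign (wt L i * wt L b) * C a b) else 0)"
  using i by (simp add: sum.distrib)
 also have "(\<Sum>a<ldim L. \<Sum>b<ldim L. if i = a then single (single b 1) (ksign (wt L i * wt L b) * C a b) else 0) =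
   (\<Sum>b<ldim L. single (single b 1) (ksign (wt L i * wt L b) * C i b))"
  using i by (subst sum.swap) simp
 finally have 2: "contr_bas L ground i (d1_gen L j) =
   (\<Sum>k<ldim L. single (single k 1) (C k i + ksign (wt L i * wt L k) * C i k))"
  by (simp add: sum.distrib single_add)
 \<comment> \<open>The pairs (k, i) and (i, k) contribute equally by graded antisymmetry of the
   bracket, which absorbs the factor 1/2 of \<open>d1_gen\<close>.\<close>
 have 3: "ksign (edeg L i) * (C k i + ksign (wt L i * wt L k) * C i k) = coord L j (lbr L (?e k) (?e i))"
  if k: "k < ldim L" for k
 proof (cases "coord L j (lbr L (?e k) (?e i)) = 0")
  case True
  have "coord L j (lbr L (?e i) (?e k)) = 0"
   unfolding lbr_sym[OF bas_grL[OF i] bas_grL[OF k]] coord_scl[OF gr_car[OF gs_L lbr_gr[OF bas_grL[OF k] bas_grL[OF i]]]] True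
   by simp
  with True show ?thesis by (simp add: C_def)
 next
  case False
  hence e: "edeg L j = edeg L k + edeg L i" using coord_gr[OF lbr_gr[OF bas_grL[OF k] bas_grL[OF i]] j] by simp
  have s: "coord L j (lbr L (?e i) (?e k)) = - ksign (edeg L i * edeg L k) * coord L j (lbr L (?e k) (?e i))"
   unfolding lbr_sym[OF bas_grL[OF i] bas_grL[OF k]] coord_scl[OF gr_car[OF gs_L lbr_gr[OF bas_grL[OF k] bas_grL[OF i]]]] ..
  show ?thesis unfolding C_def s e wt_def
   by (simp add: ksign_def algebra_simps)
 qed
 have 4: "ksign (edeg L i) * (ksign (- edeg L j + 1) * coord L j (ldiff L (?e i))) = coord L j (ldiff L (?e i))"
 proof (cases "coord L j (ldiff L (?e i)) = 0")
  case False
  hence "edeg L j = edeg L i + 1" using coord_gr[OF ldiff_gr[OF bas_grL[OF i]] j] by simp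
  thus ?thesis by (simp add: ksign_def)
 qed simp
 show ?thesis
  unfolding dgn_def klin_add[OF klin_contr_ground] 0 2 cmp_tot_adjoint[OF bas_carL[OF i]]
  unfolding sc_add sc_sum sc_single 4 by (simp add: 3 cong: sum.cong_simp)
qed

lemma cmp_tot_adjoint_gr:
 assumes y: "y \<in> gr L m" and j: "j < ldim L"
 shows "cmp L (tot (act (adjoint L)) y) j =
  sk m (\<Sum>i<ldim L. sc (coord L i y) (contr_bas L ground i (dgn L j)))"
proof -
 let ?T = "%y. single 0 (coord L j (ldiff L y)) + (\<Sum>k<ldim L. single (single k 1) (coord L j (lbr L (bas L ! k) y)))"
 have yc: "y \<in> car L" by (rule gr_car[OF gs_L y])
 have T: "?T (x + y) = ?T x + ?T y" if "x \<in> car L" "y \<in> car L" for x y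
  using that by (simp add: ldiff_lin coord_add ldiff_car lbr_lin[OF bas_grL] lbr_car[OF bas_grL] single_add sum.distrib)
 have S: "?T (scl L c (bas L ! i)) = sc (c * ksign (edeg L i)) (contr_bas L ground i (dgn L j))" if "i < ldim L" for c i
 proof -
  have "?T (scl L c (bas L ! i)) = sc c (?T (bas L ! i))"
   using that by (simp add: ldiff_lin coord_scl ldiff_car bas_carL lbr_lin[OF bas_grL] lbr_car[OF bas_grL] sc_add sc_sum sc_single)
  also have "?T (bas L ! i) = cmp L (tot (act (adjoint L)) (bas L ! i)) j"
   by (rule cmp_tot_adjoint[symmetric, OF bas_carL[OF that]])
  finally show ?thesis by (simp add: contr_dgn[OF that j, symmetric])
 qed
 have "cmp L (tot (act (adjoint L)) y) j = ?T y" by (rule cmp_tot_adjoint[OF yc])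
 also have "\<dots> = (\<Sum>i<ldim L. sc (coord L i y * ksign (edeg L i)) (contr_bas L ground i (dgn L j)))"
  by (rule lin_car[where T = ?T, OF T S yc])
 also have "\<dots> = (\<Sum>i<ldim L. sc (ksign m * coord L i y) (contr_bas L ground i (dgn L j)))"
 proof (intro sum.cong refl)
  fix i assume "i \<in> {..<ldim L}"
  hence "coord L i y * ksign (edeg L i) = ksign m * coord L i y"
   using coord_gr[OF y] by (cases "coord L i y = 0") auto
  thus "sc (coord L i y * ksign (edeg L i)) (contr_bas L ground i (dgn L j)) =
   sc (ksign m * coord L i y) (contr_bas L ground i (dgn L j))" by (simp only:)
 qed
 finally show ?thesis by (simp add: sc_sum)
qed

lemma d_tot_adjoint_alt: "d_tot L (adjoint L) b = (\<Sum>c\<in>keys b.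
  cmul L L (d_CE L (bs c)) (single 0 (lookup b c)) +
  cmul L L (sk (mdeg L c) (bs c)) (tot (act (adjoint L)) (lookup b c)))"
 by (simp add: d_tot_def cmul_adjoint single_bs[of _ "ksign _"] bs_def[symmetric])

lemma rcA_d_CE: "rcA L (d_CE L a)"
 unfolding d_CE_def by (intro keys_subset_sum rcA_cmul_ground)

text \<open>The total differential of the adjoint module is the graded commutator with d_CE: a
  cochain of degree n contracts with degree n - 1, whence the sign (-1)^n in front of the second
  term. The part with d_CE of coefficients gives the first term, \<open>contr_dgn\<close> the
  second.\<close>

lemma cmp_d_tot:
 assumes b: "v \<in> gr (coch L L) n" and j: "j < ldim L"
 shows "cmp L (d_tot L (adjoint L) v) j = vfA L (dgn L) (cmp L v j) + sk n (vfA L (cmp L v) (dgn L j))"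
proof -
 have bc: "v \<in> carC L L" by (rule gr_car[OF lc.gs_C b])
 hence l: "lookup v c \<in> car L" for c by (simp add: lc.car_C)
 have g: "lookup v c \<in> gr L (n - mdeg L c)" for c using b by (simp add: gr_coch)
 have s: "single 0 (lookup v c) \<in> carC L L" for c by (rule lc.single_car) (simp_all add: l)
 have "cmp L (d_tot L (adjoint L) v) j = (\<Sum>c\<in>keys v.
  cmul L ground (d_CE L (bs c)) (single 0 (coord L j (lookup v c))) +
  cmul L ground (sk (mdeg L c) (bs c)) (cmp L (tot (act (adjoint L)) (lookup v c)) j))"
  unfolding d_tot_adjoint_alt
  by (simp add: cmp_sum car_add[OF lc.gs_C] lc.cmul_car s tot_adjoint_car l cmp_add cmp_cmul cmp_single)
 also have "\<dots> = (\<Sum>c\<in>keys v. cmul L ground (d_CE L (bs c)) (single 0 (coord L j (lookup v c)))) +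
   (\<Sum>c\<in>keys v. sk n (\<Sum>i<ldim L. cmul L ground (single c (coord L i (lookup v c))) (contr_bas L ground i (dgn L j))))"
 proof -
  have "cmul L ground (sk (mdeg L c) (bs c)) (cmp L (tot (act (adjoint L)) (lookup v c)) j) =
   sk n (\<Sum>i<ldim L. cmul L ground (single c (coord L i (lookup v c))) (contr_bas L ground i (dgn L j)))" for c
  proof -
   have k: "ksign (n - mdeg L c) * (r * ksign (mdeg L c)) = (ksign n * r :: 'k)"
    "ksign (n - mdeg L c) * r * ksign (mdeg L c) = (ksign n * r :: 'k)" for r
    by (simp_all add: ksign_def)
   show ?thesis
    unfolding cmp_tot_adjoint_gr[OF g j]
    by (simp add: klin_sum[OF klin_cmul_ground(1)] klin_sc[OF klin_cmul_ground(1)] klin_sc[OF klin_cmul_ground(2)]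
      single_bs[of _ "coord L _ _"] sc_sum k)
  qed
  thus ?thesis by (simp only: sum.distrib)
 qed
 also have "(\<Sum>c\<in>keys v. cmul L ground (d_CE L (bs c)) (single 0 (coord L j (lookup v c)))) = vfA L (dgn L) (cmp L v j)"
  unfolding cmp_def klin_sum[OF klin_vfA]
  by (simp add: cmul_ground_one rcA_d_CE d_CE_vfA single_bs[of _ "coord L _ _"] klin_sc[OF klin_vfA] cmul_ground_one[OF rcA_d_CE, unfolded d_CE_vfA single_bs])
 also have "(\<Sum>c\<in>keys v. sk n (\<Sum>i<ldim L. cmul L ground (single c (coord L i (lookup v c))) (contr_bas L ground i (dgn L j))))
   = sk n (vfA L (cmp L v) (dgn L j))"
  unfolding vfA_def sc_sum[symmetric] cmp_def
  by (subst sum.swap) (simp add: klin_sum[OF klin_cmul_ground(2)])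
 finally show ?thesis .
qed

end

section \<open>The letters of a module, their differentials and their vector fields\<close>

context cspace
begin

lemma gr_coch_shift: "gr (coch L (shift 1 V)) n = gr (coch L V) (n + 1)"
 by (simp add: gr_coch algebra_simps)

lemma hom_emb: "X \<in> gr (coch L V) n ==> hom L (n - 1) (emb V X)"
 using gr_emb[of X "n - 1"] unfolding gr_coch_shift by simp

end

text \<open>Singles out the letters formed from the chosen basis with its degrees among all pairs of
  a vector and an integer.\<close>

definition real_ltr :: "('k::real_normed_field, 'v::ab_group_add, 'z) gspace_scheme => 'v letter => bool" where
 "real_ltr V m \<longleftrightarrow> lval m \<in> hbas V \<and> m = ltr V (lval m)"

lemma real_ltr [simp]: "real_ltr V (ltr V b) \<longleftrightarrow> b \<in> hbas V"
 by (simp add: real_ltr_def)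

lemma real_ltrE: "real_ltr V m ==> (!!b. b \<in> hbas V ==> m = ltr V b ==> P) ==> P"
 unfolding real_ltr_def by blast

abbreviation rws :: "('k::real_normed_field, 'v::ab_group_add, 'z) gspace_scheme => 'v letter list set" where
 "rws V \<equiv> {w. list_all (real_ltr V) w}"

lemma lel_iff: "lel L V x \<longleftrightarrow> el L x \<and> wds (rws V) x"
proof
 assume x: "lel L V x"
 thus "el L x \<and> wds (rws V) x" by fastforce
next
 assume x: "el L x \<and> wds (rws V) x"
 show "lel L V x"
 proof
  fix p assume p: "p \<in> keys x"
  then obtain a m where "p = (a, [m])" "a \<in> mons L" "real_ltr V m" using x by fastforce
  thus "p \<in> {(a, [ltr V b]) |a b. a \<in> mons L \<and> b \<in> hbas V}" by (auto elim: real_ltrE)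
 qed
qed

text \<open>The value 0 at letters foreign to \<open>M\<close>, here and in \<open>Fl\<close>, makes
  the assumptions of \<open>ce_module\<close> hold for all letters.\<close>

definition Dl :: "('k::real_normed_field, 'm::ab_group_add) infmod => 'm letter => ('m, 'k) walg" where
 "Dl M m = (if real_ltr M m then emb M (tot (act M) (lval m)) else 0)"

definition Fl :: "('k::real_normed_field, 'g::ab_group_add) dgla => ('k, 'm::ab_group_add) infmod =>
  (nat => 'm => 'g coc) => 'm letter => nat => 'k coc" where
 "Fl L M f m = (if real_ltr M m then cmp L (tot f (lval m)) else (%_. 0))"

locale imod = dgl L + mc: gspace_over L M + A: imap L M M 1 "act M"
 for L :: "('k::real_normed_field, 'g::ab_group_add) dgla" and M :: "('k, 'm::ab_group_add) infmod" +
 assumes dd: "\<Omega> \<in> carC L M ==> d_tot L M (d_tot L M \<Omega>) = 0"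
begin

lemma d_tot_alt: "d_tot L M X = (\<Sum>a\<in>keys X. cmul L M (d_CE L (bs a)) (single 0 (lookup X a)) +
  cmul L M (sk (mdeg L a) (bs a)) (tot (act M) (lookup X a)))"
 by (simp add: d_tot_def single_bs[of _ "ksign _"] bs_def[symmetric])

lemma cmul_0 [simp]: "cmul L M a 0 = 0"
 by (simp add: cmul_def)

lemma d_tot_add: "d_tot L M (X + Y) = d_tot L M X + d_tot L M Y"
 if "X \<in> carC L M" "Y \<in> carC L M"
 unfolding d_tot_alt
 by (rule sum_keys_add) (use that in \<open>simp_all add: mc.car_C A.tot_add single_add mc.cmul_add_right\<close>)

lemma d_tot_scl: "d_tot L M (scl (coch L M) c X) = scl (coch L M) c (d_tot L M X)" if O: "X \<in> carC L M"
proof -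
 have k: "keys (scl (coch L M) c X) <= keys X" by (auto simp: in_keys_iff lookup_scl_coch[OF mc.gs_V])
 have "d_tot L M (scl (coch L M) c X) = (\<Sum>a\<in>keys X. cmul L M (d_CE L (bs a)) (single 0 (lookup (scl (coch L M) c X) a)) +
  cmul L M (sk (mdeg L a) (bs a)) (tot (act M) (lookup (scl (coch L M) c X) a)))"
  unfolding d_tot_alt by (rule sum_keys_superset[OF _ _ k]) simp_all
 also have "\<dots> = scl (coch L M) c (d_tot L M X)"
  using O unfolding d_tot_alt
  by (simp add: module.scale_sum_right[OF graded_spaceD(2)[OF mc.gs_C]] module.scale_right_distrib[OF graded_spaceD(2)[OF mc.gs_C]]
   lookup_scl_coch[OF mc.gs_V] A.tot_scl mc.car_C mc.cmul_scl_right mc.scl_single[symmetric])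
 finally show ?thesis .
qed

lemma d_tot_car: "X \<in> carC L M ==> d_tot L M X \<in> carC L M"
 unfolding d_tot_alt
 by (intro car_sum[OF mc.gs_C] car_add[OF mc.gs_C] mc.cmul_car mc.single_car mons_0 A.tot_car) (simp_all add: mc.car_C)

lemma d_tot_single: "d_tot L M (single a v) = cmul L M (d_CE L (bs a)) (single 0 v) +
  cmul L M (sk (mdeg L a) (bs a)) (tot (act M) v)"
 by (cases "v = 0") (simp_all add: d_tot_alt)

lemma emb_d_tot_single:
 assumes b: "b \<in> hbas M"
 shows "emb M (d_tot L M (single a b)) = prd L (vf L (dgn L) (inA (bs a))) (lt (ltr M b)) +
  prd L (sgno L 1 (inA (bs a))) (emb M (tot (act M) b))"
proof -
 have s: "single 0 b \<in> carC L M" using b by (intro mc.single_car mons_0 mc.bas_car)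
 have t: "tot (act M) b \<in> carC L M" using b by (intro A.tot_car mc.bas_car)
 have "sgno L 1 (inA (bs a)) = (inA (sk (mdeg L a) (bs a)) :: ('m, 'k) walg)"
  by (subst sgno_hom[where n = "mdeg L a"]) (simp_all add: inA_bs inA_sc)
 thus ?thesis
  unfolding d_tot_single
  by (simp add: mc.emb_add mc.cmul_car s t mc.emb_cmul inA_d_CE mc.emb_single_bas[OF b] lt_def)
qed

lemma d_CE_0: "d_CE L (bs 0) = 0"
proof (rule inA_eqI)
 show "inA (d_CE L (bs 0)) = (inA 0 :: mono \<times> unit letter list \<Rightarrow>\<^sub>0 'k)"
  using vf_word[of L "dgn L" "[] :: unit letter list"] by (simp add: inA_d_CE inA_bs wone_list_def)
qed

lemma cmul_one: "X \<in> carC L M ==> cmul L M (bs 0) X = X"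
 by (rule mc.emb_inj)
  (simp_all add: mc.cmul_car mc.emb_cmul inA_bs prd_one_left el_rc[OF lel_el[OF mc.lel_emb]])

lemma d_tot_0: "v \<in> car M ==> d_tot L M (single 0 v) = tot (act M) v"
 unfolding d_tot_single by (simp add: d_CE_0 cmul_one A.tot_car) (simp add: cmul_def)

lemma Dl_ltr: "b \<in> hbas M ==> Dl M (ltr M b) = emb M (tot (act M) b)"
 by (simp add: Dl_def)

lemma lel_Dl: "lel L M (Dl M m)"
proof (cases "real_ltr M m")
 case True
 then obtain b where b: "b \<in> hbas M" "m = ltr M b" by (rule real_ltrE)
 show ?thesis unfolding b(2) Dl_ltr[OF b(1)] by (rule mc.lel_emb[OF A.tot_car[OF mc.bas_car[OF b(1)]]])
qed (simp add: Dl_def)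

lemma hom_Dl: "hom L (gdeg m + 1) (Dl M m)"
proof (cases "real_ltr M m")
 case True
 then obtain b where b: "b \<in> hbas M" "m = ltr M b" by (rule real_ltrE)
 have "tot (act M) b \<in> gr (coch L M) (mdg M b + 1)" by (rule A.tot_gr[OF mc.bas_gr[OF b(1)]])
 from mc.hom_emb[OF this] show ?thesis by (simp add: b Dl_ltr)
qed (simp add: Dl_def)

end

context dgl
begin

lemma cmp_scl: "v \<in> carC L L ==> cmp L (scl (coch L L) c v) i = sc c (cmp L v i)"
proof -
 assume b: "v \<in> carC L L"
 have k: "keys (scl (coch L L) c v) <= keys v" by (auto simp: in_keys_iff lookup_scl_coch[OF gs_L])
 have "cmp L (scl (coch L L) c v) i = (\<Sum>a\<in>keys v. single a (coord L i (lookup (scl (coch L L) c v) a)))"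
  unfolding cmp_def by (rule sum_keys_superset[OF _ _ k]) simp_all
 thus ?thesis using b by (simp add: cmp_def lookup_scl_coch[OF gs_L] coord_scl lc.car_C sc_sum sc_single)
qed

lemma vf_cmul: "vf L (%j. cmul L ground a (v j)) x = sm L a (vf L v x)"
 by (simp add: vf_def inA_cmul prd_assoc prd_sum_right)

end

locale fmap = dgl L + mc: gspace_over L M + F: imap L M "adjoint L" p f
 for L :: "('k::real_normed_field, 'g::ab_group_add) dgla" and M :: "('k, 'm::ab_group_add) infmod" and p f
begin

lemma tot_f_car: "b \<in> car M ==> tot f b \<in> carC L L"
 using F.tot_car unfolding coch_adjoint .

text \<open>Both sides are C(g)-linear in \<open>X\<close> and agree on basis vectors: the
  derivation attached to a cochain \<open>X\<close> is contraction with the extension of f at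
  \<open>X\<close>.\<close>

lemma nab_emb:
 assumes "X \<in> carC L M"
 shows "nab L (Fl L M f) (emb M X) x = vf L (cmp L (lin_adj L f X)) x"
proof (rule mc.coch_eqI[OF _ _ _ _ _ assms])
 fix X Y assume c: "X \<in> carC L M" "Y \<in> carC L M"
 note l = F.lin_ext_car[OF c(1), unfolded coch_adjoint] F.lin_ext_car[OF c(2), unfolded coch_adjoint]
 show "nab L (Fl L M f) (emb M (X + Y)) x = nab L (Fl L M f) (emb M X) x + nab L (Fl L M f) (emb M Y) x"
  by (simp add: mc.emb_add c klin_add[OF klin_nab_left[OF klin_id]])
 show "vf L (cmp L (lin_adj L f (X + Y))) x =
  vf L (cmp L (lin_adj L f X)) x + vf L (cmp L (lin_adj L f Y)) x"
  unfolding F.lin_ext_add[OF c] vf_lin(1)[symmetric] using cmp_add[OF l] by (metis (no_types) vf_cong)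
next
 fix X r assume c: "X \<in> carC L M"
 note l = F.lin_ext_car[OF c, unfolded coch_adjoint]
 show "nab L (Fl L M f) (emb M (scl (coch L M) r X)) x = sc r (nab L (Fl L M f) (emb M X) x)"
  by (simp add: mc.emb_scl c klin_sc[OF klin_nab_left[OF klin_id]])
 show "vf L (cmp L (lin_adj L f (scl (coch L M) r X))) x =
  sc r (vf L (cmp L (lin_adj L f X)) x)"
  unfolding F.lin_ext_scl[OF c] vf_lin(3)[symmetric] coch_adjoint using cmp_scl[OF l] by (metis (no_types) vf_cong)
next
 fix a b assume a: "a \<in> mons L" and b: "b \<in> hbas M"
 note t = tot_f_car[OF mc.bas_car[OF b]]
 have "vf L (cmp L (lin_adj L f (single a b))) x = vf L (%j. cmul L ground (bs a) (cmp L (tot f b) j)) x"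
  unfolding F.lin_ext_single[OF mc.bas_car[OF b]] cmul_adjoint using cmp_cmul[OF t] by (metis (no_types) vf_cong)
 thus "nab L (Fl L M f) (emb M (single a b)) x = vf L (cmp L (lin_adj L f (single a b))) x"
  using b by (simp add: mc.emb_single_bas nab_bs vf_cmul Fl_def)
qed

lemma vfdeg_Fl: "vfdeg L (gdeg m + p) (Fl L M f m)"
proof (cases "real_ltr M m")
 case True
 then obtain b where b: "b \<in> hbas M" "m = ltr M b" by (rule real_ltrE)
 have "tot f b \<in> gr (coch L L) (mdg M b + p)" using F.tot_gr[OF mc.bas_gr[OF b(1)]] unfolding coch_adjoint .
 from vfdeg_cmp[OF this] show ?thesis using b by (simp add: Fl_def algebra_simps)
qed (simp add: Fl_def vfdeg_def)

end

lemma vf_zero [simp]: "vf L (%_. 0) x = 0"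
 by (simp add: vf_def)

locale wlp = imod L M + F: fmap L M 0 f
 for L :: "('k::real_normed_field, 'g::ab_group_add) dgla" and M :: "('k, 'm::ab_group_add) infmod" and f +
 assumes mor: "\<Omega> \<in> carC L M ==>
  lin_adj L f (d_tot L M \<Omega>) = d_tot L (adjoint L) (lin_adj L f \<Omega>)"
begin

lemma mor_0: "b \<in> car M ==> lin_adj L f (tot (act M) b) = d_tot L (adjoint L) (tot f b)"
proof -
 assume b: "b \<in> car M"
 have 1: "lin_adj L f (single 0 b) = tot f b"
 proof (rule ac.emb_inj)
  show "emb (adjoint L) (lin_adj L f (single 0 b)) = emb (adjoint L) (tot f b)"
   using ac.lel_emb[OF F.F.tot_car[OF b]]
   by (simp add: F.F.emb_lin_ext_single b inA_bs prd_one_left el_rc[OF lel_el])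
 qed (simp_all add: F.F.lin_ext_car F.F.tot_car b mc.single_car)
 have "lin_adj L f (d_tot L M (single 0 b)) = d_tot L (adjoint L) (lin_adj L f (single 0 b))"
  by (rule mor[OF mc.single_car[OF mons_0 b]])
 thus ?thesis by (simp add: 1 d_tot_0 b)
qed

text \<open>The commutator of d_CE with contraction by f(m) is contraction by the adjoint
  differential of f(m), by \<open>cmp_d_tot\<close>. As f commutes with the differentials, this is
  contraction by f of the differential of m.\<close>

sublocale ce: ce_module L "dgn L" "Dl M" "Fl L M f"
proof
 show "vfdeg L 1 (dgn L)" by (rule vfdeg_dgn)
 show "el L (Dl M m)" for m using lel_Dl[of m] by (rule lel_el)
 show "hom L (gdeg m + 1) (Dl M m)" for m by (rule hom_Dl)
 show v: "vfdeg L (gdeg m) (Fl L M f m)" for m using F.vfdeg_Fl[of m] by simp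
 fix m and x :: "('m, 'k) walg"
 assume x: "rc L x"
 show "vf L (dgn L) (vf L (Fl L M f m) x) - sk (gdeg m) (vf L (Fl L M f m) (vf L (dgn L) x)) =
  nab L (Fl L M f) (Dl M m) x"
 proof (cases "real_ltr M m")
  case True
  then obtain b where b: "b \<in> hbas M" "m = ltr M b" by (rule real_ltrE)
  have t: "tot f b \<in> gr (coch L L) (mdg M b)"
   using F.F.tot_gr[OF mc.bas_gr[OF b(1)]] unfolding coch_adjoint by simp
  have Fm: "Fl L M f m = cmp L (tot f b)" using b by (simp add: Fl_def)
  have s: "ksign (mdg M b) = (- ksign (1 * gdeg m) :: 'k)" by (simp add: b ksign_def)
  have v': "vfdeg L (gdeg m) (cmp L (tot f b))" using v[of m] by (simp add: Fm)
  have "vf L (dgn L) (vf L (Fl L M f m) x) - sk (1 * gdeg m) (vf L (Fl L M f m) (vf L (dgn L) x)) =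
    vf L (%j. vfA L (dgn L) (cmp L (tot f b) j) - sk (1 * gdeg m) (vfA L (cmp L (tot f b)) (dgn L j))) x"
   unfolding Fm by (rule vf_commutator[OF vfdeg_dgn v' x])
  also have "\<dots> = vf L (cmp L (d_tot L (adjoint L) (tot f b))) x"
   by (intro fun_cong[OF vf_cong]) (simp add: cmp_d_tot[OF t] s sc_minus_left)
  also have "\<dots> = nab L (Fl L M f) (Dl M m) x"
   using b by (simp add: Dl_ltr F.nab_emb A.tot_car mc.bas_car mor_0)
  finally show ?thesis by simp
 qed (simp add: Fl_def Dl_def klin_0[OF klin_nab_left[OF klin_id]])
qed

text \<open>In word length one, Q and the total differential agree on basis vectors and treat
  coefficients alike.\<close>

lemma Q_emb:
 assumes "X \<in> carC L M"
 shows "ce.Q (emb M X) = emb M (d_tot L M X)"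
proof (rule mc.coch_eqI[OF _ _ _ _ _ assms])
 fix a b assume a: "a \<in> mons L" and b: "b \<in> hbas M"
 show "ce.Q (emb M (single a b)) = emb M (d_tot L M (single a b))"
  unfolding mc.emb_single_bas[OF b] bs_split[OF a] ce.Q_split[OF a] emb_d_tot_single[OF b]
  by (simp add: lt_def Dl_ltr b del: ce.qw.simps)
qed (simp_all add: mc.emb_add mc.emb_scl ce.Q_add ce.Q_sc d_tot_add d_tot_scl d_tot_car)

lemma wds_rws_th: "wds (rws M) e ==> wds (rws M) x ==> wds (rws M) (ce.th e x)"
 by (rule ce.wds_th[where S = "rws M" and T = "rws M"]) auto

lemma wds_rws_qw: "list_all (real_ltr M) w ==> wds (rws M) (ce.qw w)"
proof (induction w)
 case (Cons m w)
 have "wds (rws M) (Dl M m)" using lel_Dl lel_iff by blast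
 hence "wds (rws M) (ce.th (Dl M m) (bs (0, w)))" using Cons by (intro wds_rws_th) auto
 moreover have "wds (rws M) (ce.th (lt m) (ce.qw w))" using Cons by (intro wds_rws_th) (auto simp: lt_def)
 ultimately show ?case unfolding ce.qw.simps by (intro keys_subset_add keys_subset_sc)
qed simp

lemma wds_rws_Q: "wds (rws M) x ==> wds (rws M) (ce.Q x)"
 by (rule ce.wds_Q) (use wds_rws_qw in auto)

lemma Q_Dl: "ce.Q (Dl M m) = 0"
proof (cases "real_ltr M m")
 case True
 then obtain b where b: "b \<in> hbas M" "m = ltr M b" by (rule real_ltrE)
 have s: "single 0 b \<in> carC L M" using b by (intro mc.single_car mons_0 mc.bas_car)
 have "ce.Q (Dl M m) = emb M (d_tot L M (d_tot L M (single 0 b)))"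
  using b by (simp add: Dl_ltr Q_emb A.tot_car mc.bas_car d_tot_0)
 thus ?thesis by (simp add: dd[OF s])
qed (simp add: Dl_def)

lemma prd_inA_lt_inject:
 assumes "rcA L c" "sm L c (lt m) = 0"
 shows "c = 0"
proof -
 have 1: "sm L c (lt m) = ext (%a. bs (a, [m])) c" (is "?f c = ?g c")
 proof (rule klin_eqI[of "%c. sm L c (lt m)" "ext (%a. bs (a, [m]))"])
  fix a assume "a \<in> keys c"
  hence "a \<in> mons L" using assms(1) by blast
  thus "sm L (bs a) (lt m) = ext (%a. bs (a, [m])) (bs a)"
   by (simp add: lt_def bs_split[symmetric])
 qed (intro klin_intros, rule klin_ext)
 have l: "lookup (ext (%a. bs (a, [m])) c) (a, [m]) = lookup c a" for a
  by (simp add: ext_def lookup_sum lookup_bs in_keys_iff if_distrib cong: if_cong)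
 show ?thesis by (rule poly_mapping_eqI) (use 1 l assms(2) in simp)
qed

text \<open>Evaluate the square of Q at x^a b for a basis vector b. The cross terms cancel and
  \<open>Q (D b)\<close> vanishes, so what remains is d_CE d_CE x^a times the letter b, from which
  the coefficient can be read off. A letter of \<open>M\<close> is required for this.\<close>

lemma vf_dgn_dgn:
 assumes b: "b \<in> hbas M" and x: "rc L x"
 shows "vf L (dgn L) (vf L (dgn L) (x :: ('m, 'k) walg)) = 0"
proof -
 have z: "vfA L (dgn L) (vfA L (dgn L) (bs a)) = 0" if a: "a \<in> mons L" for a
 proof (rule prd_inA_lt_inject[of _ "ltr M b"])
  show "rcA L (vfA L (dgn L) (vfA L (dgn L) (bs a)))" by (rule ce.rcA_vfA)
  have s: "single a b \<in> carC L M" using a b by (intro mc.single_car mc.bas_car)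
  have e: "emb M (single a b) = sm L (bs a) (lt (ltr M b))"
   unfolding mc.emb_single_bas[OF b] by (simp add: bs_split[OF a] lt_def)
  have "ce.Q (ce.Q (emb M (single a b))) = 0" by (simp add: Q_emb s d_tot_car dd)
  moreover have "ce.Q (emb M (single a b)) =
    sm L (vfA L (dgn L) (bs a)) (lt (ltr M b)) + sm L (sk (mdeg L a) (bs a)) (Dl M (ltr M b))"
  proof -
   have "sgno L 1 (inA (bs a)) = (inA (sk (mdeg L a) (bs a)) :: ('m, 'k) walg)"
    by (subst sgno_hom[where n = "mdeg L a"]) (simp_all add: inA_bs inA_sc)
   thus ?thesis unfolding e using a by (simp add: ce.Q_sym inA_vfA lt_def del: ce.qw.simps)
  qed
  moreover have "ce.Q (sm L (vfA L (dgn L) (bs a)) (lt (ltr M b))) =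
   sm L (vfA L (dgn L) (vfA L (dgn L) (bs a))) (lt (ltr M b)) +
   prd L (sgno L 1 (inA (vfA L (dgn L) (bs a)))) (Dl M (ltr M b))"
   unfolding ce.Q_sym[OF ce.rcA_vfA rc_lt] by (simp add: inA_vfA lt_def del: ce.qw.simps)
  moreover have "ce.Q (sm L (sk (mdeg L a) (bs a)) (Dl M (ltr M b))) =
   sm L (vfA L (dgn L) (sk (mdeg L a) (bs a))) (Dl M (ltr M b))"
  proof -
   have "rcA L (sk (mdeg L a) (bs a))" using a by (intro keys_subset_sc) simp
   from ce.Q_sym[OF this el_rc[OF ce.D_el]] show ?thesis by (simp add: inA_vfA Q_Dl)
  qed
  moreover have "sgno L 1 (inA (vfA L (dgn L) (bs a))) + inA (vfA L (dgn L) (sk (mdeg L a) (bs a))) =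
    (0 :: ('m, 'k) walg)"
  proof -
   have h: "hom L (1 + mdeg L a) (vf L (dgn L) (inA (bs a) :: ('m, 'k) walg))"
    by (rule hom_vf[OF vfdeg_dgn]) (simp add: inA_bs)
   show ?thesis unfolding inA_vfA sgno_hom[OF h]
    by (simp add: inA_sc vf_sc ksign_def sc_minus_left)
  qed
  ultimately show "sm L (vfA L (dgn L) (vfA L (dgn L) (bs a))) (lt (ltr M b)) = 0"
   by (simp add: ce.Q_add add.assoc prd_add_left[symmetric])
 qed
 show ?thesis
 proof (rule rc_eqI[OF _ _ x, of "%x. vf L (dgn L) (vf L (dgn L) x)" "%x. 0"])
  fix a and w :: "'m letter list" assume a: "a \<in> mons L"
  have "vf L (dgn L) (vf L (dgn L) (sm L (bs a) (bs (0, w)))) =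
   prd L (vf L (dgn L) (vf L (dgn L) (inA (bs a)))) (bs (0, w))"
   by (simp add: vf_split[OF vfdeg_dgn a] vf_prd[OF vfdeg_dgn])
  also have "vf L (dgn L) (vf L (dgn L) (inA (bs a))) = (0 :: ('m, 'k) walg)"
   using z[OF a] by (simp add: inA_vfA[symmetric])
  finally show "vf L (dgn L) (vf L (dgn L) (sm L (bs a) (bs (0, w)))) = 0" by simp
 qed (intro klin_intros)+
qed

lemma Q_Q: "b \<in> hbas M ==> rc L x ==> ce.Q (ce.Q x) = 0"
 by (rule ce.Q_Q) (simp_all add: vf_dgn_dgn Q_Dl)

end

section \<open>Transfer between operations on cochains and operators on words\<close>

lemma leib_sum_transfer:
 assumes n: "length ds = length xs" and xs: "set xs <= S"
  and l: "!!ys. ys ~= [] ==> set ys <= S ==> l ys \<in> S \<and> l' (map h ys) = h (l ys)"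
  and F: "!!ys. ys ~= [] ==> set ys <= S ==> F ys = F' (map h ys)"
 shows "leib_sum W F l xs ds = leib_sum W F' l' (map h xs) ds"
 unfolding leib_sum_def Let_def length_map
proof (intro sum.cong refl)
 fix j k r assume j: "j \<in> {1..length xs}" and k: "k \<in> {j..length xs}" and s: "r \<in> sh (k - j) (j - 1)"
 have p: "r permutes {..<k - 1}" using s j k by (simp add: sh_def)
 have lt: "i < k - 1 ==> r i < length xs" for i using permutes_in_image[OF p, of i] k by auto
 have k1: "k - 1 < length xs" using j k by auto
 have mem: "i < length xs ==> xs ! i \<in> S" for i using xs by auto
 let ?ys = "map (%i. xs ! r i) [k - j..<k - 1] @ [xs ! (k - 1)]"
 let ?zs = "map (%i. xs ! r i) [0..<k - j] @ [l ?ys] @ drop k xs"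
 have y: "map (%i. map h xs ! r i) [k - j..<k - 1] @ [map h xs ! (k - 1)] = map h ?ys" using lt k1 by auto
 have "set ?ys <= S" using lt k1 mem by auto
 hence l1: "l ?ys \<in> S" "l' (map h ?ys) = h (l ?ys)" using l[of ?ys] by simp_all
 have "set ?zs <= S" using lt j mem xs set_drop_subset[of k xs] l1 by auto
 hence "F ?zs = F' (map h ?zs)" by (intro F) simp_all
 moreover have "map (%i. map h xs ! r i) [0..<k - j] @ [l' (map h ?ys)] @ drop k (map h xs) = map h ?zs"
  unfolding l1(2) using lt j by (auto simp: drop_map)
 ultimately show "scl W (koszul ds (k - 1) r * ksign (\<Sum>i<k - j. ds ! r i)) (F ?zs) =
  scl W (koszul ds (k - 1) r * ksign (\<Sum>i<k - j. ds ! r i)) (F' (map (%i. map h xs ! r i) [0..<k - j] @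
   [l' (map (%i. map h xs ! r i) [k - j..<k - 1] @ [map h xs ! (k - 1)])] @ drop k (map h xs)))"
  unfolding y by (simp only:)
qed

lemma comp_sum_transfer:
 assumes xs: "set xs <= S" "xs ~= []"
  and l: "!!ys. ys ~= [] ==> set ys <= S ==> l ys \<in> S' \<and> l' (map h ys) = h' (l ys)"
  and F: "!!ys. ys ~= [] ==> set ys <= S' ==> F ys = F' (map h' ys)"
 shows "comp_sum W F l xs ds = comp_sum W F' l' (map h xs) ds"
 unfolding comp_sum_def length_map
proof (intro sum.cong refl)
 fix "is" sg assume i: "is \<in> compositions (length xs)" and s: "sg \<in> ordered_shuffles is"
 have p: "sg permutes {..<length xs}" and z: "0 \<notin> set is" and n: "sum_list is = length xs"
  using i s by (auto simp: ordered_shuffles_def compositions_def)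
 have lt: "i < length xs ==> sg i < length xs" for i using permutes_in_image[OF p, of i] by simp
 have mem: "i < length xs ==> xs ! i \<in> S" for i using xs by auto
 let ?b = "%r. [psum is r..<psum is (Suc r)]"
 let ?y = "%r. map (%i. xs ! sg i) (?b r)"
 have y: "l (?y r) \<in> S'" "l' (map (%i. map h xs ! sg i) (?b r)) = h' (l (?y r))" if r: "r < length is" for r
 proof -
  have b: "psum is (Suc r) \<le> length xs" using sum_list_take_le[of "Suc r" "is"] n by simp
  have "?b r ~= []" using sum_list_take_pos[OF z r] unfolding upt_eq_Nil_conv by linarith
  hence ne: "?y r ~= []" by (simp only: map_is_Nil_conv not_False_eq_True)
  have m: "map (%i. map h xs ! sg i) (?b r) = map h (?y r)" using lt b by (auto intro!: map_cong)
  have "set (?y r) <= S" using lt b mem by auto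
  from l[OF ne this] show "l (?y r) \<in> S'" "l' (map (%i. map h xs ! sg i) (?b r)) = h' (l (?y r))"
   unfolding m by blast+
 qed
 let ?zs = "map (%r. l (?y r)) [0..<length is]"
 have "is ~= []" using n xs(2) by auto
 hence "F ?zs = F' (map h' ?zs)" using y(1) by (intro F) auto
 moreover have "map (%r. l' (map (%i. map h xs ! sg i) (?b r))) [0..<length is] = map h' ?zs"
  using y(2) by simp
 ultimately show "scl W (koszul ds (length xs) sg) (F ?zs) =
   scl W (koszul ds (length xs) sg) (F' (map (%r. l' (map (%i. map h xs ! sg i) (?b r))) [0..<length is]))"
  by (simp only:)
qed

lemma lookup_pr1: "lookup (pr1 x) b = (if length (snd b) = 1 then lookup x b else 0)"
proof -
 have "lookup (pr1 x) b = (\<Sum>c\<in>keys x. if c = b then (if length (snd b) = 1 then lookup x b else 0) else 0)"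
  unfolding pr1_def ext_def lookup_sum by (intro sum.cong refl) (auto simp: lookup_bs)
 also have "\<dots> = (if length (snd b) = 1 then lookup x b else 0)"
  by (auto simp: in_keys_iff)
 finally show ?thesis .
qed

lemma keys_pr1: "keys (pr1 x) = {b \<in> keys x. length (snd b) = 1}"
 by (auto simp: in_keys_iff lookup_pr1 split: if_splits)

lemma el_pr1: "rc L x ==> el L (pr1 x)"
proof
 fix p assume x: "rc L x" and p: "p \<in> keys (pr1 x)"
 then obtain m where "snd p = [m]" "fst p \<in> mons L" unfolding keys_pr1 by (auto simp: length_Suc_conv One_nat_def)
 thus "p \<in> {(a, [m]) |a m. a \<in> mons L}" by (cases p) auto
qed

lemma wds_mono: "wds S x ==> S <= T ==> wds T x"
 by blast

lemma Wd_update: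
 assumes "i < length es"
 shows "Wd L (es[i := e]) = prd L (Wd L (take i es)) (prd L e (Wd L (drop (Suc i) es)))"
 unfolding upd_conv_take_nth_drop[OF assms] Wd_append Wd_Cons ..

text \<open>The multilinear operation induced by an operator on words: the brackets for Q, the
  components of a morphism for a comultiplicative map.\<close>

definition opr :: "('k::real_normed_field, 'g) dgla => ('k, 'm::ab_group_add) infmod => ('k, 'm) infmod =>
  (('m, 'k) walg => ('m, 'k) walg) => 'm coc list => 'm coc" where
 "opr L V W T xs = prm W (T (Wd L (map (emb V) xs)))"

context cspace
begin

lemma prm_pr1: "prm V (pr1 x) = prm V x"
 by (rule poly_mapping_eqI) (simp add: lookup_prm lookup_pr1)

lemma emb_prm_pr1: "rc L x ==> wds (rws V) x ==> emb V (prm V x) = pr1 x"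
proof -
 assume x: "rc L x" "wds (rws V) x"
 have "wds (rws V) (pr1 x)" using x(2) unfolding keys_pr1 by blast
 hence "lel L V (pr1 x)" unfolding lel_iff using el_pr1[OF x(1)] by blast
 thus ?thesis using emb_prm[of "pr1 x"] prm_pr1 by simp
qed

lemma elh_emb: "list_all2 (%x d. x \<in> gr (coch L (shift 1 V)) d) xs ds ==> elh L (map (emb V) xs) ds"
proof (induction rule: list_all2_induct)
 case (Cons x xs d ds)
 hence "x \<in> carC L V" "hom L d (emb V x)" by (simp_all add: gr_emb)
 thus ?case using Cons lel_el[OF lel_emb] by simp
qed simp

lemma gr_C_car: "list_all2 (%x d. x \<in> gr (coch L (shift 1 V)) d) xs ds ==> set xs <= carC L V"
 by (induction rule: list_all2_induct) (simp_all add: gr_emb)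

lemma wds_Wd_emb: "set xs <= carC L V ==> wds {w. list_all (real_ltr V) w \<and> length w = length xs} (Wd L (map (emb V) xs))"
proof (induction xs)
 case (Cons x xs)
 have "lel L V (emb V x)" using Cons by (intro lel_emb) simp
 hence "wds {[ltr V b] |b. b \<in> hbas V} (emb V x)" by fastforce
 thus ?case unfolding list.map Wd_Cons
  by (rule wds_prd[OF _ Cons.IH]) (use Cons in \<open>auto simp: wmul_list_def\<close>)
qed simp

end

lemma sum_nth_take: "i \<le> length ds ==> (\<Sum>j<i. ds ! j) = sum_list (take i ds :: int list)"
 by (simp add: sum_list_sum_nth atLeast0LessThan min_def)

locale emb2 = V: cspace L V + W: cspace L W
 for L :: "('k::real_normed_field, 'g) dgla" and V W :: "('k, 'm::ab_group_add) infmod" +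
 fixes T :: "('m, 'k) walg => ('m, 'k) walg" and p :: int
 assumes T_lin: "klin T" and T_rc: "rc L x ==> rc L (T x)"
  and T_rws: "rc L x ==> wds (rws V) x ==> wds (rws W) (T x)"
  and T_hom: "hom L n x ==> hom L (n + p) (T x)"
begin

lemma wds_rws_Wd: "set xs <= carC L V ==> wds (rws V) (Wd L (map (emb V) xs))"
 by (rule wds_mono[OF V.wds_Wd_emb]) auto

lemma emb_opr: "set xs <= carC L V ==> emb W (opr L V W T xs) = pr1 (T (Wd L (map (emb V) xs)))"
 unfolding opr_def by (intro W.emb_prm_pr1 T_rc T_rws rc_Wd wds_rws_Wd)

lemma opr_car: "opr L V W T xs \<in> carC L W"
 unfolding opr_def by (intro W.prm_car T_rc rc_Wd)

lemma opr_gr: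
 assumes "list_all2 (%x d. x \<in> gr (coch L (shift 1 V)) d) xs ds"
 shows "opr L V W T xs \<in> gr (coch L (shift 1 W)) (sum_list ds + p)"
 unfolding W.gr_emb emb_opr[OF V.gr_C_car[OF assms]]
 using T_hom[OF hom_Wd[OF V.elh_emb[OF assms]]] by (auto simp: opr_car keys_pr1)

lemma opr_add:
 assumes "i < length xs" "x \<in> carC L V" "y \<in> carC L V"
 shows "opr L V W T (xs[i := x + y]) = opr L V W T (xs[i := x]) + opr L V W T (xs[i := y])"
 using assms unfolding opr_def map_update
 by (simp add: Wd_update V.emb_add prd_add_left prd_add_right klin_add[OF T_lin] W.prm_add)

lemma opr_scl:
 assumes "i < length xs" "x \<in> carC L V"
 shows "opr L V W T (xs[i := scl (coch L V) c x]) = scl (coch L W) c (opr L V W T (xs[i := x]))"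
 using assms unfolding opr_def map_update
 by (simp add: Wd_update V.emb_scl prd_sc_left prd_sc_right klin_sc[OF T_lin] W.prm_sc)

lemma opr_multilinear:
 assumes U: "scl U = scl (coch L V)" "gr U = gr (coch L (shift 1 V))"
  and U': "scl U' = scl (coch L W)" "gr U' = gr (coch L (shift 1 W))"
  and F: "!!ys. ys ~= [] ==> set ys <= carC L V ==> F ys = opr L V W T ys"
 shows "multilinear_deg U U' p F"
 unfolding multilinear_deg_def
proof (intro conjI allI impI)
 have car_U: "car U = carC L V"
  using V.car_C1 by (simp add: car_def is_decomp_def U)
 have upd: "xs[i := z] ~= []" "set (xs[i := z]) <= carC L V"
  if "set xs <= car U" "i < length xs" "z \<in> carC L V" for xs i z
  using that set_update_subset_insert[of xs i z] by (auto simp: car_U)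
 fix xs i x y c assume a: "set xs <= car U" "i < length xs" "x \<in> car U" "y \<in> car U"
 have x: "x \<in> carC L V" "y \<in> carC L V" using a by (simp_all add: car_U)
 show "F (xs[i := x + y]) = F (xs[i := x]) + F (xs[i := y])"
  using F[OF upd[OF a(1,2) x(1)]] F[OF upd[OF a(1,2) x(2)]] F[OF upd[OF a(1,2) car_add[OF V.gs_C x]]]
   opr_add[OF a(2) x] by simp
 show "F (xs[i := scl U c x]) = scl U' c (F (xs[i := x]))"
  using F[OF upd[OF a(1,2) x(1)]] F[OF upd[OF a(1,2) car_scl[OF V.gs_C x(1)]]] opr_scl[OF a(2) x(1)]
  by (simp add: U U')
next
 fix xs ds assume xs: "xs ~= []" and h: "homogeneous U xs ds"
 hence l: "list_all2 (%x d. x \<in> gr (coch L (shift 1 V)) d) xs ds" by (simp add: homogeneous_def U)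
 show "F xs \<in> gr U' (sum_list ds + p)"
  unfolding F[OF xs V.gr_C_car[OF l]] U' by (rule opr_gr[OF l])
qed

lemma opr_A_multilinear:
 fixes U U' :: "('k, mono \<Rightarrow>\<^sub>0 'k, mono \<Rightarrow>\<^sub>0 'm) leib"
 assumes U: "gr U = gr (coch L (shift 1 V))" "amul U = cmul L V"
  and U': "scl U' = scl (coch L W)" "amul U' = cmul L W"
  and F: "!!ys. ys ~= [] ==> set ys <= carC L V ==> F ys = opr L V W T ys"
  and A: "gr A = gr (coch L ground)"
  and T: "!!q u x. homA L q u ==> rcA L u ==> rc L x ==> wds {w. length w = n} x ==>
   pr1 (T (sm L u x)) = sk (p * q) (sm L u (pr1 (T x)))"
 shows "A_multilinear A U U' p F n"
 unfolding A_multilinear_def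
proof (intro allI ballI impI)
 fix xs ds i q u assume a: "u \<in> gr A q" and n: "length xs = n" and i: "i < n" and h: "homogeneous U xs ds"
 have l: "list_all2 (%x d. x \<in> gr (coch L (shift 1 V)) d) xs ds" using h by (simp add: homogeneous_def U)
 note xs = V.gr_C_car[OF l] and e = V.elh_emb[OF l]
 have il: "i < length xs" and len: "length ds = length xs" using i n list_all2_lengthD[OF l] by simp_all
 have ra: "rcA L u" using a unfolding A gr_coch by blast
 have ha: "homA L q u"
 proof
  fix c assume "c \<in> keys u"
  thus "c \<in> {a. mdeg L a = q}" using a by (auto simp: A gr_coch ground_def in_keys_iff split: if_splits)
 qed
 define x where "x = xs ! i"
 have x: "x \<in> carC L V" using xs il by (auto simp: x_def)
 define s where "s = (\<Sum>j<i. ds ! j)"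
 have s: "s = psum ds i" using il len by (simp add: s_def sum_nth_take)
 let ?es = "map (emb V) xs"
 have h1: "hom L s (Wd L (take i ?es))"
  unfolding s by (rule hom_Wd[OF list_all2_takeI[OF e]])
 \<comment> \<open>Moved from position \<open>i\<close> to the front, \<open>u\<close> passes the
   earlier factors, whose total degree is \<open>s\<close>.\<close>
 have up: "Wd L (map (emb V) (xs[i := cmul L V u x])) = sk (s * q) (sm L u (Wd L ?es))"
 proof -
  have "Wd L (map (emb V) (xs[i := cmul L V u x])) =
   prd L (Wd L (take i ?es)) (prd L (sm L u (emb V x)) (Wd L (drop (Suc i) ?es)))"
   using il by (simp add: map_update Wd_update V.emb_cmul[OF x])
  also have "\<dots> = prd L (prd L (Wd L (take i ?es)) (inA u)) (prd L (emb V x) (Wd L (drop (Suc i) ?es)))"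
   by (simp add: prd_assoc)
  also have "prd L (Wd L (take i ?es)) (inA u) = sk (s * q) (sm L u (Wd L (take i ?es)))"
   unfolding commute_inA[OF h1] sgno_hom[OF hom_inA[OF ha]] prd_sc_left ..
  also have "prd L \<dots> (prd L (emb V x) (Wd L (drop (Suc i) ?es))) =
   sk (s * q) (sm L u (Wd L (?es[i := emb V x])))"
   using il by (simp add: Wd_update prd_sc_left prd_assoc)
  also have "?es[i := emb V x] = ?es" using il by (simp add: x_def map_update[symmetric])
  finally show ?thesis .
 qed
 have ne: "xs ~= []" using i n by auto
 have c: "set (xs[i := cmul L V u x]) <= carC L V"
  using set_update_subset_insert[of xs i "cmul L V u x"] xs V.cmul_car[OF x] by blast
 have w: "wds {w. length w = n} (Wd L ?es)"
  using V.wds_Wd_emb[OF xs] n by (elim wds_mono) auto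
 have "F (xs[i := amul U u (xs ! i)]) = opr L V W T (xs[i := cmul L V u x])"
  using F[OF _ c] ne by (simp add: U x_def)
 also have "\<dots> = scl (coch L W) (ksign (s * q)) (scl (coch L W) (ksign (p * q)) (cmul L W u (opr L V W T xs)))"
 proof -
  have "opr L V W T (xs[i := cmul L V u x]) = prm W (pr1 (T (sk (s * q) (sm L u (Wd L ?es)))))"
   unfolding opr_def up W.prm_pr1 ..
  also have "\<dots> = scl (coch L W) (ksign (s * q)) (scl (coch L W) (ksign (p * q)) (prm W (sm L u (pr1 (T (Wd L ?es))))))"
   unfolding klin_sc[OF T_lin] klin_sc[OF klin_pr1[OF klin_id]] T[OF ha ra rc_Wd w] W.prm_sc ..
  also have "prm W (sm L u (pr1 (T (Wd L ?es)))) = cmul L W u (opr L V W T xs)"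
   unfolding W.cmul_prm[OF opr_car] emb_opr[OF xs] ..
  finally show ?thesis .
 qed
 also have "\<dots> = scl U' (ksign (q * (p + s))) (amul U' u (F xs))"
  using module.scale_scale[OF graded_spaceD(2)[OF W.gs_C]] F[OF ne xs]
  by (simp add: U' ksign_add[symmetric] algebra_simps)
 finally show "F (xs[i := amul U u (xs ! i)]) = scl U' (ksign (q * (p + (\<Sum>j<i. ds ! j)))) (amul U' u (F xs))"
  by (simp add: s_def)
qed

end

lemma sum_listset_Cons:
 assumes "finite A" "finite (listset As)"
 shows "(\<Sum>l\<in>listset (A # As). g l) = (\<Sum>a\<in>A. \<Sum>l\<in>listset As. g (a # l))"
proof -
 have "listset (A # As) = (%(a, l). a # l) ` (A \<times> listset As)"
  by (auto simp: set_Cons_def)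
 moreover have "inj_on (%(a, l). a # l) (A \<times> listset As)" by (auto simp: inj_on_def)
 ultimately show ?thesis by (simp only: sum.reindex sum.cartesian_product comp_def case_prod_unfold)
qed

lemma finite_listset: "list_all finite As ==> finite (listset As)"
proof (induction As)
 case (Cons A As)
 have "listset (A # As) = (%(a, l). a # l) ` (A \<times> listset As)"
  by (auto simp: set_Cons_def)
 with Cons show ?case by (simp del: listset.simps)
qed simp

lemma pr1_id: "wds {w. length w = 1} x ==> pr1 x = x"
 by (rule poly_mapping_eqI) (force simp: lookup_pr1 in_keys_iff)

lemma pr1_zero [simp]: "pr1 0 = 0"
 by (rule klin_0[OF klin_pr1[OF klin_id]])

lemma pr1_compl: "wds {w. length w ~= 1} (x - pr1 x)"
 by (auto simp: in_keys_iff lookup_minus lookup_pr1)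

lemma pr1_wds: "wds {w. length w = 1} (pr1 x)"
 by (auto simp: keys_pr1)

text \<open>A map that preserves every condition on words preserves both the length one part and its
  complement.\<close>

lemma pr1_commute:
 assumes "klin T" "!!S x. wds S x ==> wds S (T x)"
 shows "pr1 (T x) = T (pr1 x)"
proof -
 have "pr1 (T x) = pr1 (T (pr1 x)) + pr1 (T (x - pr1 x))"
  unfolding klin_add[OF klin_pr1[OF klin_id], symmetric] klin_add[OF assms(1), symmetric] by simp
 thus ?thesis using pr1_id[OF assms(2)[OF pr1_wds]] pr1_0[OF assms(2)[OF pr1_compl]] by simp
qed

lemma pr1_prd_inA: "pr1 (sm L a x) = sm L a (pr1 x)"
 by (rule pr1_commute) (intro klin_intros, rule wds_prd_inA)

lemma listset_nth: "l \<in> listset As ==> length l = length As \<and> (\<forall>i<length As. l ! i \<in> As ! i)"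
proof (induction As arbitrary: l)
 case (Cons A As)
 then obtain a l' where "l = a # l'" "a \<in> A" "l' \<in> listset As" by (auto simp: set_Cons_def)
 thus ?case using Cons.IH[of l'] by (auto simp: nth_Cons split: nat.split)
qed simp

abbreviation inAs :: "('k::real_normed_field, 'g) dgla => mono list => ('w::graded_word, 'k) galg => ('w, 'k) galg" where
 "inAs L as x \<equiv> foldr (%a. sm L (bs a)) as x"

lemma prd_inAs:
 assumes "hom L d e"
 shows "prd L e (inAs L as x) = sk (d * (\<Sum>a\<leftarrow>as. mdeg L a)) (inAs L as (prd L e x))"
proof (induction as)
 case (Cons a as)
 have h: "hom L (mdeg L a) (inA (bs a))" by (rule hom_inA) simp
 have "prd L e (inA (bs a)) = sk (d * mdeg L a) (sm L (bs a) e)"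
  by (simp add: commute_inA[OF assms] sgno_hom[OF h] prd_sc_left)
 thus ?case using Cons
  by (simp add: prd_assoc[symmetric] prd_sc_left) (simp add: prd_assoc prd_sc_right ksign_add algebra_simps)
qed simp

lemma inAs_sc: "inAs L as (sc c x) = sc c (inAs L as x)"
 by (induction as) (simp_all add: prd_sc_right)

lemma rc_inAs: "rc L x ==> rc L (inAs L as x)"
 by (cases as) simp_all

lemma wds_inAs: "wds S x ==> wds S (inAs L as x)"
 by (induction as) (simp_all add: wds_prd_inA)

text \<open>Collecting the monomials at the front gives the sign exponent of
  \<open>lambda_ext\<close> without the summand 1. That summand is the degree of the bracket and
  comes from \<open>pr1_Q_inAs\<close>.\<close>

lemma Wd_pieces:
 assumes "list_all2 (%m e. hom L (e - 1) (E m)) ms es" "length as = length ms"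
 shows "Wd L (map2 (%a m. sm L (bs a) (E m)) as ms) =
  sk (\<Sum>i<length ms. mdeg L (as ! i) * (\<Sum>j<i. es ! j - 1)) (inAs L as (Wd L (map E ms)))"
 using assms
proof (induction arbitrary: as rule: list_all2_induct)
 case (Cons m ms e es)
 then obtain a as' where as: "as = a # as'" "length as' = length ms" by (cases as) auto
 let ?S = "\<Sum>i<length ms. mdeg L (as' ! i) * (\<Sum>j<i. es ! j - 1)"
 have "(\<Sum>i<length (m # ms). mdeg L (as ! i) * (\<Sum>j<i. (e # es) ! j - 1)) =
  (\<Sum>i<length ms. mdeg L (as' ! i) * ((e - 1) + (\<Sum>j<i. es ! j - 1)))"
  unfolding as length_Cons by (subst sum.lessThan_Suc_shift) (simp add: sum.lessThan_Suc_shift del: sum.lessThan_Suc)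
 also have "\<dots> = (\<Sum>i<length ms. mdeg L (as' ! i)) * (e - 1) + ?S"
  by (simp only: distrib_left sum.distrib sum_distrib_right)
 also have "(\<Sum>i<length ms. mdeg L (as' ! i)) = (\<Sum>a\<leftarrow>as'. mdeg L a)"
  unfolding as(2)[symmetric] by (simp add: sum_list_sum_nth atLeast0LessThan)
 finally have ex: "(\<Sum>i<length (m # ms). mdeg L (as ! i) * (\<Sum>j<i. (e # es) ! j - 1)) =
  (\<Sum>a\<leftarrow>as'. mdeg L a) * (e - 1) + ?S" .
 show ?case unfolding ex
  using Cons by (simp add: as Wd_Cons prd_sc_right prd_assoc prd_inAs inAs_sc ksign_add mult.commute)
qed simp

section \<open>The explicit brackets as the length one part of Q\<close>

context wlp
begin

lemma lin_ext_f_0: "v \<in> car M ==> lin_adj L f (single 0 v) = tot f v"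
proof (rule ac.emb_inj)
 assume v: "v \<in> car M"
 show "emb (adjoint L) (lin_adj L f (single 0 v)) = emb (adjoint L) (tot f v)"
  using ac.lel_emb[OF F.F.tot_car[OF v]]
  by (simp add: F.F.emb_lin_ext_single v inA_bs prd_one_left el_rc[OF lel_el])
qed (simp_all add: F.F.lin_ext_car F.F.tot_car mc.single_car)

abbreviation "e0 v \<equiv> emb M (single 0 v)"

lemma e0_car: "v \<in> car M ==> single 0 v \<in> carC L M"
 by (simp add: mc.single_car)

lemma nab_e0: "v \<in> car M ==> nab L (Fl L M f) (e0 v) x = vf L (cmp L (tot f v)) x"
 by (simp add: F.nab_emb e0_car lin_ext_f_0)

lemma keys_e0: "keys (e0 v) <= {b. fst b = 0}"
 using mc.keys_emb[of "single 0 v"] by (auto simp: keys_single split: if_splits)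

lemma hom_e0: "v \<in> gr M d ==> hom L (d - 1) (e0 v)"
 using mc.hom_emb[OF single_gr_coch[OF mc.gs_V mons_0]] by simp

lemma Q_e0: "v \<in> car M ==> ce.Q (e0 v) = emb M (tot (act M) v)"
 by (simp add: Q_emb e0_car d_tot_0)

lemma el_emb: "X \<in> carC L M ==> el L (emb M X)"
 using mc.lel_emb by (rule lel_el)

lemma Wd_e0:
 assumes "set ms <= car M"
 shows "keys (Wd L (map e0 ms)) <= {b. fst b = 0}"
 using assms
proof (induction ms)
 case (Cons m ms)
 thus ?case
  by (simp add: Wd_Cons) (rule keys_prd[OF keys_e0], auto)
qed simp

text \<open>In the recursion for Q every product with a nonempty word has length at least two, and a
  vector field kills the constant coefficients of \<open>x\<close>. What survives in length one is
  the contraction of Q x with f(m).\<close>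

lemma pr1_Q_e0:
 assumes m: "m \<in> gr M d" and x: "ne L x" "keys x <= {b. fst b = 0}"
 shows "pr1 (ce.Q (prd L (e0 m) x)) = sk (d - 1) (vf L (cmp L (tot f m)) (pr1 (ce.Q x)))"
proof -
 have mc: "m \<in> car M" by (rule gr_car[OF mc.gs_V m])
 have el: "el L (e0 m)" by (rule el_emb[OF e0_car[OF mc]])
 note rc = ne_rc[OF x(1)]
 have z: "vf L v x = 0" for v by (rule vf_fst_0[OF x(2)])
 have w: "wds {w. w ~= []} x" "wds {w. w ~= []} (ce.Q x)"
  using x(1) primD(3)[OF ce.prim_Q x(1)] by blast+
 have big: "pr1 (prd L e y) = 0" if "el L e" "wds {w. w ~= []} y" for e y :: "('m, 'k) walg"
 proof (rule pr1_0)
  have "wds {w. length w = 1} e" using that(1) by fastforce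
  thus "wds {w. length w ~= 1} (prd L e y)"
   by (rule wds_prd[OF _ that(2)]) (auto simp: wmul_list_def One_nat_def length_Suc_conv)
 qed
 have th: "ce.th (e0 m) x = prd L (e0 m) x" by (simp add: ce.th_def nab_e0[OF mc] z)
 have "pr1 (ce.Q (prd L (e0 m) x)) = pr1 (ce.th (ce.Q (e0 m)) x + sk (d - 1) (ce.th (e0 m) (ce.Q x)))"
  unfolding th[symmetric] ce.Q_th[OF el hom_e0[OF m] rc] ..
 also have "\<dots> = sk (d - 1) (pr1 (vf L (cmp L (tot f m)) (ce.Q x)))"
  unfolding ce.th_def nab_e0[OF mc] Q_e0[OF mc] F.nab_emb[OF A.tot_car[OF mc]] z
   klin_add[OF klin_pr1[OF klin_id]] klin_sc[OF klin_pr1[OF klin_id]]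
  by (simp add: big[OF el w(2)] big[OF el_emb[OF A.tot_car[OF mc]] w(1)])
 also have "pr1 (vf L (cmp L (tot f m)) (ce.Q x)) = vf L (cmp L (tot f m)) (pr1 (ce.Q x))"
  by (rule pr1_commute) (intro klin_intros, rule wds_vf)
 finally show ?thesis .
qed

abbreviation "chain ms X \<equiv> foldr (%m. contr_coch L M (tot f m)) ms X"

lemma chain_car: "X \<in> carC L M ==> chain ms X \<in> carC L M"
 by (induction ms) (simp_all add: mc.contr_coch_car)

lemma list_all2_gr_car: "list_all2 (%m e. m \<in> gr M e) ms es ==> set ms <= car M"
 by (induction rule: list_all2_induct) (simp_all add: gr_car[OF mc.gs_V])

lemma list_all_el_e0:
 assumes "set ms <= car M"
 shows "list_all (el L) (map e0 ms)"
 unfolding list_all_iff set_map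
proof
 fix e assume "e \<in> e0 ` set ms"
 then obtain m where "m \<in> set ms" "e = e0 m" by blast
 thus "el L e" using assms el_emb[OF e0_car] by blast
qed

text \<open>Iterating \<open>pr1_Q_e0\<close> over all letters but the last leaves the differential
  of the last one under contractions with f of the others, as in the formula for the
  brackets.\<close>

lemma pr1_Q_words:
 assumes "list_all2 (%m e. m \<in> gr M e) ms es" "ms ~= []"
 shows "pr1 (ce.Q (Wd L (map e0 ms))) =
  sk (\<Sum>e\<leftarrow>butlast es. e - 1) (emb M (chain (butlast ms) (tot (act M) (last ms))))"
 using assms
proof (induction rule: list_all2_induct)
 case (Cons m ms e es)
 have m: "m \<in> car M" using Cons by (simp add: gr_car[OF mc.gs_V])
 note msc = list_all2_gr_car[OF Cons(2)]
 show ?case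
 proof (cases "ms = []")
  case True
  hence "es = []" using Cons(2) by simp
  thus ?thesis
   by (simp add: True Wd_single el_rc[OF el_emb[OF e0_car[OF m]]] Q_e0[OF m] pr1_el[OF el_emb[OF A.tot_car[OF m]]])
 next
  case False
  hence es: "es ~= []" using Cons(2) by auto
  have l: "last ms \<in> car M" using False msc by auto
  note el = list_all_el_e0[OF msc]
  have ne: "ne L (Wd L (map e0 ms))" by (rule ne_Wd[OF el]) (simp add: False)
  show ?thesis
   using Cons False es
   by (simp add: Wd_Cons pr1_Q_e0[OF _ ne Wd_e0[OF msc]] vf_sc mc.emb_contr_coch chain_car A.tot_car l ksign_add)
 qed
qed simp

lemma tot_act_Suc: "m \<in> gr M d ==> tot (act M) m = act M 0 m + tot (%k. act M (Suc k)) m"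
proof -
 assume m: "m \<in> gr M d"
 note mc = gr_car[OF mc.gs_V m]
 obtain K0 where K0: "\<forall>K'\<ge>K0. tot (act M) m = (\<Sum>k<K'. act M k m)" using A.f_supp[OF mc] by blast
 obtain K1 where K1: "\<forall>k\<ge>K1. act M k m = 0" using A.f_fin[OF mc] by blast
 let ?K = "max K0 K1"
 have "tot (%k. act M (Suc k)) m = (\<Sum>k<?K. act M (Suc k) m)"
  unfolding tot_def
 proof (rule sum.mono_neutral_left)
  show "{k. act M (Suc k) m ~= 0} <= {..<?K}"
  proof
   fix k assume "k \<in> {k. act M (Suc k) m ~= 0}"
   hence "\<not> K1 \<le> Suc k" using K1 by blast
   thus "k \<in> {..<?K}" by simp
  qed
 qed auto
 moreover have "tot (act M) m = (\<Sum>k<Suc ?K. act M k m)" by (rule K0[rule_format]) (simp add: le_SucI)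
 ultimately show ?thesis by (simp only: sum.lessThan_Suc_shift)
qed

text \<open>The component of arity 0 has constant coefficients, so the innermost contraction kills
  it. This is why the bracket formula may start its sum at k = 1.\<close>

lemma chain_act_Suc:
 assumes m: "m \<in> gr M d" and ms: "ms ~= []"
 shows "chain ms (tot (%k. act M (Suc k)) m) = chain ms (tot (act M) m)"
  and "tot (%k. act M (Suc k)) m \<in> carC L M"
proof -
 let ?X = "tot (%k. act M (Suc k)) m"
 note mc = gr_car[OF mc.gs_V m]
 have a0: "act M 0 m \<in> carC L M" by (rule gr_car[OF mc.gs_C A.f_gr[OF m]])
 have "?X = tot (act M) m + scl (coch L M) (- 1) (act M 0 m)"
  using tot_act_Suc[OF m]
  by (simp add: module.scale_minus_left[OF graded_spaceD(2)[OF mc.gs_C]] module.scale_one[OF graded_spaceD(2)[OF mc.gs_C]])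
 thus X: "?X \<in> carC L M"
  by (simp add: car_add[OF mc.gs_C] A.tot_car[OF mc] car_scl[OF mc.gs_C] a0)
 obtain ms' m' where ms': "ms = ms' @ [m']" using ms by (metis rev_exhaust)
 have "keys (act M 0 m) <= {0}"
 proof
  fix a assume a: "a \<in> keys (act M 0 m)"
  hence "arity a = 0" using A.f_arity[OF mc, of 0] by (simp add: has_arity_def)
  hence "lookup a i = 0" for i by (auto simp: arity_def in_keys_iff)
  hence "a = 0" by (intro poly_mapping_eqI) simp
  thus "a \<in> {0}" by simp
 qed
 hence "keys (emb M (act M 0 m)) <= {b. fst b = 0}" using mc.keys_emb[of "act M 0 m"] by auto
 hence z: "vf L v (emb M (act M 0 m)) = 0" for v by (rule vf_fst_0)
 have "contr_coch L M (tot f m') ?X = contr_coch L M (tot f m') (tot (act M) m)"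
 proof (rule mc.emb_inj)
  show "emb M (contr_coch L M (tot f m') ?X) = emb M (contr_coch L M (tot f m') (tot (act M) m))"
   unfolding mc.emb_contr_coch[OF X] mc.emb_contr_coch[OF A.tot_car[OF mc]]
   unfolding tot_act_Suc[OF m] mc.emb_add[OF a0 X] vf_add z by simp
 qed (simp_all add: mc.contr_coch_car X A.tot_car mc)
 thus "chain ms ?X = chain ms (tot (act M) m)" by (simp add: ms')
qed

lemma sum_list_minus_1: "(\<Sum>e\<leftarrow>es. e - 1) = sum_list es - int (length es)"
 by (induction es) simp_all

lemma lambda_gen:
 assumes h: "list_all2 (%m e. m \<in> gr M e) ms es" and n: "2 \<le> length ms"
 shows "emb M (lambda_gen L M f ms es) = pr1 (ce.Q (Wd L (map e0 ms)))"
  and "lambda_gen L M f ms es \<in> carC L M"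
proof -
 have ne: "butlast ms ~= []" "ms ~= []" "length es = length ms"
  using n list_all2_lengthD[OF h] by (cases ms; auto split: if_splits)+
 have l: "last ms \<in> gr M (last es)"
 proof -
  have "es ~= []" using ne by auto
  thus ?thesis using h ne by (simp add: list_all2_conv_all_nth last_conv_nth)
 qed
 note c = chain_act_Suc[OF l ne(1)]
 have k: "ksign (sum_list (butlast es) - int (length ms) + 1) = (ksign (\<Sum>e\<leftarrow>butlast es. e - 1) :: 'k)"
  using ne n by (intro arg_cong[where f = ksign]) (simp add: sum_list_minus_1 of_nat_diff)
 show "lambda_gen L M f ms es \<in> carC L M"
  unfolding lambda_gen_def by (intro car_scl[OF mc.gs_C] chain_car c(2))
 show "emb M (lambda_gen L M f ms es) = pr1 (ce.Q (Wd L (map e0 ms)))"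
  unfolding lambda_gen_def c(1) k pr1_Q_words[OF h ne(2)]
  by (rule mc.emb_scl[OF chain_car[OF A.tot_car[OF gr_car[OF mc.gs_V l]]]])
qed

text \<open>d_CE of a coefficient leaves the length of the word unchanged, which is not one; only
  the sign of moving Q past the coefficients remains.\<close>

lemma pr1_Q_inAs:
 assumes a: "set as <= mons L" and x: "rc L x" and w: "wds {w. length w = n} x" "n ~= 1"
 shows "pr1 (ce.Q (inAs L as x)) = sk (\<Sum>a\<leftarrow>as. mdeg L a) (inAs L as (pr1 (ce.Q x)))"
 using a
proof (induction as)
 case (Cons a as)
 hence a: "rcA L (bs a)" by simp
 have "pr1 (prd L (vf L (dgn L) (inA (bs a))) (inAs L as x)) = 0"
  unfolding inA_vfA[symmetric]
  by (intro pr1_0 wds_prd_inA wds_inAs wds_mono[OF w(1)]) (use w(2) in auto)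
 moreover have "sgno L 1 (inA (bs a)) = sk (mdeg L a) (inA (bs a) :: ('m, 'k) walg)"
  by (subst sgno_hom[where n = "mdeg L a"]) (simp_all add: inA_bs)
 ultimately show ?case
  using Cons by (simp add: ce.Q_sym[OF a rc_inAs[OF x]] klin_add[OF klin_pr1[OF klin_id]] prd_sc_left
   klin_sc[OF klin_pr1[OF klin_id]] pr1_prd_inA prd_sc_right ksign_add)
qed simp

lemma emb_expand:
 assumes x: "x \<in> carC L M"
 shows "emb M x = (\<Sum>a\<in>keys x. \<Sum>e\<in>hsupp M (lookup x a). sm L (bs a) (e0 (hcomp M (lookup x a) e)))"
proof -
 have l: "lookup x a \<in> car M" "a \<in> keys x ==> a \<in> mons L" for a using x by (auto simp: mc.car_C)
 have h: "hcomp M (lookup x a) e \<in> car M" for a e by (rule gr_car[OF mc.gs_V hcomp_gr_mem[OF mc.gs_V]])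
 have c: "a \<in> keys x ==> single a (hcomp M (lookup x a) e) \<in> carC L M" for a e
  by (intro mc.single_car l(2) h)
 have s: "emb M (single a v) = sm L (bs a) (e0 v)" if a: "a \<in> mons L" and v: "v \<in> car M" for a v
 proof -
  have "cmul L M (bs a) (single 0 v) = single a v"
   using a by (cases "v = 0") (simp_all add: mc.cmul_alt bs_def)
  thus ?thesis using mc.emb_cmul[OF e0_car[OF v], of "bs a"] by simp
 qed
 have "x = (\<Sum>a\<in>keys x. \<Sum>e\<in>hsupp M (lookup x a). single a (hcomp M (lookup x a) e))"
  by (subst poly_mapping_sum_single[of x], subst hcomp_sum[OF mc.gs_V l(1)]) (simp only: single_sum)
 hence "emb M x = emb M (\<Sum>a\<in>keys x. \<Sum>e\<in>hsupp M (lookup x a). single a (hcomp M (lookup x a) e))"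
  by (rule arg_cong)
 also have "\<dots> = (\<Sum>a\<in>keys x. \<Sum>e\<in>hsupp M (lookup x a). emb M (single a (hcomp M (lookup x a) e)))"
  by (subst mc.emb_sum, rule car_sum[OF mc.gs_C], rule c, assumption) (intro sum.cong refl mc.emb_sum, rule c, assumption)
 also have "\<dots> = (\<Sum>a\<in>keys x. \<Sum>e\<in>hsupp M (lookup x a). sm L (bs a) (e0 (hcomp M (lookup x a) e)))"
  by (intro sum.cong refl s l h)
 finally show ?thesis .
qed

text \<open>Multilinearity of the product, with the summation indexed as in
  \<open>lambda_ext\<close>.\<close>

lemma Wd_expand:
 assumes "set xs <= carC L M"
 shows "Wd L (map (emb M) xs) = (\<Sum>as\<in>listset (map keys xs).
   \<Sum>es\<in>listset (map (hsupp M) (map2 lookup xs as)).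
    Wd L (map2 (%a m. sm L (bs a) (e0 m)) as (map2 (hcomp M) (map2 lookup xs as) es)))"
 using assms
proof (induction xs)
 case (Cons x xs)
 have f1: "finite (listset (map keys xs))" by (rule finite_listset) (simp add: list_all_iff)
 have f2: "finite (listset (map (hsupp M) vs))" for vs
  by (rule finite_listset) (simp add: list_all_iff finite_hsupp[OF mc.gs_V])
 have "Wd L (map (emb M) (x # xs)) = prd L (emb M x) (Wd L (map (emb M) xs))" by (simp add: Wd_Cons)
 also have "\<dots> = (\<Sum>a\<in>keys x. \<Sum>as\<in>listset (map keys xs). \<Sum>e\<in>hsupp M (lookup x a).
   \<Sum>es\<in>listset (map (hsupp M) (map2 lookup xs as)).
   prd L (sm L (bs a) (e0 (hcomp M (lookup x a) e)))
    (Wd L (map2 (%a m. sm L (bs a) (e0 m)) as (map2 (hcomp M) (map2 lookup xs as) es))))"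
 proof -
  have x: "x \<in> carC L M" and xs: "set xs <= carC L M" using Cons by simp_all
  show ?thesis unfolding emb_expand[OF x] Cons.IH[OF xs]
   by (simp only: prd_sum_left) (simp only: prd_sum_right, intro sum.cong refl sum.swap)
 qed
 also have "\<dots> = (\<Sum>as\<in>listset (map keys (x # xs)).
   \<Sum>es\<in>listset (map (hsupp M) (map2 lookup (x # xs) as)).
    Wd L (map2 (%a m. sm L (bs a) (e0 m)) as (map2 (hcomp M) (map2 lookup (x # xs) as) es)))"
  by (simp add: sum_listset_Cons f1 f2 finite_hsupp[OF mc.gs_V] Wd_Cons del: listset.simps map_map)
 finally show ?case .
qed simp

lemma emb_inAs: "X \<in> carC L M ==> foldr (%a. cmul L M (single a 1)) as X \<in> carC L M \<and>
  emb M (foldr (%a. cmul L M (single a 1)) as X) = inAs L as (emb M X)"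
 by (induction as) (simp_all add: mc.cmul_car mc.emb_cmul bs_def)

lemma lambda_ext:
 assumes xs: "set xs <= carC L M" and n: "2 \<le> length xs"
 shows "emb M (lambda_ext L M f xs) = pr1 (ce.Q (Wd L (map (emb M) xs)))"
  and "lambda_ext L M f xs \<in> carC L M"
proof -
 have main: "emb M (scl (coch L M) (ksign (\<Sum>i<length xs. mdeg L (as ! i) * (1 + (\<Sum>j<i. es ! j - 1))))
     (foldr (%a. cmul L M (single a 1)) as (lambda_gen L M f (map2 (hcomp M) (map2 lookup xs as) es) es))) =
   pr1 (ce.Q (Wd L (map2 (%a m. sm L (bs a) (e0 m)) as (map2 (hcomp M) (map2 lookup xs as) es)))) \<and>
   scl (coch L M) (ksign (\<Sum>i<length xs. mdeg L (as ! i) * (1 + (\<Sum>j<i. es ! j - 1))))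
     (foldr (%a. cmul L M (single a 1)) as (lambda_gen L M f (map2 (hcomp M) (map2 lookup xs as) es) es)) \<in> carC L M"
  if as: "as \<in> listset (map keys xs)" and es: "es \<in> listset (map (hsupp M) (map2 lookup xs as))" for as es
 proof -
  have la: "length as = length xs" and am: "\<forall>i<length xs. as ! i \<in> keys (xs ! i)" using listset_nth[OF as] by auto
  have le: "length es = length xs" using listset_nth[OF es] la by simp
  have asm: "set as <= mons L"
  proof
   fix a assume "a \<in> set as"
   then obtain i where i: "i < length xs" "a = as ! i" using la by (auto simp: in_set_conv_nth)
   hence "xs ! i \<in> carC L M" using xs by auto
   thus "a \<in> mons L" using am i by (auto simp: mc.car_C)
  qed
  define ms where "ms = map2 (hcomp M) (map2 lookup xs as) es"
  have lm: "length ms = length xs" using la le by (simp add: ms_def)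
  have h: "list_all2 (%m e. m \<in> gr M e) ms es"
   using la le by (auto simp: list_all2_conv_all_nth ms_def hcomp_gr_mem[OF mc.gs_V])
  have h': "list_all2 (%m e. hom L (e - 1) (e0 m)) ms es"
   using h by (rule list_all2_mono) (rule hom_e0)
  note g = lambda_gen[OF h] n[folded lm]
  have w: "wds {w. length w = length ms} (Wd L (map e0 ms))"
   using wds_Wd[OF list_all_el_e0[OF list_all2_gr_car[OF h]]] unfolding length_map .
  have ne1: "length ms ~= 1" using g(3) by simp
  let ?X = "lambda_gen L M f ms es"
  let ?f = "foldr (%a. cmul L M (single a 1)) as ?X"
  have fX: "?f \<in> carC L M" "emb M ?f = inAs L as (pr1 (ce.Q (Wd L (map e0 ms))))"
   using emb_inAs[OF g(2)[OF g(3)], of as] g(1)[OF g(3)] by simp_all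
  have ex: "(\<Sum>i<length xs. mdeg L (as ! i) * (1 + (\<Sum>j<i. es ! j - 1))) =
    (\<Sum>a\<leftarrow>as. mdeg L a) + (\<Sum>i<length ms. mdeg L (as ! i) * (\<Sum>j<i. es ! j - 1))"
   unfolding lm la[symmetric] by (simp add: sum_list_sum_nth atLeast0LessThan distrib_left sum.distrib)
  have "pr1 (ce.Q (Wd L (map2 (%a m. sm L (bs a) (e0 m)) as ms))) =
   sk (\<Sum>i<length ms. mdeg L (as ! i) * (\<Sum>j<i. es ! j - 1)) (pr1 (ce.Q (inAs L as (Wd L (map e0 ms)))))"
   unfolding Wd_pieces[OF h' la[folded lm]] ce.Q_sc klin_sc[OF klin_pr1[OF klin_id]] ..
  also have "pr1 (ce.Q (inAs L as (Wd L (map e0 ms)))) = sk (\<Sum>a\<leftarrow>as. mdeg L a) (inAs L as (pr1 (ce.Q (Wd L (map e0 ms)))))"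
   by (rule pr1_Q_inAs[OF asm rc_Wd w ne1])
  finally have "pr1 (ce.Q (Wd L (map2 (%a m. sm L (bs a) (e0 m)) as ms))) =
   emb M (scl (coch L M) (ksign (\<Sum>i<length xs. mdeg L (as ! i) * (1 + (\<Sum>j<i. es ! j - 1)))) ?f)"
   unfolding ex mc.emb_scl[OF fX(1)] fX(2) ksign_add by (simp add: mult.commute)
  thus ?thesis using car_scl[OF mc.gs_C fX(1)] unfolding ms_def by simp
 qed
 show "lambda_ext L M f xs \<in> carC L M"
  unfolding lambda_ext_def by (intro car_sum[OF mc.gs_C] main[THEN conjunct2])
 have "emb M (lambda_ext L M f xs) = (\<Sum>as\<in>listset (map keys xs).
   \<Sum>es\<in>listset (map (hsupp M) (map2 lookup xs as)).
    pr1 (ce.Q (Wd L (map2 (%a m. sm L (bs a) (e0 m)) as (map2 (hcomp M) (map2 lookup xs as) es)))))"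
  unfolding lambda_ext_def
  apply (subst mc.emb_sum)
   apply (intro car_sum[OF mc.gs_C] main[THEN conjunct2]; assumption)
  apply (intro sum.cong refl)
  apply (subst mc.emb_sum)
   apply (intro main[THEN conjunct2]; assumption)
  apply (intro sum.cong refl main[THEN conjunct1]; assumption)
  done
 thus "emb M (lambda_ext L M f xs) = pr1 (ce.Q (Wd L (map (emb M) xs)))"
  unfolding Wd_expand[OF xs] klin_sum[OF ce.klin_Q[OF klin_id]] klin_sum[OF klin_pr1[OF klin_id]] .
qed

end

section \<open>Leibniz-infinity algebras and morphisms\<close>

lemma rcA_gr: "a \<in> gr (coch L ground) q ==> rcA L a"
 and homA_gr: "a \<in> gr (coch L ground) q ==> homA L q a"
 unfolding gr_coch by (auto simp: ground_def in_keys_iff split: if_splits)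

lemma gs_ground: "graded_space ground"
proof -
 have v: "vector_space ((*) :: 'a::real_normed_field => _)" by unfold_locales (simp_all add: algebra_simps)
 hence m: "module ((*) :: 'a::real_normed_field => _)" by (simp add: module_iff_vector_space)
 have c: "v = c 0 \<and> (\<forall>i. i ~= 0 \<longrightarrow> c i = 0)" if d: "is_decomp ground v c" for v and c :: "int => 'a"
 proof -
  have z: "c i = 0" if "i ~= 0" for i using d that by (auto simp: is_decomp_def ground_def dest: spec[of _ i])
  have "v = (\<Sum>i | c i ~= 0. c i)" using d by (simp add: is_decomp_def)
  also have "\<dots> = (\<Sum>i\<in>{0}. c i)" by (rule sum.mono_neutral_left) (use z in auto)
  finally show ?thesis using z by simp
 qed
 have "c = c'" if "is_decomp ground v c" "is_decomp ground v c'" for v and c c' :: "int => 'a"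
 proof
  fix i show "c i = c' i" using c[OF that(1)] c[OF that(2)] by (cases "i = 0") auto
 qed
 thus ?thesis unfolding graded_space_def
  using v by (auto simp: ground_def module.subspace_def[OF m])
qed

context wlp
begin

abbreviation "G \<equiv> G_object L (M, f)"

lemma d_tot_shift: "d_tot L (shift 1 M) = d_tot L M"
 by (simp add: fun_eq_iff d_tot_def)

lemma G_simps: "scl G = scl (coch L M)" "gr G = gr (coch L (shift 1 M))" "amul G = cmul L M"
 by (simp_all add: G_object_def)

lemma car_G: "car G = carC L M"
 using mc.car_C1 by (simp add: car_def is_decomp_def G_simps)

lemma graded_space_G: "graded_space G"
 using graded_space_coch[OF graded_space_shift[OF mc.gs_V], of L]
 unfolding graded_space_def is_decomp_def G_simps mc.scl_C1 .

lemma emb2_Q: "emb2 L M M ce.Q 1"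
 by unfold_locales (rule ce.klin_Q[OF klin_id], rule ce.rc_Q, erule wds_rws_Q, erule ce.hom_Q)

text \<open>A single formula for all arities: \<open>Q_emb\<close> settles the unary bracket,
  \<open>lambda_ext\<close> the others.\<close>

lemma brk_G: "ys ~= [] ==> set ys <= carC L M ==> brk G ys = opr L M M ce.Q ys"
proof (cases "length ys = 1")
 case True
 assume ys: "set ys <= carC L M"
 from True obtain y where y: "ys = [y]" by (auto simp: length_Suc_conv One_nat_def)
 hence yc: "y \<in> carC L M" using ys by simp
 show ?thesis
  by (simp add: y opr_def G_object_def d_tot_shift Wd_single el_rc[OF el_emb[OF yc]] Q_emb[OF yc] mc.prm_emb[OF d_tot_car[OF yc]])
next
 case False
 assume ne: "ys ~= []" and ys: "set ys <= carC L M"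
 hence n: "2 \<le> length ys" using False by (cases ys; cases "tl ys") (auto simp: One_nat_def)
 have "brk G ys = lambda_ext L M f ys" using False ne by (simp add: G_object_def)
 also have "\<dots> = prm M (pr1 (ce.Q (Wd L (map (emb M) ys))))"
  using mc.prm_emb[OF lambda_ext(2)[OF ys n]] lambda_ext(1)[OF ys n] by simp
 finally show ?thesis by (simp add: mc.prm_pr1 opr_def)
qed

lemma brk_G_car: "ys ~= [] ==> set ys <= carC L M ==> brk G ys \<in> carC L M"
 unfolding brk_G by (rule emb2.opr_car[OF emb2_Q])

lemma emb_brk_G: "ys ~= [] ==> set ys <= carC L M ==>
  emb M (brk G ys) = pr1 (ce.Q (Wd L (map (emb M) ys)))"
 unfolding brk_G by (rule emb2.emb_opr[OF emb2_Q])

lemma CE_simps: "scl (CE L) = sc" "gr (CE L) = gr (coch L ground)" "amult (CE L) = cmul L ground"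
  "aone (CE L) = bs 0" "adiff (CE L) = d_CE L"
 by (simp_all add: CE_def scl_coch sc_def fun_eq_iff bs_def) (simp add: ground_def)

lemma car_CE: "car (CE L) = carC L ground"
 by (simp add: car_def is_decomp_def CE_simps)

lemma graded_module_G: "graded_module (CE L) G"
 unfolding graded_module_def CE_simps G_simps car_G car_CE
proof (intro conjI allI ballI)
 show "graded_space G" by (rule graded_space_G)
next
 fix q u assume a: "u \<in> gr (coch L ground) q"
 show "linear_deg G G q (cmul L M u)"
  unfolding linear_deg_def G_simps car_G
 proof (intro conjI ballI allI)
  fix i X assume "X \<in> gr (coch L (shift 1 M)) i"
  hence O: "X \<in> carC L M" "hom L i (emb M X)" by (simp_all add: mc.gr_emb)
  have "hom L (q + i) (sm L u (emb M X))" by (rule hom_prd[OF hom_inA[OF homA_gr[OF a]] O(2)])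
  thus "cmul L M u X \<in> gr (coch L (shift 1 M)) (i + q)"
   by (simp add: mc.gr_emb mc.cmul_car O mc.emb_cmul add.commute)
 qed (simp_all add: mc.cmul_add_right mc.cmul_scl_right)
next
 fix u b X assume O: "X \<in> carC L M"
 show "cmul L M (u + b) X = cmul L M u X + cmul L M b X" by (rule mc.cmul_add_left)
 show "cmul L M (cmul L ground u b) X = cmul L M u (cmul L M b X)"
  by (rule mc.emb_inj) (simp_all add: mc.cmul_car O mc.emb_cmul inA_cmul prd_assoc)
next
 fix c u X show "cmul L M (sc c u) X = scl (coch L M) c (cmul L M u X)" by (rule mc.cmul_scl_left)
next
 fix X assume "X \<in> carC L M"
 thus "cmul L M (bs 0) X = X" by (rule cmul_one)
qed

text \<open>If \<open>M\<close> is zero, there is no letter from which the square of d_CE could be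
  read off, but then the product itself is zero.\<close>

lemma Q_Q_Wd:
 assumes "set xs <= carC L M" "xs ~= []"
 shows "ce.Q (ce.Q (Wd L (map (emb M) xs))) = 0"
proof (cases "hbas M = {}")
 case True
 obtain x xs' where "xs = x # xs'" using assms(2) by (cases xs) auto
 thus ?thesis using True by (simp add: Wd_Cons emb_def)
next
 case False
 then obtain b where "b \<in> hbas M" by blast
 thus ?thesis by (rule Q_Q) simp
qed

lemma pr1_Q_long:
 assumes "rcA L a" "homA L q a" "rc L x" "wds {w. length w = n} x" "n ~= 1"
 shows "pr1 (ce.Q (sm L a x)) = sk (1 * q) (sm L a (pr1 (ce.Q x)))"
proof -
 have "pr1 (prd L (vf L (dgn L) (inA a)) x) = 0"
  unfolding inA_vfA[symmetric]
  by (intro pr1_0 wds_prd_inA wds_mono[OF assms(4)]) (use assms(5) in auto)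
 thus ?thesis
  by (simp add: ce.Q_sym[OF assms(1,3)] klin_add[OF klin_pr1[OF klin_id]] klin_sc[OF klin_pr1[OF klin_id]]
   sgno_hom[OF hom_inA[OF assms(2)]] prd_sc_left pr1_prd_inA)
qed

lemma leib_algebra_G: "leib_algebra (CE L) G"
 unfolding leib_algebra_def
proof (intro conjI allI impI ballI)
 show "graded_module (CE L) G" by (rule graded_module_G)
 show "multilinear_deg G G 1 (brk G)"
  by (rule emb2.opr_multilinear[OF emb2_Q]) (simp_all add: G_simps brk_G)
next
 fix q u X assume a: "u \<in> gr (CE L) q" and O: "X \<in> car G"
 have O: "X \<in> carC L M" and a: "u \<in> gr (coch L ground) q" using a O by (simp_all add: car_G CE_simps)
 note c = mc.cmul_car[OF O, of u] and s = sgno_hom[OF hom_inA[OF homA_gr[OF a]], of 1]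
 have b: "brk G [X] = d_tot L M X" for X by (simp add: G_object_def d_tot_shift)
 show "brk G [amul G u X] = amul G (adiff (CE L) u) X + scl G (ksign q) (amul G u (brk G [X]))"
  unfolding b G_simps CE_simps
 proof (rule mc.emb_inj)
  show "emb M (d_tot L M (cmul L M u X)) =
   emb M (cmul L M (d_CE L u) X + scl (coch L M) (ksign q) (cmul L M u (d_tot L M X)))"
   by (simp add: Q_emb[symmetric] c O mc.emb_cmul mc.emb_add mc.emb_scl mc.cmul_car d_tot_car car_scl[OF mc.gs_C]
     ce.Q_sym[OF rcA_gr[OF a] el_rc[OF el_emb[OF O]]] inA_d_CE s prd_sc_left)
 qed (simp_all add: c O d_tot_car mc.cmul_car car_add[OF mc.gs_C] car_scl[OF mc.gs_C])
next
 fix n :: nat assume n: "2 \<le> n"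
 show "A_multilinear (CE L) G G 1 (brk G) n"
  by (rule emb2.opr_A_multilinear[OF emb2_Q]) (use n in \<open>simp_all add: G_simps brk_G CE_simps pr1_Q_long\<close>)
next
 fix xs ds assume ne: "xs ~= []" and h: "homogeneous G xs ds"
 hence l: "list_all2 (%x d. x \<in> gr (coch L (shift 1 M)) d) xs ds" by (simp add: homogeneous_def G_simps)
 note xs = mc.gr_C_car[OF l] and e = mc.elh_emb[OF l]
 have len: "length ds = length xs" using list_all2_lengthD[OF l] by simp
 let ?T = "%x. prm M (ce.Q x)" and ?l = "%fs. pr1 (ce.Q (Wd L fs))"
 have "leib_sum G (brk G) (brk G) xs ds = leib_sum G (%es. ?T (Wd L es)) ?l (map (emb M) xs) ds"
  by (rule leib_sum_transfer[OF len xs]) (simp add: brk_G_car emb_brk_G, simp add: brk_G opr_def)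
 also have "\<dots> = ?T (leib_sum Rsp (Wd L) ?l (map (emb M) xs) ds)"
  by (rule leib_sum_linear[symmetric]) (simp_all add: ce.Q_add ce.Q_sc mc.prm_add mc.prm_sc G_simps)
 also have "leib_sum Rsp (Wd L) ?l (map (emb M) xs) ds = ce.Q (Wd L (map (emb M) xs))"
  by (rule prim_leib_sum[OF ce.prim_Q _ e]) (simp, rule el_pr1[OF ce.rc_Q])
 finally show "leib_sum G (brk G) (brk G) xs ds = 0" by (simp add: Q_Q_Wd[OF xs ne])
qed

end

text \<open>Extended by 0, as required of the arrows of \<open>Leib\<close>.\<close>

definition arr :: "('k::real_normed_field, 'g) dgla => ('k, 'm::ab_group_add) infmod => ('k, 'm) infmod =>
  (('m, 'k) walg => ('m, 'k) walg) => 'm coc list => 'm coc" where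
 "arr L V W T xs = (if xs = [] \<or> \<not> set xs <= carC L V then 0 else opr L V W T xs)"

locale leibmap = M: wlp L M f + N: wlp L N g + emb2 L M N \<Phi> 0
 for L :: "('k::real_normed_field, 'g::ab_group_add) dgla" and M :: "('k, 'm::ab_group_add) infmod" and f
  and N :: "('k, 'm) infmod" and g and \<Phi> +
 assumes com: "comul L \<Phi>" and chain: "rc L x ==> \<Phi> (M.ce.Q x) = N.ce.Q (\<Phi> x)"
begin

lemma arr_opr: "ys ~= [] ==> set ys <= carC L M ==> arr L M N \<Phi> ys = opr L M N \<Phi> ys"
 by (simp add: arr_def)

lemma comp_sum_arr:
 fixes W :: "('k, 'w::ab_group_add, 'z) gspace_scheme" and T :: "('m, 'k) walg => 'w"
 assumes F: "!!ys. ys ~= [] ==> set ys <= carC L N ==> F ys = T (Wd L (map (emb N) ys))"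
  and T: "!!x y. T (x + y) = T x + T y" "T 0 = 0" "!!c x. T (sc c x) = scl W c (T x)"
  and ne: "xs ~= []" and l: "list_all2 (%x d. x \<in> gr (coch L (shift 1 M)) d) xs ds"
 shows "comp_sum W F (arr L M N \<Phi>) xs ds = T (\<Phi> (Wd L (map (emb M) xs)))"
proof -
 note xs = M.mc.gr_C_car[OF l] and e = M.mc.elh_emb[OF l]
 let ?l = "%fs. pr1 (\<Phi> (Wd L fs))"
 have "comp_sum W F (arr L M N \<Phi>) xs ds = comp_sum W (%es. T (Wd L es)) ?l (map (emb M) xs) ds"
  by (rule comp_sum_transfer[OF xs ne, where S' = "carC L N" and h' = "emb N"]) (simp_all add: arr_opr opr_car emb_opr F)
 also have "\<dots> = T (comp_sum Rsp (Wd L) ?l (map (emb M) xs) ds)"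
  by (rule comp_sum_linear[symmetric]) (simp_all add: T)
 also have "comp_sum Rsp (Wd L) ?l (map (emb M) xs) ds = \<Phi> (Wd L (map (emb M) xs))"
  by (rule comul_comp_sum[OF com e]) (rule el_pr1[OF T_rc[OF rc_Wd]])
 finally show ?thesis .
qed

text \<open>The two sides of the morphism identity are the length one parts of \<Phi>(Q w) and
  Q(\<Phi> w), by \<open>prim_leib_sum\<close> and \<open>comul_comp_sum\<close>.\<close>

lemma leib_morphism: "leib_morphism (CE L) M.G N.G (arr L M N \<Phi>)"
 unfolding leib_morphism_def
proof (intro conjI allI impI)
 show "multilinear_deg M.G N.G 0 (arr L M N \<Phi>)"
  by (rule opr_multilinear) (simp_all add: M.G_simps N.G_simps arr_opr)
 show "arr L M N \<Phi> xs = 0" if "xs = [] \<or> \<not> set xs <= car M.G" for xs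
  using that by (auto simp: arr_def M.car_G)
 have "pr1 (\<Phi> (sm L a x)) = sk (0 * q) (sm L a (pr1 (\<Phi> x)))"
  if "rcA L a" "rc L x" for q a x
  using that by (simp add: comulD(2)[OF com] pr1_prd_inA)
 thus "A_multilinear (CE L) M.G N.G 0 (arr L M N \<Phi>) n" for n
  by (intro opr_A_multilinear) (simp_all add: M.G_simps N.G_simps M.CE_simps arr_opr)
next
 fix xs ds assume ne: "xs ~= []" and h: "homogeneous M.G xs ds"
 hence l: "list_all2 (%x d. x \<in> gr (coch L (shift 1 M)) d) xs ds" by (simp add: homogeneous_def M.G_simps)
 note xs = M.mc.gr_C_car[OF l] and e = M.mc.elh_emb[OF l]
 have len: "length ds = length xs" using list_all2_lengthD[OF l] by simp
 let ?T = "%x. prm N (\<Phi> x)" and ?l = "%fs. pr1 (M.ce.Q (Wd L fs))"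
 have "leib_sum N.G (arr L M N \<Phi>) (brk M.G) xs ds = leib_sum N.G (%es. ?T (Wd L es)) ?l (map (emb M) xs) ds"
  by (rule leib_sum_transfer[OF len xs]) (simp add: M.brk_G_car M.emb_brk_G, simp add: arr_opr opr_def)
 also have "\<dots> = ?T (leib_sum Rsp (Wd L) ?l (map (emb M) xs) ds)"
  by (rule leib_sum_linear[symmetric])
   (simp_all add: klin_add[OF T_lin] klin_sc[OF T_lin] klin_0[OF T_lin] N.mc.prm_add N.mc.prm_sc N.G_simps)
 also have "leib_sum Rsp (Wd L) ?l (map (emb M) xs) ds = M.ce.Q (Wd L (map (emb M) xs))"
  by (rule prim_leib_sum[OF M.ce.prim_Q _ e]) (simp, rule el_pr1[OF M.ce.rc_Q])
 also have "?T \<dots> = prm N (N.ce.Q (\<Phi> (Wd L (map (emb M) xs))))" by (simp add: chain)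
 also have "\<dots> = comp_sum N.G (brk N.G) (arr L M N \<Phi>) xs ds"
  by (rule comp_sum_arr[symmetric, OF _ _ _ _ ne l])
   (simp_all add: N.brk_G opr_def N.ce.Q_add N.ce.Q_sc N.mc.prm_add N.mc.prm_sc N.G_simps)
 finally show "leib_sum N.G (arr L M N \<Phi>) (brk M.G) xs ds = comp_sum N.G (brk N.G) (arr L M N \<Phi>) xs ds" .
qed

lemma hcomp_G: "hcomp M.G = hcomp (coch L (shift 1 M))" "hsupp M.G = hsupp (coch L (shift 1 M))"
proof -
 have d: "is_decomp M.G = is_decomp (coch L (shift 1 M))" by (intro ext) (simp add: is_decomp_def M.G_simps)
 show "hcomp M.G = hcomp (coch L (shift 1 M))" by (intro ext) (simp only: hcomp_def car_def d)
 thus "hsupp M.G = hsupp (coch L (shift 1 M))" by (intro ext) (simp add: hsupp_def)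
qed

lemma Wd_hcomp:
 assumes "set xs <= carC L M"
 shows "Wd L (map (emb M) xs) = (\<Sum>ds\<in>listset (map (hsupp M.G) xs). Wd L (map (emb M) (map2 (hcomp M.G) xs ds)))"
 using assms
proof (induction xs)
 case (Cons x xs)
 have x: "x \<in> carC L M" and xs: "set xs <= carC L M" using Cons by simp_all
 have gs: "graded_space M.G" by (rule M.graded_space_G)
 have f2: "finite (listset (map (hsupp M.G) xs))"
  by (rule finite_listset) (simp add: list_all_iff finite_hsupp[OF gs])
 have "x = (\<Sum>d\<in>hsupp M.G x. hcomp M.G x d)" using x by (intro hcomp_sum[OF gs]) (simp add: M.car_G)
 hence "emb M x = emb M (\<Sum>d\<in>hsupp M.G x. hcomp M.G x d)" by (rule arg_cong)
 also have "\<dots> = (\<Sum>d\<in>hsupp M.G x. emb M (hcomp M.G x d))"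
  using gr_car[OF gs hcomp_gr_mem[OF gs]] by (intro M.mc.emb_sum) (simp add: M.car_G)
 finally have ex: "emb M x = (\<Sum>d\<in>hsupp M.G x. emb M (hcomp M.G x d))" .
 have "Wd L (map (emb M) (x # xs)) = (\<Sum>d\<in>hsupp M.G x. \<Sum>ds\<in>listset (map (hsupp M.G) xs).
   prd L (emb M (hcomp M.G x d)) (Wd L (map (emb M) (map2 (hcomp M.G) xs ds))))"
  unfolding list.map Wd_Cons ex Cons.IH[OF xs] prd_sum_left by (simp only: prd_sum_right)
 also have "\<dots> = (\<Sum>ds\<in>listset (map (hsupp M.G) (x # xs)). Wd L (map (emb M) (map2 (hcomp M.G) (x # xs) ds)))"
  by (simp add: sum_listset_Cons f2 finite_hsupp[OF gs] Wd_Cons del: listset.simps map_map)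
 finally show ?case .
qed simp

end

lemma comp_sum_Nil: "t [] = 0 ==> module (scl W) ==> comp_sum W t \<phi> [] [] = 0"
proof -
 assume t: "t [] = 0" and W: "module (scl W)"
 have "compositions 0 = {[]}"
 proof (intro equalityI subsetI)
  fix "is" :: "nat list" assume "is \<in> compositions 0"
  thus "is \<in> {[]}" by (cases "is") (auto simp: compositions_def)
 qed (simp add: compositions_def)
 thus ?thesis by (simp add: comp_sum_def t module.scale_zero_right[OF W])
qed

text \<open>By \<open>comul_comp_sum\<close> the inner components reassemble to the full
  comultiplicative map, so the composite of the operations comes from the composite of the
  maps.\<close>

lemma leib_comp_arr:
 fixes M N P :: "('k::real_normed_field, 'm::ab_group_add) infmod"
 assumes 1: "leibmap L M f N g \<Phi>" and 2: "leibmap L N g P h Y"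
 shows "leib_comp (G_object L (M, f)) (G_object L (P, h)) (arr L N P Y) (arr L M N \<Phi>) = arr L M P (%x. Y (\<Phi> x))"
proof
 interpret A: leibmap L M f N g \<Phi> by (rule 1)
 interpret B: leibmap L N g P h Y by (rule 2)
 note gs = A.M.graded_space_G
 fix xs :: "'m coc list"
 consider "xs = []" | "\<not> set xs <= carC L M" | "xs ~= []" "set xs <= carC L M" by blast
 thus "leib_comp A.M.G B.N.G (arr L N P Y) (arr L M N \<Phi>) xs = arr L M P (%x. Y (\<Phi> x)) xs"
 proof cases
  case 1
  thus ?thesis
   using comp_sum_Nil[of "arr L N P Y" B.N.G "arr L M N \<Phi>"] graded_spaceD(2)[OF B.N.graded_space_G]
   by (simp add: leib_comp_def arr_def)
 next
  case 2
  then obtain x where x: "x \<in> set xs" "x \<notin> car A.M.G" by (auto simp: A.M.car_G)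
  \<comment> \<open>By its default value \<open>hcomp\<close> vanishes outside the carrier, so the
    sum that defines the composite is empty.\<close>
  hence "hsupp A.M.G x = {}" by (simp add: hsupp_def hcomp_def)
  hence "listset (map (hsupp A.M.G) xs) = {}"
   using x(1) by (induction xs) (auto simp: set_Cons_def)
  thus ?thesis using 2 by (simp add: leib_comp_def arr_def)
 next
  case 3
  have t: "comp_sum B.N.G (arr L N P Y) (arr L M N \<Phi>) (map2 (hcomp A.M.G) xs ds) ds =
    prm P (Y (\<Phi> (Wd L (map (emb M) (map2 (hcomp A.M.G) xs ds)))))"
   if "ds \<in> listset (map (hsupp A.M.G) xs)" for ds
  proof (rule A.comp_sum_arr)
   have len: "length ds = length xs" using listset_nth[OF that] by simp
   show "map2 (hcomp A.M.G) xs ds ~= []" using 3 len by (cases xs; cases ds) auto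
   show "list_all2 (%x d. x \<in> gr (coch L (shift 1 M)) d) (map2 (hcomp A.M.G) xs ds) ds"
    using len hcomp_gr_mem[OF gs] by (auto simp: list_all2_conv_all_nth A.M.G_simps)
  qed (simp_all add: B.arr_opr opr_def klin_add[OF B.T_lin] klin_sc[OF B.T_lin] klin_0[OF B.T_lin]
    B.N.mc.prm_add B.N.mc.prm_sc B.N.G_simps)
  have "leib_comp A.M.G B.N.G (arr L N P Y) (arr L M N \<Phi>) xs =
   (\<Sum>ds\<in>listset (map (hsupp A.M.G) xs). prm P (Y (\<Phi> (Wd L (map (emb M) (map2 (hcomp A.M.G) xs ds))))))"
   unfolding leib_comp_def by (intro sum.cong refl t)
  also have "\<dots> = prm P (Y (\<Phi> (Wd L (map (emb M) xs))))"
   unfolding A.Wd_hcomp[OF 3(2)] klin_sum[OF A.T_lin] klin_sum[OF B.T_lin] B.N.mc.prm_sum ..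
  also have "\<dots> = arr L M P (%x. Y (\<Phi> x)) xs" using 3 by (simp add: arr_def opr_def)
  finally show ?thesis .
 qed
qed

text \<open>Maps on words may differ on foreign letters; the induced operation sees only words in
  letters of \<open>V\<close>.\<close>

lemma arr_cong:
 assumes V: "cspace V" and eq: "!!x. rc L x ==> wds (rws V) x ==> T x = T' x"
 shows "arr L V W T = arr L V W T'"
proof
 fix xs
 have "T (Wd L (map (emb V) xs)) = T' (Wd L (map (emb V) xs))" if "set xs <= carC L V"
 proof (rule eq)
  show "wds (rws V) (Wd L (map (emb V) xs))"
   by (rule wds_mono[OF cspace.wds_Wd_emb[OF V that]]) auto
 qed simp
 thus "arr L V W T xs = arr L V W T' xs" by (simp add: arr_def opr_def)
qed

lemma (in wlp) arr_id: "arr L M M (%x. x) = Idn (Leib (CE L)) G"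
proof
 fix xs :: "'m coc list"
 consider "xs = [] \<or> \<not> set xs <= carC L M" | x where "xs = [x]" "x \<in> carC L M" | "length xs ~= 1" "xs ~= []" "set xs <= carC L M"
  by (cases xs rule: remdups_adj.cases) auto
 thus "arr L M M (%x. x) xs = Idn (Leib (CE L)) G xs"
 proof cases
  case 1
  hence "arr L M M (%x. x) xs = 0" by (simp add: arr_def)
  moreover have "Idn (Leib (CE L)) G xs = 0"
   using 1 by (auto simp: Leib_def car_G length_Suc_conv One_nat_def)
  ultimately show ?thesis by simp
 next
  case 2
  thus ?thesis by (simp add: arr_def opr_def Wd_single el_rc[OF el_emb] mc.prm_emb Leib_def car_G)
 next
  case 3
  have "pr1 (Wd L (map (emb M) xs)) = 0"
   by (rule pr1_0, rule wds_mono[OF mc.wds_Wd_emb[OF 3(3)]]) (use 3(1) in auto)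
  hence "prm M (Wd L (map (emb M) xs)) = 0" using mc.prm_pr1[of "Wd L (map (emb M) xs)"] by simp
  thus ?thesis using 3 by (simp add: arr_def opr_def Leib_def)
 qed
qed

section \<open>The functor\<close>

definition emm :: "('k::real_normed_field, 'm::ab_group_add) infmod => ('k, 'n::ab_group_add) infmod =>
  (nat => 'm => 'n coc) => 'm letter => ('n, 'k) walg" where
 "emm M N \<phi> m = (if real_ltr M m then emb N (tot \<phi> (lval m)) else 0)"

text \<open>A letter m of \<open>M\<close> acts on words of \<open>N\<close> as the element
  \<phi>(m) acts there, see \<open>opm_th\<close>.\<close>

definition opm :: "('k::real_normed_field, 'g::ab_group_add) dgla => ('k, 'm::ab_group_add) infmod => ('k, 'm) infmod =>
  (nat => 'm => 'g coc) => (nat => 'm => 'm coc) => 'm letter =>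
  ('m, 'k) walg => ('m, 'k) walg" where
 "opm L M N g \<phi> m x = prd L (emm M N \<phi> m) x + nab L (Fl L N g) (emm M N \<phi> m) x"

context imap
begin

lemma lin_ext_cmul:
 assumes O: "X \<in> carC L M"
 shows "lin_ext L N f (cmul L M u X) = cmul L N u (lin_ext L N f X)"
proof (rule N.emb_inj)
 show "lin_ext L N f (cmul L M u X) \<in> carC L N" "cmul L N u (lin_ext L N f X) \<in> carC L N"
  by (intro lin_ext_car M.cmul_car N.cmul_car O)+
 show "emb N (lin_ext L N f (cmul L M u X)) = emb N (cmul L N u (lin_ext L N f X))"
 proof (rule M.coch_eqI[OF _ _ _ _ _ O])
  fix c b assume c: "c \<in> mons L" and b: "b \<in> hbas M"
  have cb: "single c b \<in> carC L M" by (intro M.single_car c M.bas_car b)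
  show "emb N (lin_ext L N f (cmul L M u (single c b))) = emb N (cmul L N u (lin_ext L N f (single c b)))"
  proof (rule klin_eqI[of "%u. emb N (lin_ext L N f (cmul L M u (single c b)))"])
   show "klin (%u. emb N (lin_ext L N f (cmul L M u (single c b))))"
    by (rule klinI) (simp_all add: M.cmul_add_left M.cmul_scl_left emb_lin_ext_add emb_lin_ext_scl M.cmul_car cb)
   show "klin (%u. emb N (cmul L N u (lin_ext L N f (single c b))))"
    by (rule klinI) (simp_all add: N.cmul_add_left N.cmul_scl_left N.emb_add N.emb_scl N.cmul_car lin_ext_car cb)
   fix a
   have 1: "cmul L M (bs a) (single c b) = scl (coch L M) (mcoef L a c) (single (a + c) b)"
    using M.bas_nz[OF b] by (simp add: M.cmul_alt bs_def M.scl_single)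
   have 2: "emb N (lin_ext L N f (scl (coch L M) (mcoef L a c) (single (a + c) b))) =
     sc (mcoef L a c) (sm L (bs (a + c)) (emb N (tot f b)))"
   proof (cases "a + c \<in> mons L")
    case True
    thus ?thesis by (simp add: emb_lin_ext_scl M.single_car M.bas_car b emb_lin_ext_single)
   qed (simp add: mcoef_def M.scl_single)
   have 3: "sm L (bs a) (inA (bs c)) = (sc (mcoef L a c) (inA (bs (a + c))) :: ('n, 'k) walg)"
    by (simp add: inA_bs prd_bs)
   show "emb N (lin_ext L N f (cmul L M (bs a) (single c b))) = emb N (cmul L N (bs a) (lin_ext L N f (single c b)))"
    unfolding 1 2 N.emb_cmul[OF lin_ext_car[OF cb]] emb_lin_ext_single[OF M.bas_car[OF b]] prd_assoc[symmetric] 3 prd_sc_left ..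
  qed
 qed (simp_all add: M.cmul_add_right M.cmul_scl_right emb_lin_ext_add emb_lin_ext_scl M.cmul_car
   lin_ext_add lin_ext_scl N.cmul_add_right N.cmul_scl_right N.emb_add N.emb_scl N.cmul_car lin_ext_car)
qed

lemma hom_lin_ext:
 assumes O: "X \<in> gr (coch L M) n"
 shows "lin_ext L N f X \<in> gr (coch L N) (n + p)"
proof -
 have Oc: "X \<in> carC L M" by (rule gr_car[OF M.gs_C O])
 have l: "lookup X a \<in> gr M (n - mdeg L a)" "lookup X a \<in> car M" for a
  using O Oc by (simp_all add: gr_coch M.car_C)
 have "emb N (lin_ext L N f X) = (\<Sum>a\<in>keys X. sm L (bs a) (emb N (tot f (lookup X a))))"
  unfolding lin_ext_alt by (subst N.emb_sum) (simp_all add: N.cmul_car tot_car l N.emb_cmul)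
 also have "hom L (n + p - 1) \<dots>"
 proof (rule keys_subset_sum)
  fix a
  have "hom L (mdeg L a + (n - mdeg L a + p - 1)) (sm L (bs a) (emb N (tot f (lookup X a))))"
   by (rule hom_prd[OF hom_inA N.hom_emb[OF tot_gr[OF l(1)]]]) simp
  thus "hom L (n + p - 1) (sm L (bs a) (emb N (tot f (lookup X a))))" by (simp add: algebra_simps)
 qed
 finally have "lin_ext L N f X \<in> gr (coch L (shift 1 N)) (n + p - 1)"
  by (simp add: N.gr_emb lin_ext_car Oc)
 thus ?thesis by (simp add: N.gr_coch_shift)
qed

end

lemma lin_ext_lin_ext:
 assumes \<phi>: "imap L M N p \<phi>" and ps: "imap L N P q ps" and \<chi>: "imap L M P r \<chi>"
  and eq: "!!m. m \<in> car M ==> tot \<chi> m = lin_ext L P ps (tot \<phi> m)" and O: "X \<in> carC L M"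
 shows "lin_ext L P \<chi> X = lin_ext L P ps (lin_ext L N \<phi> X)"
proof -
 interpret A: imap L M N p \<phi> by (rule \<phi>)
 interpret B: imap L N P q ps by (rule ps)
 interpret C: imap L M P r \<chi> by (rule \<chi>)
 show ?thesis
 proof (rule B.N.emb_inj)
  show "emb P (lin_ext L P \<chi> X) = emb P (lin_ext L P ps (lin_ext L N \<phi> X))"
  proof (rule A.M.coch_eqI[OF _ _ _ _ _ O])
   fix a b assume a: "a \<in> mons L" and b: "b \<in> hbas M"
   have bc: "b \<in> car M" by (rule A.M.bas_car[OF b])
   show "emb P (lin_ext L P \<chi> (single a b)) = emb P (lin_ext L P ps (lin_ext L N \<phi> (single a b)))"
    unfolding C.lin_ext_single[OF bc] A.lin_ext_single[OF bc] B.lin_ext_cmul[OF A.tot_car[OF bc]] eq[OF bc] ..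
  qed (simp_all add: C.emb_lin_ext_add C.emb_lin_ext_scl A.lin_ext_add A.lin_ext_scl A.lin_ext_car B.emb_lin_ext_add B.emb_lin_ext_scl)
 qed (simp_all add: C.lin_ext_car A.lin_ext_car B.lin_ext_car O)
qed

lemma lookup_arity_part: "lookup (arity_part k X) a = (if arity a = k then lookup X a else 0)"
proof -
 have "lookup (arity_part k X) a = (\<Sum>a'\<in>{a \<in> keys X. arity a = k}. if a' = a then lookup X a' else 0)"
  by (simp add: arity_part_def lookup_sum lookup_single when_def)
 also have "\<dots> = (if arity a = k then lookup X a else 0)"
  by (auto simp: in_keys_iff)
 finally show ?thesis .
qed

lemma arity_part_nz: "arity_part k X ~= 0 ==> k \<in> arity ` keys X"
proof -
 assume "arity_part k X ~= 0"
 then obtain a where "lookup (arity_part k X) a ~= 0" by (metis lookup_zero poly_mapping_eqI)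
 thus ?thesis by (auto simp: lookup_arity_part in_keys_iff split: if_splits)
qed

text \<open>\<open>inf_comp\<close> cuts a cochain into its arities, and \<open>tot\<close> puts the
  parts together again.\<close>

lemma tot_inf_comp: "tot (inf_comp L P ps \<phi>) m = lin_ext L P ps (tot \<phi> m)"
proof -
 define X where "X = lin_ext L P ps (tot \<phi> m)"
 have "tot (inf_comp L P ps \<phi>) m = (\<Sum>k | arity_part k X ~= 0. arity_part k X)"
  by (simp add: tot_def inf_comp_def X_def)
 also have "\<dots> = (\<Sum>k\<in>arity ` keys X. arity_part k X)"
  by (rule sum.mono_neutral_left) (auto dest: arity_part_nz)
 also have "\<dots> = X"
 proof (rule poly_mapping_eqI)
  fix a
  have "lookup (\<Sum>k\<in>arity ` keys X. arity_part k X) a = (\<Sum>k\<in>arity ` keys X. if arity a = k then lookup X a else 0)"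
   by (simp add: lookup_sum lookup_arity_part)
  also have "\<dots> = lookup X a" by (auto simp: in_keys_iff)
  finally show "lookup (\<Sum>k\<in>arity ` keys X. arity_part k X) a = lookup X a" .
 qed
 finally show ?thesis by (simp add: X_def)
qed

lemma imap_inf_comp:
 assumes \<phi>: "imap L M N 0 \<phi>" and ps: "imap L N P 0 ps"
 shows "imap L M P 0 (inf_comp L P ps \<phi>)"
proof -
 interpret A: imap L M N 0 \<phi> by (rule \<phi>)
 interpret B: imap L N P 0 ps by (rule ps)
 let ?X = "%m. lin_ext L P ps (tot \<phi> m)"
 have add: "?X (x + y) = ?X x + ?X y" if "x \<in> car M" "y \<in> car M" for x y
  using that by (simp add: A.tot_add B.lin_ext_add A.tot_car)
 have scl: "?X (scl M c x) = scl (coch L P) c (?X x)" if "x \<in> car M" for c x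
  using that by (simp add: A.tot_scl B.lin_ext_scl A.tot_car)
 have deg: "?X x \<in> gr (coch L P) i" if "x \<in> gr M i" for x i
  using B.hom_lin_ext[OF A.tot_gr[OF that]] by simp
 show ?thesis
 proof unfold_locales
  show "cochain_family L M P 0 (inf_comp L P ps \<phi>)"
   unfolding cochain_family_def linear_deg_def
  proof (intro conjI allI ballI)
   fix k x y c assume x: "x \<in> car M"
   show "inf_comp L P ps \<phi> k (scl M c x) = scl (coch L P) c (inf_comp L P ps \<phi> k x)"
    unfolding inf_comp_def scl[OF x]
    by (rule poly_mapping_eqI) (simp add: lookup_arity_part lookup_scl_coch[OF B.N.gs_V])
   show "has_arity k (inf_comp L P ps \<phi> k x)"
    by (auto simp: has_arity_def inf_comp_def in_keys_iff lookup_arity_part split: if_splits)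
   obtain K where K: "\<forall>k\<in>arity ` keys (?X x). k < K"
    using finite_nat_set_iff_bounded[of "arity ` keys (?X x)"] by auto
   show "\<exists>K. \<forall>k\<ge>K. inf_comp L P ps \<phi> k x = 0"
   proof (intro exI[of _ K] allI impI)
    fix k assume "K \<le> k"
    hence "k \<notin> arity ` keys (?X x)" using K by (meson not_le)
    thus "inf_comp L P ps \<phi> k x = 0" using arity_part_nz[of k "?X x"] by (auto simp: inf_comp_def)
   qed
   assume y: "y \<in> car M"
   show "inf_comp L P ps \<phi> k (x + y) = inf_comp L P ps \<phi> k x + inf_comp L P ps \<phi> k y"
    unfolding inf_comp_def add[OF x y]
    by (rule poly_mapping_eqI) (simp add: lookup_arity_part lookup_add)
  next
   fix k i x assume "x \<in> gr M i"
   from deg[OF this] have X: "?X x \<in> gr (coch L P) i" .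
   have "keys (arity_part k (?X x)) <= keys (?X x)" by (auto simp: in_keys_iff lookup_arity_part split: if_splits)
   with X show "inf_comp L P ps \<phi> k x \<in> gr (coch L P) (i + 0)"
    by (auto simp: inf_comp_def gr_coch lookup_arity_part gr_0[OF B.N.gs_V])
  qed
 qed
qed

section \<open>Morphisms of weak Loday-Pirashvili modules as comparison maps\<close>

locale wlpmap = M: wlp L M f + N: wlp L N g + P: imap L M N 0 \<phi>
 for L :: "('k::real_normed_field, 'g::ab_group_add) dgla" and M :: "('k, 'm::ab_group_add) infmod" and f
  and N :: "('k, 'm) infmod" and g and \<phi> +
 assumes mor_P: "\<Omega> \<in> carC L M ==> lin_ext L N \<phi> (d_tot L M \<Omega>) = d_tot L N (lin_ext L N \<phi> \<Omega>)"
  and comp_P: "m \<in> car M ==> lin_adj L g (tot \<phi> m) = tot f m"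
begin

lemma lin_ext_P_0: "b \<in> car M ==> lin_ext L N \<phi> (single 0 b) = tot \<phi> b"
 by (simp add: P.lin_ext_single N.cmul_one P.tot_car)

lemma mor_P_0: "b \<in> car M ==> lin_ext L N \<phi> (tot (act M) b) = d_tot L N (tot \<phi> b)"
 using mor_P[OF M.e0_car[of b]] by (simp add: M.d_tot_0 lin_ext_P_0)

lemma lel_emm: "lel L N (emm M N \<phi> m)"
proof (cases "real_ltr M m")
 case True
 then obtain b where b: "b \<in> hbas M" "m = ltr M b" by (rule real_ltrE)
 have "emm M N \<phi> m = emb N (tot \<phi> b)" using b by (simp add: emm_def)
 thus ?thesis using N.mc.lel_emb[OF P.tot_car[OF M.mc.bas_car[OF b(1)]]] by simp
qed (simp add: emm_def)

lemmas el_emm = lel_el[OF lel_emm]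

lemma hom_emm: "hom L (gdeg m) (emm M N \<phi> m)"
proof (cases "real_ltr M m")
 case True
 then obtain b where b: "b \<in> hbas M" "m = ltr M b" by (rule real_ltrE)
 from N.mc.hom_emb[OF P.tot_gr[OF M.mc.bas_gr[OF b(1)]]] show ?thesis using b by (simp add: emm_def)
qed (simp add: emm_def)

lemma opm_th: "opm L M N g \<phi> m x = N.ce.th (emm M N \<phi> m) x"
 by (simp add: opm_def N.ce.th_def)

lemma opx_emb:
 assumes "X \<in> carC L M"
 shows "opx L (opm L M N g \<phi>) (emb M X) x = N.ce.th (emb N (lin_ext L N \<phi> X)) x"
proof (rule M.mc.coch_eqI[OF _ _ _ _ _ assms])
 fix a b assume a: "a \<in> mons L" and b: "b \<in> hbas M"
 have "opx L (opm L M N g \<phi>) (emb M (single a b)) x = sm L (bs a) (opm L M N g \<phi> (ltr M b) x)"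
  using opx_inA_lt[OF a] by (simp add: M.mc.emb_single_bas[OF b] bs_split[OF a] lt_def)
 thus "opx L (opm L M N g \<phi>) (emb M (single a b)) x = N.ce.th (emb N (lin_ext L N \<phi> (single a b))) x"
  using b by (simp add: P.emb_lin_ext_single M.mc.bas_car N.ce.th_inA opm_th emm_def)
qed (simp_all add: M.mc.emb_add M.mc.emb_scl klin_add[OF klin_opx[OF klin_id]] klin_sc[OF klin_opx[OF klin_id]]
  P.emb_lin_ext_add P.emb_lin_ext_scl N.ce.th_add_left N.ce.th_sc_left)

text \<open>The condition g \<circ> \<phi> = f in terms of vector fields: contraction with
  g(\<phi>(m)) is contraction with f(m).\<close>

lemma nab_emm: "nab L (Fl L N g) (emm M N \<phi> m) x = vf L (Fl L M f m) x"
proof (cases "real_ltr M m")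
 case True
 then obtain b where b: "b \<in> hbas M" "m = ltr M b" by (rule real_ltrE)
 thus ?thesis
  by (simp add: emm_def N.F.nab_emb P.tot_car M.mc.bas_car comp_P Fl_def)
qed (simp add: emm_def Fl_def klin_0[OF klin_nab_left[OF klin_id]])

lemma th_one: "el L e ==> N.ce.th e (bs (0, [])) = e"
 by (simp add: N.ce.th_def prd_one el_rc)

text \<open>\<open>nab_emm\<close> gives the coefficient rule. The rule for Q follows from
  \<open>N.ce.Q_th\<close>, because Q sends \<phi>(m) to \<phi> of the differential of m.\<close>

sublocale cc: ce_comparison L "dgn L" "Dl M" "Fl L M f" "Dl N" "Fl L N g" "opm L M N g \<phi>"
proof
 fix m
 have fe: "opm L M N g \<phi> m = N.ce.th (emm M N \<phi> m)" by (simp add: fun_eq_iff opm_th)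
 show "prim L (gdeg m) (opm L M N g \<phi> m)" unfolding fe by (rule N.ce.prim_th[OF el_emm hom_emm])
 show "el L (opm L M N g \<phi> m (bs (0, [])))" unfolding fe th_one[OF el_emm] by (rule el_emm)
 fix x :: "('m, 'k) walg" assume x: "rc L x"
 show "opm L M N g \<phi> m (sm L a x) = prd L (vf L (Fl L M f m) (inA a)) x +
   prd L (sgno L (gdeg m) (inA a)) (opm L M N g \<phi> m x)" if "rcA L a" for a
  unfolding fe N.ce.th_sym[OF el_emm hom_emm that x] nab_emm ..
 show "N.ce.Q (opm L M N g \<phi> m x) = opx L (opm L M N g \<phi>) (Dl M m) x +
   sk (gdeg m) (opm L M N g \<phi> m (N.ce.Q x))"
 proof (cases "real_ltr M m")
  case True
  then obtain b where b: "b \<in> hbas M" "m = ltr M b" by (rule real_ltrE)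
  have bc: "b \<in> car M" by (rule M.mc.bas_car[OF b(1)])
  have "N.ce.Q (emm M N \<phi> m) = emb N (lin_ext L N \<phi> (tot (act M) b))"
   using b by (simp add: emm_def N.Q_emb P.tot_car bc mor_P_0)
  hence "N.ce.th (N.ce.Q (emm M N \<phi> m)) x = opx L (opm L M N g \<phi>) (Dl M m) x"
   using b by (simp add: M.Dl_ltr opx_emb M.A.tot_car bc)
  thus ?thesis unfolding fe N.ce.Q_th[OF el_emm hom_emm x] by simp
 qed (simp add: fe emm_def Dl_def klin_0[OF klin_opx[OF klin_id]])
qed

lemma Phi_emb:
 assumes "X \<in> carC L M"
 shows "cc.Phi (emb M X) = emb N (lin_ext L N \<phi> X)"
proof (rule M.mc.coch_eqI[OF _ _ _ _ _ assms])
 fix a b assume a: "a \<in> mons L" and b: "b \<in> hbas M"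
 have "cc.Phi (emb M (single a b)) = sm L (bs a) (opm L M N g \<phi> (ltr M b) (bs (0, [])))"
  by (simp add: M.mc.emb_single_bas[OF b] bs_split[OF a] cc.Phi_inA)
 also have "\<dots> = emb N (lin_ext L N \<phi> (single a b))"
  unfolding opm_th th_one[OF el_emm] using b by (simp add: P.emb_lin_ext_single M.mc.bas_car emm_def)
 finally show "cc.Phi (emb M (single a b)) = emb N (lin_ext L N \<phi> (single a b))" .
qed (simp_all add: M.mc.emb_add M.mc.emb_scl cc.Phi_add cc.Phi_sc P.emb_lin_ext_add P.emb_lin_ext_scl)

lemma wds_rws_ow: "list_all (real_ltr M) w ==> wds (rws N) (cc.ow w)"
proof (induction w)
 case (Cons m w)
 have "wds (rws N) (emm M N \<phi> m)" using lel_emm lel_iff by blast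
 thus ?case using Cons unfolding cc.ow.simps opm_th[of m] by (intro N.wds_rws_th) simp_all
qed simp

sublocale lm: leibmap L M f N g cc.Phi
proof unfold_locales
 show "klin cc.Phi" by (rule cc.klin_Phi[OF klin_id])
 fix x :: "('m, 'k) walg"
 show "rc L (cc.Phi x)" by (rule cc.rc_Phi)
 show "wds (rws N) (cc.Phi x)" if "wds (rws M) x"
  by (rule cc.wds_Phi[OF that]) (rule wds_rws_ow, simp)
 show "hom L (n + 0) (cc.Phi x)" if "hom L n x" for n using cc.hom_Phi[OF that] by simp
 show "comul L cc.Phi" by (rule cc.comul_Phi)
 show "cc.Phi (M.ce.Q x) = N.ce.Q (cc.Phi x)" if "rc L x" by (rule cc.Phi_Q[OF that])
qed

lemma arr_single:
 assumes O: "X \<in> carC L M"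
 shows "arr L M N cc.Phi [X] = lin_ext L (shift 1 N) \<phi> X"
proof -
 have "lin_ext L (shift 1 N) \<phi> X = lin_ext L N \<phi> X" by (simp add: lin_ext_def)
 thus ?thesis
  by (simp add: arr_def opr_def O Wd_single el_rc[OF M.el_emb[OF O]] Phi_emb N.mc.prm_emb P.lin_ext_car)
qed

end

lemma wlpmap_comp:
 assumes 1: "wlpmap L M f N g \<phi>" and 2: "wlpmap L N g P h ps"
 shows "wlpmap L M f P h (inf_comp L P ps \<phi>)"
proof -
 interpret A: wlpmap L M f N g \<phi> by (rule 1)
 interpret B: wlpmap L N g P h ps by (rule 2)
 interpret C: imap L M P 0 "inf_comp L P ps \<phi>" by (rule imap_inf_comp) unfold_locales
 have l: "lin_ext L P (inf_comp L P ps \<phi>) X = lin_ext L P ps (lin_ext L N \<phi> X)" if "X \<in> carC L M" for X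
  by (rule lin_ext_lin_ext[OF A.P.imap_axioms B.P.imap_axioms C.imap_axioms tot_inf_comp that])
 show ?thesis
 proof unfold_locales
  fix X assume O: "X \<in> carC L M"
  show "lin_ext L P (inf_comp L P ps \<phi>) (d_tot L M X) = d_tot L P (lin_ext L P (inf_comp L P ps \<phi>) X)"
   by (simp add: l O A.M.d_tot_car A.mor_P B.mor_P A.P.lin_ext_car)
 next
  fix m assume m: "m \<in> car M"
  have "lin_adj L h (lin_ext L P ps (tot \<phi> m)) = lin_adj L g (tot \<phi> m)"
   by (rule lin_ext_lin_ext[OF B.P.imap_axioms B.N.F.F.imap_axioms A.N.F.F.imap_axioms _ A.P.tot_car[OF m], symmetric])
    (simp add: B.comp_P)
  thus "lin_adj L h (tot (inf_comp L P ps \<phi>) m) = tot f m"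
   by (simp add: tot_inf_comp A.comp_P m)
 qed
qed

text \<open>On words in letters of \<open>M\<close> both maps satisfy the same recursion: the
  composite turns a letter m into the action of the element ps(\<phi>(m)). By
  \<open>arr_cong\<close> these words decide.\<close>

lemma Phi_comp:
 fixes L :: "('k::real_normed_field, 'g::ab_group_add) dgla" and M N P :: "('k, 'm::ab_group_add) infmod"
 assumes 1: "wlpmap L M f N g \<phi>" and 2: "wlpmap L N g P h ps"
 shows "arr L M P (ce_comparison.Phi L (opm L M P h (inf_comp L P ps \<phi>))) =
  arr L M P (%x. ce_comparison.Phi L (opm L N P h ps) (ce_comparison.Phi L (opm L M N g \<phi>) x))"
proof -
 interpret A: wlpmap L M f N g \<phi> by (rule 1)
 interpret B: wlpmap L N g P h ps by (rule 2)
 interpret C: wlpmap L M f P h "inf_comp L P ps \<phi>" by (rule wlpmap_comp[OF 1 2])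
 have w: "C.cc.ow w = B.cc.Phi (A.cc.ow w)" if "list_all (real_ltr M) w" for w
  using that
 proof (induction w)
  case (Cons m w)
  then obtain b where b: "b \<in> hbas M" "m = ltr M b" by (auto elim: real_ltrE)
  have bc: "b \<in> car M" by (rule A.M.mc.bas_car[OF b(1)])
  have "B.cc.Phi (A.cc.ow (m # w)) = opx L (opm L N P h ps) (emm M N \<phi> m) (B.cc.Phi (A.cc.ow w))"
   unfolding A.cc.ow.simps A.opm_th[of m] by (rule B.cc.Phi_th[OF A.el_emm A.cc.rc_ow])
  also have "\<dots> = B.N.ce.th (emm M P (inf_comp L P ps \<phi>) m) (B.cc.Phi (A.cc.ow w))"
   using b by (simp add: emm_def B.opx_emb A.P.tot_car bc tot_inf_comp)
  finally have s: "B.cc.Phi (A.cc.ow (m # w)) = B.N.ce.th (emm M P (inf_comp L P ps \<phi>) m) (B.cc.Phi (A.cc.ow w))" .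
  have IH: "C.cc.ow w = B.cc.Phi (A.cc.ow w)" using Cons by simp
  show ?case unfolding s unfolding C.cc.ow.simps C.opm_th[of m] IH ..
 qed simp
 show ?thesis
 proof (rule arr_cong)
  show "cspace M" by unfold_locales
  fix x :: "('m, 'k) walg" assume x: "rc L x" "wds (rws M) x"
  show "C.cc.Phi x = B.cc.Phi (A.cc.Phi x)"
  proof (rule rc_eqI[OF _ _ x(1), of C.cc.Phi "%x. B.cc.Phi (A.cc.Phi x)"])
   show "klin C.cc.Phi" "klin (%x. B.cc.Phi (A.cc.Phi x))"
    by (intro C.cc.klin_Phi B.cc.klin_Phi A.cc.klin_Phi klin_id)+
   fix a and v :: "'m letter list" assume "(a, v) \<in> keys x"
   hence v: "list_all (real_ltr M) v" using x(2) by auto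
   show "C.cc.Phi (sm L (bs a) (bs (0, v))) = B.cc.Phi (A.cc.Phi (sm L (bs a) (bs (0, v))))"
    by (simp add: C.cc.Phi_inA B.cc.Phi_inA A.cc.Phi_inA w[OF v])
  qed
 qed
qed

context wlp
begin

abbreviation "sid \<equiv> strict M (%m. m)"

lemma tot_sid: "m \<in> car M ==> tot sid m = single 0 m"
proof -
 assume m: "m \<in> car M"
 have "tot sid m = (\<Sum>k\<in>{0}. sid k m)"
  unfolding tot_def by (rule sum.mono_neutral_left) (auto simp: strict_def)
 thus ?thesis using m by (simp add: strict_def)
qed

lemma wlpmap_sid: "wlpmap L M f M f sid"
proof -
 interpret S: imap L M M 0 sid
 proof unfold_locales
  have s: "single 0 (scl M c x) = scl (coch L M) c (single 0 x)" for c x by (simp add: mc.scl_single)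
  show "cochain_family L M M 0 sid"
   unfolding cochain_family_def linear_deg_def strict_def
  proof (intro conjI allI ballI)
   fix k i x assume x: "x \<in> gr M i"
   show "(if k = 0 \<and> x \<in> car M then single 0 x else 0) \<in> gr (coch L M) (i + 0)"
    using single_gr_coch[OF mc.gs_V mons_0 x] by (auto simp: gr_0[OF mc.gs_C])
  next
   fix x assume x: "x \<in> car M"
   show "\<exists>K::nat. \<forall>k\<ge>K. (if k = 0 \<and> x \<in> car M then single 0 x else 0) = (0 :: mono \<Rightarrow>\<^sub>0 'm)"
    by (rule exI[of _ 1]) auto
  next
   fix k x assume x: "x \<in> car M"
   show "has_arity k (if k = 0 \<and> x \<in> car M then single 0 x else 0)"
    by (auto simp: has_arity_def arity_def split: if_splits)
  qed (auto simp: car_add[OF mc.gs_V] car_scl[OF mc.gs_V] single_add s module.scale_zero_right[OF graded_spaceD(2)[OF mc.gs_C]])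
 qed
 have l: "lin_ext L M sid X = X" if O: "X \<in> carC L M" for X
 proof (rule mc.emb_inj[OF S.lin_ext_car[OF O] O])
  show "emb M (lin_ext L M sid X) = emb M X"
  proof (rule mc.coch_eqI[OF _ _ _ _ _ O])
   fix a b assume a: "a \<in> mons L" and b: "b \<in> hbas M"
   show "emb M (lin_ext L M sid (single a b)) = emb M (single a b)"
    by (simp add: S.emb_lin_ext_single mc.bas_car b tot_sid mc.emb_single_bas bs_split[OF a])
  qed (simp_all add: S.emb_lin_ext_add S.emb_lin_ext_scl mc.emb_add mc.emb_scl)
 qed
 show ?thesis
  by unfold_locales (simp_all add: l d_tot_car tot_sid lin_ext_f_0)
qed

lemma arr_sid: "arr L M M (ce_comparison.Phi L (opm L M M f sid)) = Idn (Leib (CE L)) G"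
proof -
 interpret S: wlpmap L M f M f sid by (rule wlpmap_sid)
 have w: "S.cc.ow w = bs (0, w)" if "list_all (real_ltr M) w" for w
  using that
 proof (induction w)
  case (Cons m w)
  then obtain b where b: "b \<in> hbas M" "m = ltr M b" by (auto elim: real_ltrE)
  hence "emm M M sid m = lt m" by (simp add: emm_def tot_sid mc.bas_car mc.emb_single_bas lt_def)
  thus ?case using Cons unfolding S.cc.ow.simps S.opm_th[of m] by (simp add: ce.th_lt_word)
 qed simp
 have "arr L M M S.cc.Phi = arr L M M (%x. x)"
 proof (rule arr_cong)
  show "cspace M" by unfold_locales
  fix x :: "('m, 'k) walg" assume x: "rc L x" "wds (rws M) x"
  show "S.cc.Phi x = x"
  proof (rule rc_eqI[OF _ _ x(1), of S.cc.Phi "%x. x"])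
   fix a and v :: "'m letter list" assume "(a, v) \<in> keys x"
   hence v: "list_all (real_ltr M) v" using x(2) by auto
   show "S.cc.Phi (sm L (bs a) (bs (0, v))) = sm L (bs a) (bs (0, v))"
    by (simp add: S.cc.Phi_inA w[OF v])
  qed (intro S.cc.klin_Phi klin_id)+
 qed
 thus ?thesis by (simp add: arr_id)
qed

end

lemma wlpI:
 assumes d: "dg_lie_algebra L" and w: "weak_LP_module L M f"
 shows "wlp L M f"
proof -
 interpret dgl L by (rule dgl.intro[OF d])
 have f: "graded_space M" "fin_dim M" "cochain_family L M M 1 (act M)" "cochain_family L M (adjoint L) 0 f"
  "!!X. X \<in> carC L M ==> d_tot L M (d_tot L M X) = 0"
  "!!X. X \<in> carC L M ==> lin_adj L f (d_tot L M X) = d_tot L (adjoint L) (lin_adj L f X)"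
  using w by (simp_all add: weak_LP_module_def inf_module_def inf_morphism_def)
 show ?thesis by unfold_locales (rule f; assumption?)+
qed

lemma wlpmapI:
 assumes 1: "wlp L M f" and 2: "wlp L N g" and h: "inf_morphism L M N \<phi>" "inf_comp L (adjoint L) g \<phi> = f"
 shows "wlpmap L M f N g \<phi>"
proof -
 interpret A: wlp L M f by (rule 1)
 interpret B: wlp L N g by (rule 2)
 have f: "cochain_family L M N 0 \<phi>"
  "!!X. X \<in> carC L M ==> lin_ext L N \<phi> (d_tot L M X) = d_tot L N (lin_ext L N \<phi> X)"
  using h by (simp_all add: inf_morphism_def)
 show ?thesis
 proof unfold_locales
  show "lin_adj L g (tot \<phi> m) = tot f m" for m
   using tot_inf_comp[of L "adjoint L" g \<phi> m] h(2) by simp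
 qed (rule f; assumption?)+
qed

definition garr :: "('k::real_normed_field, 'g::ab_group_add) dgla => ('k, 'g, 'm::ab_group_add) wLP_object =>
  ('k, 'g, 'm) wLP_object => (nat => 'm => 'm coc) => 'm coc list => 'm coc" where
 "garr L X Y \<phi> = arr L (fst X) (fst Y) (ce_comparison.Phi L (opm L (fst X) (fst Y) (snd Y) \<phi>))"

lemma is_functor_garr:
 fixes L :: "('k::real_normed_field, 'g::ab_group_add) dgla"
 assumes d: "dg_lie_algebra L"
 shows "is_functor (wLP L :: (('k, 'g, 'm::ab_group_add) wLP_object, _) cat) (Leib (CE L)) (G_object L) (garr L)"
proof -
 have obj: "(M, f) \<in> Obj (wLP L) \<longleftrightarrow> weak_LP_module L M f" for M :: "('k, 'm) infmod" and f
  by (simp add: wLP_def)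
 have map: "wlpmap L M f N g \<phi>" if "(M, f) \<in> Obj (wLP L)" "(N, g) \<in> Obj (wLP L)" "\<phi> \<in> Hom (wLP L) (M, f) (N, g)"
  for M N :: "('k, 'm) infmod" and f g \<phi>
  using that by (intro wlpmapI wlpI[OF d]) (simp_all add: wLP_def)
 show ?thesis
  unfolding is_functor_def
 proof (intro conjI ballI; clarify)
  fix M :: "('k, 'm) infmod" and f assume "(M, f) \<in> Obj (wLP L)"
  then interpret wlp L M f using wlpI[OF d] by (simp add: obj)
  show "G_object L (M, f) \<in> Obj (Leib (CE L))" using leib_algebra_G by (simp add: Leib_def)
  show "garr L (M, f) (M, f) (Idn (wLP L) (M, f)) = Idn (Leib (CE L)) (G_object L (M, f))"
   using arr_sid by (simp add: garr_def wLP_def)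
 next
  fix M :: "('k, 'm) infmod" and f N g \<phi>
  assume "(M, f) \<in> Obj (wLP L)" "(N, g) \<in> Obj (wLP L)" "\<phi> \<in> Hom (wLP L) (M, f) (N, g)"
  then interpret wlpmap L M f N g \<phi> by (rule map)
  show "garr L (M, f) (N, g) \<phi> \<in> Hom (Leib (CE L)) (G_object L (M, f)) (G_object L (N, g))"
   using lm.leib_morphism by (simp add: garr_def Leib_def)
 next
  fix M :: "('k, 'm) infmod" and f N g P h \<phi> ps
  assume o: "(M, f) \<in> Obj (wLP L)" "(N, g) \<in> Obj (wLP L)" "(P, h) \<in> Obj (wLP L)"
   and a: "\<phi> \<in> Hom (wLP L) (M, f) (N, g)" "ps \<in> Hom (wLP L) (N, g) (P, h)"
  note 1 = map[OF o(1,2) a(1)] and 2 = map[OF o(2,3) a(2)]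
  interpret A: wlpmap L M f N g \<phi> by (rule 1)
  interpret B: wlpmap L N g P h ps by (rule 2)
  show "garr L (M, f) (P, h) (Cmp (wLP L) (M, f) (N, g) (P, h) ps \<phi>) =
   Cmp (Leib (CE L)) (G_object L (M, f)) (G_object L (N, g)) (G_object L (P, h)) (garr L (N, g) (P, h) ps) (garr L (M, f) (N, g) \<phi>)"
   using Phi_comp[OF 1 2] leib_comp_arr[OF A.lm.leibmap_axioms B.lm.leibmap_axioms]
   by (simp add: garr_def Leib_def wLP_def)
 qed
qed

section \<open>Homotopies\<close>

lemma homA_cmul_ground: "homA L p a ==> homA L q b ==> homA L (p + q) (cmul L ground a b)"
 unfolding cmul_def by (intro keys_subset_sum) (auto simp: keys_single split: if_splits)

lemma rcA_cmul_ground': "rcA L (cmul L ground a b)"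
 unfolding cmul_def by (intro keys_subset_sum) (auto simp: keys_single)

text \<open>Serves to show that \<open>wop\<close> is a vector field of the degree of its letter,
  hence a derivation and a coderivation.\<close>

lemma nab_vf:
 fixes E :: "'m letter => nat => 'k::real_normed_field coc"
 assumes E: "!!m. vfdeg L (gdeg m + r) (E m)" and e: "el L e" "hom L n e"
 shows "\<exists>v. vfdeg L (n + r) v \<and> (\<forall>x :: ('m, 'k) walg. nab L E e x = vf L v x)"
proof -
 define v where "v j = (\<Sum>b\<in>keys e. sc (lookup e b) (cmul L ground (bs (fst b)) (E (hd (snd b)) j)))" for j
 have "vfdeg L (n + r) v"
  unfolding vfdeg_def
 proof (intro allI impI conjI)
  fix j assume j: "j < ldim L"
  show "rcA L (v j)" unfolding v_def by (intro keys_subset_sum keys_subset_sc rcA_cmul_ground')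
  show "homA L (n + r + wt L j) (v j)" unfolding v_def
  proof (intro keys_subset_sum keys_subset_sc)
   fix b assume b: "b \<in> keys e"
   then obtain a m where am: "b = (a, [m])" using e(1) by blast
   have "mdeg L a + gdeg m = n" using e(2) b am by (auto simp: wdeg_list_def)
   moreover have "homA L (mdeg L a + (gdeg m + r + wt L j)) (cmul L ground (bs a) (E m j))"
    using E[of m] j by (intro homA_cmul_ground) (simp_all add: vfdeg_def)
   ultimately show "homA L (n + r + wt L j) (cmul L ground (bs (fst b)) (E (hd (snd b)) j))"
    unfolding am using \<open>mdeg L a + gdeg m = n\<close>[symmetric] by (simp add: add.assoc)
  qed
 qed
 moreover have "nab L E e x = vf L v x" for x :: "('m, 'k) walg"
 proof -
  have "vf L v x = (\<Sum>j<ldim L. \<Sum>b\<in>keys e. sc (lookup e b) (sm L (bs (fst b)) (sm L (E (hd (snd b)) j) (pd L j x))))"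
   by (simp add: vf_def v_def inA_sum inA_sc inA_cmul prd_sum_left prd_sc_left prd_assoc)
  also have "\<dots> = (\<Sum>b\<in>keys e. sc (lookup e b) (sm L (bs (fst b)) (vf L (E (hd (snd b))) x)))"
   by (subst sum.swap) (simp add: vf_def prd_sum_right sc_sum)
  also have "\<dots> = nab L E e x"
   unfolding nab_def ext_def
  proof (intro sum.cong refl)
   fix b assume "b \<in> keys e"
   then obtain a m where "b = (a, [m])" using e(1) by blast
   thus "sc (lookup e b) (sm L (bs (fst b)) (vf L (E (hd (snd b))) x)) =
    sc (lookup e b) (if length (snd b) = 1 then sm L (bs (fst b)) (vf L (E (hd (snd b))) x) else 0)"
    by (simp add: One_nat_def)
  qed
  finally show ?thesis by simp
 qed
 ultimately show ?thesis by blast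
qed

text \<open>The assignment m \<mapsto> E_m has degree -1, so its extension to x^a m carries the sign
  of passing x^a. This operator inserts that sign.\<close>

definition sA :: "('k::real_normed_field, 'g) dgla => ('m, 'k) walg => ('m, 'k) walg" where
 "sA L = ext (%b. sk (mdeg L (fst b)) (bs b))"

lemma klin_sA [intro]: "klin f ==> klin (%x. sA L (f x))"
 unfolding sA_def by (rule klin_comp[OF klin_ext])

lemma sA_bs: "sA L (bs (a, w)) = sk (mdeg L a) (bs (a, w))"
 by (simp add: sA_def)

lemma sA_lt [simp]: "sA L (lt m) = lt m"
 by (simp add: lt_def sA_bs)

lemma sA_0 [simp]: "sA L 0 = 0"
 by (rule klin_0[OF klin_sA[OF klin_id]])

lemma keys_sA: "keys (sA L x) <= keys x"
 unfolding sA_def ext_def by (intro keys_subset_sum keys_subset_sc) simp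

lemma sA_prd:
 assumes h: "homA L q u"
 shows "sA L (sm L u x) = sk q (sm L u (sA L x))"
proof (rule klin_eqI[of "%x. sA L (sm L u x)"])
 fix b :: "mono \<times> 'c letter list"
 obtain c w where b: "b = (c, w)" by force
 show "sA L (sm L u (bs b)) = sk q (sm L u (sA L (bs b)))"
 proof (rule klin_eqI[of "%u. sA L (sm L u (bs b))" "%u. sk q (sm L u (sA L (bs b)))"])
  fix a assume "a \<in> keys u"
  hence "mdeg L a = q" using h by blast
  thus "sA L (sm L (bs a) (bs b)) = sk q (sm L (bs a) (sA L (bs b)))"
   by (simp add: b inA_bs prd_bs sA_bs klin_sc[OF klin_sA[OF klin_id]] prd_sc_right ksign_add mult_ac)
 qed (intro klin_sA klin_intros)+
qed (intro klin_sA klin_intros)+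

text \<open>\<open>F'_F\<close> is what a homotopy says about the two vector fields of a letter.
  \<open>QQ\<close> is conditional because the square of Q is computed from a letter of the module;
  where there is none, all fields \<open>E m\<close> are zero.\<close>

locale ce_homotopy = M: ce_module L dg D F + N: ce_module L dg D F'
 for L :: "('k::real_normed_field, 'g) dgla" and dg
  and D :: "'m letter => ('m, 'k) walg" and F F' +
 fixes E :: "'m letter => nat => 'k coc"
 assumes E: "vfdeg L (gdeg m - 1) (E m)"
  and F'_F: "rc L x ==> vf L (F' m) x - vf L (F m) (x :: ('m, 'k) walg) =
   (vf L dg (vf L (E m) x) - sk (1 * (gdeg m - 1)) (vf L (E m) (vf L dg x))) + nab L E (sA L (D m)) x"
  and QQ: "E m ~= (%_. 0) ==> rc L x ==> N.Q (N.Q x) = 0"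
  and QD: "N.Q (D m) = 0"
begin

definition com :: "'m letter => ('m, 'k) walg => ('m, 'k) walg" where
 "com m x = N.Q (vf L (E m) x) - sk (1 * (gdeg m - 1)) (vf L (E m) (N.Q x))"

definition wop :: "'m letter => ('m, 'k) walg => ('m, 'k) walg" where "wop m x = nab L E (sA L (D m)) x"

text \<open>The two corrections change the derivative of coefficients from \<open>F'\<close> to
  \<open>F\<close>, see \<open>op_inA\<close>. So \<open>op m\<close> can represent the source
  letter m on the target.\<close>

definition op :: "'m letter => ('m, 'k) walg => ('m, 'k) walg" where "op m x = N.th (lt m) x - com m x - wop m x"

lemma el_sD: "el L (sA L (D m))" and hom_sD: "hom L (gdeg m + 1) (sA L (D m))"
 using keys_sA[of L "D m"] M.D_el[of m] M.D_hom[of m] by (blast intro: subset_trans)+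

lemma wop_vf: obtains v where "vfdeg L (gdeg m) v" "!!x. wop m x = vf L v x"
proof -
 have "!!m. vfdeg L (gdeg m + (- 1)) (E m)" using E by simp
 from nab_vf[OF this el_sD hom_sD, of m] obtain v where
  "vfdeg L (gdeg m + 1 + - 1) v" "\<forall>x :: ('m, 'k) walg. nab L E (sA L (D m)) x = vf L v x" by blast
 thus thesis by (intro that) (simp_all add: wop_def)
qed

lemma prim_com: "prim L (gdeg m) (com m)"
 using prim_commutator[OF N.prim_Q prim_vf[OF E[of m]]] by (simp add: com_def[abs_def])

lemma prim_wop: "prim L (gdeg m) (wop m)"
proof -
 obtain v where v: "vfdeg L (gdeg m) v" "!!x. wop m x = vf L v x" by (rule wop_vf[of m]) (rule that)
 from v(2) have "wop m = vf L v" by (rule ext)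
 thus ?thesis using prim_vf[OF v(1)] by simp
qed

lemma prim_op: "prim L (gdeg m) (op m)"
 unfolding op_def[abs_def]
 using prim_diff[OF prim_diff[OF N.prim_th[OF el_lt hom_lt, of m] prim_com] prim_wop] .

text \<open>Q is a derivation over d_CE, and a vector field one over itself; in their commutator the
  mixed terms cancel, leaving a derivation over the commutator of the fields.\<close>

lemma com_inA:
 assumes a: "rcA L a" and x: "rc L x"
 shows "com m (sm L a x) =
  prd L (vf L dg (vf L (E m) (inA a)) - sk (1 * (gdeg m - 1)) (vf L (E m) (vf L dg (inA a)))) x +
  prd L (sgno L (gdeg m) (inA a)) (com m x)"
proof -
 let ?q = "gdeg m - 1" and ?V = "vf L (E m)" and ?d = "vf L dg" and ?i = "inA a :: ('m, 'k) walg"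
 note i = rc_inA[OF a]
 have V: "?V (prd L y z) = prd L (?V y) z + prd L (sgno L ?q y) (?V z)" if "rc L y" "rc L z" for y z :: "('m, 'k) walg"
  by (rule vf_prd[OF E that])
 have iv: "?V ?i = inA (vfA L (E m) a)" "?d ?i = inA (vfA L dg a)" by (simp_all add: inA_vfA)
 obtain b where b: "sgno L ?q ?i = inA b" "rcA L b" using M.sgno_inA[of ?q a] a by blast
 have si: "rc L (sgno L 1 ?i)" by (rule rc_sgno[OF i])
 have Q1: "N.Q (prd L (?V ?i) x) = prd L (?d (?V ?i)) x + prd L (sgno L 1 (?V ?i)) (N.Q x)"
  unfolding iv by (rule N.Q_sym[OF M.rcA_vfA x])
 have Q2: "N.Q (prd L (sgno L ?q ?i) (?V x)) = prd L (?d (sgno L ?q ?i)) (?V x) + prd L (sgno L 1 (sgno L ?q ?i)) (N.Q (?V x))"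
  unfolding b(1) by (rule N.Q_sym[OF b(2) rc_vf])
 have s1: "sgno L 1 (?V ?i) = sk ?q (?V (sgno L 1 ?i))" using sgno_vf[OF E, where q = 1] by simp
 have s2: "sgno L ?q (?d ?i) = sk ?q (?d (sgno L ?q ?i))" using sgno_vf[OF M.dg, where q = ?q] by simp
 have s3: "sgno L 1 (sgno L ?q ?i) = sgno L (gdeg m) ?i" "sgno L ?q (sgno L 1 ?i) = sgno L (gdeg m) ?i"
  by (simp_all add: sgno_sgno)
 show ?thesis
  unfolding com_def N.Q_sym[OF a x] V[OF i x] V[OF rc_vf x] vf_add V[OF si N.rc_Q] N.Q_add Q1 Q2 s1 s2 s3
  by (simp add: sc_add sc_diff prd_diff_left prd_diff_right prd_sc_left prd_sc_right)
qed

lemma op_inA: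
 assumes a: "rcA L a" and x: "rc L x"
 shows "op m (sm L a x) = prd L (vf L (F m) (inA a)) x + prd L (sgno L (gdeg m) (inA a)) (op m x)"
proof -
 let ?i = "inA a :: ('m, 'k) walg"
 let ?c = "vf L dg (vf L (E m) ?i) - sk (1 * (gdeg m - 1)) (vf L (E m) (vf L dg ?i))"
 obtain v where v: "vfdeg L (gdeg m) v" "!!x. wop m x = vf L v x" by (rule wop_vf[of m]) (rule that)
 have w: "wop m (prd L ?i x) = prd L (wop m ?i) x + prd L (sgno L (gdeg m) ?i) (wop m x)"
  unfolding v(2) by (rule vf_prd[OF v(1) rc_inA[OF a] x])
 have F: "vf L (F m) ?i = vf L (F' m) ?i - ?c - wop m ?i"
  using F'_F[OF rc_inA[OF a], of m] unfolding wop_def by (simp add: algebra_simps)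
 show ?thesis
  unfolding op_def N.th_sym[OF el_lt hom_lt a x] com_inA[OF a x] w F nab_lt
  by (simp add: prd_diff_left prd_diff_right)
qed

lemma op_one: "op m (bs (0, [])) = lt m"
proof -
 obtain v where v: "vfdeg L (gdeg m) v" "!!x. wop m x = vf L v x" by (rule wop_vf[of m]) (rule that)
 show ?thesis by (simp add: op_def com_def v(2) N.th_lt_word) (simp add: lt_def)
qed

text \<open>Write E_e for \<open>nab L E (sA L e)\<close>. The claim is that [Q, E_e] is the
  extension of \<open>com\<close> plus that of \<open>wop\<close> minus E_(Qe). At a letter,
  \<open>wop m\<close> is E_(Qm) and this is the definition of \<open>com\<close>; a coefficient x^a
  contributes its d_CE to the commutator and to E_(Qe) alike.\<close>

lemma Q_wop_gen:
 assumes e: "el L e" "hom L n e" and x: "rc L x"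
 shows "N.Q (nab L E (sA L e) x) - sk (n - 1) (nab L E (sA L e) (N.Q x)) =
  opx L com e x + opx L wop e x - nab L E (sA L (N.Q e)) x"
proof (rule el_eqI[where f = "%e. N.Q (nab L E (sA L e) x) - sk (n - 1) (nab L E (sA L e) (N.Q x))"
   and g = "%e. opx L com e x + opx L wop e x - nab L E (sA L (N.Q e)) x", OF _ _ e(1)])
 fix a m assume a: "a \<in> mons L" and k: "(a, [m]) \<in> keys e"
 have n: "n = mdeg L a + gdeg m" using e(2) k by (auto simp: wdeg_list_def)
 let ?i = "inA (bs a) :: ('m, 'k) walg" and ?V = "vf L (E m)" and ?d = "vf L dg"
 have ha: "homA L (mdeg L a) (bs a)" by simp
 have hi: "hom L (mdeg L a) ?i" by (rule hom_inA[OF ha])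
 have hd: "homA L (1 + mdeg L a) (vfA L dg (bs a))"
 proof -
  have "hom L (1 + mdeg L a) (inA (vfA L dg (bs a)) :: ('m, 'k) walg)"
   unfolding inA_vfA by (rule hom_vf[OF M.dg hi])
  moreover have "(c, []) \<in> keys (inA ga :: ('m, 'k) walg)" if "c \<in> keys ga" for c ga
  proof -
   have "lookup (inA ga :: ('m, 'k) walg) (c, []) = lookup ga c"
    by (simp add: inA_def ext_def lookup_sum lookup_bs wone_list_def in_keys_iff if_distrib cong: if_cong)
   thus ?thesis using that by (simp add: in_keys_iff)
  qed
  ultimately show ?thesis by force
 qed
 have s1: "sgno L 1 ?i = sk (mdeg L a) ?i" using sgno_hom[OF hi, of 1] by simp
 have nb: "nab L E (sA L (prd L ?i (lt m))) y = sk (mdeg L a) (prd L ?i (?V y))" for y :: "('m, 'k) walg"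
  by (simp add: sA_prd[OF ha] klin_sc[OF klin_nab_left[OF klin_id]] nab_inA nab_lt)
 have Qe: "N.Q (prd L ?i (lt m)) = sm L (vfA L dg (bs a)) (lt m) + sk (mdeg L a) (prd L ?i (D m))"
  unfolding lt_def N.Q_split[OF a] s1 inA_vfA prd_sc_left N.qw_lt ..
 have hs: "ksign (1 + mdeg L a) = (- ksign (mdeg L a) :: 'k)" by (simp add: ksign_def)
 have nQ: "nab L E (sA L (N.Q (prd L ?i (lt m)))) x =
   sc (- ksign (mdeg L a)) (prd L (?d ?i) (?V x)) + prd L ?i (wop m x)"
  unfolding Qe klin_add[OF klin_sA[OF klin_id]] klin_sc[OF klin_sA[OF klin_id]] sA_prd[OF hd] sA_prd[OF ha]
   klin_add[OF klin_nab_left[OF klin_id]] klin_sc[OF klin_nab_left[OF klin_id]] nab_inA sA_lt nab_lt wop_def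
  by (simp add: inA_vfA hs)
 have QV: "N.Q (prd L ?i (?V x)) = prd L (?d ?i) (?V x) + sk (mdeg L a) (prd L ?i (N.Q (?V x)))"
  using a by (simp add: N.Q_sym s1 prd_sc_left)
 have sg: "ksign (n - 1) * ksign (mdeg L a) = (ksign (1 * (gdeg m - 1)) :: 'k)"
  by (simp add: n ksign_def)
 show "N.Q (nab L E (sA L (prd L ?i (lt m))) x) - sk (n - 1) (nab L E (sA L (prd L ?i (lt m))) (N.Q x)) =
  opx L com (prd L ?i (lt m)) x + opx L wop (prd L ?i (lt m)) x - nab L E (sA L (N.Q (prd L ?i (lt m)))) x"
  unfolding nb nQ opx_inA_lt[OF a] com_def N.Q_sc QV sc_sc sg prd_diff_right prd_sc_right sc_add sc_minus_left
  by simp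
qed (intro klin_intros klin_opx klin_nab_left klin_sA N.klin_Q)+

text \<open>A commutator with Q commutes with Q in the graded sense, since Q squares to
  zero.\<close>

lemma Q_com:
 assumes x: "rc L x"
 shows "N.Q (com m x) = sk (gdeg m) (com m (N.Q x))"
proof (cases "E m = (%_. 0)")
 case True
 thus ?thesis by (simp add: com_def)
next
 case False
 note q = QQ[OF False]
 have s: "- ksign (1 * (gdeg m - 1)) = (ksign (gdeg m) :: 'k)" by (simp add: ksign_def)
 show ?thesis
  unfolding com_def klin_diff[OF N.klin_Q[OF klin_id]] N.Q_sc q[OF x] q[OF rc_vf] vf_0 sc_diff sc_zero
   s[symmetric] sc_minus_left by simp
qed

lemma opx_op: "opx L op e x = opx L (%m. N.th (lt m)) e x - opx L com e x - opx L wop e x"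
proof (rule klin_eqI[of "%e. opx L op e x"])
 fix b :: "mono \<times> 'm letter list"
 show "opx L op (bs b) x = opx L (%m. N.th (lt m)) (bs b) x - opx L com (bs b) x - opx L wop (bs b) x"
  by (simp add: opx_def op_def prd_diff_right)
qed (intro klin_intros klin_opx)+

lemma opx_th:
 assumes "el L e"
 shows "opx L (%m. N.th (lt m)) e x = N.th e x"
proof (rule el_eqI[where f = "%e. opx L (%m. N.th (lt m)) e x" and g = "%e. N.th e x", OF _ _ assms])
 fix a m assume "a \<in> mons L"
 thus "opx L (%m. N.th (lt m)) (sm L (bs a) (lt m)) x = N.th (sm L (bs a) (lt m)) x"
  by (simp add: opx_inA_lt N.th_inA)
qed (intro klin_intros klin_opx N.klin_th_left)+

lemma op_Q:
 assumes x: "rc L x"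
 shows "N.Q (op m x) = opx L op (D m) x + sk (gdeg m) (op m (N.Q x))"
proof -
 \<comment> \<open>This is \<open>Q_wop_gen\<close> at \<open>D m\<close>, where \<open>Q e\<close>
   vanishes. The two extra terms are the corrections that \<open>opx L op (D m)\<close> contains
   besides the letter action.\<close>
 have W: "N.Q (wop m x) = sk (gdeg m) (wop m (N.Q x)) + opx L com (D m) x + opx L wop (D m) x"
  using Q_wop_gen[OF M.D_el M.D_hom x, of m]
  by (simp add: QD wop_def klin_0[OF klin_nab_left[OF klin_id]] algebra_simps)
 show ?thesis
  unfolding opx_op opx_th[OF M.D_el]
  unfolding op_def klin_diff[OF N.klin_Q[OF klin_id]] W Q_com[OF x] N.Q_th_lt[OF x] sc_diff by simp
qed

sublocale cc: ce_comparison L dg D F D F' op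
 by unfold_locales (simp_all only: prim_op op_inA op_one el_lt op_Q)

lemma wds_op:
 assumes S: "!!w. w \<in> S ==> wds S (N.qw w)" and x: "wds S x" and th: "wds S (N.th (lt m) x)"
 shows "wds S (op m x)"
proof -
 have Q: "wds S (N.Q y)" if "wds S y" for y by (rule N.wds_Q[OF that S])
 show ?thesis unfolding op_def com_def wop_def
  by (intro keys_subset_diff keys_subset_sc wds_vf wds_nab Q x th)
qed

lemma qw_length: "wds {v. length v \<le> length w} (N.qw w)"
proof (induction w)
 case (Cons m w)
 have "wds {v. length v \<le> length (m # w)} (N.th (D m) (bs (0, w)))"
 proof (rule N.wds_th[where S = "{v. length v = 1}" and T = "{w}"])
  show "wds {v. length v = 1} (D m)" using M.D_el[of m] by fastforce
 qed auto
 moreover have "wds {v. length v \<le> length (m # w)} (N.th (lt m) (N.qw w))"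
  by (rule N.wds_th[OF _ Cons.IH, where S = "{[m]}"]) (auto simp: lt_def)
 ultimately show ?case unfolding N.qw.simps by (intro keys_subset_add keys_subset_sc)
qed simp

text \<open>Vector fields and Q do not lengthen words, so both corrections applied to the image of w
  have length at most that of w; only the letter action prepends m.\<close>

lemma ow_low: "wds {v. length v < length w} (cc.ow w - bs (0, w))"
proof (induction w)
 case (Cons m w)
 define y where "y = cc.ow w - bs (0, w)"
 have y: "wds {v. length v < length w} y" unfolding y_def by (rule Cons.IH)
 have ow: "cc.ow w = y + bs (0, w)" by (simp add: y_def)
 let ?S = "{v. length v \<le> length w}"
 have S: "wds ?S (N.qw v)" if "v \<in> ?S" for v
  using qw_length[of v] by (rule wds_mono) (use that in auto)
 have x: "wds ?S (cc.ow w)" unfolding ow by (rule keys_subset_add[OF wds_mono[OF y]]) auto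
 have "op m (cc.ow w) - bs (0, m # w) = (N.th (lt m) y - com m (cc.ow w)) - wop m (cc.ow w)"
 proof -
  have "op m (cc.ow w) = N.th (lt m) (y + bs (0, w)) - com m (cc.ow w) - wop m (cc.ow w)"
   unfolding op_def ow ..
  thus ?thesis by (simp add: N.th_add_right N.th_lt_word)
 qed
 moreover have "wds ?S \<dots>"
 proof (intro keys_subset_diff)
  show "wds ?S (N.th (lt m) y)"
   by (rule N.wds_th[OF _ y, where S = "{[m]}"]) (auto simp: lt_def)
  show "wds ?S (com m (cc.ow w))" unfolding com_def
   by (intro keys_subset_diff keys_subset_sc wds_vf N.wds_Q x) (use S in auto)
  show "wds ?S (wop m (cc.ow w))" unfolding wop_def by (rule wds_nab[OF x])
 qed
 ultimately have "wds ?S (cc.ow (m # w) - bs (0, m # w))" by simp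
 thus ?case by (rule wds_mono) auto
qed simp

end

section \<open>The module J(g) and the components of a homotopy\<close>

lemma lookup_pmap: "q 0 = 0 ==> lookup (Poly_Mapping.map q Y) a = q (lookup Y a)"
 by (simp add: Poly_Mapping.map.rep_eq when_def)

text \<open>The sign of the identification of J \<otimes> C(g, N) with C(g, J(N)) on the
  dt-component.\<close>

definition sg :: "('k::real_normed_field, 'g::ab_group_add) dgla => 'g coc => 'g coc" where
 "sg L Y = (\<Sum>a\<in>keys Y. single a (scl L (ksign (mdeg L a)) (lookup Y a)))"

context dgl
begin

lemma scl_0 [simp]: "scl L c 0 = 0"
 by (rule lb.vs.scale_zero_right)

lemma lookup_sg: "lookup (sg L Y) a = scl L (ksign (mdeg L a)) (lookup Y a)"
proof -
 have "lookup (sg L Y) a = (\<Sum>c\<in>keys Y. if c = a then scl L (ksign (mdeg L a)) (lookup Y a) else 0)"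
  unfolding sg_def lookup_sum by (intro sum.cong refl) (auto simp: lookup_single when_def)
 also have "\<dots> = scl L (ksign (mdeg L a)) (lookup Y a)"
  by (auto simp: in_keys_iff)
 finally show ?thesis .
qed

lemma keys_sg: "keys (sg L Y) <= keys Y"
 by (auto simp: in_keys_iff lookup_sg)

lemma sg_gr: "Y \<in> gr (coch L L) n ==> sg L Y \<in> gr (coch L L) n"
 using keys_sg[of Y] by (auto simp: gr_coch lookup_sg gr_scl[OF gs_L])

lemma sg_car: "Y \<in> carC L L ==> sg L Y \<in> carC L L"
 using keys_sg[of Y] by (auto simp: lc.car_C lookup_sg car_scl[OF gs_L])

lemma cmp_superset: "finite S ==> keys Y <= S ==> cmp L Y j = (\<Sum>a\<in>S. single a (coord L j (lookup Y a)))"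
 unfolding cmp_def by (rule sum_keys_superset) simp_all

lemma inA_cmp_sg:
 assumes P: "Y \<in> carC L L"
 shows "inA (cmp L (sg L Y) j) = sgno L 1 (inA (cmp L Y j))"
proof -
 have l: "lookup Y a \<in> car L" for a using P by (simp add: lc.car_C)
 have "cmp L (sg L Y) j = (\<Sum>a\<in>keys Y. single a (coord L j (lookup (sg L Y) a)))"
  by (rule cmp_superset[OF finite_keys keys_sg])
 thus ?thesis
  by (simp add: cmp_def lookup_sg coord_scl[OF l] inA_sum klin_sum[OF klin_sgno[OF klin_id]]
   single_bs[of _ "_ * _"] single_bs[of _ "coord L _ _"] inA_sc sgno_sc inA_bs sgno_bs mult.commute)
qed

lemma cmp_diff:
 assumes a: "u \<in> carC L L" and b: "v \<in> carC L L"
 shows "u - v \<in> carC L L" "cmp L (u - v) j = cmp L u j - cmp L v j"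
proof -
 have 1: "u - v = u + scl (coch L L) (- 1) v"
  by (rule poly_mapping_eqI) (simp add: lookup_minus lookup_add lookup_scl_coch[OF gs_L])
 show c: "u - v \<in> carC L L" unfolding 1 by (intro car_add[OF lc.gs_C] car_scl[OF lc.gs_C] a b)
 show "cmp L (u - v) j = cmp L u j - cmp L v j" using cmp_add[OF c b, of j] by simp
qed

lemma cmp_tot_adjoint_scl: "y \<in> car L ==> cmp L (tot (act (adjoint L)) (scl L c y)) j = sc c (cmp L (tot (act (adjoint L)) y) j)"
 by (simp add: cmp_tot_adjoint car_scl[OF gs_L] ldiff_lin coord_scl ldiff_car lbr_lin[OF bas_grL] lbr_car[OF bas_grL] sc_add sc_sum sc_single)

abbreviation "J \<equiv> J_module L (adjoint L)"

lemma J_simps: "scl J c n = (scl L c (fst n), scl L c (fst (snd n)), scl L c (snd (snd n)))"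
  "gr J i = gr L i \<times> gr L i \<times> gr L (i - 1)"
 by (simp_all add: J_module_def case_prod_unfold)

text \<open>The projections of \<open>J(\<gg>)\<close> to \<open>\<gg>\<close>, with the shift \<open>r\<close> of degree that they cause.\<close>

definition proj :: "int => ('g \<times> 'g \<times> 'g => 'g) => bool" where
 "proj r q \<longleftrightarrow> (\<forall>x y. q (x + y) = q x + q y) \<and> (\<forall>c x. q (scl J c x) = scl L c (q x)) \<and>
  (\<forall>i. \<forall>x\<in>gr J i. q x \<in> gr L (i + r))"

lemma projD:
 assumes "proj r q"
 shows "q (x + y) = q x + q y" "q (scl J c x) = scl L c (q x)" "x \<in> gr J i ==> q x \<in> gr L (i + r)" "q 0 = 0"
proof -
 show a: "q (x + y) = q x + q y" for x y using assms unfolding proj_def by blast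
 show "q (scl J c x) = scl L c (q x)" "x \<in> gr J i ==> q x \<in> gr L (i + r)" using assms unfolding proj_def by blast+
 show "q 0 = 0" using a[of 0 0] by simp
qed

lemma proj_components: "proj 0 fst" "proj 0 (%n. fst (snd n))" "proj 0 (%n. fst n + fst (snd n))" "proj (- 1) (%n. snd (snd n))"
 by (auto simp: proj_def J_simps gr_add[OF gs_L] lb.vs.scale_right_distrib)

lemma pmap_add: "proj r q ==> Poly_Mapping.map q (x + y) = Poly_Mapping.map q x + Poly_Mapping.map q y"
 by (rule poly_mapping_eqI) (simp add: lookup_pmap projD lookup_add)

lemma pmap_sum: "proj r q ==> Poly_Mapping.map q (sum g A) = (\<Sum>i\<in>A. Poly_Mapping.map q (g i))"
proof (induction A rule: infinite_finite_induct)
 case (insert i A)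
 thus ?case by (simp add: pmap_add)
qed (simp_all add: poly_mapping_eqI lookup_pmap projD(4))

lemma pmap_single: "proj r q ==> Poly_Mapping.map q (single a v) = single a (q v)"
 by (rule poly_mapping_eqI) (simp add: lookup_pmap projD(4) lookup_single when_def)

lemma pmap_cmul:
 assumes q: "proj r q"
 shows "Poly_Mapping.map q (cmul L J u Y) = cmul L L u (Poly_Mapping.map q Y)"
proof -
 have k: "keys (Poly_Mapping.map q Y) <= keys Y" by (auto simp: in_keys_iff lookup_pmap projD(4)[OF q])
 have 1: "Poly_Mapping.map q (cmul L J u Y) = (\<Sum>a\<in>keys u. \<Sum>b\<in>keys Y.
   single (a + b) (scl L (mcoef L a b * lookup u a) (lookup (Poly_Mapping.map q Y) b)))"
  unfolding cmul_def pmap_sum[OF q]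
 proof (intro sum.cong refl)
  fix a b
  have z: "Poly_Mapping.map q 0 = 0" by (rule poly_mapping_eqI) (simp add: lookup_pmap projD(4)[OF q])
  show "Poly_Mapping.map q (if a + b \<in> mons L then single (a + b) (scl J (msign L a b * lookup u a) (lookup Y b)) else 0) =
   single (a + b) (scl L (mcoef L a b * lookup u a) (lookup (Poly_Mapping.map q Y) b))"
   by (simp add: mcoef_def pmap_single[OF q] projD[OF q] lookup_pmap z)
 qed
 have 2: "(\<Sum>b\<in>keys Y. single (a + b) (scl L (mcoef L a b * lookup u a) (lookup (Poly_Mapping.map q Y) b))) =
  (\<Sum>b\<in>keys (Poly_Mapping.map q Y). single (a + b) (scl L (mcoef L a b * lookup u a) (lookup (Poly_Mapping.map q Y) b)))" for a
  by (rule sum_keys_superset[symmetric, OF _ _ k]) simp_all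
 show ?thesis unfolding 1 2 lc.cmul_alt ..
qed

lemma lookup_act_J: "snd (snd (lookup (act J k n) c)) =
  (if k = 0 \<and> c = 0 then fst (snd n) else 0) - scl L (ksign (mdeg L c)) (lookup (act (adjoint L) k (snd (snd n))) c)"
proof -
 let ?Y = "act (adjoint L) k (snd (snd n))"
 have s: "lookup (\<Sum>a\<in>keys ?Y. single a (0 :: 'g, 0 :: 'g, scl L (ksign (mdeg L a)) (lookup ?Y a))) c =
   (0, 0, scl L (ksign (mdeg L c)) (lookup ?Y c))"
 proof -
  have "lookup (\<Sum>a\<in>keys ?Y. single a (0 :: 'g, 0 :: 'g, scl L (ksign (mdeg L a)) (lookup ?Y a))) c =
    (\<Sum>a\<in>keys ?Y. if a = c then (0, 0, scl L (ksign (mdeg L c)) (lookup ?Y c)) else 0)"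
   unfolding lookup_sum by (intro sum.cong refl) (auto simp: lookup_single when_def)
  also have "\<dots> = (0, 0, scl L (ksign (mdeg L c)) (lookup ?Y c))"
   by (auto simp: in_keys_iff zero_prod_def)
  finally show ?thesis .
 qed
 have p: "lookup (Poly_Mapping.map (%y. (y, 0 :: 'g, 0 :: 'g)) X) c = (lookup X c, 0, 0)"
  "lookup (Poly_Mapping.map (%y. (0 :: 'g, y, 0 :: 'g)) X) c = (0, lookup X c, 0)" for X
  by (simp_all add: lookup_pmap zero_prod_def)
 show ?thesis
  by (simp add: J_module_def case_prod_unfold lookup_add lookup_minus s p lookup_single when_def)
qed

lemma act_J_0: "2 \<le> k ==> act J k n = 0"
proof -
 assume k: "2 \<le> k"
 hence "act (adjoint L) k y = 0" for y by (simp add: adjoint_def)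
 moreover have "Poly_Mapping.map (%y. (y, 0 :: 'g, 0 :: 'g)) (0 :: mono \<Rightarrow>\<^sub>0 'g) = 0"
  "Poly_Mapping.map (%y. (0 :: 'g, y, 0 :: 'g)) (0 :: mono \<Rightarrow>\<^sub>0 'g) = 0"
  by (rule poly_mapping_eqI, simp add: lookup_pmap zero_prod_def)+
 ultimately show ?thesis using k by (simp add: J_module_def case_prod_unfold)
qed

abbreviation "q3 \<equiv> (%n :: 'g \<times> 'g \<times> 'g. snd (snd n))"
abbreviation "q1 \<equiv> (%n :: 'g \<times> 'g \<times> 'g. fst (snd n))"

text \<open>The dt-part of the differential: t \<mapsto> dt contributes the coefficient of t, and d
  (dt u) = - dt (d u) the rest, with the sign of the identification.\<close>

lemma tot_act_J: "Poly_Mapping.map q3 (tot (act J) n) = single 0 (q1 n) - sg L (tot (act (adjoint L)) (q3 n))"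
proof (rule poly_mapping_eqI)
 fix c
 have J: "tot (act J) n = (\<Sum>k\<in>{0, 1}. act J k n)"
  unfolding tot_def
 proof (rule sum.mono_neutral_left)
  show "{k. act J k n ~= 0} <= {0, 1}"
  proof
   fix k assume "k \<in> {k. act J k n ~= 0}"
   hence "\<not> 2 \<le> k" using act_J_0 by blast
   thus "k \<in> {0, 1}" by auto
  qed
 qed auto
 have A: "tot (act (adjoint L)) (q3 n) = (\<Sum>k\<in>{0, 1}. act (adjoint L) k (q3 n))"
  unfolding tot_def by (rule sum.mono_neutral_left) (auto simp: adjoint_def)
 show "lookup (Poly_Mapping.map q3 (tot (act J) n)) c = lookup (single 0 (q1 n) - sg L (tot (act (adjoint L)) (q3 n))) c"
  unfolding J A by (simp add: lookup_pmap lookup_add lookup_minus lookup_sg lookup_act_J lookup_single when_def lb.vs.scale_right_distrib)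
qed

lemma pmap_d_tot_J: "Poly_Mapping.map q3 (d_tot L J Y) = (\<Sum>a\<in>keys Y.
  cmul L L (d_CE L (bs a)) (single 0 (q3 (lookup Y a))) +
  cmul L L (sk (mdeg L a) (bs a)) (single 0 (q1 (lookup Y a)) - sg L (tot (act (adjoint L)) (q3 (lookup Y a)))))"
 unfolding d_tot_def pmap_sum[OF proj_components(4)] pmap_add[OF proj_components(4)] pmap_cmul[OF proj_components(4)]
  pmap_single[OF proj_components(4)] tot_act_J
 by (simp add: single_bs[of _ "ksign _"] bs_def[symmetric])

end

locale hmt = A: wlp L M f + B: wlp L M f'
 for L :: "('k::real_normed_field, 'g::ab_group_add) dgla" and M :: "('k, 'm::ab_group_add) infmod" and f f' +
 fixes H
 assumes H: "inf_morphism L M (J_module L (adjoint L)) H"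
  and H0: "inf_comp L (adjoint L) (strict (J_module L (adjoint L)) (%(n\<^sub>0, n\<^sub>1, u). n\<^sub>0)) H = f"
  and H1: "inf_comp L (adjoint L) (strict (J_module L (adjoint L)) (%(n\<^sub>0, n\<^sub>1, u). n\<^sub>0 + n\<^sub>1)) H = f'"
begin

lemma H_fam: "cochain_family L M A.J 0 H"
 using H by (simp add: inf_morphism_def)

lemma H_mor: "X \<in> carC L M ==> lin_ext L A.J H (d_tot L M X) = d_tot L A.J (lin_ext L A.J H X)"
 using H by (simp add: inf_morphism_def)

lemma H_props: "x \<in> car M ==> y \<in> car M ==> H k (x + y) = H k x + H k y"
 "x \<in> car M ==> H k (scl M c x) = scl (coch L A.J) c (H k x)"
 "x \<in> gr M i ==> H k x \<in> gr (coch L A.J) i"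
 "x \<in> car M ==> has_arity k (H k x)"
 "x \<in> car M ==> \<exists>K. \<forall>k\<ge>K. H k x = 0"
 using H_fam by (simp_all add: cochain_family_def linear_deg_def)

text \<open>H is studied through its composites with the projections, which are cochain families
  with values in g; in this way no basis of J(g) has to be chosen.\<close>

abbreviation "hq q \<equiv> %k m. Poly_Mapping.map q (H k m)"

lemma fam_hq:
 assumes q: "A.proj r q"
 shows "cochain_family L M (adjoint L) r (hq q)"
 unfolding cochain_family_def linear_deg_def
proof (intro conjI allI ballI)
 fix k x c assume x: "x \<in> car M"
 have z: "scl A.J c 0 = 0" by (simp add: A.J_simps zero_prod_def)
 show "hq q k (scl M c x) = scl (coch L (adjoint L)) c (hq q k x)"
  unfolding H_props(2)[OF x] scl_coch
  by (rule poly_mapping_eqI) (simp add: lookup_pmap A.projD[OF q] z)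
 have "keys (hq q k x) <= keys (H k x)" by (auto simp: in_keys_iff lookup_pmap A.projD(4)[OF q])
 thus "has_arity k (hq q k x)" using H_props(4)[OF x, of k] by (auto simp: has_arity_def)
 obtain K where K: "\<forall>k\<ge>K. H k x = 0" using H_props(5)[OF x] by blast
 have "hq q k x = 0" if "k \<ge> K" for k
  by (rule poly_mapping_eqI) (simp add: K that lookup_pmap A.projD(4)[OF q])
 thus "\<exists>K. \<forall>k\<ge>K. hq q k x = 0" by blast
 fix y assume y: "y \<in> car M"
 show "hq q k (x + y) = hq q k x + hq q k y" by (simp add: H_props(1)[OF x y] A.pmap_add[OF q])
next
 fix k i x assume "x \<in> gr M i"
 from H_props(3)[OF this, of k]
 have h: "keys (H k x) <= mons L" "lookup (H k x) a \<in> gr A.J (i - mdeg L a)" for a by (simp_all add: gr_coch)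
 have "keys (hq q k x) <= keys (H k x)" by (auto simp: in_keys_iff lookup_pmap A.projD(4)[OF q])
 moreover have "lookup (hq q k x) a \<in> gr L (i + r - mdeg L a)" for a
 proof -
  have "q (lookup (H k x) a) \<in> gr L (i - mdeg L a + r)" by (rule A.projD(3)[OF q h(2)])
  thus ?thesis by (simp add: lookup_pmap A.projD(4)[OF q] algebra_simps)
 qed
 ultimately show "hq q k x \<in> gr (coch L (adjoint L)) (i + r)"
  using h(1) by (simp add: gr_coch)
qed

lemma tot_hq:
 assumes q: "A.proj r q" and x: "x \<in> car M"
 shows "tot (hq q) x = Poly_Mapping.map q (tot H x)"
proof -
 obtain K where K: "\<forall>k\<ge>K. H k x = 0" using H_props(5)[OF x] by blast
 have H: "tot H x = (\<Sum>k<K. H k x)" unfolding tot_def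
 proof (rule sum.mono_neutral_left)
  show "{k. H k x ~= 0} <= {..<K}" using K by (auto simp: not_le[symmetric])
 qed auto
 have "hq q k x = 0" if "k \<ge> K" for k
  by (rule poly_mapping_eqI) (simp add: K that lookup_pmap A.projD(4)[OF q])
 hence "tot (hq q) x = (\<Sum>k<K. hq q k x)" unfolding tot_def
  by (intro sum.mono_neutral_left) (auto simp: not_le[symmetric])
 thus ?thesis by (simp add: H A.pmap_sum[OF q])
qed

sublocale h3: fmap L M "- 1" "hq A.q3"
 by unfold_locales (rule fam_hq[OF A.proj_components(4)])

lemma imap_hq: "A.proj r q ==> imap L M (adjoint L) r (hq q)"
 by unfold_locales (rule fam_hq)

lemma H_car: "b \<in> car M ==> A.proj r q ==> Poly_Mapping.map q (tot H b) \<in> carC L L"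
 using cfam.tot_car[OF imap.axioms(1)[OF imap_hq]] tot_hq by (simp add: coch_adjoint)

lemma keys_tot_H: "b \<in> gr M i ==> keys (tot H b) <= mons L"
 unfolding tot_def using H_props(3) by (intro keys_subset_sum) (auto simp: gr_coch)

text \<open>\<open>strict\<close> has the value 0 outside the carrier, so membership is required
  before \<epsilon>_0 and \<epsilon>_1 can be evaluated.\<close>

lemma lookup_tot_H: "b \<in> gr M i ==> lookup (tot H b) a \<in> car A.J"
proof -
 assume b: "b \<in> gr M i"
 have z: "0 \<in> gr A.J j" for j by (simp add: A.J_simps gr_0[OF A.gs_L] zero_prod_def)
 have "lookup (tot H b) a = (\<Sum>k | H k b ~= 0. lookup (H k b) a)" by (simp add: tot_def lookup_sum)
 also have "\<dots> \<in> gr A.J (i - mdeg L a)"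
 proof -
  have "(\<Sum>k\<in>A. lookup (H k b) a) \<in> gr A.J (i - mdeg L a)" for A
  proof (induction A rule: infinite_finite_induct)
   case (insert k A)
   have "lookup (H k b) a \<in> gr A.J (i - mdeg L a)" using H_props(3)[OF b, of k] by (simp add: gr_coch)
   thus ?case using insert by (auto simp: A.J_simps gr_add[OF A.gs_L])
  qed (simp_all add: z)
  thus ?thesis .
 qed
 finally have "lookup (tot H b) a \<in> gr A.J (i - mdeg L a)" .
 hence "is_decomp A.J (lookup (tot H b) a) (%j. if j = i - mdeg L a then lookup (tot H b) a else 0)"
  by (intro is_decompI[where F = "{i - mdeg L a}"]) (auto simp: z)
 thus ?thesis by (auto simp: car_def)
qed

lemma tot_strict:
 assumes q: "A.proj 0 q" and b: "b \<in> gr M i" and g: "inf_comp L (adjoint L) (strict A.J q) H = g"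
 shows "tot g b = Poly_Mapping.map q (tot H b)"
proof -
 have t: "tot (strict A.J q) n = single 0 (q n)" if "n \<in> car A.J" for n
 proof -
  have "tot (strict A.J q) n = (\<Sum>k\<in>{0}. strict A.J q k n)"
   unfolding tot_def by (rule sum.mono_neutral_left) (auto simp: strict_def)
  thus ?thesis using that by (simp add: strict_def)
 qed
 have "tot g b = lin_adj L (strict A.J q) (tot H b)" unfolding g[symmetric] by (rule tot_inf_comp)
 also have "\<dots> = (\<Sum>a\<in>keys (tot H b). single a (q (lookup (tot H b) a)))"
  unfolding lin_ext_alt
 proof (intro sum.cong refl)
  fix a assume "a \<in> keys (tot H b)"
  hence a: "a \<in> mons L" using keys_tot_H[OF b] by blast
  let ?v = "q (lookup (tot H b) a)"
  show "cmul L (adjoint L) (bs a) (tot (strict A.J q) (lookup (tot H b) a)) = single a ?v"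
   unfolding t[OF lookup_tot_H[OF b]] cmul_adjoint
   using a by (cases "?v = 0") (simp_all add: A.lc.cmul_alt bs_def)
 qed
 also have "\<dots> = Poly_Mapping.map q (\<Sum>a\<in>keys (tot H b). single a (lookup (tot H b) a))"
  by (simp add: A.pmap_sum[OF q] A.pmap_single[OF q])
 finally show ?thesis by (simp only: poly_mapping_sum_single[symmetric])
qed

lemma tot_f: "b \<in> gr M i ==> tot f b = Poly_Mapping.map fst (tot H b)"
proof (rule tot_strict[OF A.proj_components(1)])
 have "fst = (%(n\<^sub>0 :: 'g, n\<^sub>1 :: 'g, u :: 'g). n\<^sub>0)" by (simp add: fun_eq_iff)
 thus "inf_comp L (adjoint L) (strict A.J fst) H = f" using H0 by simp
qed

lemma tot_f': "b \<in> gr M i ==> tot f' b = Poly_Mapping.map (%n. fst n + fst (snd n)) (tot H b)"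
proof (rule tot_strict[OF A.proj_components(3)])
 have "(%n. fst n + fst (snd n)) = (%(n\<^sub>0 :: 'g, n\<^sub>1 :: 'g, u :: 'g). n\<^sub>0 + n\<^sub>1)" by (simp add: fun_eq_iff)
 thus "inf_comp L (adjoint L) (strict A.J (%n. fst n + fst (snd n))) H = f'" using H1 by simp
qed

lemma pmap_lin_ext_H:
 assumes q: "A.proj r q" and O: "X \<in> carC L M"
 shows "Poly_Mapping.map q (lin_ext L A.J H X) = lin_adj L (hq q) X"
 unfolding lin_ext_alt A.pmap_sum[OF q] A.pmap_cmul[OF q] cmul_adjoint
 using O by (intro sum.cong refl) (simp add: tot_hq[OF q] A.mc.car_C)

text \<open>The dt-component of the condition that H commutes with the total differentials.\<close>

lemma third_component:
 assumes b: "b \<in> gr M i"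
 shows "lin_adj L (hq A.q3) (tot (act M) b) = Poly_Mapping.map A.q3 (d_tot L A.J (tot H b))"
proof -
 note bc = gr_car[OF A.mc.gs_V b]
 have s: "single 0 b \<in> carC L M" by (rule A.e0_car[OF bc])
 have c: "Poly_Mapping.map q (lin_ext L A.J H (single 0 b)) = Poly_Mapping.map q (tot H b)" if q: "A.proj r q" for r q
 proof -
  interpret I: imap L M "adjoint L" r "hq q" by (rule imap_hq[OF q])
  have "cmul L L (bs 0) Y = Y" if "Y \<in> carC L L" for Y
   by (rule A.lc.emb_inj) (use that in \<open>simp_all add: A.lc.cmul_car A.lc.emb_cmul inA_bs prd_one_left el_rc[OF lel_el[OF A.lc.lel_emb]]\<close>)
  thus ?thesis
   unfolding pmap_lin_ext_H[OF q s] I.lin_ext_single[OF bc] tot_hq[OF q bc] cmul_adjoint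
   using H_car[OF bc q] by simp
 qed
 have X: "lin_ext L A.J H (single 0 b) = tot H b"
 proof (rule poly_mapping_eqI)
  fix a
  have l: "q (lookup (lin_ext L A.J H (single 0 b)) a) = q (lookup (tot H b) a)" if q: "A.proj r q" for r q
   using arg_cong[OF c[OF q], of "%x. lookup x a"] by (simp add: lookup_pmap A.projD(4)[OF q])
  show "lookup (lin_ext L A.J H (single 0 b)) a = lookup (tot H b) a"
   using l[OF A.proj_components(1)] l[OF A.proj_components(2)] l[OF A.proj_components(4)] by (simp add: prod_eq_iff)
 qed
 have "lin_ext L A.J H (tot (act M) b) = d_tot L A.J (tot H b)"
  using H_mor[OF s] by (simp add: A.d_tot_0[OF bc] X)
 thus ?thesis
  using pmap_lin_ext_H[OF A.proj_components(4) A.A.tot_car[OF bc]] by simp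
qed

text \<open>The dt-component of H(b), with the sign that undoes the identification and puts dt in
  front of the coefficient.\<close>

definition eta where "eta b = sg L (Poly_Mapping.map A.q3 (tot H b))"

lemma eta_gr: "b \<in> gr M i ==> eta b \<in> gr (coch L L) (i - 1)"
 using h3.F.tot_gr[of b i] tot_hq[OF A.proj_components(4) gr_car[OF A.mc.gs_V, of b i]]
 by (auto simp: eta_def coch_adjoint intro: A.sg_gr)

text \<open>f' - f is the coefficient of t in H. The dt-component of the chain condition expresses
  it by the adjoint differential of \<open>eta\<close> and the dt-component of H at the differential
  of b.\<close>

lemma homotopy_formula:
 fixes j
 assumes b: "b \<in> gr M i"
 shows "(inA (cmp L (tot f' b) j) - inA (cmp L (tot f b) j) :: ('m, 'k) walg) =
  inA (cmp L (d_tot L (adjoint L) (eta b)) j) +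
  sgno L 1 (inA (cmp L (lin_adj L (hq A.q3) (tot (act M) b)) j))"
proof -
 note bc = gr_car[OF A.mc.gs_V b]
 let ?P = "tot H b" and ?i = "inA :: 'k coc => ('m, 'k) walg"
 define u n where "u a = A.q3 (lookup ?P a)" and "n a = A.q1 (lookup ?P a)" for a
 define t where "t a = cmp L (tot (act (adjoint L)) (u a)) j" for a
 have u: "u a \<in> car L" and n: "n a \<in> car L" for a
  using H_car[OF bc A.proj_components(4)] H_car[OF bc A.proj_components(2)]
  by (simp_all add: u_def n_def A.lc.car_C lookup_pmap)
 have n0: "fst (lookup ?P a) \<in> car L" for a
  using H_car[OF bc A.proj_components(1)] by (simp add: A.lc.car_C lookup_pmap)
 have tc: "tot (act (adjoint L)) (u a) \<in> carC L L" for a by (rule A.tot_adjoint_car[OF u])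
 have s: "single 0 v \<in> carC L L" if "v \<in> car L" for v using that by (intro A.lc.single_car mons_0)
 let ?d = "%a. vf L (dgn L) (?i (bs a))"
 have hb: "hom L (mdeg L a) (?i (bs a))" for a by (rule hom_inA) simp
 have hd: "hom L (1 + mdeg L a) (?d a)" for a by (rule hom_vf[OF A.vfdeg_dgn hb])
 have one: "prd L x (?i (single 0 c)) = sc c x" if "rc L x" for x c
  using that by (simp add: single_bs[of _ c] inA_sc inA_bs prd_sc_right prd_one_right)
 have rcb: "rc L (?i (bs a))" if "a \<in> keys ?P" for a
  using keys_tot_H[OF b] that by (intro rc_inA) auto
 have kq: "keys (Poly_Mapping.map q ?P) <= keys ?P" if q: "A.proj r q" for r q
  by (auto simp: in_keys_iff lookup_pmap A.projD(4)[OF q])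
 have L: "?i (cmp L (tot f' b) j) - ?i (cmp L (tot f b) j) = (\<Sum>a\<in>keys ?P. sc (coord L j (n a)) (?i (bs a)))"
 proof -
  have "cmp L (tot f' b) j = (\<Sum>a\<in>keys ?P. single a (coord L j (fst (lookup ?P a)) + coord L j (n a)))"
   unfolding tot_f'[OF b] A.cmp_superset[OF finite_keys kq[OF A.proj_components(3)]]
   by (simp add: lookup_pmap A.coord_add n0 n n_def[symmetric])
  moreover have "cmp L (tot f b) j = (\<Sum>a\<in>keys ?P. single a (coord L j (fst (lookup ?P a))))"
   unfolding tot_f[OF b] A.cmp_superset[OF finite_keys kq[OF A.proj_components(1)]]
   by (simp add: lookup_pmap)
  ultimately have "cmp L (tot f' b) j = cmp L (tot f b) j + (\<Sum>a\<in>keys ?P. single a (coord L j (n a)))"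
   by (simp add: single_add sum.distrib)
  thus ?thesis by (simp add: inA_add inA_sum single_bs[of _ "coord L j (n _)"] inA_sc)
 qed
 have D: "?i (cmp L (d_tot L (adjoint L) (eta b)) j) = (\<Sum>a\<in>keys ?P.
   sc (ksign (mdeg L a) * coord L j (u a)) (?d a) + prd L (?i (bs a)) (?i (t a)))"
 proof -
  have le: "lookup (eta b) a = scl L (ksign (mdeg L a)) (u a)" for a
   by (simp add: eta_def A.lookup_sg lookup_pmap u_def)
  have ke: "keys (eta b) <= keys ?P"
   unfolding eta_def using A.keys_sg kq[OF A.proj_components(4)] by blast
  have "d_tot L (adjoint L) (eta b) = (\<Sum>a\<in>keys ?P.
    cmul L L (d_CE L (bs a)) (single 0 (lookup (eta b) a)) +
    cmul L L (sk (mdeg L a) (bs a)) (tot (act (adjoint L)) (lookup (eta b) a)))"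
   unfolding A.d_tot_adjoint_alt
  proof (rule sum_keys_superset[OF _ _ ke])
   have "ldiff L 0 = 0" using A.ldiff_lin(2)[OF car_0[OF A.gs_L], of 0] by simp
   moreover have "lbr L (bas L ! k) 0 = 0" if "k < ldim L" for k
    using A.lbr_lin(2)[OF A.bas_grL[OF that] car_0[OF A.gs_L], of 0] by simp
   ultimately have "tot (act (adjoint L)) 0 = 0" by (simp add: A.tot_adjoint)
   thus "cmul L L (d_CE L (bs a)) (single 0 0) + cmul L L (sk (mdeg L a) (bs a)) (tot (act (adjoint L)) 0) = 0" for a
    by (simp add: cmul_def)
  qed simp
  hence "cmp L (d_tot L (adjoint L) (eta b)) j = (\<Sum>a\<in>keys ?P.
    cmul L ground (d_CE L (bs a)) (single 0 (ksign (mdeg L a) * coord L j (u a))) +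
    cmul L ground (sk (mdeg L a) (bs a)) (sk (mdeg L a) (t a)))"
   by (simp add: le A.cmp_sum car_add[OF A.lc.gs_C] A.lc.cmul_car s car_scl[OF A.gs_L] u A.tot_adjoint_car
    A.cmp_add A.cmp_cmul A.cmp_single A.coord_scl A.cmp_tot_adjoint_scl t_def)
  thus ?thesis
   by (simp add: inA_sum inA_add inA_cmul inA_d_CE one inA_sc prd_sc_left prd_sc_right)
 qed
 have T: "sgno L 1 (?i (cmp L (lin_adj L (hq A.q3) (tot (act M) b)) j)) = (\<Sum>a\<in>keys ?P.
   sc (- ksign (mdeg L a) * coord L j (u a)) (?d a) + (sc (coord L j (n a)) (?i (bs a)) - prd L (?i (bs a)) (?i (t a))))"
 proof -
  have dc: "single 0 (n a) - sg L (tot (act (adjoint L)) (u a)) \<in> carC L L" for a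
   by (rule A.cmp_diff(1)[OF s[OF n] A.sg_car[OF tc]])
  have "lin_adj L (hq A.q3) (tot (act M) b) = (\<Sum>a\<in>keys ?P.
   cmul L L (d_CE L (bs a)) (single 0 (u a)) +
   cmul L L (sk (mdeg L a) (bs a)) (single 0 (n a) - sg L (tot (act (adjoint L)) (u a))))"
   unfolding third_component[OF b] A.pmap_d_tot_J u_def n_def ..
  hence "cmp L (lin_adj L (hq A.q3) (tot (act M) b)) j = (\<Sum>a\<in>keys ?P.
   cmul L ground (d_CE L (bs a)) (single 0 (coord L j (u a))) +
   cmul L ground (sk (mdeg L a) (bs a)) (single 0 (coord L j (n a)) - cmp L (sg L (tot (act (adjoint L)) (u a))) j))"
   by (simp add: A.cmp_sum car_add[OF A.lc.gs_C] A.lc.cmul_car s u dc A.cmp_add A.cmp_cmul A.cmp_single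
    A.cmp_diff(2)[OF s[OF n] A.sg_car[OF tc]])
  hence "?i (cmp L (lin_adj L (hq A.q3) (tot (act M) b)) j) = (\<Sum>a\<in>keys ?P.
   sc (coord L j (u a)) (?d a) + sk (mdeg L a) (sc (coord L j (n a)) (?i (bs a)) - prd L (?i (bs a)) (sgno L 1 (?i (t a)))))"
   by (simp add: inA_sum inA_add inA_cmul inA_d_CE one inA_sc prd_sc_left klin_diff[OF klin_inA[OF klin_id]]
    A.inA_cmp_sg[OF tc] t_def[symmetric] prd_diff_right rcb sc_diff)
  moreover have "sgno L 1 (sc (coord L j (u a)) (?d a) + sk (mdeg L a) (sc (coord L j (n a)) (?i (bs a)) - prd L (?i (bs a)) (sgno L 1 (?i (t a)))))
   = sc (- ksign (mdeg L a) * coord L j (u a)) (?d a) + (sc (coord L j (n a)) (?i (bs a)) - prd L (?i (bs a)) (?i (t a)))" for a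
  proof -
   have k: "ksign (1 + mdeg L a) = (- ksign (mdeg L a) :: 'k)" by (simp add: ksign_def)
   have s1: "sgno L 1 (?d a) = sc (- ksign (mdeg L a)) (?d a)" using sgno_hom[OF hd, of 1 a] by (simp add: k)
   have s2: "sgno L 1 (?i (bs a)) = sk (mdeg L a) (?i (bs a))" using sgno_hom[OF hb, of 1 a] by simp
   have s3: "sgno L 1 (sgno L 1 x) = x" for x :: "('m, 'k) walg" by (simp add: sgno_sgno sgno_even)
   show ?thesis
    by (simp add: sgno_add sgno_sc klin_diff[OF klin_sgno[OF klin_id]] sgno_prd s1 s2 s3 prd_sc_left sc_diff mult.commute)
  qed
  ultimately show ?thesis by (simp only: klin_sum[OF klin_sgno[OF klin_id]])
 qed
 \<comment> \<open>The terms with d_CE(x^a) and those with the adjoint differential of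
   \<open>u a\<close> occur in \<open>D\<close> and \<open>T\<close> with opposite signs; the
   coefficients of t remain.\<close>
 show ?thesis unfolding L D T sum.distrib[symmetric]
  by (intro sum.cong refl) (simp add: sc_minus_left)
qed

end

section \<open>The isomorphism defined by a homotopy\<close>

context hmt
begin

definition Ef where "Ef m = (if real_ltr M m then cmp L (eta (lval m)) else (%_. 0))"

lemma vfdeg_Ef: "vfdeg L (gdeg m - 1) (Ef m)"
proof (cases "real_ltr M m")
 case True
 then obtain b where b: "b \<in> hbas M" "m = ltr M b" by (rule real_ltrE)
 from A.vfdeg_cmp[OF eta_gr[OF A.mc.bas_gr[OF b(1)]]] show ?thesis using b by (simp add: Ef_def)
qed (simp add: Ef_def vfdeg_def)

abbreviation "ext3 X \<equiv> lin_adj L (hq A.q3) X"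

lemma ext3_car: "X \<in> carC L M ==> ext3 X \<in> carC L L"
 using h3.F.lin_ext_car unfolding coch_adjoint .

text \<open>The signs in \<open>sA\<close> and in \<open>eta\<close> combine to the parity operator
  on components, the form in which \<open>homotopy_formula\<close> delivers its second term.\<close>

lemma nab_Ef:
 assumes "X \<in> carC L M"
 shows "nab L Ef (sA L (emb M X)) (x :: ('m, 'k) walg) =
  (\<Sum>j<ldim L. prd L (sgno L 1 (inA (cmp L (ext3 X) j))) (pd L j x))"
proof (rule A.mc.coch_eqI[OF _ _ _ _ _ assms])
 fix X Y assume c: "X \<in> carC L M" "Y \<in> carC L M"
 show "nab L Ef (sA L (emb M (X + Y))) x = nab L Ef (sA L (emb M X)) x + nab L Ef (sA L (emb M Y)) x"
  by (simp add: A.mc.emb_add c klin_add[OF klin_sA[OF klin_id]] klin_add[OF klin_nab_left[OF klin_id]])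
 show "(\<Sum>j<ldim L. prd L (sgno L 1 (inA (cmp L (ext3 (X + Y)) j))) (pd L j x)) =
  (\<Sum>j<ldim L. prd L (sgno L 1 (inA (cmp L (ext3 X) j))) (pd L j x)) +
  (\<Sum>j<ldim L. prd L (sgno L 1 (inA (cmp L (ext3 Y) j))) (pd L j x))"
  by (simp add: h3.F.lin_ext_add c A.cmp_add ext3_car inA_add sgno_add prd_add_left sum.distrib)
next
 fix X r assume c: "X \<in> carC L M"
 show "nab L Ef (sA L (emb M (scl (coch L M) r X))) x = sc r (nab L Ef (sA L (emb M X)) x)"
  by (simp add: A.mc.emb_scl c klin_sc[OF klin_sA[OF klin_id]] klin_sc[OF klin_nab_left[OF klin_id]])
 show "(\<Sum>j<ldim L. prd L (sgno L 1 (inA (cmp L (ext3 (scl (coch L M) r X)) j))) (pd L j x)) =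
  sc r (\<Sum>j<ldim L. prd L (sgno L 1 (inA (cmp L (ext3 X) j))) (pd L j x))"
  by (simp add: h3.F.lin_ext_scl c coch_adjoint A.cmp_scl ext3_car inA_sc sgno_sc prd_sc_left sc_sum)
next
 fix a b assume a: "a \<in> mons L" and b: "b \<in> hbas M"
 note bc = A.mc.bas_car[OF b]
 have t: "tot (hq A.q3) b = Poly_Mapping.map A.q3 (tot H b)" by (rule tot_hq[OF A.proj_components(4) bc])
 note P = H_car[OF bc A.proj_components(4)]
 have s: "sgno L 1 (inA (bs a)) = sk (mdeg L a) (inA (bs a) :: ('m, 'k) walg)"
  by (subst sgno_hom[where n = "mdeg L a"]) (simp_all add: inA_bs)
 have "(\<Sum>j<ldim L. prd L (sgno L 1 (inA (cmp L (ext3 (single a b)) j))) (pd L j x)) =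
  sk (mdeg L a) (sm L (bs a) (\<Sum>j<ldim L. prd L (sgno L 1 (inA (cmp L (Poly_Mapping.map A.q3 (tot H b)) j))) (pd L j x)))"
  unfolding h3.F.lin_ext_single[OF bc] cmul_adjoint t
  by (simp add: A.cmp_cmul[OF P] inA_cmul sgno_prd s prd_sc_left prd_assoc prd_sum_right sc_sum)
 also have "\<dots> = sk (mdeg L a) (sm L (bs a) (vf L (Ef (ltr M b)) x))"
  using b by (simp add: vf_def Ef_def eta_def A.inA_cmp_sg[OF P])
 also have "\<dots> = nab L Ef (sA L (emb M (single a b))) x"
  by (simp add: A.mc.emb_single_bas[OF b] sA_bs klin_sc[OF klin_nab_left[OF klin_id]] nab_bs)
 finally show "nab L Ef (sA L (emb M (single a b))) x =
  (\<Sum>j<ldim L. prd L (sgno L 1 (inA (cmp L (ext3 (single a b)) j))) (pd L j x))" by simp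
qed

text \<open>[d_CE, E_m] is contraction with the adjoint differential of \<open>eta\<close>, by
  \<open>vf_commutator\<close> and \<open>cmp_d_tot\<close>. Thus \<open>F'_F\<close> is
  \<open>homotopy_formula\<close> read as an identity of vector fields.\<close>

sublocale ch: ce_homotopy L "dgn L" "Dl M" "Fl L M f" "Fl L M f'" Ef
proof unfold_locales
 fix m
 show "vfdeg L (gdeg m - 1) (Ef m)" by (rule vfdeg_Ef)
 show "B.ce.Q (Dl M m) = 0" by (rule B.Q_Dl)
 fix x :: "('m, 'k) walg" assume x: "rc L x"
 show "B.ce.Q (B.ce.Q x) = 0" if E: "Ef m ~= (%_. 0)"
 proof -
  have "real_ltr M m" using E by (auto simp: Ef_def split: if_splits)
  then obtain b where "b \<in> hbas M" by (rule real_ltrE)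
  thus ?thesis using x by (rule B.Q_Q)
 qed
 show "vf L (Fl L M f' m) x - vf L (Fl L M f m) x =
  vf L (dgn L) (vf L (Ef m) x) - sk (1 * (gdeg m - 1)) (vf L (Ef m) (vf L (dgn L) x)) +
  nab L Ef (sA L (Dl M m)) x"
 proof (cases "real_ltr M m")
  case True
  then obtain b where b: "b \<in> hbas M" "m = ltr M b" by (rule real_ltrE)
  note bg = A.mc.bas_gr[OF b(1)] and bc = A.mc.bas_car[OF b(1)]
  have e: "Ef m = cmp L (eta b)" using b by (simp add: Ef_def)
  have s: "ksign (mdg M b - 1) = (- ksign (1 * (gdeg m - 1)) :: 'k)" by (simp add: b ksign_def)
  have v: "vfdeg L (gdeg m - 1) (cmp L (eta b))" using vfdeg_Ef[of m] by (simp add: e)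
  have "vf L (dgn L) (vf L (cmp L (eta b)) x) - sk (1 * (gdeg m - 1)) (vf L (cmp L (eta b)) (vf L (dgn L) x)) =
    vf L (%j. vfA L (dgn L) (cmp L (eta b) j) - sk (1 * (gdeg m - 1)) (vfA L (cmp L (eta b)) (dgn L j))) x"
   by (rule vf_commutator[OF A.vfdeg_dgn v x])
  also have "\<dots> = vf L (cmp L (d_tot L (adjoint L) (eta b))) x"
   by (intro fun_cong[OF vf_cong]) (simp add: A.cmp_d_tot[OF eta_gr[OF bg]] s sc_minus_left)
  finally have c: "vf L (dgn L) (vf L (Ef m) x) - sk (1 * (gdeg m - 1)) (vf L (Ef m) (vf L (dgn L) x)) =
    vf L (cmp L (d_tot L (adjoint L) (eta b))) x" unfolding e .
  have "vf L (Fl L M f' m) x - vf L (Fl L M f m) x = (\<Sum>j<ldim L. prd L (inA (cmp L (tot f' b) j) - inA (cmp L (tot f b) j)) (pd L j x))"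
   using b by (simp add: Fl_def vf_def prd_diff_left sum_subtractf)
  also have "\<dots> = vf L (cmp L (d_tot L (adjoint L) (eta b))) x + nab L Ef (sA L (Dl M m)) x"
   unfolding homotopy_formula[OF bg] b(2) A.Dl_ltr[OF b(1)] nab_Ef[OF A.A.tot_car[OF bc]]
   by (simp add: vf_def prd_add_left sum.distrib)
  finally show ?thesis unfolding c .
 qed (simp add: Fl_def Ef_def Dl_def klin_0[OF klin_nab_left[OF klin_id]])
qed

lemma wds_rws_ow: "list_all (real_ltr M) w ==> wds (rws M) (ch.cc.ow w)"
proof (induction w)
 case (Cons m w)
 have "wds (rws M) (ch.op m (ch.cc.ow w))"
 proof (rule ch.wds_op)
  show o: "wds (rws M) (ch.cc.ow w)" using Cons by simp
  show "wds (rws M) (B.ce.th (lt m) (ch.cc.ow w))"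
   by (rule B.wds_rws_th[OF _ o]) (use Cons in \<open>simp add: lt_def\<close>)
 qed (rule B.wds_rws_qw, simp)
 thus ?case by simp
qed simp

lemma wds_rws_Phi: "wds (rws M) x ==> wds (rws M) (ch.cc.Phi x)"
 by (erule ch.cc.wds_Phi) (rule wds_rws_ow, simp)

lemma leibmap_Phi: "leibmap L M f M f' ch.cc.Phi"
proof unfold_locales
 show "klin ch.cc.Phi" by (rule ch.cc.klin_Phi[OF klin_id])
 fix x :: "('m, 'k) walg"
 show "rc L (ch.cc.Phi x)" by (rule ch.cc.rc_Phi)
 show "wds (rws M) (ch.cc.Phi x)" if "wds (rws M) x" by (rule wds_rws_Phi[OF that])
 show "hom L (n + 0) (ch.cc.Phi x)" if "hom L n x" for n using ch.cc.hom_Phi[OF that] by simp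
 show "comul L ch.cc.Phi" by (rule ch.cc.comul_Phi)
 show "ch.cc.Phi (A.ce.Q x) = B.ce.Q (ch.cc.Phi x)" if "rc L x" by (rule ch.cc.Phi_Q[OF that])
qed

text \<open>The inverse from \<open>comul_inverse\<close> intertwines the differentials in the
  opposite direction, and its support clause keeps it within words in letters of \<open>M\<close>;
  so it yields a morphism as well.\<close>

lemma isomorphic_G: "isomorphic (Leib (CE L)) (G_object L (M, f)) (G_object L (M, f'))"
proof -
 have "keys (ch.cc.Phi (bs (0, w)) - bs (0, w)) <= {b. length (snd b) < length w}" for w
  using ch.ow_low[of w] by simp
 from comul_inverse[OF ch.cc.comul_Phi this] obtain X where X: "comul L X"
  "!!x. rc L x ==> ch.cc.Phi (X x) = x" "!!x. rc L x ==> X (ch.cc.Phi x) = x"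
  "!!K x. (!!x. keys x <= K ==> keys (ch.cc.Phi x) <= K) ==> keys x <= K ==> keys (X x) <= K"
  by blast
 interpret P: leibmap L M f M f' ch.cc.Phi by (rule leibmap_Phi)
 have "leibmap L M f' M f X"
 proof unfold_locales
  show "klin X" "comul L X" by (rule comulD(1)[OF X(1)], rule X(1))
  fix x :: "('m, 'k) walg"
  show "rc L (X x)" if "rc L x" by (rule comulD(3)[OF X(1) that])
  show "wds (rws M) (X x)" if "wds (rws M) x" by (rule X(4)[OF wds_rws_Phi that])
  show "hom L (n + 0) (X x)" if "hom L n x" for n using comulD(5)[OF X(1) that] by simp
  show "X (B.ce.Q x) = A.ce.Q (X x)" if x: "rc L x"
  proof -
   have r: "rc L (X x)" by (rule comulD(3)[OF X(1) x])
   have "B.ce.Q x = ch.cc.Phi (A.ce.Q (X x))" using ch.cc.Phi_Q[OF r] X(2)[OF x] by simp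
   thus ?thesis using X(3)[OF A.ce.rc_Q, of "X x"] by simp
  qed
 qed
 then interpret X: leibmap L M f' M f X .
 have c: "cspace M" by unfold_locales
 have 1: "arr L M M (%x. X (ch.cc.Phi x)) = arr L M M (%x. x)" "arr L M M (%x. ch.cc.Phi (X x)) = arr L M M (%x. x)"
  by (rule arr_cong[OF c], rule X(3), assumption) (rule arr_cong[OF c], rule X(2), assumption)
 note 2 = leib_comp_arr[OF P.leibmap_axioms X.leibmap_axioms] leib_comp_arr[OF X.leibmap_axioms P.leibmap_axioms]
 show ?thesis
  unfolding isomorphic_def
 proof (intro bexI conjI)
  show "arr L M M ch.cc.Phi \<in> Hom (Leib (CE L)) A.G B.G" using P.leib_morphism by (simp add: Leib_def)
  show "arr L M M X \<in> Hom (Leib (CE L)) B.G A.G" using X.leib_morphism by (simp add: Leib_def)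
  show "Cmp (Leib (CE L)) A.G B.G A.G (arr L M M X) (arr L M M ch.cc.Phi) = Idn (Leib (CE L)) A.G"
   unfolding A.arr_id[symmetric] 1(1)[symmetric] using 2(1) by (simp add: Leib_def)
  show "Cmp (Leib (CE L)) B.G A.G B.G (arr L M M ch.cc.Phi) (arr L M M X) = Idn (Leib (CE L)) B.G"
   unfolding B.arr_id[symmetric] 1(2)[symmetric] using 2(2) by (simp add: Leib_def)
 qed
qed

end

theorem theorem2:
  fixes L :: "('k::real_normed_field, 'g::ab_group_add) dgla"
  assumes "dg_lie_algebra L"
  shows
    "(\<forall>(M :: ('k, 'm::ab_group_add) infmod) f. weak_LP_module L M f \<longrightarrow>
        leib_algebra (CE L) (G_object L (M, f)) \<and>
        (\<forall>\<Omega> \<in> car (coch L (shift 1 M)). brk (G_object L (M, f)) [\<Omega>] = d_tot L (shift 1 M) \<Omega>)) \<and>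
     (\<exists>G_arrow.
        is_functor (wLP L :: (('k, 'g, 'm) wLP_object, _) cat) (Leib (CE L)) (G_object L) G_arrow \<and>
        (\<forall>(M :: ('k, 'm) infmod) f N g. \<forall>\<phi> \<in> Hom (wLP L) (M, f) (N, g).
           weak_LP_module L M f \<longrightarrow> weak_LP_module L N g \<longrightarrow>
           (\<forall>\<Omega> \<in> car (coch L (shift 1 M)).
              G_arrow (M, f) (N, g) \<phi> [\<Omega>] = lin_ext L (shift 1 N) \<phi> \<Omega>))) \<and>
     (\<forall>(M :: ('k, 'm) infmod) f f'.
        weak_LP_module L M f \<longrightarrow> weak_LP_module L M f' \<longrightarrow> homotopic L M f f' \<longrightarrow>
        isomorphic (Leib (CE L)) (G_object L (M, f)) (G_object L (M, f')))"
proof (intro conjI allI impI exI[of _ "garr L"] ballI)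
 fix M :: "('k, 'm) infmod" and f assume "weak_LP_module L M f"
 then interpret wlp L M f by (rule wlpI[OF assms])
 show "leib_algebra (CE L) (G_object L (M, f))" by (rule leib_algebra_G)
 show "brk (G_object L (M, f)) [\<Omega>] = d_tot L (shift 1 M) \<Omega>" for \<Omega> by (simp add: G_object_def)
next
 show "is_functor (wLP L :: (('k, 'g, 'm) wLP_object, _) cat) (Leib (CE L)) (G_object L) (garr L)"
  by (rule is_functor_garr[OF assms])
next
 fix M N :: "('k, 'm) infmod" and f g \<phi> \<Omega>
 assume h: "\<phi> \<in> Hom (wLP L) (M, f) (N, g)" and M: "weak_LP_module L M f" and N: "weak_LP_module L N g"
  and O: "\<Omega> \<in> car (coch L (shift 1 M))"
 interpret wlpmap L M f N g \<phi>
  by (rule wlpmapI[OF wlpI[OF assms M] wlpI[OF assms N]]) (use h in \<open>simp_all add: wLP_def\<close>)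
 show "garr L (M, f) (N, g) \<phi> [\<Omega>] = lin_ext L (shift 1 N) \<phi> \<Omega>"
  using arr_single[of \<Omega>] O by (simp add: garr_def)
next
 fix M :: "('k, 'm) infmod" and f f'
 assume M: "weak_LP_module L M f" "weak_LP_module L M f'" and h: "homotopic L M f f'"
 interpret A: wlp L M f by (rule wlpI[OF assms M(1)])
 interpret B: wlp L M f' by (rule wlpI[OF assms M(2)])
 obtain H where "hmt L M f f' H"
 proof -
  from h obtain H where H: "inf_morphism L M (J_module L (adjoint L)) H"
   "inf_comp L (adjoint L) (strict (J_module L (adjoint L)) (%(n\<^sub>0, n\<^sub>1, u). n\<^sub>0)) H = f"
   "inf_comp L (adjoint L) (strict (J_module L (adjoint L)) (%(n\<^sub>0, n\<^sub>1, u). n\<^sub>0 + n\<^sub>1)) H = f'"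
   unfolding homotopic_def by blast
  have "hmt L M f f' H" by unfold_locales (rule H)+
  thus thesis by (rule that)
 qed
 then interpret hmt L M f f' H .
 show "isomorphic (Leib (CE L)) (G_object L (M, f)) (G_object L (M, f'))" by (rule isomorphic_G)
qed

end
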